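(* Suppose Assumption B holds and that the value function $V$ of the mean field control problem belongs to $\mathcal{C}^{1,1}([0,T]\times S_d)$. Let $\mu^N$ be the optimal process of the $N$-agent optimization (associated with the unique optimal feedback $\alpha_N$) and $\mu$ the optimal trajectory of the mean field control problem (associated with the unique optimal feedback $\alpha_*$), as described in the context. Then there is a constant $C$, independent of $N$, such that for every $N\ge1$ $$\mathbb{E}\Big[\sup_{t\in[0,T]}|\mu^N_t-\mu_t|\Big]\le\frac{C}{N^{1/9}}.$$
   Context: **Notation.** $d\ge2$ is an integer, $T>0$, $S_d=\{m\in\mathbb{R}^d:m_i\ge0,\ \sum_im_i=1\}$, $S_d^N=S_d\cap\frac1N\mathbb{N}^d$ (with $0\in\mathbb{N}$), $|\cdot|$ is the Euclidean norm, $\delta_i$ is the $i$-th canonical basis vector of $\mathbb{R}^d$. A function $v$ on $S_d$ is identified with $\hat v(x)=v(x_1,\dots,x_{d-1},1-\sum_{j<d}x_j)$ on $\hat S_d=\{x\in\mathbb{R}^{d-1}:x_j\ge0,\sum_jx_j\le1\}$. $v\in\mathcal{C}^{1,1}([0,T]\times S_d)$ means that $\hat v$ is $\mathcal{C}^1$ on $[0,T]\times\mathrm{Int}(\hat S_d)$ with derivatives in $t$ and $x$ extending continuously up to the boundary and globally Lipschitz. $D^iv=(\partial_{m_j-m_i}v)_{j=1,\dots,d}$, where $\partial_{m_j-m_i}$ is the derivative along $\delta_j-\delta_i$ (extended by continuity to the boundary). For $v$ on $S_d^N$ or $S_d$, $D^{N,i}v(m)=\big(N[v(m+\frac1N(\delta_j-\delta_i))-v(m)]\big)_{j=1,\dots,d}$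 (used when $m_i>0$). An initial law $m_0\in S_d$ is given. **Data.** $f^i:[0,T]\times A\times S_d\to\mathbb{R}$, $g^i:S_d\to\mathbb{R}$, $i\in\{1,\dots,d\}$; $F(t,a^1,\dots,a^d,m)=\sum_im_if^i(t,a^i,m)$, $G(m)=\sum_im_ig^i(m)$. **Assumption B.** (i) The action space is $A=[0,M]^d$ and the transition rates are $Q_{i,j}(t,a,m)=a_j$ for $j\ne i$. (ii) $F$ is continuous on $[0,T]\times A^d\times S_d$, $|F(t,a,m)-F(s,a,p)|\le C(|t-s|+|m-p|)$ with $C$ independent of $a\in A^d$, and $|G(m)-G(p)|\le C|m-p|$. (iii) $f^i$ is continuously differentiable in $a\in A$, $\nabla_af^i$ is Lipschitz-continuous in $m$, and there is $\lambda>0$ with $f^i(t,b,m)\ge f^i(t,a,m)+\langle\nabla_af^i(t,a,m),b-a\rangle+\lambda|b-a|^2$. Convention: since the coordinate $a_i$ of an action used in state $i$ never enters the dynamics, in state $i$ an action is identified with $(a_j)_{j\ne i}$; $f^i$ is a function of these coordinates and the gradient, scalar product and norm in (iii) refer to them. For $z\in\mathbb{R}^d$ with $z_i=0$, $a^*(t,i,m,z)\in A$ denotes the unique maximizer over $a\in A$ of $-\sum_{j\ne i}a_jz_j-f^i(t,a,m)$. **$N$-agent optimization.** Controls are measurable feedbacks $\alpha=(\alpha^{i,j}):[0,T]\times S_d^N\to[0,M]^{d\times d}$, with rows $\alpha^i$. The state is the Markov chain on $S_d^N$ jumping at time $t$ from $m$ to $m+\frac1N(\delta_j-\delta_i)$,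 $i\ne j$, with rate $Nm_i\alpha^{i,j}(t,m)$. $V^N(t,m)$ is the infimum over such controls of $\mathbb{E}[\int_t^TF(s,\alpha(s,\mu^N_s),\mu^N_s)ds+G(\mu^N_T)]$ for the chain starting from $\mu^N_t=m\in S_d^N$. The optimal feedback is $\alpha_N^{i,j}(t,m)=a^*_j(t,i,m,D^{N,i}V^N(t,m))$ (for $m_i>0$; irrelevant if $m_i=0$), and $\mu^N$ denotes the chain with feedback $\alpha_N$, started at time $0$ from the empirical measure $\mu_0^N$ of $N$ i.i.d. random variables in $\{1,\dots,d\}$ with law $m_0$. **Mean field control problem.** $V(t,m)$, for $(t,m)\in[0,T]\times S_d$, is the infimum over measurable $\alpha:[0,T]\to[0,M]^{d\times d}$ of $\int_t^TF(s,\alpha(s),\mu_s)ds+G(\mu_T)$, where $\frac{d}{ds}\mu^i_s=\sum_j(\mu^j_s\alpha^{j,i}(s)-\mu^i_s\alpha^{i,j}(s))$, $\mu_t=m$. The optimal feedback is $\alpha_*^{i,j}(t,m)=a^*_j(t,i,m,D^iV(t,m))$, and $\mu$ denotes the solution of $\frac{d}{dt}\mu^i_t=\sum_j(\mu^j_t\alpha_*^{j,i}(t,\mu_t)-\mu^i_t\alpha_*^{i,j}(t,\mu_t))$, $\mu_0=m_0$. *)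

theory Defs
  imports "HOL-Probability.Probability"
begin

definition prob_simplex :: "(real^'d::finite) set" where
  "prob_simplex = {m. (\<forall>i. 0 \<le> m $ i) \<and> (\<Sum>i\<in>UNIV. m $ i) = 1}"

definition simplex_grid :: "nat \<Rightarrow> (real^'d::finite) set" where
  "simplex_grid N = {m \<in> prob_simplex. \<forall>i. \<exists>k::nat. m $ i = real k / real N}"

definition shift :: "'d::finite \<Rightarrow> 'd \<Rightarrow> real^'d" where
  "shift i j = axis j 1 - axis i 1"

definition action_set :: "real \<Rightarrow> (real^'d::finite) set" where
  "action_set M = {a. \<forall>j. 0 \<le> a $ j \<and> a $ j \<le> M}"

text \<open>A matrix \<open>a\<close> collects one action per state: its row \<open>a $ i\<close> is the action used in state \<open>i\<close>.\<close>

definition action_matrices :: "real \<Rightarrow> (real^'d::finite^'d) set" where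
  "action_matrices M = {a. \<forall>i. a $ i \<in> action_set M}"

type_synonym 'd running_cost = "'d \<Rightarrow> real \<Rightarrow> real^'d \<Rightarrow> real^'d \<Rightarrow> real"
type_synonym 'd terminal_cost = "'d \<Rightarrow> real^'d \<Rightarrow> real"

definition total_running :: "('d::finite) running_cost \<Rightarrow> real \<Rightarrow> real^'d^'d \<Rightarrow> real^'d \<Rightarrow> real" where
  "total_running f t a m = (\<Sum>i\<in>UNIV. m $ i * f i t (a $ i) m)"

definition total_terminal :: "('d::finite) terminal_cost \<Rightarrow> real^'d \<Rightarrow> real" where
  "total_terminal g m = (\<Sum>i\<in>UNIV. m $ i * g i m)"

text \<open>
  The first conjunct says that \<open>f i\<close> is a function of the coordinates \<open>a $ j\<close>, \<open>j \<noteq> i\<close>, only.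
  For \<open>M > 0\<close> it forces the \<open>i\<close>-th component of the gradient \<open>Df i t a m\<close> to vanish, so that the
  inner product below involves those coordinates only; the squared norm in the convexity inequality
  is restricted to them explicitly. The transition rates \<open>a $ j\<close> are built into the dynamics
  (\<open>mf_drift\<close> and \<open>jump_rate\<close>).
\<close>

definition assumption_B ::
    "real \<Rightarrow> real \<Rightarrow> ('d::finite) running_cost \<Rightarrow> 'd terminal_cost \<Rightarrow> bool" where
  "assumption_B T M f g \<longleftrightarrow>
     (\<forall>i. \<forall>t\<in>{0..T}. \<forall>m\<in>prob_simplex. \<forall>a\<in>action_set M. \<forall>b\<in>action_set M.
        (\<forall>j. j \<noteq> i \<longrightarrow> a $ j = b $ j) \<longrightarrow> f i t a m = f i t b m) \<and>
     continuous_on ({0..T} \<times> action_matrices M \<times> prob_simplex)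
       (\<lambda>(t, a, m). total_running f t a m) \<and>
     (\<exists>C. \<forall>t\<in>{0..T}. \<forall>s\<in>{0..T}. \<forall>a\<in>action_matrices M. \<forall>m\<in>prob_simplex. \<forall>p\<in>prob_simplex.
        \<bar>total_running f t a m - total_running f s a p\<bar> \<le> C * (\<bar>t - s\<bar> + norm (m - p))) \<and>
     (\<exists>C. \<forall>m\<in>prob_simplex. \<forall>p\<in>prob_simplex.
        \<bar>total_terminal g m - total_terminal g p\<bar> \<le> C * norm (m - p)) \<and>
     (\<exists>Df :: 'd \<Rightarrow> real \<Rightarrow> real^'d \<Rightarrow> real^'d \<Rightarrow> real^'d.
        (\<forall>i. \<forall>t\<in>{0..T}. \<forall>m\<in>prob_simplex.
           (\<forall>a\<in>action_set M. ((\<lambda>b. f i t b m) has_derivative (\<lambda>h. Df i t a m \<bullet> h))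
              (at a within action_set M)) \<and>
           continuous_on (action_set M) (\<lambda>a. Df i t a m)) \<and>
        (\<exists>L. \<forall>i. \<forall>t\<in>{0..T}. \<forall>a\<in>action_set M. \<forall>m\<in>prob_simplex. \<forall>p\<in>prob_simplex.
           norm (Df i t a m - Df i t a p) \<le> L * norm (m - p)) \<and>
        (\<exists>\<kappa>>0. \<forall>i. \<forall>t\<in>{0..T}. \<forall>m\<in>prob_simplex. \<forall>a\<in>action_set M. \<forall>b\<in>action_set M.
           f i t b m \<ge> f i t a m + Df i t a m \<bullet> (b - a)
             + \<kappa> * (\<Sum>j\<in>UNIV - {i}. (b $ j - a $ j)\<^sup>2)))"

text \<open>
  Actions in state \<open>i\<close> that differ only in the irrelevant \<open>i\<close>-th coordinate are identified; the
  representative with \<open>a $ i = 0\<close> is chosen, so that the maximizer is unique as a vector.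
\<close>

definition opt_action ::
    "real \<Rightarrow> ('d::finite) running_cost \<Rightarrow> real \<Rightarrow> 'd \<Rightarrow> real^'d \<Rightarrow> real^'d \<Rightarrow> real^'d" where
  "opt_action M f t i m z = (THE a. a \<in> action_set M \<and> a $ i = 0 \<and>
     (\<forall>b\<in>action_set M.
        - (\<Sum>j\<in>UNIV - {i}. b $ j * z $ j) - f i t b m
          \<le> - (\<Sum>j\<in>UNIV - {i}. a $ j * z $ j) - f i t a m))"


text \<open>
  The state space \<open>{1, \<dots>, d}\<close> with \<open>d \<ge> 2\<close> is represented by \<open>'n option\<close> for a finite (nonempty)
  type \<open>'n\<close> of size \<open>d - 1\<close>, with \<open>None\<close> as the last state. Then \<open>real^'n\<close> is the space
  of the first \<open>d - 1\<close> coordinates.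
\<close>

definition hat_simplex :: "(real^'n::finite) set" where
  "hat_simplex = {x. (\<forall>j. 0 \<le> x $ j) \<and> (\<Sum>j\<in>UNIV. x $ j) \<le> 1}"

definition chart :: "real^'n::finite \<Rightarrow> real^('n option)" where
  "chart x = (\<chi> k. case k of None \<Rightarrow> 1 - (\<Sum>j\<in>UNIV. x $ j) | Some j \<Rightarrow> x $ j)"

text \<open>
  \<open>vt\<close> and \<open>vx\<close> are the continuous extensions to \<open>{0..T} \<times> hat_simplex\<close> of the derivatives in time
  and space; the derivative within \<open>{0..T} \<times> interior hat_simplex\<close> is one-sided in time at the
  endpoints.
\<close>

definition C11_simplex :: "real \<Rightarrow> (real \<Rightarrow> real^('n::finite option) \<Rightarrow> real) \<Rightarrow> bool" where
  "C11_simplex T v \<longleftrightarrow>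
     (\<exists>(vt :: real \<times> (real^'n) \<Rightarrow> real) (vx :: real \<times> (real^'n) \<Rightarrow> real^'n) L.
        (\<forall>t\<in>{0..T}. \<forall>x\<in>interior hat_simplex.
           ((\<lambda>(s, y). v s (chart y)) has_derivative (\<lambda>(h, k). vt (t, x) * h + vx (t, x) \<bullet> k))
             (at (t, x) within {0..T} \<times> interior hat_simplex)) \<and>
        L-lipschitz_on ({0..T} \<times> hat_simplex) vt \<and>
        L-lipschitz_on ({0..T} \<times> hat_simplex) vx)"

definition simplex_interior :: "(real^'d::finite) set" where
  "simplex_interior = {m \<in> prob_simplex. \<forall>i. 0 < m $ i}"

definition dir_deriv :: "'d::finite \<Rightarrow> 'd \<Rightarrow> (real^'d \<Rightarrow> real) \<Rightarrow> real^'d \<Rightarrow> real" where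
  "dir_deriv i j v m = deriv (\<lambda>h. v (m + h *\<^sub>R shift i j)) 0"

definition simplex_grad :: "'d::finite \<Rightarrow> (real^'d \<Rightarrow> real) \<Rightarrow> real^'d \<Rightarrow> real^'d" where
  "simplex_grad i v m = (\<chi> j. if m \<in> simplex_interior then dir_deriv i j v m
     else Lim (at m within simplex_interior) (dir_deriv i j v))"

definition discrete_grad :: "nat \<Rightarrow> 'd::finite \<Rightarrow> (real^'d \<Rightarrow> real) \<Rightarrow> real^'d \<Rightarrow> real^'d" where
  "discrete_grad N i v m = (\<chi> j. real N * (v (m + (1 / real N) *\<^sub>R shift i j) - v m))"


definition mf_drift :: "real^'d::finite^'d \<Rightarrow> real^'d \<Rightarrow> real^'d" where
  "mf_drift a m = (\<chi> i. \<Sum>j\<in>UNIV. m $ j * a $ j $ i - m $ i * a $ i $ j)"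

definition mf_control :: "real \<Rightarrow> real \<Rightarrow> (real \<Rightarrow> real^'d::finite^'d) \<Rightarrow> bool" where
  "mf_control T M \<alpha> \<longleftrightarrow> \<alpha> \<in> borel_measurable (restrict_space borel {0..T}) \<and>
     (\<forall>t\<in>{0..T}. \<alpha> t \<in> action_matrices M)"

text \<open>Controls are merely measurable in time, so the state equation is understood in integral form.\<close>

definition mf_trajectory ::
    "real \<Rightarrow> (real \<Rightarrow> real^'d::finite^'d) \<Rightarrow> real \<Rightarrow> real^'d \<Rightarrow> (real \<Rightarrow> real^'d) \<Rightarrow> bool" where
  "mf_trajectory T \<alpha> t m \<mu> \<longleftrightarrow>
     (\<forall>s\<in>{t..T}. ((\<lambda>u. mf_drift (\<alpha> u) (\<mu> u)) has_integral (\<mu> s - m)) {t..s})"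

definition mf_value ::
    "real \<Rightarrow> real \<Rightarrow> ('d::finite) running_cost \<Rightarrow> 'd terminal_cost \<Rightarrow> real \<Rightarrow> real^'d \<Rightarrow> real" where
  "mf_value T M f g t m =
     Inf {(LINT s:{t..T}|lborel. total_running f s (\<alpha> s) (\<mu> s)) + total_terminal g (\<mu> T) |
            \<alpha> \<mu>. mf_control T M \<alpha> \<and> mf_trajectory T \<alpha> t m \<mu>}"

definition mf_opt_feedback ::
    "real \<Rightarrow> real \<Rightarrow> ('d::finite) running_cost \<Rightarrow> 'd terminal_cost \<Rightarrow> real \<Rightarrow> real^'d \<Rightarrow> real^'d^'d" where
  "mf_opt_feedback T M f g t m =
     (\<chi> i j. opt_action M f t i m (simplex_grad i (mf_value T M f g t) m) $ j)"

text \<open>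
  The optimal feedback is meaningful on the simplex only, so a solution is required to take its
  values there.
\<close>

definition mf_opt_trajectory ::
    "real \<Rightarrow> real \<Rightarrow> ('d::finite) running_cost \<Rightarrow> 'd terminal_cost \<Rightarrow> real^'d
      \<Rightarrow> (real \<Rightarrow> real^'d) \<Rightarrow> bool" where
  "mf_opt_trajectory T M f g m0 \<mu> \<longleftrightarrow> \<mu> 0 = m0 \<and>
     (\<forall>t\<in>{0..T}. \<mu> t \<in> prob_simplex \<and>
        (\<mu> has_vector_derivative mf_drift (mf_opt_feedback T M f g t (\<mu> t)) (\<mu> t))
          (at t within {0..T}))"


text \<open>
  \<open>q u x y\<close> is the rate of jumps from \<open>x\<close> to \<open>y \<noteq> x\<close> at time \<open>u\<close>. Rates are only measurable in time,
  hence the forward Kolmogorov equation for \<open>p r s x y = P (X s = y | X r = x)\<close> is stated in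
  integral form.
\<close>

definition transition_probabilities ::
    "'e set \<Rightarrow> (real \<Rightarrow> 'e \<Rightarrow> 'e \<Rightarrow> real) \<Rightarrow> real \<Rightarrow> real
      \<Rightarrow> (real \<Rightarrow> real \<Rightarrow> 'e \<Rightarrow> 'e \<Rightarrow> real) \<Rightarrow> bool" where
  "transition_probabilities E q t0 T p \<longleftrightarrow>
     (\<forall>r\<in>{t0..T}. \<forall>s\<in>{r..T}. \<forall>x\<in>E. \<forall>y\<in>E.
        ((\<lambda>u. (\<Sum>z\<in>E - {y}. p r u x z * q u z y) - p r u x y * (\<Sum>z\<in>E - {y}. q u y z))
           has_integral (p r s x y - (if x = y then 1 else 0))) {r..s})"

definition natural_filtration ::
    "'w measure \<Rightarrow> 'e set \<Rightarrow> real \<Rightarrow> (real \<Rightarrow> 'w \<Rightarrow> 'e) \<Rightarrow> real \<Rightarrow> 'w measure" where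
  "natural_filtration P E t0 X r =
     sigma (space P) {X u -` {x} \<inter> space P | u x. u \<in> {t0..r} \<and> x \<in> E}"

definition cadlag_on :: "real \<Rightarrow> real \<Rightarrow> (real \<Rightarrow> 'e::topological_space) \<Rightarrow> bool" where
  "cadlag_on t0 T x \<longleftrightarrow> (\<forall>s\<in>{t0..<T}. (x \<longlongrightarrow> x s) (at_right s)) \<and>
     (\<forall>s\<in>{t0<..T}. \<exists>l. (x \<longlongrightarrow> l) (at_left s))"

definition markov_jump_chain ::
    "'w measure \<Rightarrow> 'e::topological_space set \<Rightarrow> (real \<Rightarrow> 'e \<Rightarrow> 'e \<Rightarrow> real) \<Rightarrow> real \<Rightarrow> real
      \<Rightarrow> (real \<Rightarrow> 'w \<Rightarrow> 'e) \<Rightarrow> bool" where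
  "markov_jump_chain P E q t0 T X \<longleftrightarrow>
     prob_space P \<and>
     (\<forall>s\<in>{t0..T}. X s \<in> measurable P (count_space E)) \<and>
     (\<forall>\<omega>\<in>space P. cadlag_on t0 T (\<lambda>s. X s \<omega>)) \<and>
     (\<exists>p. transition_probabilities E q t0 T p \<and>
        (\<forall>r\<in>{t0..T}. \<forall>s\<in>{r..T}. \<forall>y\<in>E. AE \<omega> in P.
           real_cond_exp P (natural_filtration P E t0 X r)
             (indicator {\<omega>\<in>space P. X s \<omega> = y}) \<omega> = p r s (X r \<omega>) y))"


definition feedback_control ::
    "real \<Rightarrow> real \<Rightarrow> nat \<Rightarrow> (real \<Rightarrow> real^'d::finite \<Rightarrow> real^'d^'d) \<Rightarrow> bool" where
  "feedback_control T M N \<alpha> \<longleftrightarrow>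
     (\<forall>m\<in>simplex_grid N. (\<lambda>t. \<alpha> t m) \<in> borel_measurable (restrict_space borel {0..T}) \<and>
        (\<forall>t\<in>{0..T}. \<alpha> t m \<in> action_matrices M))"

definition jump_rate ::
    "nat \<Rightarrow> (real \<Rightarrow> real^'d::finite \<Rightarrow> real^'d^'d) \<Rightarrow> real \<Rightarrow> real^'d \<Rightarrow> real^'d \<Rightarrow> real" where
  "jump_rate N \<alpha> t m p = (\<Sum>i\<in>UNIV. \<Sum>j\<in>UNIV - {i}.
     if p = m + (1 / real N) *\<^sub>R shift i j then real N * m $ i * \<alpha> t m $ i $ j else 0)"

definition agent_chain ::
    "real \<Rightarrow> nat \<Rightarrow> (real \<Rightarrow> real^'d::finite \<Rightarrow> real^'d^'d) \<Rightarrow> real \<Rightarrow> 'w measure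
      \<Rightarrow> (real \<Rightarrow> 'w \<Rightarrow> real^'d) \<Rightarrow> bool" where
  "agent_chain T N \<alpha> t P X \<longleftrightarrow> markov_jump_chain P (simplex_grid N) (jump_rate N \<alpha>) t T X"

text \<open>
  The law of the chain is determined by the control and the starting point, so every realization
  gives the same cost. Realizations are taken on the path space \<open>real \<Rightarrow> real^'d\<close>, which carries
  every such law.
\<close>

definition agent_value ::
    "real \<Rightarrow> real \<Rightarrow> ('d::finite) running_cost \<Rightarrow> 'd terminal_cost \<Rightarrow> nat
      \<Rightarrow> real \<Rightarrow> real^'d \<Rightarrow> real" where
  "agent_value T M f g N t m =
     Inf {(LINT \<omega>|P. (LINT s:{t..T}|lborel. total_running f s (\<alpha> s (X s \<omega>)) (X s \<omega>))
              + total_terminal g (X T \<omega>)) |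
            \<alpha> (P :: (real \<Rightarrow> real^'d) measure) X.
            feedback_control T M N \<alpha> \<and> agent_chain T N \<alpha> t P X \<and> (AE \<omega> in P. X t \<omega> = m)}"

definition agent_opt_feedback ::
    "real \<Rightarrow> real \<Rightarrow> ('d::finite) running_cost \<Rightarrow> 'd terminal_cost \<Rightarrow> nat
      \<Rightarrow> real \<Rightarrow> real^'d \<Rightarrow> real^'d^'d" where
  "agent_opt_feedback T M f g N t m =
     (\<chi> i j. opt_action M f t i m (discrete_grad N i (agent_value T M f g N t) m) $ j)"

definition iid_with_law :: "'w measure \<Rightarrow> nat \<Rightarrow> real^'d::finite \<Rightarrow> (nat \<Rightarrow> 'w \<Rightarrow> 'd) \<Rightarrow> bool" where
  "iid_with_law P N m0 Y \<longleftrightarrow>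
     prob_space.indep_vars P (\<lambda>_. count_space UNIV) Y {..<N} \<and>
     (\<forall>k<N. \<forall>i. measure P {\<omega>\<in>space P. Y k \<omega> = i} = m0 $ i)"

definition empirical_measure :: "nat \<Rightarrow> (nat \<Rightarrow> 'd::finite) \<Rightarrow> real^'d" where
  "empirical_measure N y = (1 / real N) *\<^sub>R (\<Sum>k<N. axis (y k) 1)"

definition agent_opt_process ::
    "real \<Rightarrow> real \<Rightarrow> ('d::finite) running_cost \<Rightarrow> 'd terminal_cost \<Rightarrow> real^'d \<Rightarrow> nat
      \<Rightarrow> 'w measure \<Rightarrow> (real \<Rightarrow> 'w \<Rightarrow> real^'d) \<Rightarrow> bool" where
  "agent_opt_process T M f g m0 N P X \<longleftrightarrow>
     agent_chain T N (agent_opt_feedback T M f g N) 0 P X \<and>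
     (\<exists>Y. iid_with_law P N m0 Y \<and> (AE \<omega> in P. X 0 \<omega> = empirical_measure N (\<lambda>k. Y k \<omega>)))"

end

theory Submission imports Defs begin

text \<open>
The derivatives of \<open>V\<close> are Lipschitz, so on the grid \<open>V\<close> solves the Hamilton--Jacobi--Bellman system of
the \<open>N\<close>-agent problem up to an error \<open>O(1/N)\<close>. Running the \<open>N\<close>-agent chain with the feedback of the mean field
problem gives \<open>V\<^sup>N \<le> V + O(1/N)\<close>. Applying Dynkin's formula to \<open>V - V\<^sup>N\<close> along the optimal chain, the uniform
convexity of the Hamiltonian minimization turns this one-sided bound into
\<open>E \<integral> |\<alpha>\<^sub>N - \<alpha>\<^sub>*|\<^sup>2 = O(1/N)\<close>; no regularity of \<open>V\<^sup>N\<close> in the space variable enters. The drift of the mean field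
problem is Lipschitz, so Gronwall's lemma and Doob's inequality for the martingale part (of quadratic variation \<open>O(1/N)\<close>)
bound the expected supremum by \<open>O(N powr (-1/2))\<close>, which is stronger than the claim.

\<open>V\<^sup>N\<close> is identified as the solution of a finite system of ordinary differential equations. That its infimum is
attained needs a Markov chain with prescribed time-dependent rates on the path space \<open>real \<Rightarrow> real^'d\<close>; it is
obtained from Kolmogorov's extension theorem and a right-continuous modification along dyadic times.
\<close>

section \<open>Integral equations\<close>

text \<open>Three obstacles shape the proof. Rates and controls are only measurable in time, so the
  evolution equations are integral equations, and the product rule behind Dynkin's formula is proved
  for primitives of bounded densities. Next, the regularity of \<open>V\<close> is given on the
  interior of the simplex, while the chain also visits the faces: the interior values are extended
  continuously, and the Taylor bound and the Hamilton-Jacobi-Bellman equation pass to the extension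
  \<open>U\<close> by closure. On a row \<open>i\<close> with \<open>m $ i = 0\<close> the cost
  \<open>f i\<close> need not be regular in time; such rows carry no mass, and the feedback is set
  to 0 there. Finally, the supremum over time is reached through dyadic grids with \<open>N\<close>
  fixed: discretization errors have constants that depend on \<open>N\<close>, but a factor
  \<open>(1/2)^n\<close> removes them before the rate in \<open>N\<close> is read off. The passage
  from a mean square distance of order \<open>1 / N\<close> between the feedbacks to a mean distance
  of order \<open>1 / sqrt N\<close> is Young's inequality with parameter
  \<open>1 / sqrt N\<close>.\<close>

lemma const_if_quadratic_increments:
 fixes w :: "real => real"
 assumes q: "\<And>r s. [|a <= r; r <= s; s <= b|] ==> \<bar>w s - w r\<bar> <= C * (s - r)\<^sup>2"
  and s: "s \<in> {a..b}"
 shows "w s = w a"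
proof -
 have q2: "\<bar>w s - w r\<bar> <= \<bar>C\<bar> * (s - r)\<^sup>2" if "r \<in> {a..b}" "s \<in> {a..b}" for r s
 proof (cases "r <= s")
  case True
  with q[of r s] that show ?thesis
   by (smt (verit) abs_ge_self atLeastAtMost_iff mult_right_mono zero_le_power2)
 next
  case False
  with q[of s r] that show ?thesis
   by (smt (verit) abs_ge_self atLeastAtMost_iff mult_right_mono power2_commute zero_le_power2)
 qed
 have "(w has_field_derivative 0) (at x within {a..b})" if x: "x \<in> {a..b}" for x
  unfolding has_field_derivative_iff
 proof (rule Lim_null_comparison)
  show "\<forall>\<^sub>F y in at x within {a..b}. norm ((w y - w x) / (y - x)) <= \<bar>C\<bar> * \<bar>y - x\<bar>"
   unfolding eventually_at_filter
  proof (intro always_eventually allI impI)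
   fix y assume y: "y ~= x" "y \<in> {a..b}"
   have "\<bar>w y - w x\<bar> <= \<bar>C\<bar> * \<bar>y - x\<bar> * \<bar>y - x\<bar>"
    using q2[OF x y(2)] by (simp add: power2_eq_square flip: abs_mult)
   thus "norm ((w y - w x) / (y - x)) <= \<bar>C\<bar> * \<bar>y - x\<bar>"
    using y(1) by (simp add: divide_le_eq)
  qed
  have "((\<lambda>y. \<bar>C\<bar> * \<bar>y - x\<bar>) \<longlongrightarrow> \<bar>C\<bar> * \<bar>x - x\<bar>) (at x within {a..b})"
   by (intro tendsto_intros)
  thus "((\<lambda>y. \<bar>C\<bar> * \<bar>y - x\<bar>) \<longlongrightarrow> 0) (at x within {a..b})" by simp
 qed
 then obtain c where "\<And>x. x \<in> {a..b} ==> w x = c"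
  using has_field_derivative_zero_constant[of "{a..b}" w] by (metis convex_real_interval(5))
 with s show ?thesis by auto
qed

lemma has_integral_abs_le:
 fixes f :: "real => real"
 assumes "(f has_integral i) {a..b}" "a <= b" "\<And>u. u \<in> {a..b} ==> \<bar>f u\<bar> <= B"
 shows "\<bar>i\<bar> <= B * (b - a)"
proof -
 have "0 <= B" using assms(3)[of a] assms(2) abs_ge_zero[of "f a"] by auto
 thus ?thesis
  using has_integral_bound[of B f i a b] assms by (simp add: cbox_interval)
qed

lemma indefinite_integral_facts:
 fixes A :: "real => real"
 assumes A: "\<forall>s\<in>{c..d}. (a has_integral (A s - Ac)) {c..s}"
  and bd: "\<forall>u\<in>{c..d}. \<bar>a u\<bar> <= K" and "c <= d"
 shows "A c = Ac"
  and "\<And>r s. [|c <= r; r <= s; s <= d|] ==> (a has_integral (A s - A r)) {r..s}"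
  and "\<And>r s. [|r \<in> {c..d}; s \<in> {c..d}|] ==> \<bar>A s - A r\<bar> <= K * \<bar>s - r\<bar>"
  and "continuous_on {c..d} A"
  and "a absolutely_integrable_on {c..d}"
proof -
 show Ac: "A c = Ac"
  using A[rule_format, of c] \<open>c <= d\<close> has_integral_refl(1)[of a c] has_integral_unique[of a "A c - Ac" "{c..c}" 0] by (simp add: cbox_interval)
 have int: "a integrable_on {c..d}" using A \<open>c <= d\<close> by auto
 show inc: "(a has_integral (A s - A r)) {r..s}" if "c <= r" "r <= s" "s <= d" for r s
 proof -
  have i: "a integrable_on {c..s}" using A that by auto
  have "integral {c..r} a + integral {r..s} a = integral {c..s} a"
   using that i by (intro Henstock_Kurzweil_Integration.integral_combine) auto
  moreover have "integral {c..r} a = A r - Ac" "integral {c..s} a = A s - Ac"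
   using A that by (auto simp: integral_unique)
  moreover have "a integrable_on {r..s}"
   using i that by (auto intro: integrable_on_subinterval)
  ultimately show ?thesis by (metis add_diff_cancel_left' diff_add_eq diff_diff_eq2 has_integral_integrable_integral diff_add_cancel add.commute)
 qed
 have *: "\<bar>A s - A r\<bar> <= K * \<bar>s - r\<bar>" if "c <= r" "r <= s" "s <= d" for r s
  using has_integral_abs_le[OF inc[OF that] that(2), of K] bd that by simp
 show lip: "\<bar>A s - A r\<bar> <= K * \<bar>s - r\<bar>" if "r \<in> {c..d}" "s \<in> {c..d}" for r s
  using *[of r s] *[of s r] that by (cases "r <= s") (auto simp: abs_minus_commute)
 have "0 <= K" using bd \<open>c <= d\<close> abs_ge_zero[of "a c"] by fastforce
 hence "K-lipschitz_on {c..d} A"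
  by (intro lipschitz_onI) (auto simp: dist_real_def lip)
 thus "continuous_on {c..d} A" by (rule lipschitz_on_continuous_on)
 show "a absolutely_integrable_on {c..d}"
  using int bd by (intro absolutely_integrable_integrable_bound[where g = "\<lambda>_. K"]) auto
qed

lemma integrable_on_mult_continuous:
 fixes a f :: "real => real"
 assumes "a integrable_on {c..d}" "\<forall>u\<in>{c..d}. \<bar>a u\<bar> <= K" "continuous_on {c..d} f"
 shows "(\<lambda>u. a u * f u) integrable_on {c..d}"
proof -
 have "a absolutely_integrable_on {c..d}"
  using assms(1,2) by (intro absolutely_integrable_integrable_bound[where g = "\<lambda>_. K"]) auto
 moreover have "f \<in> borel_measurable (lebesgue_on {c..d})"
  using assms(3) by (intro continuous_imp_measurable_on_sets_lebesgue) auto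
 moreover have "bounded (f ` {c..d})"
  using assms(3) by (intro compact_imp_bounded compact_continuous_image) auto
 ultimately have "(\<lambda>u. f u * a u) absolutely_integrable_on {c..d}"
  by (intro absolutely_integrable_bounded_measurable_product_real) auto
 thus ?thesis
  by (simp add: mult.commute set_lebesgue_integral_eq_integral(1))
qed

text \<open>\<open>A\<close> and \<open>B\<close> are primitives of bounded densities and need not
  be differentiable. The defect between \<open>A * B\<close> and the claimed integral has
  quadratically small increments, as one sees by freezing \<open>A\<close> and \<open>B\<close> at
  the left end of a short interval; such a function has derivative 0 and is constant.\<close>

lemma has_integral_product_rule:
 fixes A B :: "real => real"
 assumes A: "\<forall>s\<in>{c..d}. (a has_integral (A s - A c)) {c..s}"
  and B: "\<forall>s\<in>{c..d}. (b has_integral (B s - B c)) {c..s}"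
  and a: "\<forall>u\<in>{c..d}. \<bar>a u\<bar> <= K" and b: "\<forall>u\<in>{c..d}. \<bar>b u\<bar> <= K'"
  and s: "s \<in> {c..d}"
 shows "((\<lambda>u. a u * B u + A u * b u) has_integral (A s * B s - A c * B c)) {c..s}"
proof -
 have cd: "c <= d" using s by auto
 note FA = indefinite_integral_facts[OF A a cd]
 note FB = indefinite_integral_facts[OF B b cd]
 let ?f = "\<lambda>u. a u * B u + A u * b u"
 have aint: "a integrable_on {c..d}" "b integrable_on {c..d}" using A B cd by auto
 have "(\<lambda>u. b u * A u) integrable_on {c..d}"
  by (rule integrable_on_mult_continuous[OF aint(2) b FA(4)])
 hence fint: "?f integrable_on {c..d}"
  using integrable_on_mult_continuous[OF aint(1) a FB(4)]
  by (intro integrable_add) (auto simp: mult.commute)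
 define w where "w = (\<lambda>s. A s * B s - integral {c..s} ?f)"
 have K0: "0 <= K" "0 <= K'" using a b cd abs_ge_zero[of "a c"] abs_ge_zero[of "b c"] by fastforce+
 \<comment> \<open>\<open>3 * K * K'\<close>: freezing \<open>A\<close> and \<open>B\<close> costs
   \<open>2 * K * K' * (s - r)^2\<close>, the product of the two increments another
   \<open>K * K' * (s - r)^2\<close>.\<close>
 have "w s = w c"
 proof (rule const_if_quadratic_increments[OF _ s, where C = "3 * K * K'"])
  fix r s assume rs: "c <= r" "r <= s" "s <= d"
  have fi: "?f integrable_on {c..s}" "?f integrable_on {r..s}"
   using fint rs by (auto intro: integrable_on_subinterval)
  have "integral {c..r} ?f + integral {r..s} ?f = integral {c..s} ?f"
   using rs fi by (intro Henstock_Kurzweil_Integration.integral_combine) auto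
  hence w: "w s - w r = A s * B s - A r * B r - integral {r..s} ?f"
   by (simp add: w_def)
  have "((\<lambda>u. a u * B r + A r * b u) has_integral ((A s - A r) * B r + A r * (B s - B r))) {r..s}"
   by (intro has_integral_add has_integral_mult_left has_integral_mult_right FA(2) FB(2) rs)
  from has_integral_diff[OF integrable_integral[OF fi(2)] this]
  have d: "((\<lambda>u. a u * (B u - B r) + (A u - A r) * b u) has_integral
    (integral {r..s} ?f - ((A s - A r) * B r + A r * (B s - B r)))) {r..s}"
   by (simp add: algebra_simps)
  have bd: "norm (a u * (B u - B r) + (A u - A r) * b u) <= 2 * K * K' * (s - r)" if "u \<in> {r..s}" for u
  proof -
   have u: "u \<in> {c..d}" "r \<in> {c..d}" "\<bar>u - r\<bar> <= s - r" using that rs by auto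
   have "\<bar>a u * (B u - B r)\<bar> <= K * (K' * (s - r))"
    unfolding abs_mult using bspec[OF a u(1)] FB(3)[OF u(2,1)] u(3) K0
    by (intro mult_mono) (auto intro: order_trans[OF _ mult_left_mono])
   moreover have "\<bar>(A u - A r) * b u\<bar> <= (K * (s - r)) * K'"
    unfolding abs_mult using bspec[OF b u(1)] FA(3)[OF u(2,1)] u(3) K0
    by (intro mult_mono) (auto intro: order_trans[OF _ mult_left_mono])
   ultimately show ?thesis by (simp add: algebra_simps)
  qed
  have 1: "\<bar>integral {r..s} ?f - ((A s - A r) * B r + A r * (B s - B r))\<bar> <= 2 * K * K' * (s - r)\<^sup>2"
   using has_integral_abs_le[OF d rs(2), of "2 * K * K' * (s - r)"] bd
   by (simp add: power2_eq_square mult.assoc)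
  have "\<bar>(A s - A r) * (B s - B r)\<bar> <= (K * (s - r)) * (K' * (s - r))"
   unfolding abs_mult using FA(3)[of r s] FB(3)[of r s] rs K0
   by (intro mult_mono) auto
  hence 2: "\<bar>(A s - A r) * (B s - B r)\<bar> <= K * K' * (s - r)\<^sup>2"
   by (simp add: power2_eq_square algebra_simps)
  have "w s - w r = (A s - A r) * (B s - B r) -
    (integral {r..s} ?f - ((A s - A r) * B r + A r * (B s - B r)))"
   unfolding w by (simp add: algebra_simps)
  thus "\<bar>w s - w r\<bar> <= 3 * K * K' * (s - r)\<^sup>2"
   using 1 2 by linarith
 qed
 hence "integral {c..s} ?f = A s * B s - A c * B c" by (simp add: w_def)
 moreover have "?f integrable_on {c..s}"
  using fint s by (auto intro: integrable_on_subinterval)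
 ultimately show ?thesis using integrable_integral by fastforce
qed

lemma has_integral_exp_scaled:
 fixes l :: real
 assumes "0 < l" "a <= s"
 shows "((\<lambda>r. exp (l * (r - a))) has_integral ((exp (l * (s - a)) - 1) / l)) {a..s}"
proof -
 have "((\<lambda>r. exp (l * (r - a)) / l) has_vector_derivative exp (l * (x - a))) (at x within {a..s})" for x
  unfolding has_real_derivative_iff_has_vector_derivative[symmetric]
  by (rule derivative_eq_intros refl | use assms in simp)+
 from fundamental_theorem_of_calculus[OF \<open>a <= s\<close> this] show ?thesis
  by (simp add: diff_divide_distrib)
qed

text \<open>Picard iteration in the norm weighted by \<open>exp (l * (s - a))\<close>, in which each
  step halves the distance of consecutive iterates, so the whole interval is covered at once. The
  components are indexed by a finite set because the lemma serves both the forward equation and the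
  backward system of the \<open>N\<close> agents. Integrability along continuous arguments is a
  hypothesis since \<open>\<Phi>\<close> may be only measurable in time.\<close>

lemma picard_finite:
 fixes \<Phi> :: "real => ('e => real) => 'e => real" and u0 :: "'e => real"
 assumes E: "finite E" and ab: "a <= b" and K: "0 <= K"
  and lip: "\<And>s u v e. [|s \<in> {a..b}; e \<in> E|] ==> \<bar>\<Phi> s u e - \<Phi> s v e\<bar> <= K * (\<Sum>z\<in>E. \<bar>u z - v z\<bar>)"
  and bnd: "\<And>s e. [|s \<in> {a..b}; e \<in> E|] ==> \<bar>\<Phi> s u0 e\<bar> <= B"
  and int: "\<And>u e. [|\<And>z. z \<in> E ==> continuous_on {a..b} (\<lambda>s. u s z); e \<in> E|]
        ==> (\<lambda>s. \<Phi> s (u s) e) integrable_on {a..b}"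
 shows "\<exists>u. \<forall>e\<in>E. continuous_on {a..b} (\<lambda>s. u s e) \<and>
      (\<forall>s\<in>{a..b}. ((\<lambda>r. \<Phi> r (u r) e) has_integral (u s e - u0 e)) {a..s})"
proof -
 define U where "U = rec_nat (\<lambda>s::real. u0) (\<lambda>(k::nat) V s e. u0 e + integral {a..s} (\<lambda>r. \<Phi> r (V r) e))"
 have U0: "U 0 s e = u0 e" for s :: real and e by (simp add: U_def)
 have US: "U (Suc k) s e = u0 e + integral {a..s} (\<lambda>r. \<Phi> r (U k r) e)" for k :: nat and s e
  unfolding U_def by simp
 have contU: "continuous_on {a..b} (\<lambda>s. U k s e)" if "e \<in> E" for k :: nat and e
  using that
 proof (induction k arbitrary: e)
  case 0 thus ?case by (simp add: U0)
 next
  case (Suc k)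
  have "(\<lambda>s. \<Phi> s (U k s) e) integrable_on {a..b}" by (intro int Suc)
  thus ?case unfolding US
   by (intro continuous_intros indefinite_integral_continuous_1)
 qed
 have intU: "(\<lambda>s. \<Phi> s (U k s) e) integrable_on {a..s}" if "e \<in> E" "s \<in> {a..b}" for k e s
 proof -
  have "(\<lambda>s. \<Phi> s (U k s) e) integrable_on {a..b}" by (rule int) (auto intro: contU that)
  thus ?thesis using that(2) by (auto intro: integrable_on_subinterval)
 qed
 define n where "n = real (card E)"
 \<comment> \<open>Chosen so that \<open>K * n / l <= 1/2\<close>; adding 1 keeps \<open>l\<close>
   positive when \<open>n * K = 0\<close>.\<close>
 define l where "l = 2 * n * K + 1"
 have n0: "0 <= n" by (simp add: n_def)
 have l1: "1 <= l" using K n0 by (simp add: l_def)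
 define B' where "B' = B * (b - a)"
 \<comment> \<open>The sign of \<open>B\<close> is forced only by the bound at some element of
   \<open>E\<close>.\<close>
 have B0: "0 <= B" if ne: "E ~= {}"
 proof -
  obtain e where "e \<in> E" using ne by auto
  with bnd[of a e] ab show ?thesis by fastforce
 qed
 have diff: "\<bar>U (Suc k) s e - U k s e\<bar> <= B' * (1/2)^k * exp (l * (s - a))"
  if "e \<in> E" "s \<in> {a..b}" for k s e
  using that
 proof (induction k arbitrary: s e)
  case 0
  have B: "0 <= B" using B0 0 by auto
  have "\<bar>integral {a..s} (\<lambda>r. \<Phi> r (U 0 r) e)\<bar> <= B * (s - a)"
   using bnd[of _ e] 0
   by (intro has_integral_abs_le[OF integrable_integral[OF intU[OF 0(1,2), of 0]]]) (auto simp: U_def)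
  also have "\<dots> <= B' * exp (l * (s - a))"
  proof -
   have "B * (s - a) <= B'" using B 0 by (auto simp: B'_def intro!: mult_left_mono)
   also have "\<dots> <= B' * exp (l * (s - a))"
    using B ab l1 0 mult_left_mono[of 1 "exp (l * (s - a))" B'] by (auto simp: B'_def)
   finally show ?thesis .
  qed
  finally show ?case by (simp add: US U0)
 next
  case (Suc k)
  have B: "0 <= B" using B0 Suc by auto
  have B'0: "0 <= B'" using B ab by (simp add: B'_def)
  have "U (Suc (Suc k)) s e - U (Suc k) s e =
    integral {a..s} (\<lambda>r. \<Phi> r (U (Suc k) r) e - \<Phi> r (U k r) e)"
   unfolding US[of "Suc k"] US[of k s e] using intU[OF Suc.prems] by (simp add: Henstock_Kurzweil_Integration.integral_diff)
  also have "norm \<dots> <= integral {a..s} (\<lambda>r. (K * n * B' * (1/2)^k) * exp (l * (r - a)))"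
  proof (rule integral_norm_bound_integral)
   show "(\<lambda>r. \<Phi> r (U (Suc k) r) e - \<Phi> r (U k r) e) integrable_on {a..s}"
    using intU[OF Suc.prems] by (intro integrable_diff)
   show "(\<lambda>r. (K * n * B' * (1/2)^k) * exp (l * (r - a))) integrable_on {a..s}"
    by (intro integrable_continuous_interval continuous_intros)
   fix r assume r: "r \<in> {a..s}"
   have rb: "r \<in> {a..b}" using r Suc.prems by auto
   have "\<bar>\<Phi> r (U (Suc k) r) e - \<Phi> r (U k r) e\<bar> <= K * (\<Sum>z\<in>E. \<bar>U (Suc k) r z - U k r z\<bar>)"
    by (rule lip[OF rb Suc.prems(1)])
   also have "\<dots> <= K * (\<Sum>z\<in>E. B' * (1/2)^k * exp (l * (r - a)))"
    by (intro mult_left_mono sum_mono Suc.IH rb K) auto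
   also have "\<dots> = (K * n * B' * (1/2)^k) * exp (l * (r - a))"
    by (simp add: n_def)
   finally show "norm (\<Phi> r (U (Suc k) r) e - \<Phi> r (U k r) e) <= (K * n * B' * (1/2)^k) * exp (l * (r - a))"
    by simp
  qed
  also have "\<dots> = (K * n * B' * (1/2)^k) * ((exp (l * (s - a)) - 1) / l)"
   using has_integral_exp_scaled[of l a s] l1 Suc.prems by (simp add: integral_unique)
  also have "\<dots> <= (K * n * B' * (1/2)^k) * (exp (l * (s - a)) / l)"
   using K n0 B'0 l1 by (intro mult_left_mono divide_right_mono) auto
  also have "\<dots> = (K * n / l) * (B' * (1/2)^k * exp (l * (s - a)))" by simp
  also have "\<dots> <= (1/2) * (B' * (1/2)^k * exp (l * (s - a)))"
   using K n0 B'0 l1 by (intro mult_right_mono) (auto simp: l_def divide_le_eq add_nonneg_pos)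
  finally show ?case by simp
 qed
 define R where "R = exp (l * (b - a))"
 define u where "u = (\<lambda>s e. u0 e + (\<Sum>k. U (Suc k) s e - U k s e))"
 have Usum: "U k s e = u0 e + (\<Sum>j<k. U (Suc j) s e - U j s e)" for k s e
  by (induction k) (auto simp: U0)
 have unif: "uniform_limit {a..b} (\<lambda>k s. U k s e) (\<lambda>s. u s e) sequentially" if e: "e \<in> E" for e
 proof -
  have B: "0 <= B'" using B0 e ab by (auto simp: B'_def intro!: mult_nonneg_nonneg)
  have "uniform_limit {a..b} (\<lambda>k s. \<Sum>j<k. U (Suc j) s e - U j s e) (\<lambda>s. \<Sum>k. U (Suc k) s e - U k s e) sequentially"
  proof (rule Weierstrass_m_test)
   show "norm (U (Suc j) s e - U j s e) <= B' * R * (1/2)^j" if "s \<in> {a..b}" for j s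
   proof -
    have "norm (U (Suc j) s e - U j s e) <= B' * (1/2)^j * exp (l * (s - a))"
     using diff[OF e that, of j] by simp
    also have "\<dots> <= B' * (1/2)^j * R"
     using B l1 that by (intro mult_left_mono) (auto simp: R_def)
    finally show ?thesis by (simp add: mult_ac)
   qed
   show "summable (\<lambda>j. B' * R * (1/2)^j)" by (intro summable_mult summable_geometric) simp
  qed
  hence "uniform_limit {a..b} (\<lambda>k s. u0 e + (\<Sum>j<k. U (Suc j) s e - U j s e)) (\<lambda>s. u0 e + (\<Sum>k. U (Suc k) s e - U k s e)) sequentially"
   by (intro uniform_limit_intros)
  thus ?thesis
   unfolding u_def by (simp flip: Usum)
 qed
 have contu: "continuous_on {a..b} (\<lambda>s. u s e)" if "e \<in> E" for e
  by (rule uniform_limit_theorem[OF _ unif[OF that]]) (auto simp: contU that)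
 have intu: "(\<lambda>s. \<Phi> s (u s) e) integrable_on {a..s}" if "e \<in> E" "s \<in> {a..b}" for e s
 proof -
  have "(\<lambda>s. \<Phi> s (u s) e) integrable_on {a..b}" by (rule int) (auto intro: contu that)
  thus ?thesis using that(2) by (auto intro: integrable_on_subinterval)
 qed
 have "((\<lambda>r. \<Phi> r (u r) e) has_integral (u s e - u0 e)) {a..s}" if e: "e \<in> E" and s: "s \<in> {a..b}" for s e
 proof -
  \<comment> \<open>Uniform convergence of the finitely many components, combined with
    \<open>lip\<close>, moves the limit under the integral.\<close>
  have "(\<lambda>k. integral {a..s} (\<lambda>r. \<Phi> r (U k r) e)) \<longlonglongrightarrow> integral {a..s} (\<lambda>r. \<Phi> r (u r) e)"
  proof (rule LIMSEQ_I)
   fix eps :: real assume eps: "0 < eps"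
   define \<eta> where "\<eta> = eps / (2 * (K * n + 1) * (b - a + 1))"
   have den: "0 < 2 * (K * n + 1) * (b - a + 1)" using K n0 ab by (auto intro!: mult_pos_pos add_nonneg_pos)
   have \<eta>: "0 < \<eta>" using eps den by (simp add: \<eta>_def)
   have "\<forall>\<^sub>F k in sequentially. \<forall>z\<in>E. \<forall>r\<in>{a..b}. dist (U k r z) (u r z) < \<eta>"
    using unif \<eta> by (intro eventually_ball_finite E) (auto simp: uniform_limit_iff)
   then obtain k0 where k0: "\<And>k z r. [|k \<ge> k0; z \<in> E; r \<in> {a..b}|] ==> \<bar>U k r z - u r z\<bar> <= \<eta>"
    unfolding eventually_sequentially dist_real_def by (metis less_imp_le)
   have "norm (integral {a..s} (\<lambda>r. \<Phi> r (U k r) e) - integral {a..s} (\<lambda>r. \<Phi> r (u r) e)) < eps" if k: "k \<ge> k0" for k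
   proof -
    have "((\<lambda>r. \<Phi> r (U k r) e - \<Phi> r (u r) e) has_integral
      (integral {a..s} (\<lambda>r. \<Phi> r (U k r) e) - integral {a..s} (\<lambda>r. \<Phi> r (u r) e))) {a..s}"
     using intU[OF e s] intu[OF e s] by (intro has_integral_diff integrable_integral)
    moreover have "norm (\<Phi> r (U k r) e - \<Phi> r (u r) e) <= K * n * \<eta>" if "r \<in> {a..s}" for r
    proof -
     have r: "r \<in> {a..b}" using that s by auto
     have "\<bar>\<Phi> r (U k r) e - \<Phi> r (u r) e\<bar> <= K * (\<Sum>z\<in>E. \<bar>U k r z - u r z\<bar>)" by (rule lip[OF r e])
     also have "\<dots> <= K * (\<Sum>z\<in>E. \<eta>)" by (intro mult_left_mono sum_mono k0 K k r) auto
     finally show ?thesis by (simp add: n_def)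
    qed
    moreover have "0 <= K * n * \<eta>" using K n0 \<eta> by simp
    ultimately have "norm (integral {a..s} (\<lambda>r. \<Phi> r (U k r) e) - integral {a..s} (\<lambda>r. \<Phi> r (u r) e))
      <= K * n * \<eta> * (s - a)"
     using s has_integral_abs_le[of "\<lambda>r. \<Phi> r (U k r) e - \<Phi> r (u r) e"] by simp
    also have "\<dots> <= (K * n + 1) * \<eta> * (b - a + 1)"
     using s K n0 \<eta> ab by (intro mult_mono) (auto intro!: mult_right_mono)
    also have "\<dots> = eps / 2"
    proof -
     define x y where "x = K * n + 1" and "y = b - a + 1"
     have "x ~= 0" "y ~= 0" using K n0 ab add_nonneg_pos[of "K * n" 1] by (auto simp: x_def y_def)
     hence "x * (eps / (2 * x * y)) * y = eps / 2" by simp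
     thus ?thesis by (simp add: \<eta>_def x_def y_def)
    qed
    finally show ?thesis using eps by simp
   qed
   thus "\<exists>no. \<forall>k\<ge>no. norm (integral {a..s} (\<lambda>r. \<Phi> r (U k r) e) - integral {a..s} (\<lambda>r. \<Phi> r (u r) e)) < eps"
    by blast
  qed
  hence "(\<lambda>k. U (Suc k) s e) \<longlonglongrightarrow> u0 e + integral {a..s} (\<lambda>r. \<Phi> r (u r) e)"
   unfolding US by (intro tendsto_intros)
  moreover have "(\<lambda>k. U (Suc k) s e) \<longlonglongrightarrow> u s e"
   using tendsto_uniform_limitI[OF unif[OF e] s] by (rule LIMSEQ_Suc)
  ultimately have "u s e = u0 e + integral {a..s} (\<lambda>r. \<Phi> r (u r) e)"
   using LIMSEQ_unique by blast
  thus ?thesis using integrable_integral[OF intu[OF e s]] by simp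
 qed
 with contu show ?thesis by blast
qed

section \<open>The forward Kolmogorov equation on a finite set\<close>

text \<open>Inflow minus outflow of the forward Kolmogorov equation. Diagonal entries of
  \<open>q\<close> are never read, so no convention for them is imposed.\<close>

definition fwd :: "'e set => (real => 'e => 'e => real) => real => ('e => real) => 'e => real" where
 "fwd E q u \<pi> y = (\<Sum>z\<in>E - {y}. \<pi> z * q u z y) - \<pi> y * (\<Sum>z\<in>E - {y}. q u y z)"

definition forward_sol :: "'e set => (real => 'e => 'e => real) => real => real => (real => 'e => real) => bool" where
 "forward_sol E q c d \<pi> \<longleftrightarrow>
   (\<forall>s\<in>{c..d}. \<forall>y\<in>E. ((\<lambda>u. fwd E q u (\<pi> u) y) has_integral (\<pi> s y - \<pi> c y)) {c..s})"

lemma sum_offdiag_swap: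
 assumes "finite E"
 shows "(\<Sum>y\<in>E. \<Sum>z\<in>E - {y}. h z y) = (\<Sum>z\<in>E. \<Sum>y\<in>E - {z}. h z (y::'e) :: real)"
proof -
 have "(\<Sum>y\<in>E. \<Sum>z\<in>{z\<in>E. z ~= y}. h z y) = (\<Sum>z\<in>E. \<Sum>y\<in>{y\<in>E. z ~= y}. h z y)"
  by (rule sum.swap_restrict[OF assms assms])
 moreover have "{z\<in>E. z ~= y} = E - {y}" "{z\<in>E. y ~= z} = E - {y}" for y by auto
 ultimately show ?thesis by simp
qed

text \<open>Duality of the forward operator and the generator, by exchanging the order of summation
  over off-diagonal pairs; it turns the product rule into Dynkin's formula.\<close>

lemma fwd_pairing:
 assumes "finite E"
 shows "(\<Sum>y\<in>E. fwd E q u \<pi> y * v y) = (\<Sum>y\<in>E. \<pi> y * (\<Sum>z\<in>E - {y}. q u y z * (v z - v y)))"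
proof -
 have "(\<Sum>y\<in>E. fwd E q u \<pi> y * v y) = (\<Sum>y\<in>E. \<Sum>z\<in>E - {y}. \<pi> z * q u z y * v y) - (\<Sum>y\<in>E. \<pi> y * (\<Sum>z\<in>E - {y}. q u y z) * v y)"
  by (simp add: fwd_def left_diff_distrib sum_subtractf sum_distrib_right)
 also have "(\<Sum>y\<in>E. \<Sum>z\<in>E - {y}. \<pi> z * q u z y * v y) = (\<Sum>y\<in>E. \<Sum>z\<in>E - {y}. \<pi> y * q u y z * v z)"
  by (rule sum_offdiag_swap[OF assms])
 finally show ?thesis
  by (simp add: sum_subtractf right_diff_distrib sum_distrib_left sum_distrib_right mult_ac)
qed

lemma fwd_linear:
 "fwd E q u (\<lambda>y. k1 * \<pi> y + k2 * \<rho> y) y = k1 * fwd E q u \<pi> y + k2 * fwd E q u \<rho> y"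
proof -
 have "(\<Sum>z\<in>E - {y}. (k1 * \<pi> z + k2 * \<rho> z) * q u z y) = k1 * (\<Sum>z\<in>E - {y}. \<pi> z * q u z y) + k2 * (\<Sum>z\<in>E - {y}. \<rho> z * q u z y)"
  by (simp add: sum_distrib_left distrib_right sum.distrib mult.assoc)
 thus ?thesis unfolding fwd_def by (simp only: distrib_right right_diff_distrib mult.assoc)
qed

lemma fwd_sum:
 "fwd E q u (\<lambda>y. \<Sum>x\<in>A. k x * \<pi> x y) y = (\<Sum>x\<in>A. k x * fwd E q u (\<pi> x) y)"
proof (induction A rule: infinite_finite_induct)
 case (insert x A)
 thus ?case using fwd_linear[of E q u "k x" "\<pi> x" 1 "\<lambda>y. \<Sum>x\<in>A. k x * \<pi> x y" y] by simp
qed (simp_all add: fwd_def)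

lemma forward_sol_cong:
 assumes "\<And>s y. [|s \<in> {c..d}; y \<in> E|] ==> \<pi> s y = \<rho> s y" and "forward_sol E q c d \<pi>"
 shows "forward_sol E q c d \<rho>"
proof (cases "c <= d")
 case True
 show ?thesis unfolding forward_sol_def
 proof (intro ballI)
  fix s y assume s: "s \<in> {c..d}" and y: "y \<in> E"
  have "((\<lambda>u. fwd E q u (\<pi> u) y) has_integral (\<pi> s y - \<pi> c y)) {c..s}"
   using assms(2) s y by (auto simp: forward_sol_def)
  moreover have "fwd E q u (\<pi> u) y = fwd E q u (\<rho> u) y" if "u \<in> {c..s}" for u
   using that s y assms(1) by (auto simp: fwd_def intro!: sum.cong)
  ultimately have "((\<lambda>u. fwd E q u (\<rho> u) y) has_integral (\<pi> s y - \<pi> c y)) {c..s}"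
   using has_integral_eq by (metis (no_types, lifting))
  moreover have "\<pi> s y = \<rho> s y" "\<pi> c y = \<rho> c y" using assms(1) s y True by auto
  ultimately show "((\<lambda>u. fwd E q u (\<rho> u) y) has_integral (\<rho> s y - \<rho> c y)) {c..s}" by simp
 qed
qed (simp add: forward_sol_def)

lemma forward_sol_sum:
 assumes "finite A" "\<And>x. x \<in> A ==> forward_sol E q c d (\<pi> x)"
 shows "forward_sol E q c d (\<lambda>s y. \<Sum>x\<in>A. k x * \<pi> x s y)"
 unfolding forward_sol_def
proof (intro ballI)
 fix s y assume "s \<in> {c..d}" "y \<in> E"
 hence "((\<lambda>u. \<Sum>x\<in>A. k x * fwd E q u (\<pi> x u) y) has_integral (\<Sum>x\<in>A. k x * (\<pi> x s y - \<pi> x c y))) {c..s}"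
  using assms by (intro has_integral_sum has_integral_mult_right) (auto simp: forward_sol_def)
 thus "((\<lambda>u. fwd E q u (\<lambda>y. \<Sum>x\<in>A. k x * \<pi> x u y) y) has_integral
    ((\<Sum>x\<in>A. k x * \<pi> x s y) - (\<Sum>x\<in>A. k x * \<pi> x c y))) {c..s}"
  by (simp only: fwd_sum right_diff_distrib sum_subtractf)
qed

lemma forward_sol_diff:
 assumes "forward_sol E q c d \<pi>" "forward_sol E q c d \<rho>"
 shows "forward_sol E q c d (\<lambda>s y. \<pi> s y - \<rho> s y)"
 unfolding forward_sol_def
proof (intro ballI)
 fix s y assume "s \<in> {c..d}" "y \<in> E"
 hence "((\<lambda>u. fwd E q u (\<pi> u) y - fwd E q u (\<rho> u) y) has_integral ((\<pi> s y - \<pi> c y) - (\<rho> s y - \<rho> c y))) {c..s}"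
  using assms by (intro has_integral_diff) (auto simp: forward_sol_def)
 moreover have "fwd E q u (\<lambda>y. \<pi> u y - \<rho> u y) y = fwd E q u (\<pi> u) y - fwd E q u (\<rho> u) y" for u
  using fwd_linear[of E q u 1 "\<pi> u" "-1" "\<rho> u" y] by simp
 moreover have "(\<pi> s y - \<pi> c y) - (\<rho> s y - \<rho> c y) = (\<pi> s y - \<rho> s y) - (\<pi> c y - \<rho> c y)" by simp
 ultimately show "((\<lambda>u. fwd E q u (\<lambda>y. \<pi> u y - \<rho> u y) y) has_integral ((\<pi> s y - \<rho> s y) - (\<pi> c y - \<rho> c y))) {c..s}"
  by (simp only:)
qed

lemma forward_sol_continuous:
 assumes "forward_sol E q c d \<pi>" "y \<in> E"
 shows "continuous_on {c..d} (\<lambda>s. \<pi> s y)"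
proof (cases "c <= d")
 case True
 have h: "((\<lambda>u. fwd E q u (\<pi> u) y) has_integral (\<pi> s y - \<pi> c y)) {c..s}" if "s \<in> {c..d}" for s
  using assms that by (auto simp: forward_sol_def)
 have "continuous_on {c..d} (\<lambda>s. \<pi> c y + integral {c..s} (\<lambda>u. fwd E q u (\<pi> u) y))"
  using h[of d] True by (intro continuous_intros indefinite_integral_continuous_1) auto
 moreover have "\<pi> s y = \<pi> c y + integral {c..s} (\<lambda>u. fwd E q u (\<pi> u) y)" if "s \<in> {c..d}" for s
  using h[OF that] by (simp add: integral_unique)
 ultimately show ?thesis using continuous_on_cong by (metis (no_types, lifting))
qed simp

lemma forward_sol_bounded:
 assumes "finite E" "forward_sol E q c d \<pi>"
 obtains K where "0 <= K" "\<forall>s\<in>{c..d}. \<forall>y\<in>E. \<bar>\<pi> s y\<bar> <= K"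
proof -
 have "bounded (\<Union>y\<in>E. (\<lambda>s. \<pi> s y) ` {c..d})"
  using assms by (intro bounded_UN ballI compact_imp_bounded compact_continuous_image)
   (auto intro: forward_sol_continuous)
 then obtain K where "\<And>x. x \<in> (\<Union>y\<in>E. (\<lambda>s. \<pi> s y) ` {c..d}) ==> norm x <= K"
  unfolding bounded_iff by blast
 hence "\<forall>s\<in>{c..d}. \<forall>y\<in>E. \<bar>\<pi> s y\<bar> <= max K 0" by fastforce
 thus ?thesis using that[of "max K 0"] by simp
qed

text \<open>The bound \<open>L\<close> may grow with the number of agents; in the final estimate it
  enters only terms that vanish with the time step.\<close>

locale rates =
 fixes E :: "'e set" and q :: "real => 'e => 'e => real" and a b L :: real
 assumes fin: "finite E" and ab: "a <= b" and L0: "0 <= L"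
  and q0: "\<And>u x y. [|u \<in> {a..b}; x \<in> E; y \<in> E; x ~= y|] ==> 0 <= q u x y"
  and qL: "\<And>u x y. [|u \<in> {a..b}; x \<in> E; y \<in> E; x ~= y|] ==> q u x y <= L"
  and qint: "\<And>x y. [|x \<in> E; y \<in> E; x ~= y|] ==> (\<lambda>u. q u x y) integrable_on {a..b}"
begin

definition "Lam = real (card E) * L"

lemma Lam0: "0 <= Lam" using L0 by (simp add: Lam_def)

lemma exit_rate:
 assumes "u \<in> {a..b}" "x \<in> E"
 shows "0 <= (\<Sum>z\<in>E - {x}. q u x z)" "(\<Sum>z\<in>E - {x}. q u x z) <= Lam"
proof -
 show "0 <= (\<Sum>z\<in>E - {x}. q u x z)" using assms by (intro sum_nonneg q0) auto
 have "(\<Sum>z\<in>E - {x}. q u x z) <= (\<Sum>z\<in>E - {x}. L)" using assms by (intro sum_mono qL) auto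
 also have "\<dots> <= (\<Sum>z\<in>E. L)" using L0 fin by (intro sum_mono2) auto
 finally show "(\<Sum>z\<in>E - {x}. q u x z) <= Lam" by (simp add: Lam_def)
qed

lemma fwd_abs_le:
 assumes "u \<in> {a..b}" "y \<in> E"
 shows "\<bar>fwd E q u \<pi> y\<bar> <= (L + Lam) * (\<Sum>z\<in>E. \<bar>\<pi> z\<bar>)"
proof -
 have "\<bar>\<pi> z * q u z y\<bar> <= \<bar>\<pi> z\<bar> * L" if "z \<in> E - {y}" for z
  unfolding abs_mult using that assms q0[of u z y] qL[of u z y] by (intro mult_left_mono) auto
 hence "\<bar>\<Sum>z\<in>E - {y}. \<pi> z * q u z y\<bar> <= (\<Sum>z\<in>E - {y}. \<bar>\<pi> z\<bar> * L)"
  by (rule order_trans[OF sum_abs sum_mono])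
 also have "\<dots> <= (\<Sum>z\<in>E. \<bar>\<pi> z\<bar> * L)" using fin L0 by (intro sum_mono2) auto
 also have "\<dots> = (\<Sum>z\<in>E. \<bar>\<pi> z\<bar>) * L" by (simp add: sum_distrib_right)
 finally have 1: "\<bar>\<Sum>z\<in>E - {y}. \<pi> z * q u z y\<bar> <= (\<Sum>z\<in>E. \<bar>\<pi> z\<bar>) * L" .
 have "\<bar>\<pi> y\<bar> <= (\<Sum>z\<in>E. \<bar>\<pi> z\<bar>)"
  using fin assms member_le_sum[of y E "\<lambda>z. \<bar>\<pi> z\<bar>"] by simp
 hence "\<bar>\<pi> y * (\<Sum>z\<in>E - {y}. q u y z)\<bar> <= (\<Sum>z\<in>E. \<bar>\<pi> z\<bar>) * Lam"
  unfolding abs_mult using exit_rate[OF assms] by (intro mult_mono) (auto intro: sum_nonneg)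
 with 1 have "\<bar>fwd E q u \<pi> y\<bar> <= (\<Sum>z\<in>E. \<bar>\<pi> z\<bar>) * L + (\<Sum>z\<in>E. \<bar>\<pi> z\<bar>) * Lam"
  unfolding fwd_def by linarith
 thus ?thesis by (simp add: algebra_simps)
qed

lemma fwd_integrable:
 assumes "{c..d} \<subseteq> {a..b}" "y \<in> E" "\<And>z. z \<in> E ==> continuous_on {c..d} (\<lambda>s. \<pi> s z)"
 shows "(\<lambda>u. fwd E q u (\<pi> u) y) integrable_on {c..d}"
proof -
 have *: "(\<lambda>u. q u x z * \<pi> u w) integrable_on {c..d}" if "x \<in> E" "z \<in> E" "x ~= z" "w \<in> E" for x z w
 proof (rule integrable_on_mult_continuous[where K = L])
  show "(\<lambda>u. q u x z) integrable_on {c..d}"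
   using qint[OF that(1-3)] assms(1) by (rule integrable_on_subinterval)
  show "\<forall>u\<in>{c..d}. \<bar>q u x z\<bar> <= L"
   using q0[of _ x z] qL[of _ x z] that assms(1) by (metis abs_of_nonneg subsetD)
 qed (use assms that in auto)
 have "(\<lambda>u. (\<Sum>z\<in>E - {y}. q u z y * \<pi> u z) - (\<Sum>z\<in>E - {y}. q u y z * \<pi> u y)) integrable_on {c..d}"
  using fin assms(2) by (intro integrable_diff integrable_sum *) auto
 thus ?thesis unfolding fwd_def by (simp add: sum_distrib_left mult.commute)
qed

lemma forward_sol_exists:
 assumes c: "c \<in> {a..b}"
 obtains \<pi> where "\<And>y. y \<in> E ==> \<pi> c y = \<pi>0 y" "forward_sol E q c b \<pi>"
proof -
 have "\<exists>\<pi>. \<forall>y\<in>E. continuous_on {c..b} (\<lambda>s. \<pi> s y) \<and>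
      (\<forall>s\<in>{c..b}. ((\<lambda>r. fwd E q r (\<pi> r) y) has_integral (\<pi> s y - \<pi>0 y)) {c..s})"
 proof (rule picard_finite[OF fin, where K = "L + Lam" and B = "(L + Lam) * (\<Sum>z\<in>E. \<bar>\<pi>0 z\<bar>)"])
  fix s u v e assume "s \<in> {c..b}" "e \<in> E"
  thus "\<bar>fwd E q s u e - fwd E q s v e\<bar> <= (L + Lam) * (\<Sum>z\<in>E. \<bar>u z - v z\<bar>)"
   using fwd_abs_le[of s e "\<lambda>y. 1 * u y + (-1) * v y"] c fwd_linear[of E q s 1 u "-1" v e] by simp
 next
  fix s e assume "s \<in> {c..b}" "e \<in> E"
  thus "\<bar>fwd E q s \<pi>0 e\<bar> <= (L + Lam) * (\<Sum>z\<in>E. \<bar>\<pi>0 z\<bar>)" using c by (intro fwd_abs_le) auto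
 next
  show "0 <= L + Lam" using L0 Lam0 by simp
  show "c <= b" using c by simp
  show "(\<lambda>s. fwd E q s (u s) e) integrable_on {c..b}"
   if "\<And>z. z \<in> E ==> continuous_on {c..b} (\<lambda>s. u s z)" "e \<in> E" for u e
   using c that by (intro fwd_integrable) auto
 qed
 then obtain \<pi> where \<pi>: "\<And>y s. [|y \<in> E; s \<in> {c..b}|] ==> ((\<lambda>r. fwd E q r (\<pi> r) y) has_integral (\<pi> s y - \<pi>0 y)) {c..s}"
  by blast
 have eq: "\<pi> c y = \<pi>0 y" if "y \<in> E" for y
  using \<pi>[OF that, of c] c has_integral_refl(1)[of "\<lambda>r. fwd E q r (\<pi> r) y" c]
   has_integral_unique[of "\<lambda>r. fwd E q r (\<pi> r) y" "\<pi> c y - \<pi>0 y" "{c..c}" 0] by (simp add: cbox_interval)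
 thus ?thesis using \<pi> by (intro that[of \<pi>]) (auto simp: forward_sol_def)
qed

lemma forward_sol_derivative_bounded:
 assumes "{c..d} \<subseteq> {a..b}" "forward_sol E q c d \<pi>"
 obtains K where "0 <= K" "\<forall>u\<in>{c..d}. \<forall>y\<in>E. \<bar>fwd E q u (\<pi> u) y\<bar> <= K"
  "\<forall>u\<in>{c..d}. \<forall>y\<in>E. \<bar>\<pi> u y\<bar> <= K"
proof -
 obtain K where K: "0 <= K" "\<forall>s\<in>{c..d}. \<forall>y\<in>E. \<bar>\<pi> s y\<bar> <= K"
  by (rule forward_sol_bounded[OF fin assms(2)])
 note K = K(1) K(2)[rule_format]
 have n: "0 <= (L + Lam) * (real (card E) * K)" using L0 Lam0 K(1) by simp
 have "\<bar>fwd E q u (\<pi> u) y\<bar> <= (L + Lam) * (real (card E) * K) + K" if "u \<in> {c..d}" "y \<in> E" for u y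
 proof -
  have "\<bar>fwd E q u (\<pi> u) y\<bar> <= (L + Lam) * (\<Sum>z\<in>E. \<bar>\<pi> u z\<bar>)"
   using that assms(1) by (intro fwd_abs_le) auto
  also have "\<dots> <= (L + Lam) * (\<Sum>z\<in>E. K)"
   using L0 Lam0 that K by (intro mult_left_mono sum_mono) auto
  finally show ?thesis using K(1) by simp
 qed
 moreover have "\<bar>\<pi> u y\<bar> <= (L + Lam) * (real (card E) * K) + K" if "u \<in> {c..d}" "y \<in> E" for u y
  using K(2)[OF that] n by linarith
 moreover have "0 <= (L + Lam) * (real (card E) * K) + K" using K(1) n by linarith
 ultimately show ?thesis by (intro that[of "(L + Lam) * (real (card E) * K) + K"] ballI)
qed

lemma forward_sol_subinterval:
 assumes "{c..d} \<subseteq> {a..b}" "forward_sol E q c d \<pi>" "{c'..d'} \<subseteq> {c..d}"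
 shows "forward_sol E q c' d' \<pi>"
proof (cases "c' <= d'")
 case True
 hence cd: "c <= c'" "d' <= d" "c <= d" using assms(3) by auto
 obtain K where "0 <= K" and K: "\<forall>u\<in>{c..d}. \<forall>y\<in>E. \<bar>fwd E q u (\<pi> u) y\<bar> <= K"
  and "\<forall>u\<in>{c..d}. \<forall>y\<in>E. \<bar>\<pi> u y\<bar> <= K"
  by (rule forward_sol_derivative_bounded[OF assms(1,2)])
 note K = K[rule_format]
 show ?thesis unfolding forward_sol_def
 proof (intro ballI)
  fix s y assume s: "s \<in> {c'..d'}" and y: "y \<in> E"
  have h: "\<forall>s\<in>{c..d}. ((\<lambda>u. fwd E q u (\<pi> u) y) has_integral (\<pi> s y - \<pi> c y)) {c..s}"
   using assms(2) y by (auto simp: forward_sol_def)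
  have K': "\<forall>u\<in>{c..d}. \<bar>fwd E q u (\<pi> u) y\<bar> <= K" using K y by blast
  have "c <= c'" "c' <= s" "s <= d" using s cd by auto
  thus "((\<lambda>u. fwd E q u (\<pi> u) y) has_integral (\<pi> s y - \<pi> c' y)) {c'..s}"
   by (intro indefinite_integral_facts(2)[OF h K' cd(3)])
 qed
qed (simp add: forward_sol_def)

text \<open>After multiplication by \<open>exp (Lam * (s - c))\<close> all coefficients of the equation are nonnegative.\<close>

lemma forward_sol_nonneg:
 assumes cd: "{c..d} \<subseteq> {a..b}" and fs: "forward_sol E q c d \<pi>"
  and init: "\<And>y. y \<in> E ==> 0 <= \<pi> c y" and s: "s \<in> {c..d}" and y: "y \<in> E"
 shows "0 <= \<pi> s y"
proof -
 obtain K where K: "0 <= K" "\<forall>u\<in>{c..d}. \<forall>y\<in>E. \<bar>fwd E q u (\<pi> u) y\<bar> <= K" "\<forall>u\<in>{c..d}. \<forall>y\<in>E. \<bar>\<pi> u y\<bar> <= K"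
  by (rule forward_sol_derivative_bounded[OF cd fs])
 note K = K(1) K(2,3)[rule_format]
 define g where "g = (\<lambda>s. exp (Lam * (s - c)))"
 define Y where "Y = (\<lambda>s y. g s * \<pi> s y)"
 define R where "R = (\<lambda>u y. (\<Sum>z\<in>E - {y}. q u z y * Y u z) + (Lam - (\<Sum>z\<in>E - {y}. q u y z)) * Y u y)"
 define G where "G = exp (Lam * (d - c))"
 have gG: "g u <= G" "0 < g u" if "u \<in> {c..d}" for u
  using that Lam0 by (auto simp: g_def G_def intro!: mult_left_mono)
 have Yint: "((\<lambda>u. R u y) has_integral (Y s y - Y c y)) {c..s}" if s: "s \<in> {c..d}" and y: "y \<in> E" for s y
 proof -
  have gi: "\<forall>s\<in>{c..d}. ((\<lambda>u. Lam * g u) has_integral (g s - g c)) {c..s}"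
  proof
   fix s assume s: "s \<in> {c..d}"
   have "(g has_vector_derivative (Lam * g x)) (at x within {c..s})" for x
    unfolding has_real_derivative_iff_has_vector_derivative[symmetric] g_def
    by (rule derivative_eq_intros refl | simp)+
   with s show "((\<lambda>u. Lam * g u) has_integral (g s - g c)) {c..s}"
    by (intro fundamental_theorem_of_calculus) auto
  qed
  have "((\<lambda>u. Lam * g u * \<pi> u y + g u * fwd E q u (\<pi> u) y) has_integral (g s * \<pi> s y - g c * \<pi> c y)) {c..s}"
  proof (rule has_integral_product_rule[OF gi _ _ _ s])
   show "\<forall>u\<in>{c..d}. \<bar>Lam * g u\<bar> <= Lam * G"
   proof
    fix u assume "u \<in> {c..d}"
    thus "\<bar>Lam * g u\<bar> <= Lam * G" using gG[of u] Lam0 by (simp add: abs_mult mult_left_mono)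
   qed
   show "\<forall>s\<in>{c..d}. ((\<lambda>u. fwd E q u (\<pi> u) y) has_integral \<pi> s y - \<pi> c y) {c..s}"
    using fs y by (auto simp: forward_sol_def)
   show "\<forall>u\<in>{c..d}. \<bar>fwd E q u (\<pi> u) y\<bar> <= K" using K(2) y by blast
  qed
  moreover have "Lam * g u * \<pi> u y + g u * fwd E q u (\<pi> u) y = R u y" for u
  proof -
   have "(\<Sum>z\<in>E - {y}. q u z y * (g u * \<pi> u z)) = g u * (\<Sum>z\<in>E - {y}. \<pi> u z * q u z y)"
    by (simp add: sum_distrib_left mult_ac)
   hence "R u y = g u * (\<Sum>z\<in>E - {y}. \<pi> u z * q u z y) + (Lam - (\<Sum>z\<in>E - {y}. q u y z)) * (g u * \<pi> u y)"
    unfolding R_def Y_def by simp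
   moreover have "\<And>k l x h w :: real. h * x + (l - k) * (h * w) = l * h * w + h * (x - w * k)"
    by (simp add: algebra_simps)
   ultimately show ?thesis unfolding fwd_def by metis
  qed
  ultimately show ?thesis by (simp add: Y_def)
 qed
 define l where "l = 2 * ((real (card E)) * L + Lam) + 1"
 have l1: "0 < l" using L0 Lam0 by (simp add: l_def add_nonneg_pos)
 \<comment> \<open>The integral equation for \<open>Y\<close> improves a lower bound by the factor
   1/2, measured in the weight \<open>exp (l * (s - c))\<close>; iteration drives the bound to
   0.\<close>
 have low: "Y s y \<ge> - (G * K) * (1/2)^k * exp (l * (s - c))" if "s \<in> {c..d}" "y \<in> E" for k s y
  using that
 proof (induction k arbitrary: s y)
  case 0
  have "\<bar>Y s y\<bar> <= G * K"
   unfolding Y_def abs_mult using 0 gG[OF 0(1)] K(1,3) by (intro mult_mono) auto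
  also have "\<dots> <= G * K * exp (l * (s - c))"
   using mult_left_mono[of 1 "exp (l * (s - c))" "G * K"] K(1) 0 l1 by (auto simp: G_def)
  finally have "\<bar>Y s y\<bar> <= G * K * exp (l * (s - c))" .
  moreover have "- (G * K) * (1/2)^0 * exp (l * (s - c)) = - (G * K * exp (l * (s - c)))" by simp
  ultimately show ?case by linarith
 next
  case (Suc k)
  define e where "e = (\<lambda>u. (G * K) * (1/2)^k * exp (l * (u - c)))"
  have e0: "0 <= e u" for u using K(1) by (simp add: e_def G_def)
  have "R u y \<ge> - ((real (card E) * L + Lam) * e u)" if u: "u \<in> {c..s}" for u
  proof -
   have u': "u \<in> {c..d}" "u \<in> {a..b}" using u Suc.prems cd by auto
   have Ye: "Y u z \<ge> - e u" if "z \<in> E" for z using Suc.IH[OF u'(1) that] by (simp add: e_def)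
   have "(\<Sum>z\<in>E - {y}. q u z y * Y u z) \<ge> (\<Sum>z\<in>E - {y}. - (L * e u))"
   proof (rule sum_mono)
    fix z assume z: "z \<in> E - {y}"
    have "q u z y * Y u z \<ge> q u z y * (- e u)"
     using Ye z q0[OF u'(2)] Suc.prems by (intro mult_left_mono) auto
    moreover have "q u z y * e u <= L * e u" using z qL[OF u'(2)] Suc.prems e0 by (intro mult_right_mono) auto
    ultimately show "q u z y * Y u z \<ge> - (L * e u)" by simp
   qed
   moreover have "(\<Sum>z\<in>E - {y}. - (L * e u)) \<ge> (\<Sum>z\<in>E. - (L * e u))"
    using fin e0[of u] L0 unfolding sum_negf neg_le_iff_le by (intro sum_mono2) auto
   ultimately have 1: "(\<Sum>z\<in>E - {y}. q u z y * Y u z) \<ge> - (real (card E) * L * e u)" by (simp add: sum_negf)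
   have ex: "0 <= Lam - (\<Sum>z\<in>E - {y}. q u y z)" "Lam - (\<Sum>z\<in>E - {y}. q u y z) <= Lam"
    using exit_rate[OF u'(2) Suc.prems(2)] by auto
   have "(Lam - (\<Sum>z\<in>E - {y}. q u y z)) * Y u y \<ge> (Lam - (\<Sum>z\<in>E - {y}. q u y z)) * (- e u)"
    using Ye Suc.prems ex by (intro mult_left_mono) auto
   moreover have "(Lam - (\<Sum>z\<in>E - {y}. q u y z)) * e u <= Lam * e u"
    using ex e0 by (intro mult_right_mono) auto
   ultimately have "(Lam - (\<Sum>z\<in>E - {y}. q u y z)) * Y u y \<ge> - (Lam * e u)" by linarith
   thus ?thesis unfolding R_def distrib_right using 1 by linarith
  qed
  note Rlow = this
  have "((\<lambda>u. - ((real (card E) * L + Lam) * e u)) has_integral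
    (- ((real (card E) * L + Lam) * ((G * K) * (1/2)^k * ((exp (l * (s - c)) - 1) / l))))) {c..s}"
   unfolding e_def using Suc.prems l1
   by (intro has_integral_neg has_integral_mult_right has_integral_exp_scaled) auto
  from has_integral_le[OF this Yint[OF Suc.prems] Rlow]
  have "Y s y - Y c y \<ge> - ((real (card E) * L + Lam) * ((G * K) * (1/2)^k * ((exp (l * (s - c)) - 1) / l)))" .
  moreover have "Y c y \<ge> 0" using init[of y] Suc.prems(2) by (simp add: Y_def g_def)
  moreover have "(real (card E) * L + Lam) * ((G * K) * (1/2)^k * ((exp (l * (s - c)) - 1) / l))
    <= (1/2) * ((G * K) * (1/2)^k * exp (l * (s - c)))"
  proof -
   have "(real (card E) * L + Lam) / l <= 1/2" using l1 by (simp add: l_def divide_le_eq)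
   moreover have "1 <= exp (l * (s - c))" using l1 Suc.prems by simp
   ultimately have "((real (card E) * L + Lam) / l) * ((G * K) * (1/2)^k * (exp (l * (s - c)) - 1))
    <= (1/2) * ((G * K) * (1/2)^k * exp (l * (s - c)))"
    using K(1) unfolding G_def by (intro mult_mono mult_left_mono mult_nonneg_nonneg) auto
   thus ?thesis by (simp only: times_divide_eq_left times_divide_eq_right)
  qed
  moreover have "- (G * K) * (1/2)^Suc k * exp (l * (s - c)) = - ((1/2) * ((G * K) * (1/2)^k * exp (l * (s - c))))" by simp
  ultimately show ?case by linarith
 qed
 have "(\<lambda>k. - (G * K) * (1/2)^k * exp (l * (s - c))) \<longlonglongrightarrow> - (G * K) * 0 * exp (l * (s - c))"
  by (intro tendsto_intros LIMSEQ_realpow_zero) auto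
 hence "(\<lambda>k. - (G * K) * (1/2)^k * exp (l * (s - c))) \<longlonglongrightarrow> 0" by simp
 hence "0 <= Y s y" by (rule LIMSEQ_le_const2) (use low[OF s y] in blast)
 thus ?thesis using gG[OF s] by (simp add: Y_def zero_le_mult_iff)
qed

text \<open>By linearity the difference and its negative both solve the equation with initial value
  0, so both are nonnegative.\<close>

lemma forward_sol_unique:
 assumes cd: "{c..d} \<subseteq> {a..b}" and "forward_sol E q c d \<pi>" "forward_sol E q c d \<rho>"
  and "\<And>y. y \<in> E ==> \<pi> c y = \<rho> c y" and "s \<in> {c..d}" "y \<in> E"
 shows "\<pi> s y = \<rho> s y"
 using forward_sol_nonneg[OF cd forward_sol_diff[OF assms(2,3)], of s y]
  forward_sol_nonneg[OF cd forward_sol_diff[OF assms(3,2)], of s y] assms(4-6) by auto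

text \<open>Product rule for each \<open>\<pi> u y * v u y\<close>, then the duality
  \<open>fwd_pairing\<close>. The formula concerns solutions of the forward equation rather than
  processes, so it also applies to feedbacks for which no chain is constructed.\<close>

lemma dynkin:
 assumes cd: "{c..d} \<subseteq> {a..b}" and fs: "forward_sol E q c d \<pi>" and s: "s \<in> {c..d}"
  and v: "\<And>y s. [|y \<in> E; s \<in> {c..d}|] ==> ((\<lambda>u. v' u y) has_integral (v s y - v c y)) {c..s}"
  and v': "\<And>u y. [|u \<in> {c..d}; y \<in> E|] ==> \<bar>v' u y\<bar> <= K'"
 shows "((\<lambda>u. \<Sum>y\<in>E. \<pi> u y * (v' u y + (\<Sum>z\<in>E - {y}. q u y z * (v u z - v u y)))) has_integral
      ((\<Sum>y\<in>E. \<pi> s y * v s y) - (\<Sum>y\<in>E. \<pi> c y * v c y))) {c..s}"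
proof -
 obtain K where "0 <= K" and K: "\<forall>u\<in>{c..d}. \<forall>y\<in>E. \<bar>fwd E q u (\<pi> u) y\<bar> <= K"
  and "\<forall>u\<in>{c..d}. \<forall>y\<in>E. \<bar>\<pi> u y\<bar> <= K"
  by (rule forward_sol_derivative_bounded[OF cd fs])
 note K = K[rule_format]
 have "((\<lambda>u. fwd E q u (\<pi> u) y * v u y + \<pi> u y * v' u y) has_integral (\<pi> s y * v s y - \<pi> c y * v c y)) {c..s}"
  if "y \<in> E" for y
 proof (rule has_integral_product_rule[where K = K and K' = K' and d = d])
  show "\<forall>u\<in>{c..d}. \<bar>fwd E q u (\<pi> u) y\<bar> <= K" using K that by blast
  show "\<forall>u\<in>{c..d}. \<bar>v' u y\<bar> <= K'" using v' that by blast
 qed (use fs that v s in \<open>auto simp: forward_sol_def\<close>)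
 hence "((\<lambda>u. \<Sum>y\<in>E. fwd E q u (\<pi> u) y * v u y + \<pi> u y * v' u y) has_integral (\<Sum>y\<in>E. \<pi> s y * v s y - \<pi> c y * v c y)) {c..s}"
  using fin by (intro has_integral_sum) auto
 thus ?thesis
  by (simp only: sum.distrib fwd_pairing[OF fin] sum_subtractf distrib_left add.commute[of "\<Sum>y\<in>E. \<pi> _ y * (\<Sum>z\<in>E - {y}. q _ y z * (v _ z - v _ y))"])
qed

text \<open>Dynkin's formula for the constant function 1.\<close>

lemma forward_sol_mass:
 assumes cd: "{c..d} \<subseteq> {a..b}" and fs: "forward_sol E q c d \<pi>" and s: "s \<in> {c..d}"
 shows "(\<Sum>y\<in>E. \<pi> s y) = (\<Sum>y\<in>E. \<pi> c y)"
proof -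
 have "((\<lambda>u. \<Sum>y\<in>E. \<pi> u y * (0 + (\<Sum>z\<in>E - {y}. q u y z * (1 - 1)))) has_integral
      ((\<Sum>y\<in>E. \<pi> s y * 1) - (\<Sum>y\<in>E. \<pi> c y * 1))) {c..s}"
  by (rule dynkin[OF cd fs s, where K' = 0]) auto
 from has_integral_unique[OF this, of 0] show ?thesis by simp
qed

end

text \<open>For a fixed start \<open>(r, x)\<close> the definition says two things at once: the case
  \<open>s = r\<close> yields the initial value, the rest is the forward equation.\<close>

lemma transition_probabilities_iff:
 "transition_probabilities E q t0 T p \<longleftrightarrow>
   (\<forall>r\<in>{t0..T}. \<forall>x\<in>E. (\<forall>y\<in>E. p r r x y = (if x = y then 1 else 0)) \<and> forward_sol E q r T (\<lambda>s. p r s x))"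
proof (intro iffI ballI conjI)
 fix r x assume tp: "transition_probabilities E q t0 T p" and r: "r \<in> {t0..T}" and x: "x \<in> E"
 have h: "((\<lambda>u. fwd E q u (p r u x) y) has_integral (p r s x y - (if x = y then 1 else 0))) {r..s}" if "s \<in> {r..T}" "y \<in> E" for s y
  using tp r x that by (auto simp: transition_probabilities_def fwd_def)
 show eq: "p r r x y = (if x = y then 1 else 0)" if "y \<in> E" for y
  using h[of r y] r that has_integral_refl(1)[of "\<lambda>u. fwd E q u (p r u x) y" r]
   has_integral_unique[of "\<lambda>u. fwd E q u (p r u x) y" _ "{r..r}" 0] by (fastforce simp add: cbox_interval)
 show "forward_sol E q r T (\<lambda>s. p r s x)"
  unfolding forward_sol_def using h eq by auto
next
 assume *: "\<forall>r\<in>{t0..T}. \<forall>x\<in>E. (\<forall>y\<in>E. p r r x y = (if x = y then 1 else 0)) \<and> forward_sol E q r T (\<lambda>s. p r s x)"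
 show "transition_probabilities E q t0 T p"
  unfolding transition_probabilities_def
 proof (intro ballI)
  fix r s x y assume "r \<in> {t0..T}" "s \<in> {r..T}" "x \<in> E" "y \<in> E"
  hence "((\<lambda>u. fwd E q u (p r u x) y) has_integral (p r s x y - p r r x y)) {r..s}" "p r r x y = (if x = y then 1 else 0)"
   using * unfolding forward_sol_def by blast+
  thus "((\<lambda>u. (\<Sum>z\<in>E - {y}. p r u x z * q u z y) - p r u x y * (\<Sum>z\<in>E - {y}. q u y z))
      has_integral (p r s x y - (if x = y then 1 else 0))) {r..s}" by (simp only: fwd_def)
 qed
qed

locale transition_rates = rates E q a b L for E :: "'e set" and q a b L +
 fixes p :: "real => real => 'e => 'e => real"
 assumes tp: "transition_probabilities E q a b p"
begin

lemma p_refl: "[|r \<in> {a..b}; x \<in> E; y \<in> E|] ==> p r r x y = (if x = y then 1 else 0)"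
 and p_forward: "[|r \<in> {a..b}; x \<in> E|] ==> forward_sol E q r b (\<lambda>s. p r s x)"
 using tp unfolding transition_probabilities_iff by simp_all

lemma p_nonneg: "[|a <= r; r <= s; s <= b; x \<in> E; y \<in> E|] ==> 0 <= p r s x y"
 by (rule forward_sol_nonneg[OF _ p_forward]) (auto simp: p_refl)

lemma p_sum:
 assumes "a <= r" "r <= s" "s <= b" "x \<in> E" shows "(\<Sum>y\<in>E. p r s x y) = 1"
proof -
 have "(\<Sum>y\<in>E. p r s x y) = (\<Sum>y\<in>E. p r r x y)"
  using assms by (intro forward_sol_mass[OF _ p_forward]) auto
 thus ?thesis using assms fin by (simp add: p_refl)
qed

lemma p_le_1: assumes "a <= r" "r <= s" "s <= b" "x \<in> E" "y \<in> E" shows "p r s x y <= 1"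
proof -
 have "p r s x y <= (\<Sum>y\<in>E. p r s x y)" using assms fin by (intro member_le_sum p_nonneg) auto
 thus ?thesis using p_sum assms by simp
qed

lemma p_mixture_forward:
 assumes "r \<in> {a..b}"
 shows "forward_sol E q r b (\<lambda>s y. \<Sum>x\<in>E. k x * p r s x y)"
 by (rule forward_sol_sum[OF fin]) (use assms p_forward in auto)

text \<open>Both sides solve the forward equation on \<open>{s..b}\<close> and agree at time
  \<open>s\<close>.\<close>

lemma p_Chapman_Kolmogorov:
 assumes "a <= r" "r <= s" "s <= t" "t <= b" "x \<in> E" "y \<in> E"
 shows "(\<Sum>z\<in>E. p r s x z * p s t z y) = p r t x y"
proof (rule forward_sol_unique[where c = s and d = b and s = t])
 show "forward_sol E q s b (\<lambda>t y. \<Sum>z\<in>E. p r s x z * p s t z y)"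
  using assms by (intro p_mixture_forward) auto
 show "forward_sol E q s b (\<lambda>t. p r t x)"
  by (rule forward_sol_subinterval[OF _ p_forward, of r]) (use assms in auto)
 show "(\<Sum>z\<in>E. p r s x z * p s s z y) = p r s x y" if "y \<in> E" for y
  using that assms fin by (simp add: p_refl if_distrib cong: if_cong)
qed (use assms in auto)

text \<open>Only the outflow can lower the probability of the starting state, and its rate is at
  most \<open>Lam\<close>.\<close>

lemma p_stay:
 assumes "a <= r" "r <= s" "s <= b" "x \<in> E"
 shows "1 - p r s x x <= Lam * (s - r)"
proof -
 have h: "((\<lambda>u. fwd E q u (p r u x) x) has_integral (p r s x x - p r r x x)) {r..s}"
  using p_forward[of r x] assms by (auto simp: forward_sol_def)
 have low: "- Lam <= fwd E q u (p r u x) x" if "u \<in> {r..s}" for u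
 proof -
  have u: "u \<in> {a..b}" using that assms by auto
  have "0 <= (\<Sum>z\<in>E - {x}. p r u x z * q u z x)"
   using u that assms by (intro sum_nonneg mult_nonneg_nonneg p_nonneg q0) auto
  moreover have "p r u x x * (\<Sum>z\<in>E - {x}. q u x z) <= 1 * Lam"
   using u that assms exit_rate[OF u assms(4)] p_le_1 p_nonneg by (intro mult_mono) auto
  ultimately show ?thesis by (simp add: fwd_def)
 qed
 have "((\<lambda>u. - Lam) has_integral (- Lam) * (s - r)) {r..s}"
  using has_integral_const_real[of "- Lam" r s] assms by (simp add: mult.commute)
 from has_integral_le[OF this h low] show ?thesis using assms by (simp add: p_refl)
qed

lemma p_leave:
 assumes "a <= r" "r <= s" "s <= b" "x \<in> E"
 shows "(\<Sum>y\<in>E - {x}. p r s x y) <= Lam * (s - r)"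
 using p_sum[OF assms] p_stay[OF assms] fin assms(4) by (simp add: sum.remove)

end

lemma (in rates) transition_probabilities_exist: "\<exists>p. transition_probabilities E q a b p"
proof -
 have "\<exists>\<pi>. (\<forall>y\<in>E. \<pi> r y = (if x = y then 1 else 0)) \<and> forward_sol E q r b \<pi>" if "r \<in> {a..b}" for r x
  using forward_sol_exists[OF that, of "\<lambda>y. if x = y then 1 else 0"] by metis
 then obtain \<pi> where "\<And>r x. r \<in> {a..b} ==> (\<forall>y\<in>E. \<pi> r x r y = (if x = y then 1 else 0)) \<and> forward_sol E q r b (\<pi> r x)"
  by metis
 thus ?thesis
  by (intro exI[of _ "\<lambda>r s x y. \<pi> r x s y"]) (auto simp: transition_probabilities_iff)
qed

section \<open>Existence of Markov chains with given rates\<close>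

lemma sum_even_odd:
 fixes f :: "nat => 'a::comm_monoid_add"
 shows "(\<Sum>k<2 * m. f k) = (\<Sum>k<m. f (2 * k) + f (Suc (2 * k)))"
 by (induction m) (auto simp: add.assoc)

text \<open>The linear bound in \<open>jump\<close> bounds the expected number of changes of
  \<open>Z\<close> on every dyadic grid by one and the same number; this yields one-sided limits
  along dyadic times almost surely.\<close>

locale jump_regularity = prob_space P for P :: "'w measure" +
 fixes Z :: "real => 'w => 'e::topological_space" and E :: "'e set" and x0 :: 'e and a b L :: real
 assumes finE: "finite E" and x0: "x0 \<in> E" and ab: "a <= b" and L0: "0 <= L"
  and Zm: "\<And>t. t \<in> {a..b} ==> Z t \<in> measurable P (count_space E)"
  and jump: "\<And>r s. [|a <= r; r <= s; s <= b|] ==> measure P {om\<in>space P. Z r om ~= Z s om} <= L * (s - r)"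
begin

definition "dy n k = a + (b - a) * real k / 2 ^ n"
definition "D = {dy n k | n k. k <= 2 ^ n}"
definition "jumps n om = (\<Sum>k<2 ^ n. if Z (dy n k) om ~= Z (dy n (Suc k)) om then 1 else 0 :: real)"
definition "good = {om\<in>space P. \<exists>K. \<forall>n. jumps n om <= K}"

lemma dy_double: "dy (Suc n) (2 * k) = dy n k"
 by (simp add: dy_def)

lemma dy_refine: "dy n k = dy (n + m) (2 ^ m * k)"
 by (simp add: dy_def power_add)

lemma dy_in: assumes "k <= 2 ^ n" shows "dy n k \<in> {a..b}"
proof -
 have "real k / 2 ^ n <= 1" using assms by simp
 hence "(b - a) * (real k / 2 ^ n) <= (b - a) * 1" using ab by (intro mult_left_mono) auto
 thus ?thesis using ab by (auto simp: dy_def)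
qed

lemma D_sub: "D \<subseteq> {a..b}" using dy_in by (auto simp: D_def)

lemma Z_eq_sets[measurable]:
 assumes "r \<in> {a..b}" "s \<in> {a..b}"
 shows "{om\<in>space P. Z r om ~= Z s om} \<in> sets P"
proof -
 have "{om\<in>space P. Z r om ~= Z s om} = (\<Union>x\<in>E. (Z r -` {x} \<inter> space P) - (Z s -` {x} \<inter> space P))"
  using measurable_space[OF Zm[OF assms(1)]] by auto
 moreover have "Z t -` {x} \<inter> space P \<in> sets P" if "t \<in> {a..b}" "x \<in> E" for t x
  using measurable_sets[OF Zm[OF that(1)], of "{x}"] that by simp
 ultimately show ?thesis using assms finE by auto
qed

text \<open>If \<open>Z\<close> differs at the ends of a cell, it differs at the ends of one of its
  two halves.\<close>

lemma jumps_mono_Suc: "jumps n om <= jumps (Suc n) om"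
proof -
 define c where "c = (\<lambda>n k. if Z (dy n k) om ~= Z (dy n (Suc k)) om then 1 else 0 :: real)"
 have "c n k <= c (Suc n) (2 * k) + c (Suc n) (Suc (2 * k))" for k
  unfolding c_def using dy_double[of n k] dy_double[of n "Suc k"] by simp
 hence "(\<Sum>k<2 ^ n. c n k) <= (\<Sum>k<2 * 2 ^ n. c (Suc n) k)"
  unfolding sum_even_odd by (intro sum_mono)
 thus ?thesis unfolding jumps_def c_def by simp
qed

lemma jumps_mono: "n <= m ==> jumps n om <= jumps m om"
 using jumps_mono_Suc by (rule lift_Suc_mono_le[of "\<lambda>n. jumps n om"])

lemma jumps_nonneg: "0 <= jumps n om" unfolding jumps_def by (intro sum_nonneg) simp

lemma jumps_measurable[measurable]: "jumps n \<in> borel_measurable P"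
 unfolding jumps_def
 by (intro borel_measurable_sum measurable_If Z_eq_sets dy_in) auto

lemma good_sets[measurable]: "good \<in> sets P"
proof -
 have "good = {om\<in>space P. \<exists>K::nat. \<forall>n. jumps n om <= real K}"
  unfolding good_def using real_nat_ceiling_ge order_trans by (blast)
 thus ?thesis by simp
qed

text \<open>Each of the \<open>2 ^ n\<close> cells contributes at most \<open>L\<close> times its
  length \<open>(b - a) / 2 ^ n\<close>, so the bound does not depend on \<open>n\<close>.\<close>

lemma expected_jumps: "integral\<^sup>L P (jumps n) <= L * (b - a)"
proof -
 have cell: "measure P {om\<in>space P. Z (dy n k) om ~= Z (dy n (Suc k)) om} <= L * ((b - a) / 2 ^ n)" if "k < 2 ^ n" for k
 proof -
  have d: "dy n k \<in> {a..b}" "dy n (Suc k) \<in> {a..b}" "dy n (Suc k) - dy n k = (b - a) / 2 ^ n"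
   using that by (auto intro!: dy_in[THEN subsetD[OF order_refl]] simp del: atLeastAtMost_iff) (simp add: dy_def field_simps)
  moreover have "dy n k <= dy n (Suc k)" using d(3) ab by (smt (verit) divide_nonneg_nonneg zero_le_power)
  ultimately show ?thesis using jump[of "dy n k" "dy n (Suc k)"] by simp
 qed
 have "integral\<^sup>L P (jumps n) = (\<Sum>k<2 ^ n. \<integral>om. indicator {om\<in>space P. Z (dy n k) om ~= Z (dy n (Suc k)) om} om \<partial>P)"
 proof -
  have "integral\<^sup>L P (jumps n) = (\<integral>om. (\<Sum>k<2 ^ n. indicator {om\<in>space P. Z (dy n k) om ~= Z (dy n (Suc k)) om} om) \<partial>P)"
  proof (intro Bochner_Integration.integral_cong refl)
   fix om assume "om \<in> space P"
   thus "jumps n om = (\<Sum>k<2 ^ n. indicator {om\<in>space P. Z (dy n k) om ~= Z (dy n (Suc k)) om} om)"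
    unfolding jumps_def indicator_def by (intro sum.cong refl) simp
  qed
  also have "\<dots> = (\<Sum>k<2 ^ n. \<integral>om. indicator {om\<in>space P. Z (dy n k) om ~= Z (dy n (Suc k)) om} om \<partial>P)"
   by (intro Bochner_Integration.integral_sum integrable_real_indicator Z_eq_sets dy_in) (auto simp: less_top[symmetric])
  finally show ?thesis .
 qed
 also have "\<dots> = (\<Sum>k<2 ^ n. measure P {om\<in>space P. Z (dy n k) om ~= Z (dy n (Suc k)) om})"
 proof (intro sum.cong refl)
  fix k :: nat
  have "{om\<in>space P. Z (dy n k) om ~= Z (dy n (Suc k)) om} \<inter> space P = {om\<in>space P. Z (dy n k) om ~= Z (dy n (Suc k)) om}" by blast
  thus "(\<integral>om. indicator {om\<in>space P. Z (dy n k) om ~= Z (dy n (Suc k)) om} om \<partial>P) =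
    prob {om\<in>space P. Z (dy n k) om ~= Z (dy n (Suc k)) om}"
   by (simp only: Bochner_Integration.integral_indicator)
 qed
 also have "\<dots> <= (\<Sum>k<(2::nat) ^ n. L * ((b - a) / 2 ^ n))"
  by (intro sum_mono cell) auto
 also have "\<dots> = L * (b - a)" by simp
 finally show ?thesis .
qed

lemma jumps_le: "jumps n om <= 2 ^ n"
proof -
 have "jumps n om <= (\<Sum>k<(2::nat) ^ n. 1)" unfolding jumps_def by (intro sum_mono) simp
 thus ?thesis by simp
qed

text \<open>The counts increase with \<open>n\<close> and have bounded expectations, so by monotone
  convergence their supremum is finite almost surely.\<close>

lemma AE_good: "AE om in P. om \<in> good"
proof -
 have int: "integrable P (jumps n)" for n
  using jumps_le[of n] jumps_nonneg by (intro integrable_const_bound[where B = "2 ^ n"]) auto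
 have "(\<integral>\<^sup>+om. (SUP n. ennreal (jumps n om)) \<partial>P) = (SUP n. \<integral>\<^sup>+om. ennreal (jumps n om) \<partial>P)"
  by (intro nn_integral_monotone_convergence_SUP) (auto simp: incseq_def le_fun_def jumps_mono ennreal_leI)
 also have "\<dots> <= ennreal (L * (b - a))"
  using expected_jumps int by (intro SUP_least) (simp add: nn_integral_eq_integral jumps_nonneg ennreal_leI)
 finally have "(\<integral>\<^sup>+om. (SUP n. ennreal (jumps n om)) \<partial>P) ~= \<infinity>"
  using ennreal_less_top by (metis infinity_ennreal_def linorder_not_le)
 hence "AE om in P. (SUP n. ennreal (jumps n om)) ~= \<infinity>"
  by (intro nn_integral_PInf_AE) auto
 with AE_space show ?thesis
 proof eventually_elim
  fix om assume w: "om \<in> space P" "(SUP n. ennreal (jumps n om)) ~= \<infinity>"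
  hence "(SUP n. ennreal (jumps n om)) < top" using less_top infinity_ennreal_def by metis
  then obtain K :: nat where K: "(SUP n. ennreal (jumps n om)) < of_nat K" using ennreal_Ex_less_of_nat by blast
  have "jumps n om <= real K" for n
  proof -
   have "ennreal (jumps n om) <= ennreal (real K)"
    using K by (metis SUP_upper UNIV_I ennreal_of_nat_eq_real_of_nat less_imp_le order_trans)
   thus ?thesis by (simp add: ennreal_le_iff)
  qed
  thus "om \<in> good" using w(1) by (auto simp: good_def)
 qed
qed

text \<open>A witness of \<open>m\<close> changes of value along increasing dyadic times, which may
  belong to different levels.\<close>

definition "alternates om m e \<longleftrightarrow> (\<forall>i\<le>m. e i \<in> D) \<and> (\<forall>i<m. e i < e (Suc i) \<and> Z (e i) om ~= Z (e (Suc i)) om)"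

lemma common_level:
 assumes "\<forall>i\<le>(m::nat). e i \<in> D"
 shows "\<exists>n \<kappa>. \<forall>i\<le>m. e i = dy n (\<kappa> i) \<and> \<kappa> i <= 2 ^ n"
proof -
 have "\<forall>i\<in>{..m}. \<exists>p. e i = dy (fst p) (snd p) \<and> snd p <= 2 ^ fst p" using assms by (auto simp: D_def)
 then obtain p where p: "\<forall>i\<in>{..m}. e i = dy (fst (p i)) (snd (p i)) \<and> snd (p i) <= 2 ^ fst (p i)" by (rule bchoice[THEN exE])
 \<comment> \<open>The sum of the levels is a level that refines all of them.\<close>
 define N where "N = (\<Sum>i\<le>m. fst (p i))"
 define \<kappa> where "\<kappa> = (\<lambda>i. 2 ^ (N - fst (p i)) * snd (p i))"
 have "e i = dy N (\<kappa> i) \<and> \<kappa> i <= 2 ^ N" if i: "i <= m" for i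
 proof
  have N: "fst (p i) <= N" unfolding N_def using i member_le_sum[of i "{..m}" "\<lambda>i. fst (p i)"] by simp
  show "e i = dy N (\<kappa> i)"
   using bspec[OF p, of i] i dy_refine[of "fst (p i)" "snd (p i)" "N - fst (p i)"] N by (simp add: \<kappa>_def)
  have "\<kappa> i <= 2 ^ (N - fst (p i)) * 2 ^ fst (p i)"
   unfolding \<kappa>_def using bspec[OF p, of i] i by (intro mult_left_mono) auto
  also have "\<dots> = 2 ^ N" using N by (simp flip: power_add)
  finally show "\<kappa> i <= 2 ^ N" .
 qed
 thus ?thesis by blast
qed

lemma dy_less_iff: "a < b ==> dy n k < dy n l \<longleftrightarrow> k < l"
 by (simp add: dy_def divide_less_cancel)

text \<open>On a common grid consecutive times of \<open>e\<close> enclose disjoint blocks of cells,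
  and in each block \<open>Z\<close> changes over at least one cell.\<close>

lemma alternates_bound:
 assumes ab': "a < b" and alt: "alternates om m e" and K: "\<And>n. jumps n om <= K"
 shows "real m <= K"
proof -
 obtain n \<kappa> where \<kappa>: "\<And>i. i <= m ==> e i = dy n (\<kappa> i) \<and> \<kappa> i <= 2 ^ n"
  using common_level[of m e] alt unfolding alternates_def by blast
 define c where "c = (\<lambda>k. if Z (dy n k) om ~= Z (dy n (Suc k)) om then 1 else 0 :: real)"
 have const: "Z (dy n (i + j)) om = Z (dy n i) om" if "\<forall>k\<in>{i..<i + j}. c k = 0" for i j
  using that
 proof (induction j)
  case (Suc j)
  hence "Z (dy n (i + j)) om = Z (dy n i) om" "c (i + j) = 0" by auto
  moreover from this(2) have "Z (dy n (i + j)) om = Z (dy n (i + Suc j)) om" unfolding c_def by (metis add_Suc_right zero_neq_one)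
  ultimately show ?case by simp
 qed simp
 have "real i <= (\<Sum>k<\<kappa> i. c k)" if "i <= m" for i
  using that
 proof (induction i)
  case 0 thus ?case by (simp add: c_def sum_nonneg)
 next
  case (Suc i)
  have lt: "\<kappa> i < \<kappa> (Suc i)" and ne: "Z (dy n (\<kappa> i)) om ~= Z (dy n (\<kappa> (Suc i))) om"
  proof -
   have e: "e i = dy n (\<kappa> i)" "e (Suc i) = dy n (\<kappa> (Suc i))" using \<kappa>[of i] \<kappa>[of "Suc i"] Suc.prems by auto
   have "e i < e (Suc i)" "Z (e i) om ~= Z (e (Suc i)) om" using alt Suc.prems by (auto simp: alternates_def)
   thus "\<kappa> i < \<kappa> (Suc i)" "Z (dy n (\<kappa> i)) om ~= Z (dy n (\<kappa> (Suc i))) om"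
    unfolding e using dy_less_iff[OF ab'] by auto
  qed
  have "\<not> (\<forall>k\<in>{\<kappa> i..<\<kappa> (Suc i)}. c k = 0)"
   using const[of "\<kappa> i" "\<kappa> (Suc i) - \<kappa> i"] lt ne by auto
  then obtain k where k: "k \<in> {\<kappa> i..<\<kappa> (Suc i)}" "c k ~= 0" by blast
  have c1: "c k = 1" using k(2) by (auto simp: c_def split: if_splits)
  have "1 <= (\<Sum>k\<in>{\<kappa> i..<\<kappa> (Suc i)}. c k)"
   unfolding c1[symmetric] using k(1) by (intro member_le_sum) (auto simp: c_def)
  moreover have "(\<Sum>k<\<kappa> (Suc i). c k) = (\<Sum>k<\<kappa> i. c k) + (\<Sum>k\<in>{\<kappa> i..<\<kappa> (Suc i)}. c k)"
   using sum.atLeastLessThan_concat[of 0 "\<kappa> i" "\<kappa> (Suc i)" c] lt by (simp add: atLeast0LessThan)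
  ultimately show ?case using Suc by simp
 qed
 hence "real m <= (\<Sum>k<\<kappa> m. c k)" by simp
 also have "\<dots> <= (\<Sum>k<2 ^ n. c k)" using \<kappa>[of m] by (intro sum_mono2) (auto simp: c_def)
 also have "\<dots> = jumps n om" by (simp add: jumps_def c_def)
 finally show ?thesis using K[of n] by simp
qed

text \<open>Otherwise dyadic times ever closer to \<open>s\<close> from the right, each with a new
  change of value, can be prepended without end, against \<open>alternates_bound\<close>.\<close>

lemma right_limit:
 assumes w: "om \<in> good" and s: "a <= s" "s < b"
 shows "\<exists>c eps. 0 < eps \<and> (\<forall>d\<in>D. s < d \<and> d < s + eps --> Z d om = c)"
proof (rule ccontr)
 assume "\<not> ?thesis"
 hence h: "\<exists>d\<in>D. s < d \<and> d < s + eps \<and> Z d om ~= c" if "0 < eps" for eps c using that by blast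
 have alt: "\<exists>e. alternates om m e \<and> s < e 0" for m
 proof (induction m)
  case 0
  obtain d where "d \<in> D" "s < d" using h[of 1 undefined] by auto
  thus ?case by (intro exI[of _ "\<lambda>_. d"]) (auto simp: alternates_def)
 next
  case (Suc m)
  then obtain e where e: "alternates om m e" "s < e 0" by blast
  obtain d where d: "d \<in> D" "s < d" "d < e 0" "Z d om ~= Z (e 0) om" using h[of "e 0 - s" "Z (e 0) om"] e(2) by auto
  have "alternates om (Suc m) (\<lambda>i. case i of 0 => d | Suc j => e j)"
   using e(1) d unfolding alternates_def by (auto split: nat.splits)
  thus ?case using d(2) by (intro exI[of _ "\<lambda>i. case i of 0 => d | Suc j => e j"]) auto
 qed
 obtain K where K: "\<And>n. jumps n om <= K" using w by (auto simp: good_def)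
 obtain m :: nat where "K < real m" using reals_Archimedean2 by blast
 moreover obtain e where "alternates om m e" using alt by blast
 ultimately show False using alternates_bound[of om m e K] K s by auto
qed

text \<open>Mirror image of \<open>right_limit\<close>: the new dyadic times increase to
  \<open>s\<close> and are appended.\<close>

lemma left_limit:
 assumes w: "om \<in> good" and s: "a < s" "s <= b"
 shows "\<exists>c eps. 0 < eps \<and> (\<forall>d\<in>D. s - eps < d \<and> d < s --> Z d om = c)"
proof (rule ccontr)
 assume "\<not> ?thesis"
 hence h: "\<exists>d\<in>D. s - eps < d \<and> d < s \<and> Z d om ~= c" if "0 < eps" for eps c using that by blast
 have alt: "\<exists>e. alternates om m e \<and> e m < s" for m
 proof (induction m)
  case 0
  obtain d where "d \<in> D" "d < s" using h[of 1 undefined] by auto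
  thus ?case by (intro exI[of _ "\<lambda>_. d"]) (auto simp: alternates_def)
 next
  case (Suc m)
  then obtain e where e: "alternates om m e" "e m < s" by blast
  obtain d where d: "d \<in> D" "e m < d" "d < s" "Z d om ~= Z (e m) om" using h[of "s - e m" "Z (e m) om"] e(2) by auto
  have "alternates om (Suc m) (\<lambda>i. if i <= m then e i else d)"
   using e(1) d unfolding alternates_def by (auto simp: le_Suc_eq less_Suc_eq)
  thus ?case using d(3) by (intro exI[of _ "\<lambda>i. if i <= m then e i else d"]) auto
 qed
 obtain K where K: "\<And>n. jumps n om <= K" using w by (auto simp: good_def)
 obtain m :: nat where "K < real m" using reals_Archimedean2 by blast
 moreover obtain e where "alternates om m e" using alt by blast
 ultimately show False using alternates_bound[of om m e K] K s by auto
qed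

text \<open>The first dyadic time of level \<open>n\<close> strictly after \<open>s\<close>;
  rounding down and adding 1 keeps it strict also when \<open>s\<close> itself is dyadic.\<close>

definition "up n s = dy n (nat \<lfloor>(s - a) * 2 ^ n / (b - a)\<rfloor> + 1)"

lemma up_props:
 assumes s: "a <= s" "s < b"
 shows "up n s \<in> D" "s < up n s" "up n s <= s + (b - a) / 2 ^ n"
proof -
 have ab': "a < b" using s by simp
 define x where "x = (s - a) * 2 ^ n / (b - a)"
 have x0: "0 <= x" using s by (simp add: x_def)
 have "(s - a) / (b - a) < 1" using s by simp
 hence "(s - a) / (b - a) * 2 ^ n < 1 * 2 ^ n" by (intro mult_strict_right_mono) auto
 hence x1: "x < 2 ^ n" by (simp add: x_def)
 have fl: "real (nat \<lfloor>x\<rfloor>) <= x" "x < real (nat \<lfloor>x\<rfloor>) + 1" using x0 by (auto simp: le_floor_iff)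
 have "real (2 ^ n) = 2 ^ n" by simp
 hence "real (nat \<lfloor>x\<rfloor>) < real (2 ^ n)" using fl(1) x1 by linarith
 hence "nat \<lfloor>x\<rfloor> < 2 ^ n" unfolding of_nat_less_iff .
 hence k: "nat \<lfloor>x\<rfloor> + 1 <= 2 ^ n" unfolding Suc_eq_plus1[symmetric] by (rule Suc_leI)
 thus "up n s \<in> D" unfolding up_def x_def[symmetric] D_def by blast
 have sx: "s = a + (b - a) * x / 2 ^ n" using ab' by (simp add: x_def)
 have up: "up n s = a + (b - a) * (real (nat \<lfloor>x\<rfloor>) + 1) / 2 ^ n" by (simp add: up_def dy_def x_def)
 show "s < up n s" unfolding up using fl(2) ab' by (subst sx) (simp add: divide_strict_right_mono)
 have "(b - a) * (real (nat \<lfloor>x\<rfloor>) + 1) / 2 ^ n <= (b - a) * (x + 1) / 2 ^ n"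
  using fl(1) ab' by (intro divide_right_mono mult_left_mono) auto
 thus "up n s <= s + (b - a) / 2 ^ n" unfolding up by (subst sx) (simp add: distrib_left add_divide_distrib)
qed

lemma half_powers_small: "0 < eps ==> \<exists>m. \<forall>n\<ge>m. (b - a) / 2 ^ n < eps"
proof -
 assume e: "0 < eps"
 have "(\<lambda>n. (b - a) * (1/2) ^ n) \<longlonglongrightarrow> (b - a) * 0" by (intro tendsto_intros LIMSEQ_realpow_zero) auto
 hence "(\<lambda>n. (b - a) / 2 ^ n) \<longlonglongrightarrow> 0" by (simp add: power_divide)
 hence "\<forall>\<^sub>F n in sequentially. (b - a) / 2 ^ n < eps" using e by (rule order_tendstoD(2))
 thus ?thesis by (simp add: eventually_sequentially)
qed

text \<open>The limit of \<open>Z\<close> along dyadic times from the right, which by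
  \<open>right_limit\<close> is an eventually constant value. The other branches are defaults:
  \<open>x0\<close> on the exceptional set and before \<open>a\<close>, and the value at
  \<open>b\<close> from \<open>b\<close> on, where no dyadic time lies to the right.\<close>

definition "rcv t om = (if om \<notin> good then x0 else if b <= t then Z b om else if t < a then x0 else
  (SOME c. \<exists>eps>0. \<forall>d\<in>D. t < d \<and> d < t + eps --> Z d om = c))"

lemma rcv_eqI:
 assumes w: "om \<in> good" and s: "a <= s" "s < b" and e: "0 < eps" and c: "\<And>d. [|d \<in> D; s < d; d < s + eps|] ==> Z d om = c"
 shows "rcv s om = c"
proof -
 have "c' = c" if h: "0 < \<delta>" "\<forall>d\<in>D. s < d \<and> d < s + \<delta> --> Z d om = c'" for c' \<delta>
 proof -
  obtain n where n: "(b - a) / 2 ^ n < min eps \<delta>" using half_powers_small[of "min eps \<delta>"] e h by auto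
  show ?thesis using up_props[OF s, of n] n h c[of "up n s"] by auto
 qed
 hence "(SOME c. \<exists>eps>0. \<forall>d\<in>D. s < d \<and> d < s + eps --> Z d om = c) = c"
  using e c by (intro some_equality) blast+
 thus ?thesis using w s by (simp add: rcv_def)
qed

text \<open>Countably many variables \<open>Z (up n s)\<close> decide the value of
  \<open>rcv\<close>, which gives its measurability.\<close>

lemma rcv_eq_iff:
 assumes w: "om \<in> good" and s: "a <= s" "s < b"
 shows "rcv s om = y \<longleftrightarrow> (\<exists>m. \<forall>n\<ge>m. Z (up n s) om = y)"
proof -
 obtain c eps where c: "0 < eps" "\<And>d. [|d \<in> D; s < d; d < s + eps|] ==> Z d om = c" using right_limit[OF w s] by blast
 obtain m where "\<forall>n\<ge>m. (b - a) / 2 ^ n < eps" using half_powers_small[OF c(1)] by blast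
 hence m: "Z (up n s) om = c" if "n \<ge> m" for n
  using up_props[OF s, of n] that by (intro c(2)) (auto intro: le_less_trans)
 have "rcv s om = c" by (rule rcv_eqI[OF w s c])
 thus ?thesis using m by (metis max.cobounded1 max.cobounded2)
qed

lemma rcv_in_E:
 assumes "t \<in> {a..b}" "om \<in> space P" shows "rcv t om \<in> E"
proof (cases "om \<in> good \<and> t < b")
 case True
 then obtain m where "Z (up m t) om = rcv t om" using rcv_eq_iff[of om t "rcv t om"] assms by auto
 moreover have "up m t \<in> {a..b}" using up_props(1)[of t m] D_sub True assms by auto
 ultimately show ?thesis using measurable_space[OF Zm, of "up m t" om] assms by simp
next
 case False
 thus ?thesis using x0 assms measurable_space[OF Zm, of b om] ab by (auto simp: rcv_def)
qed

lemma Z_val_sets[measurable]: "t \<in> {a..b} ==> {om\<in>space P. Z t om = y} \<in> sets P"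
proof -
 assume t: "t \<in> {a..b}"
 have "{om\<in>space P. Z t om = y} = Z t -` ({y} \<inter> E) \<inter> space P" using measurable_space[OF Zm[OF t]] by auto
 also have "\<dots> \<in> sets P" by (rule measurable_sets[OF Zm[OF t]]) simp
 finally show ?thesis .
qed

lemma rcv_measurable:
 assumes t: "t \<in> {a..b}"
 shows "rcv t \<in> measurable P (count_space E)"
proof -
 have "{om\<in>space P. rcv t om = y} \<in> sets P" for y
 proof (cases "t < b")
  case True
  have u: "up n t \<in> {a..b}" for n using up_props(1)[of t n] D_sub True t by auto
  have "{om\<in>space P. rcv t om = y} = (good \<inter> (\<Union>m. \<Inter>n\<in>{m..}. {om\<in>space P. Z (up n t) om = y})) \<union> (if y = x0 then space P - good else {})"
  proof (rule set_eqI)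
   fix om
   have gs: "good \<subseteq> space P" by (auto simp: good_def)
   show "om \<in> {om\<in>space P. rcv t om = y} \<longleftrightarrow> om \<in> (good \<inter> (\<Union>m. \<Inter>n\<in>{m..}. {om\<in>space P. Z (up n t) om = y})) \<union> (if y = x0 then space P - good else {})"
   proof (cases "om \<in> good")
    case g: True
    have "rcv t om = y \<longleftrightarrow> (\<exists>m. \<forall>n\<ge>m. Z (up n t) om = y)" using t True by (intro rcv_eq_iff[OF g]) auto
    thus ?thesis using g gs by auto
   next
    case False
    hence "rcv t om = x0" by (simp add: rcv_def)
    with False show ?thesis by auto
   qed
  qed
  also have "\<dots> \<in> sets P"
  proof -
   have "(\<Inter>n\<in>{m..}. {om\<in>space P. Z (up n t) om = y}) \<in> sets P" for m
    by (rule sets.countable_INT') (auto intro!: Z_val_sets u)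
   hence "(\<Union>m. \<Inter>n\<in>{m..}. {om\<in>space P. Z (up n t) om = y}) \<in> sets P" by (intro sets.countable_nat_UN) blast
   moreover have "(if y = x0 then space P - good else {}) \<in> sets P" using good_sets by simp
   ultimately show ?thesis using good_sets by (intro sets.Un sets.Int)
  qed
  finally show ?thesis .
 next
  case False
  hence "{om\<in>space P. rcv t om = y} = (good \<inter> {om\<in>space P. Z b om = y}) \<union> (if y = x0 then space P - good else {})"
   by (auto simp: rcv_def good_def)
  also have "\<dots> \<in> sets P" using Z_val_sets[of b y] ab good_sets by simp
  finally show ?thesis .
 qed
 thus ?thesis
  using rcv_in_E[OF t] unfolding measurable_count_space_eq2[OF finE] vimage_def Int_def by (auto simp: conj_commute)
qed

lemma rcv_cadlag: "cadlag_on a b (\<lambda>t. rcv t om)"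
proof (cases "om \<in> good")
 case False
 hence "rcv t om = x0" for t by (simp add: rcv_def)
 thus ?thesis unfolding cadlag_on_def by auto
next
 case w: True
 show ?thesis unfolding cadlag_on_def
 proof (intro conjI ballI)
  fix s assume "s \<in> {a..<b}"
  hence s: "a <= s" "s < b" by auto
  obtain c eps where c: "0 < eps" "\<And>d. [|d \<in> D; s < d; d < s + eps|] ==> Z d om = c" using right_limit[OF w s] by blast
  have ms: "rcv s om = c" by (rule rcv_eqI[OF w s c])
  have "rcv t om = c" if "s < t" "t < min b (s + eps)" for t
   by (rule rcv_eqI[OF w, where eps = "s + eps - t"]) (use s that in \<open>auto intro!: c(2)\<close>)
  hence "\<forall>\<^sub>F t in at_right s. rcv t om = c"
   using s c(1) by (intro eventually_at_rightI[of s "min b (s + eps)"]) auto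
  thus "((\<lambda>t. rcv t om) \<longlongrightarrow> rcv s om) (at_right s)" unfolding ms by (rule tendsto_eventually)
 next
  fix s assume "s \<in> {a<..b}"
  hence s: "a < s" "s <= b" by auto
  obtain c eps where c: "0 < eps" "\<And>d. [|d \<in> D; s - eps < d; d < s|] ==> Z d om = c" using left_limit[OF w s] by blast
  have "rcv t om = c" if "max a (s - eps) < t" "t < s" for t
   by (rule rcv_eqI[OF w, where eps = "s - t"]) (use s that in \<open>auto intro!: c(2)\<close>)
  hence "\<forall>\<^sub>F t in at_left s. rcv t om = c"
   using s c(1) by (intro eventually_at_leftI[of "max a (s - eps)" s]) auto
  thus "\<exists>l. ((\<lambda>t. rcv t om) \<longlongrightarrow> l) (at_left s)" by (blast intro: tendsto_eventually)
 qed
qed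

text \<open>The probability that \<open>Z t\<close> and \<open>Z (up n t)\<close> differ tends to 0
  with \<open>n\<close>. Hence almost surely they agree for arbitrarily large \<open>n\<close>,
  where \<open>Z (up n t)\<close> is already \<open>rcv t\<close>.\<close>

lemma rcv_AE:
 assumes t: "t \<in> {a..b}"
 shows "AE om in P. rcv t om = Z t om"
proof (cases "t < b")
 case True
 have at: "a <= t" using t by simp
 have u: "up n t \<in> {a..b}" for n using up_props(1)[OF at True, of n] D_sub by auto
 have "AE om in P. \<not> (\<forall>n\<ge>m. Z t om ~= Z (up n t) om)" for m
 proof -
  let ?S = "{om\<in>space P. \<forall>n\<ge>m. Z t om ~= Z (up n t) om}"
  have S: "?S \<in> sets P"
  proof -
   have "(\<Inter>n\<in>{m..}. {om\<in>space P. Z t om ~= Z (up n t) om}) \<in> sets P"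
    by (rule sets.countable_INT') (auto intro!: Z_eq_sets t u)
   also have "(\<Inter>n\<in>{m..}. {om\<in>space P. Z t om ~= Z (up n t) om}) = ?S" by auto
   finally show ?thesis .
  qed
  have "measure P ?S <= eps" if e: "0 < eps" for eps
  proof -
   \<comment> \<open>Division by \<open>L + 1\<close> also covers \<open>L = 0\<close>.\<close>
   obtain m' where m': "\<forall>n\<ge>m'. (b - a) / 2 ^ n < eps / (L + 1)" using half_powers_small[of "eps / (L + 1)"] divide_pos_pos[OF e, of "L + 1"] L0 by fastforce
   define n where "n = max m m'"
   have "measure P ?S <= measure P {om\<in>space P. Z t om ~= Z (up n t) om}"
   proof (intro finite_measure_mono Z_eq_sets t u)
    have "m <= n" by (simp add: n_def)
    thus "?S \<subseteq> {om\<in>space P. Z t om ~= Z (up n t) om}" by blast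
   qed
   also have "\<dots> <= L * (up n t - t)" using up_props(2)[OF at True, of n] u[of n] at by (intro jump) auto
   also have "\<dots> <= (L + 1) * ((b - a) / 2 ^ n)" using up_props(2,3)[OF at True, of n] L0 by (intro mult_mono) auto
   also have "\<dots> <= (L + 1) * (eps / (L + 1))"
   proof (rule mult_left_mono)
    have "m' <= n" by (simp add: n_def)
    thus "(b - a) / 2 ^ n <= eps / (L + 1)" using m' by (meson less_imp_le)
   qed (use L0 in linarith)
   also have "\<dots> = eps" using L0 by simp
   finally show ?thesis .
  qed
  hence "measure P ?S <= 0 + eps" if "0 < eps" for eps unfolding add_0 using that .
  hence "measure P ?S <= 0" by (rule field_le_epsilon)
  hence "measure P ?S = 0" using measure_nonneg[of P ?S] by linarith
  hence "emeasure P ?S = 0" by (simp only: emeasure_eq_measure ennreal_0)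
  hence "?S \<in> null_sets P" using S by (rule null_setsI)
  hence "AE om in P. om \<notin> ?S" by (rule AE_not_in)
  with AE_space show ?thesis
  proof eventually_elim
   fix om assume "om \<in> space P" "om \<notin> ?S"
   thus "\<not> (\<forall>n\<ge>m. Z t om ~= Z (up n t) om)" by blast
  qed
 qed
 hence "AE om in P. \<forall>m. \<not> (\<forall>n\<ge>m. Z t om ~= Z (up n t) om)" by (rule AE_all_countable[THEN iffD2, OF allI])
 with AE_good show ?thesis
 proof eventually_elim
  fix om assume w: "om \<in> good" and h: "\<forall>m. \<not> (\<forall>n\<ge>m. Z t om ~= Z (up n t) om)"
  obtain m where "\<forall>n\<ge>m. Z (up n t) om = rcv t om" using iffD1[OF rcv_eq_iff[OF w at True] refl] by blast
  moreover obtain n where "n \<ge> m" "Z t om = Z (up n t) om" using h by blast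
  ultimately show "rcv t om = Z t om" by simp
 qed
next
 case False
 hence "t = b" using t by simp
 show ?thesis using AE_good
 proof eventually_elim
  fix om assume "om \<in> good"
  thus "rcv t om = Z t om" using \<open>t = b\<close> by (simp add: rcv_def)
 qed
qed

end

section \<open>Finite-dimensional distributions and their projective limit\<close>

primrec path_weight :: "(real => real => 'e => 'e => real) => real => 'e => real list => (real => 'e) => real" where
 "path_weight p r x [] \<xi> = 1"
| "path_weight p r x (s # ss) \<xi> = p r s x (\<xi> s) * path_weight p s (\<xi> s) ss \<xi>"

lemma path_weight_cong: "(\<And>s. s \<in> set ss ==> \<xi> s = \<eta> s) ==> path_weight p r x ss \<xi> = path_weight p r x ss \<eta>"
 by (induction ss arbitrary: r x) auto

lemma path_weight_snoc:
 "path_weight p r x (ss @ [s]) \<xi> =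
   path_weight p r x ss \<xi> * (if ss = [] then p r s x (\<xi> s) else p (last ss) s (\<xi> (last ss)) (\<xi> s))"
 by (induction ss arbitrary: r x) auto

context transition_rates begin

lemma path_weight_nonneg:
 "[|sorted (r # ss); a <= r; \<forall>s\<in>set ss. s <= b; x \<in> E; \<forall>s\<in>set ss. \<xi> s \<in> E|] ==> 0 <= path_weight p r x ss \<xi>"
proof (induction ss arbitrary: r x)
 case (Cons s ss)
 hence "0 <= path_weight p s (\<xi> s) ss \<xi>" by auto
 moreover have "0 <= p r s x (\<xi> s)" using Cons.prems by (intro p_nonneg) auto
 ultimately show ?case by simp
qed simp

text \<open>Consistency under forgetting the time \<open>s\<close>: between two times of the list
  this is Chapman-Kolmogorov at \<open>s\<close>, after the last one it is total mass 1.\<close>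

lemma path_weight_insort:
 "[|sorted (r # ss); a <= r; \<forall>u\<in>set ss. u <= b; x \<in> E; \<forall>u\<in>set ss. \<xi> u \<in> E; s \<notin> set ss; r <= s; s <= b|]
  ==> (\<Sum>v\<in>E. path_weight p r x (insort s ss) (\<xi>(s := v))) = path_weight p r x ss \<xi>"
proof (induction ss arbitrary: r x)
 case Nil
 thus ?case by (simp add: p_sum)
next
 case (Cons t ss)
 have ts: "t ~= s" "s \<notin> set ss" using Cons.prems by auto
 show ?case
 proof (cases "s < t")
  case True
  have "path_weight p r x (insort s (t # ss)) (\<xi>(s := v)) = (p r s x v * p s t v (\<xi> t)) * path_weight p t (\<xi> t) ss \<xi>" for v
  proof -
   have "path_weight p t (\<xi> t) ss (\<xi>(s := v)) = path_weight p t (\<xi> t) ss \<xi>"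
    using ts by (intro path_weight_cong) auto
   thus ?thesis using True ts by (simp add: mult.assoc)
  qed
  hence "(\<Sum>v\<in>E. path_weight p r x (insort s (t # ss)) (\<xi>(s := v))) = (\<Sum>v\<in>E. p r s x v * p s t v (\<xi> t)) * path_weight p t (\<xi> t) ss \<xi>"
   by (simp only: sum_distrib_right)
  also have "(\<Sum>v\<in>E. p r s x v * p s t v (\<xi> t)) = p r t x (\<xi> t)"
   using Cons.prems True by (intro p_Chapman_Kolmogorov) auto
  finally show ?thesis by simp
 next
  case False
  hence st: "t < s" using ts by simp
  have "(\<Sum>v\<in>E. path_weight p r x (insort s (t # ss)) (\<xi>(s := v)))
    = (\<Sum>v\<in>E. p r t x (\<xi> t) * path_weight p t (\<xi> t) (insort s ss) (\<xi>(s := v)))"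
   using st ts by (intro sum.cong refl) auto
  also have "\<dots> = p r t x (\<xi> t) * (\<Sum>v\<in>E. path_weight p t (\<xi> t) (insort s ss) (\<xi>(s := v)))"
   by (simp only: sum_distrib_left)
  also have "(\<Sum>v\<in>E. path_weight p t (\<xi> t) (insort s ss) (\<xi>(s := v))) = path_weight p t (\<xi> t) ss \<xi>"
   using Cons.prems st by (intro Cons.IH) auto
  finally show ?thesis by simp
 qed
qed

definition "fdw x J \<xi> = path_weight p a x (sorted_list_of_set J) \<xi>"

lemma fdw_nonneg:
 assumes "finite J" "J \<subseteq> {a..b}" "x \<in> E" "\<And>t. t \<in> J ==> \<xi> t \<in> E"
 shows "0 <= fdw x J \<xi>"
 unfolding fdw_def using assms by (intro path_weight_nonneg) auto

lemma fdw_cong: "[|finite J; \<And>t. t \<in> J ==> \<xi> t = \<eta> t|] ==> fdw x J \<xi> = fdw x J \<eta>"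
 unfolding fdw_def by (intro path_weight_cong) auto

lemma fdw_insert:
 assumes "finite J" "insert s J \<subseteq> {a..b}" "x \<in> E" "\<And>t. t \<in> J ==> \<xi> t \<in> E" "s \<notin> J"
 shows "(\<Sum>v\<in>E. fdw x (insert s J) (\<xi>(s := v))) = fdw x J \<xi>"
proof -
 have "sorted_list_of_set (insert s J) = insort s (sorted_list_of_set J)"
  using assms by (simp add: sorted_list_of_set_insert)
 thus ?thesis unfolding fdw_def using assms
  by (simp only:) (intro path_weight_insort, auto)
qed

text \<open>A new last time sees only the state at \<open>r\<close>, the latest time of
  \<open>J\<close>; this is the Markov property at the level of weights.\<close>

lemma fdw_snoc:
 assumes J: "finite J" "r \<in> J" "\<And>t. t \<in> J ==> t <= r" and s: "r < s"
 shows "fdw x (insert s J) \<xi> = fdw x J \<xi> * p r s (\<xi> r) (\<xi> s)"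
proof -
 let ?l = "sorted_list_of_set J"
 have sJ: "s \<notin> J" using J(3)[of s] s by auto
 have "?l ~= []" using J by auto
 moreover have "last ?l = r"
 proof -
  have "last ?l <= r" using last_in_set[OF \<open>?l ~= []\<close>] J by simp
  obtain i where i: "i < length ?l" "?l ! i = r" using J(1,2) by (metis in_set_conv_nth set_sorted_list_of_set)
  have "?l ! i <= ?l ! (length ?l - 1)" using i by (intro sorted_nth_mono) auto
  hence "r <= last ?l" using i \<open>?l ~= []\<close> by (simp add: last_conv_nth)
  with \<open>last ?l <= r\<close> show ?thesis by simp
 qed
 moreover have "sorted_list_of_set (insert s J) = ?l @ [s]"
 proof -
  have "sorted_list_of_set (insert s J) = insort s ?l" using J(1) sJ by (simp add: sorted_list_of_set_insert)
  also have "\<dots> = ?l @ [s]" using J s by (intro sorted_insort_is_snoc) (auto intro: less_imp_le order_trans)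
  finally show ?thesis .
 qed
 ultimately show ?thesis unfolding fdw_def by (simp add: path_weight_snoc)
qed

end

locale kolmogorov_extension = transition_rates E q a b L p for E :: "'e::polish_space set" and q a b L p +
 fixes x0 :: 'e
 assumes x0: "x0 \<in> E"
begin

text \<open>The weights live on the finitely many families with values in \<open>E\<close>; the
  identity map transports them to the Borel product space over which the projective limit is
  taken.\<close>

definition fdd :: "real set => (real => 'e) measure" where
 "fdd J = distr (point_measure (PiE J (\<lambda>_. E)) (\<lambda>\<xi>. ennreal (fdw x0 J \<xi>))) (PiM J (\<lambda>_. borel)) (\<lambda>\<xi>. \<xi>)"

lemma emeasure_fdd:
 assumes J: "finite J" and A: "A \<in> sets (PiM J (\<lambda>_. borel))"
 shows "emeasure (fdd J) A = (\<Sum>\<xi>\<in>{\<xi>\<in>PiE J (\<lambda>_. E). \<xi> \<in> A}. ennreal (fdw x0 J \<xi>))"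
proof -
 have m: "(\<lambda>\<xi>. \<xi>) \<in> measurable (point_measure (PiE J (\<lambda>_. E)) (\<lambda>\<xi>. ennreal (fdw x0 J \<xi>))) (PiM J (\<lambda>_. borel))"
  by (auto simp: point_measure_def space_PiM PiE_def intro!: measurableI)
 have "emeasure (fdd J) A = emeasure (point_measure (PiE J (\<lambda>_. E)) (\<lambda>\<xi>. ennreal (fdw x0 J \<xi>))) {\<xi>\<in>PiE J (\<lambda>_. E). \<xi> \<in> A}"
  unfolding fdd_def by (subst emeasure_distr[OF m A]) (auto simp: space_point_measure vimage_def Int_def conj_commute)
 also have "\<dots> = (\<Sum>\<xi>\<in>{\<xi>\<in>PiE J (\<lambda>_. E). \<xi> \<in> A}. ennreal (fdw x0 J \<xi>))"
  using J fin by (intro emeasure_point_measure_finite finite_PiE) auto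
 finally show ?thesis .
qed

lemma sets_fdd[simp]: "sets (fdd J) = sets (PiM J (\<lambda>_. borel))" and space_fdd[simp]: "space (fdd J) = space (PiM J (\<lambda>_. borel))"
 by (auto simp: fdd_def)

lemma fdd_insert:
 assumes J: "finite J" "insert s J \<subseteq> {a..b}" "s \<notin> J"
 shows "fdd J = distr (fdd (insert s J)) (PiM J (\<lambda>_. borel)) (\<lambda>\<xi>. restrict \<xi> J)"
proof (rule measure_eqI)
 fix A assume "A \<in> sets (fdd J)"
 hence A: "A \<in> sets (PiM J (\<lambda>_. borel))" by simp
 let ?B = "(\<lambda>\<xi>. restrict \<xi> J) -` A \<inter> space (PiM (insert s J) (\<lambda>_. borel))"
 have m: "(\<lambda>\<xi>. restrict \<xi> J) \<in> measurable (PiM (insert s J) (\<lambda>_. borel :: 'e measure)) (PiM J (\<lambda>_. borel))"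
  by (rule measurable_restrict_subset) auto
 have B: "?B \<in> sets (PiM (insert s J) (\<lambda>_. borel))" using measurable_sets[OF m A] .
 define S where "S = {\<eta>\<in>PiE J (\<lambda>_. E). \<eta> \<in> A}"
 have finS: "finite S" unfolding S_def using J fin by (intro finite_subset[OF _ finite_PiE[of J "\<lambda>_. E"]]) auto
 have S: "{\<xi>\<in>PiE (insert s J) (\<lambda>_. E). \<xi> \<in> ?B} = (\<lambda>(v, \<eta>). \<eta>(s := v)) ` (E \<times> S)"
 proof -
  have res: "restrict (\<eta>(s := v)) J = \<eta>" if "\<eta> \<in> PiE J (\<lambda>_. E)" for \<eta> v
   using that J(3) by (auto simp: restrict_def PiE_def extensional_def fun_eq_iff)
  show ?thesis
  proof (intro set_eqI iffI)
   fix \<xi> assume x: "\<xi> \<in> {\<xi>\<in>PiE (insert s J) (\<lambda>_. E). \<xi> \<in> ?B}"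
   then obtain v \<eta> where v: "v \<in> E" "\<eta> \<in> PiE J (\<lambda>_. E)" "\<xi> = \<eta>(s := v)"
    unfolding PiE_insert_eq by auto
   hence "\<eta> \<in> S" using x res[OF v(2), of v] by (simp add: S_def)
   thus "\<xi> \<in> (\<lambda>(v, \<eta>). \<eta>(s := v)) ` (E \<times> S)" using v by auto
  next
   fix \<xi> assume "\<xi> \<in> (\<lambda>(v, \<eta>). \<eta>(s := v)) ` (E \<times> S)"
   then obtain v \<eta> where v: "v \<in> E" "\<eta> \<in> PiE J (\<lambda>_. E)" "\<eta> \<in> A" "\<xi> = \<eta>(s := v)" by (auto simp: S_def)
   hence "\<xi> \<in> PiE (insert s J) (\<lambda>_. E)" by (auto simp: PiE_def extensional_def)
   thus "\<xi> \<in> {\<xi>\<in>PiE (insert s J) (\<lambda>_. E). \<xi> \<in> ?B}" using v res[OF v(2), of v]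
    by (auto simp: space_PiM PiE_def)
  qed
 qed
 have inj: "inj_on (\<lambda>(v, \<eta>). \<eta>(s := v)) (E \<times> S)"
  by (rule inj_on_subset[OF inj_combinator[OF J(3), of "\<lambda>_. E"]]) (auto simp: S_def)
 have "emeasure (distr (fdd (insert s J)) (PiM J (\<lambda>_. borel)) (\<lambda>\<xi>. restrict \<xi> J)) A = emeasure (fdd (insert s J)) ?B"
  using m A by (subst emeasure_distr) (auto cong: measurable_cong_sets)
 also have "\<dots> = (\<Sum>\<xi>\<in>{\<xi>\<in>PiE (insert s J) (\<lambda>_. E). \<xi> \<in> ?B}. ennreal (fdw x0 (insert s J) \<xi>))"
  using J by (intro emeasure_fdd B) auto
 also have "\<dots> = (\<Sum>(v, \<eta>)\<in>E \<times> S. ennreal (fdw x0 (insert s J) (\<eta>(s := v))))"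
  unfolding S by (subst sum.reindex[OF inj]) (simp add: case_prod_unfold)
 also have "\<dots> = (\<Sum>\<eta>\<in>S. \<Sum>v\<in>E. ennreal (fdw x0 (insert s J) (\<eta>(s := v))))"
  by (subst sum.swap) (simp add: sum.cartesian_product)
 also have "\<dots> = (\<Sum>\<eta>\<in>S. ennreal (fdw x0 J \<eta>))"
 proof (intro sum.cong refl)
  fix \<eta> assume "\<eta> \<in> S"
  hence e: "\<And>t. t \<in> J ==> \<eta> t \<in> E" by (auto simp: S_def)
  have "0 <= fdw x0 (insert s J) (\<eta>(s := v))" if "v \<in> E" for v
   using J x0 e that by (intro fdw_nonneg) auto
  hence "(\<Sum>v\<in>E. ennreal (fdw x0 (insert s J) (\<eta>(s := v)))) = ennreal (\<Sum>v\<in>E. fdw x0 (insert s J) (\<eta>(s := v)))"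
   by (intro sum_ennreal) auto
  also have "\<dots> = ennreal (fdw x0 J \<eta>)" using fdw_insert[OF J(1,2) x0 e J(3)] by simp
  finally show "(\<Sum>v\<in>E. ennreal (fdw x0 (insert s J) (\<eta>(s := v)))) = ennreal (fdw x0 J \<eta>)" .
 qed
 also have "\<dots> = emeasure (fdd J) A" unfolding S_def by (rule emeasure_fdd[OF J(1) A, symmetric])
 finally show "emeasure (fdd J) A = emeasure (distr (fdd (insert s J)) (PiM J (\<lambda>_. borel)) (\<lambda>\<xi>. restrict \<xi> J)) A" by simp
qed simp

lemma fdd_restrict:
 assumes "finite K" "finite J" "J \<union> K \<subseteq> {a..b}" "J \<inter> K = {}"
 shows "fdd J = distr (fdd (J \<union> K)) (PiM J (\<lambda>_. borel)) (\<lambda>\<xi>. restrict \<xi> J)"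
 using assms
proof (induction K)
 case empty
 have "distr (fdd J) (PiM J (\<lambda>_. borel)) (\<lambda>\<xi>. restrict \<xi> J) = distr (fdd J) (fdd J) (\<lambda>\<xi>. \<xi>)"
  by (intro distr_cong) (auto simp: space_PiM PiE_def extensional_restrict)
 also have "\<dots> = fdd J" by (rule distr_id)
 finally show ?case unfolding Un_empty_right by (rule sym)
next
 case (insert s K)
 have m1: "(\<lambda>\<xi>. restrict \<xi> (J \<union> K)) \<in> measurable (fdd (J \<union> insert s K)) (PiM (J \<union> K) (\<lambda>_. borel))"
  unfolding measurable_cong_sets[OF sets_fdd refl] by (rule measurable_restrict_subset) auto
 have m2: "(\<lambda>\<xi>. restrict \<xi> J) \<in> measurable (PiM (J \<union> K) (\<lambda>_. borel :: 'e measure)) (PiM J (\<lambda>_. borel))"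
  by (rule measurable_restrict_subset) auto
 have "fdd J = distr (fdd (J \<union> K)) (PiM J (\<lambda>_. borel)) (\<lambda>\<xi>. restrict \<xi> J)"
  by (rule insert.IH) (use insert.prems in auto)
 also have "fdd (J \<union> K) = distr (fdd (J \<union> insert s K)) (PiM (J \<union> K) (\<lambda>_. borel)) (\<lambda>\<xi>. restrict \<xi> (J \<union> K))"
  unfolding Un_insert_right using insert.hyps insert.prems by (intro fdd_insert) auto
 also have "distr \<dots> (PiM J (\<lambda>_. borel)) (\<lambda>\<xi>. restrict \<xi> J) = distr (fdd (J \<union> insert s K)) (PiM J (\<lambda>_. borel)) (\<lambda>\<xi>. restrict \<xi> J)"
  unfolding distr_distr[OF m2 m1] by (intro distr_cong) (auto simp: restrict_def fun_eq_iff)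
 finally show ?case .
qed

lemma prob_space_fdd:
 assumes "finite J" "J \<subseteq> {a..b}"
 shows "prob_space (fdd J)"
proof
 have "emeasure (fdd {}) (space (fdd {})) = 1"
  unfolding space_fdd by (subst emeasure_fdd[OF finite.emptyI sets.top]) (simp add: fdw_def space_PiM)
 moreover have "fdd {} = distr (fdd J) (PiM {} (\<lambda>_. borel)) (\<lambda>\<xi>. restrict \<xi> {})"
  using fdd_restrict[of J "{}"] assms unfolding Un_empty_left by blast
 moreover have m: "(\<lambda>\<xi>. restrict \<xi> {}) \<in> measurable (fdd J) (PiM {} (\<lambda>_. borel :: 'e measure))"
  unfolding measurable_cong_sets[OF sets_fdd refl] by (rule measurable_restrict_subset) auto
 ultimately have "emeasure (distr (fdd J) (PiM {} (\<lambda>_. borel)) (\<lambda>\<xi>. restrict \<xi> {})) (space (PiM {} (\<lambda>_. borel))) = 1"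
  by simp
 thus "emeasure (fdd J) (space (fdd J)) = 1"
  by (subst (asm) emeasure_distr[OF m sets.top]) (auto simp: space_PiM PiE_def restrict_def)
qed

sublocale Pr: polish_projective "{a..b}" fdd
proof (intro polish_projective.intro projective_family.intro prob_space_fdd)
 fix J H :: "real set" assume h: "J \<subseteq> H" "finite H" "H \<subseteq> {a..b}"
 hence "J \<union> (H - J) = H" by auto
 thus "fdd J = distr (fdd H) (PiM J (\<lambda>_. borel)) (\<lambda>f. restrict f J)"
  using fdd_restrict[of "H - J" J] h finite_subset[OF h(1,2)] by auto
qed

abbreviation "LP \<equiv> Pr.lim"

lemma LP_coord: "t \<in> {a..b} ==> (\<lambda>om. om t) \<in> borel_measurable LP"
 by (simp cong: measurable_cong_sets)

lemma LP_cylinder: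
 assumes J: "finite J" "J \<subseteq> {a..b}" and \<xi>: "\<And>t. t \<in> J ==> \<xi> t \<in> E"
 shows "measure LP {om\<in>space LP. \<forall>t\<in>J. om t = \<xi> t} = fdw x0 J \<xi>"
proof -
 let ?X = "PiE J (\<lambda>t. {\<xi> t})"
 have X: "?X \<in> sets (PiM J (\<lambda>_. borel))" using J by (intro sets_PiM_I_finite) auto
 have "{om\<in>space LP. \<forall>t\<in>J. om t = \<xi> t} = prod_emb {a..b} (\<lambda>_. borel) J ?X"
  using J(2) by (auto simp: prod_emb_def space_PiM PiE_def Pi_iff)
 hence "measure LP {om\<in>space LP. \<forall>t\<in>J. om t = \<xi> t} = measure (fdd J) ?X"
  using Pr.measure_lim_emb[OF J(2,1) X] by simp
 moreover have "{\<zeta>\<in>PiE J (\<lambda>_. E). \<zeta> \<in> ?X} = {restrict \<xi> J}"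
  using \<xi> by (auto simp: PiE_singleton PiE_def extensional_def restrict_def fun_eq_iff)
 hence "emeasure (fdd J) ?X = ennreal (fdw x0 J (restrict \<xi> J))"
  using emeasure_fdd[OF J(1) X] by simp
 moreover have "fdw x0 J (restrict \<xi> J) = fdw x0 J \<xi>" using J by (intro fdw_cong) auto
 ultimately show ?thesis using fdw_nonneg[OF J x0 \<xi>] by (simp add: measure_def)
qed

end

section \<open>Natural filtration and the Markov property\<close>

definition filtration_generators :: "'w measure => 'e set => real => (real => 'w => 'e) => real => 'w set set" where
 "filtration_generators P E t0 X r = {X u -` {x} \<inter> space P | u x. u \<in> {t0..r} \<and> x \<in> E}"

lemma space_natural_filtration [simp]: "space (natural_filtration P E t0 X r) = space P"
 unfolding natural_filtration_def by (rule space_measure_of) auto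

lemma sets_natural_filtration:
 "sets (natural_filtration P E t0 X r) = sigma_sets (space P) (filtration_generators P E t0 X r)"
 unfolding natural_filtration_def filtration_generators_def by (rule sets_measure_of) auto

lemma natural_filtration_measurable:
 assumes "finite E" "u \<in> {t0..r}" "\<And>om. om \<in> space P ==> X u om \<in> E"
 shows "X u \<in> measurable (natural_filtration P E t0 X r) (count_space E)"
 unfolding measurable_count_space_eq2[OF assms(1)]
proof (intro conjI ballI)
 fix x assume "x \<in> E"
 hence "X u -` {x} \<inter> space P \<in> filtration_generators P E t0 X r"
  using assms(2) unfolding filtration_generators_def by blast
 thus "X u -` {x} \<inter> space (natural_filtration P E t0 X r) \<in> sets (natural_filtration P E t0 X r)"
  unfolding sets_natural_filtration space_natural_filtration by (rule sigma_sets.Basic)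
qed (use assms(3) in auto)

lemma subalgebra_natural_filtration:
 assumes "\<And>t. t \<in> {t0..r} ==> X t \<in> measurable P (count_space E)"
 shows "subalgebra P (natural_filtration P E t0 X r)"
proof -
 have "filtration_generators P E t0 X r \<subseteq> sets P"
 proof
  fix A assume "A \<in> filtration_generators P E t0 X r"
  then obtain u x where u: "u \<in> {t0..r}" "x \<in> E" "A = X u -` {x} \<inter> space P"
   unfolding filtration_generators_def by blast
  thus "A \<in> sets P" using measurable_sets[OF assms[OF u(1)], of "{x}"] by simp
 qed
 thus ?thesis
  unfolding subalgebra_def sets_natural_filtration space_natural_filtration
  by (auto intro: sets.sigma_sets_subset[THEN subsetD])
qed

definition cylinder :: "'w measure => (real => 'w => 'e) => real set => (real => 'e) => 'w set" where
 "cylinder P X J \<xi> = {om\<in>space P. \<forall>t\<in>J. X t om = \<xi> t}"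

lemma cylinder_sets:
 assumes "finite J" "\<And>t. t \<in> J ==> X t \<in> measurable P (count_space E)" "\<And>t. t \<in> J ==> \<xi> t \<in> E"
 shows "cylinder P X J \<xi> \<in> sets P"
 using assms
proof (induction J)
 case empty
 thus ?case by (simp add: cylinder_def)
next
 case (insert s J)
 have "cylinder P X (insert s J) \<xi> = cylinder P X J \<xi> \<inter> (X s -` {\<xi> s} \<inter> space P)"
  unfolding cylinder_def by blast
 moreover have "X s -` {\<xi> s} \<inter> space P \<in> sets P"
  using measurable_sets[OF insert.prems(1)[of s], of "{\<xi> s}"] insert.prems(2)[of s] by simp
 ultimately show ?case using insert by auto
qed

text \<open>A conditional expectation is characterized by its integrals over the sets of the
  filtration. These are generated by cylinders over finitely many times up to \<open>r\<close>,
  which are stable under intersection, so the claim reduces to cylinders that contain the time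
  \<open>r\<close>; on such a cylinder \<open>X r\<close> is constant.\<close>

lemma markov_property_from_cylinders:
 assumes P: "prob_space P" and finE: "finite E"
  and X: "\<And>t. t \<in> {t0..T} ==> X t \<in> measurable P (count_space E)"
  and r: "r \<in> {t0..T}" and s: "s \<in> {r..T}" and y: "y \<in> E"
  and cyl: "\<And>J \<xi>. [|finite J; J \<subseteq> {t0..r}; r \<in> J; \<And>t. t \<in> J ==> \<xi> t \<in> E|] ==>
   measure P (cylinder P X J \<xi> \<inter> {om\<in>space P. X s om = y}) = measure P (cylinder P X J \<xi>) * h (\<xi> r)"
 shows "AE om in P. real_cond_exp P (natural_filtration P E t0 X r)
       (indicator {om\<in>space P. X s om = y}) om = h (X r om)"
proof -
 interpret prob_space P by (rule P)
 let ?F = "natural_filtration P E t0 X r"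
 let ?S = "{om\<in>space P. X s om = y}"
 have XE: "X t om \<in> E" if "t \<in> {t0..T}" "om \<in> space P" for t om
  using measurable_space[OF X[OF that(1)] that(2)] by simp
 have sub: "subalgebra P ?F" using X r by (intro subalgebra_natural_filtration) auto
 interpret finite_measure_subalgebra P ?F by unfold_locales (rule sub)
 have S: "?S \<in> sets P"
  using cylinder_sets[of "{s}" X P E "\<lambda>_. y"] X[of s] r s y unfolding cylinder_def by auto
 have hX: "(\<lambda>om. h (X r om)) \<in> borel_measurable ?F"
  using natural_filtration_measurable[OF finE, of r t0 r P X] XE r
  by (intro measurable_compose[of "X r" ?F "count_space E" h]) auto
 have hXP: "(\<lambda>om. h (X r om)) \<in> borel_measurable P" using hX by (rule measurable_from_subalg[OF sub])
 obtain B where B: "\<And>x. x \<in> E ==> \<bar>h x\<bar> <= B"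
  using finE by (metis finite_imageI Max_ge image_eqI)
 have inth: "integrable P (\<lambda>om. h (X r om))"
  using B XE r by (intro integrable_const_bound[where B = B] hXP AE_I2) auto
 have intS: "integrable P (indicator ?S :: _ => real)" using S by (intro integrable_real_indicator) (auto simp: less_top[symmetric])
 \<comment> \<open>The empty set is included for stability under intersection: two cylinders may
   prescribe different values at a common time.\<close>
 define G where "G = insert {} {cylinder P X J \<xi> | J \<xi>. finite J \<and> J \<subseteq> {t0..r} \<and> (\<forall>t\<in>J. \<xi> t \<in> E)}"
 have cylG: "cylinder P X J \<xi> \<in> G" if "finite J" "J \<subseteq> {t0..r}" "\<forall>t\<in>J. \<xi> t \<in> E" for J \<xi>
  using that unfolding G_def by blast
 have stable: "Int_stable G"
 proof (rule Int_stableI)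
  fix A A' assume "A \<in> G" "A' \<in> G"
  show "A \<inter> A' \<in> G"
  proof (cases "A = {} \<or> A' = {}")
   case True
   thus ?thesis by (auto simp: G_def)
  next
   case False
   then obtain J \<xi> J' \<xi>' where A: "A = cylinder P X J \<xi>" "finite J" "J \<subseteq> {t0..r}" "\<forall>t\<in>J. \<xi> t \<in> E"
    and A': "A' = cylinder P X J' \<xi>'" "finite J'" "J' \<subseteq> {t0..r}" "\<forall>t\<in>J'. \<xi>' t \<in> E"
    using \<open>A \<in> G\<close> \<open>A' \<in> G\<close> unfolding G_def by blast
   show ?thesis
   proof (cases "\<forall>t\<in>J \<inter> J'. \<xi> t = \<xi>' t")
    case True
    have "A \<inter> A' = cylinder P X (J \<union> J') (\<lambda>t. if t \<in> J then \<xi> t else \<xi>' t)"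
     unfolding A(1) A'(1) cylinder_def using True by auto
    thus ?thesis using A A' by (simp only:) (rule cylG, auto)
   next
    case False
    hence "A \<inter> A' = {}" unfolding A(1) A'(1) cylinder_def by auto
    thus ?thesis by (simp add: G_def)
   qed
  qed
 qed
 have Gpow: "G \<subseteq> Pow (space P)" by (auto simp: G_def cylinder_def)
 have Gsets: "A \<in> sets P" if "A \<in> G" for A
  using that X r unfolding G_def by (auto intro!: cylinder_sets[where E = E])
 have sG: "sigma_sets (space P) G \<subseteq> sets P" using Gsets by (intro sets.sigma_sets_subset) auto
 have FG: "sets ?F \<subseteq> sigma_sets (space P) G"
  unfolding sets_natural_filtration
 proof (rule sigma_sets_mono')
  show "filtration_generators P E t0 X r \<subseteq> G"
  proof
   fix A assume "A \<in> filtration_generators P E t0 X r"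
   then obtain u x where u: "u \<in> {t0..r}" "x \<in> E" "A = X u -` {x} \<inter> space P"
    unfolding filtration_generators_def by blast
   have "A = cylinder P X {u} (\<lambda>_. x)" unfolding u(3) cylinder_def by auto
   thus "A \<in> G" using u by (simp only:) (rule cylG, auto)
  qed
 qed
 \<comment> \<open>A cylinder need not mention the time \<open>r\<close>; splitting it by the value
   of \<open>X r\<close> makes \<open>h (X r om)\<close> constant on each piece.\<close>
 have split_lemma: "(\<integral>om\<in>A. f om \<partial>P) = (\<Sum>x\<in>E. \<integral>om\<in>(A \<inter> {om\<in>space P. X r om = x}). f om \<partial>P)"
  if A: "A \<in> sets P" and f: "integrable P f" for A and f :: "_ => real"
 proof -
  have Ax: "A \<inter> {om\<in>space P. X r om = x} \<in> sets P" if "x \<in> E" for x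
   using cylinder_sets[of "{r}" X P E "\<lambda>_. x"] X[of r] r that A unfolding cylinder_def by auto
  have "(\<integral>om\<in>A. f om \<partial>P) = (\<integral>om. (\<Sum>x\<in>E. indicator (A \<inter> {om\<in>space P. X r om = x}) om *\<^sub>R f om) \<partial>P)"
   unfolding set_lebesgue_integral_def
  proof (intro Bochner_Integration.integral_cong refl)
   fix om assume w: "om \<in> space P"
   have "(\<Sum>x\<in>E. indicator (A \<inter> {om\<in>space P. X r om = x}) om *\<^sub>R f om) = (\<Sum>x\<in>E. if x = X r om then indicator A om *\<^sub>R f om else 0)"
    using w by (intro sum.cong refl) (auto simp: indicator_def)
   also have "\<dots> = indicator A om *\<^sub>R f om" using XE[OF r w] finE by simp
   finally show "indicator A om *\<^sub>R f om = (\<Sum>x\<in>E. indicator (A \<inter> {om\<in>space P. X r om = x}) om *\<^sub>R f om)" by (rule sym)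
  qed
  also have "\<dots> = (\<Sum>x\<in>E. \<integral>om. indicator (A \<inter> {om\<in>space P. X r om = x}) om *\<^sub>R f om \<partial>P)"
   using Ax f by (intro Bochner_Integration.integral_sum integrable_mult_indicator)
  finally show ?thesis unfolding set_lebesgue_integral_def .
 qed
 have base: "(\<integral>om\<in>A. indicator ?S om \<partial>P) = (\<integral>om\<in>A. h (X r om) \<partial>P)" if A: "A \<in> G" for A
 proof -
  have *: "(\<integral>om\<in>(A \<inter> {om\<in>space P. X r om = x}). indicator ?S om \<partial>P) = (\<integral>om\<in>(A \<inter> {om\<in>space P. X r om = x}). h (X r om) \<partial>P)" if x: "x \<in> E" for x
  proof -
   let ?C = "A \<inter> {om\<in>space P. X r om = x}"
   have "{om\<in>space P. X r om = x} = cylinder P X {r} (\<lambda>_. x)" by (auto simp: cylinder_def)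
   moreover have "cylinder P X {r} (\<lambda>_. x) \<in> G" using r x by (intro cylG) auto
   ultimately have CG: "?C \<in> G" using stable A unfolding Int_stable_def by metis
   hence C: "?C \<in> sets P" by (rule Gsets)
   have m: "measure P (?C \<inter> ?S) = measure P ?C * h x"
   proof (cases "?C = {}")
    case False
    then obtain J \<xi> where J: "?C = cylinder P X J \<xi>" "finite J" "J \<subseteq> {t0..r}" "\<forall>t\<in>J. \<xi> t \<in> E"
     using CG unfolding G_def by blast
    define \<xi>' where "\<xi>' = \<xi>(r := x)"
    obtain om where "om \<in> ?C" using False by blast
    hence "X r om = x" "om \<in> cylinder P X J \<xi>" using J(1) by auto
    hence "r \<in> J ==> \<xi> r = x" unfolding cylinder_def by auto
    hence "?C = cylinder P X (insert r J) \<xi>'"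
     using J(1) unfolding cylinder_def \<xi>'_def by (auto split: if_splits)
    moreover have "measure P (cylinder P X (insert r J) \<xi>' \<inter> ?S) = measure P (cylinder P X (insert r J) \<xi>') * h (\<xi>' r)"
     by (rule cyl) (use J r x in \<open>auto simp: \<xi>'_def\<close>)
    ultimately show ?thesis by (simp add: \<xi>'_def)
   qed simp
   have "(\<integral>om\<in>?C. (indicator ?S om :: real) \<partial>P) = (\<integral>om. indicator (?C \<inter> ?S) om \<partial>P)"
    unfolding set_lebesgue_integral_def by (intro Bochner_Integration.integral_cong refl) (simp only: indicator_inter_arith real_scaleR_def)
   also have "\<dots> = measure P (?C \<inter> ?S)" using C S by (subst Bochner_Integration.integral_indicator) (auto intro!: arg_cong[where f = "measure P"])
   also have "\<dots> = (\<integral>om. indicator ?C om * h x \<partial>P)" unfolding m using C sets.sets_into_space[OF C] by (simp add: Int_absorb2)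
   also have "\<dots> = (\<integral>om\<in>?C. h (X r om) \<partial>P)"
    unfolding set_lebesgue_integral_def by (intro Bochner_Integration.integral_cong refl) (auto simp: indicator_def)
   finally show ?thesis .
  qed
  show ?thesis unfolding split_lemma[OF Gsets[OF A] intS] split_lemma[OF Gsets[OF A] inth]
   by (intro sum.cong refl *)
 qed
 have main: "(\<integral>om\<in>A. indicator ?S om \<partial>P) = (\<integral>om\<in>A. h (X r om) \<partial>P)" if A: "A \<in> sigma_sets (space P) G" for A
  using stable Gpow A
 proof (induction rule: sigma_sets_induct_disjoint)
  case (basic A)
  thus ?case by (rule base)
 next
  case empty
  show ?case by (simp add: set_lebesgue_integral_def)
 next
  case (compl A)
  have A: "A \<in> sets P" using compl(1) sG by blast
  have c: "(\<integral>om\<in>(space P - A). f om \<partial>P) = (\<integral>om\<in>space P. f om \<partial>P) - (\<integral>om\<in>A. f om \<partial>P)" if f: "integrable P f" for f :: "_ => real"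
  proof -
   have i: "set_integrable P B f" if "B \<in> sets P" for B
    unfolding set_integrable_def using that f by (rule integrable_mult_indicator)
   have "(\<integral>om\<in>(A \<union> (space P - A)). f om \<partial>P) = (\<integral>om\<in>A. f om \<partial>P) + (\<integral>om\<in>(space P - A). f om \<partial>P)"
    using A by (intro set_integral_Un i) auto
   moreover have "A \<union> (space P - A) = space P" using sets.sets_into_space[OF A] by blast
   ultimately show ?thesis by simp
  qed
  have "space P = cylinder P X {} undefined" by (simp add: cylinder_def)
  hence "space P \<in> G" by (simp only:) (rule cylG, auto)
  hence "(\<integral>om\<in>space P. indicator ?S om \<partial>P) = (\<integral>om\<in>space P. h (X r om) \<partial>P)" by (rule base)
  thus ?case unfolding c[OF intS] c[OF inth] using compl(2) by simp
 next
  case (union A)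
  have A: "A i \<in> sets P" for i using union(2) sG by blast
  have u: "(\<integral>om\<in>(\<Union>i. A i). f om \<partial>P) = (\<Sum>i. \<integral>om\<in>A i. f om \<partial>P)" if f: "integrable P f" for f :: "_ => real"
  proof (rule lebesgue_integral_countable_add)
   show "set_integrable P (\<Union>i. A i) f"
    unfolding set_integrable_def using A f by (intro integrable_mult_indicator) auto
   show "A i \<inter> A j = {}" if "i ~= j" for i j using union(1) that by (auto simp: disjoint_family_on_def)
  qed (rule A)
  show ?case unfolding u[OF intS] u[OF inth] union(3) ..
 qed
 show ?thesis
  by (rule real_cond_exp_charact[OF main intS inth hX]) (use FG in blast)
qed

section \<open>The Markov chain on path space\<close>

context kolmogorov_extension begin

text \<open>A coordinate of the projective limit lies in \<open>E\<close> only almost surely; the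
  correction makes this hold everywhere.\<close>

definition "Zc t om = (if om t \<in> E then om t else x0)"

lemma Zc_in_E: "Zc t om \<in> E" using x0 by (simp add: Zc_def)

lemma Zc_measurable:
 assumes t: "t \<in> {a..b}" shows "Zc t \<in> measurable LP (count_space E)"
proof -
 have c: "(\<lambda>om. om t) \<in> borel_measurable LP" by (rule LP_coord[OF t])
 have "E \<in> sets borel" using fin by (intro borel_closed finite_imp_closed)
 from measurable_sets[OF c this] have "{om\<in>space LP. om t \<in> E} \<in> sets LP" by (simp only: vimage_def Int_def mem_Collect_eq conj_commute)
 hence Z: "Zc t \<in> borel_measurable LP" unfolding Zc_def by (intro measurable_If c) auto
 show ?thesis unfolding measurable_count_space_eq2[OF fin]
 proof (intro conjI ballI)
  fix x :: 'e show "Zc t -` {x} \<inter> space LP \<in> sets LP" by (rule measurable_sets[OF Z]) simp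
 qed (use Zc_in_E in auto)
qed

lemma fdw_singleton: "fdw x {t} \<xi> = p a t x (\<xi> t)" by (simp add: fdw_def)

lemma coord_in_E:
 assumes t: "t \<in> {a..b}" shows "AE om in LP. om t \<in> E"
proof -
 have m: "measure LP {om\<in>space LP. om t = v} = p a t x0 v" if "v \<in> E" for v
  using LP_cylinder[of "{t}" "\<lambda>_. v"] t that by (simp add: fdw_singleton)
 have s: "{om\<in>space LP. om t = v} \<in> sets LP" for v
 proof -
  have "(\<lambda>om. om t) -` {v} \<inter> space LP \<in> sets LP" by (rule measurable_sets[OF LP_coord[OF t]]) simp
  thus ?thesis by (simp only: vimage_def Int_def mem_Collect_eq conj_commute singleton_iff)
 qed
 have "measure LP (\<Union>v\<in>E. {om\<in>space LP. om t = v}) = (\<Sum>v\<in>E. measure LP {om\<in>space LP. om t = v})"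
  using fin s by (intro Pr.P.finite_measure_finite_Union) (auto simp: disjoint_family_on_def)
 also have "\<dots> = (\<Sum>v\<in>E. p a t x0 v)" using m by (rule sum.cong[OF refl])
 also have "\<dots> = 1" using t x0 by (intro p_sum) auto
 finally have "AE om in LP. om \<in> (\<Union>v\<in>E. {om\<in>space LP. om t = v})"
  using Pr.P.AE_prob_1 by blast
 thus ?thesis by eventually_elim auto
qed

text \<open>Applied to \<open>Zc\<close> and to its right-continuous version: changing finitely many
  coordinates on null sets does not affect the measure of a cylinder.\<close>

lemma cylinder_AE_eq:
 assumes J: "finite J" "J \<subseteq> {a..b}" "\<And>t. t \<in> J ==> \<xi> t \<in> E"
  and Y: "\<And>t. t \<in> J ==> Y t \<in> measurable LP (count_space E)" "\<And>t. t \<in> J ==> AE om in LP. Y t om = om t"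
 shows "measure LP (cylinder LP Y J \<xi>) = fdw x0 J \<xi>"
proof -
 have c: "cylinder LP Y J \<xi> \<in> sets LP" using J(1) Y(1) J(3) by (rule cylinder_sets)
 have e: "{om\<in>space LP. \<forall>t\<in>J. om t = \<xi> t} \<in> sets LP"
 proof -
  have "{om\<in>space LP. om t = \<xi> t} \<in> sets LP" if "t \<in> J" for t
  proof -
   have "(\<lambda>om. om t) -` {\<xi> t} \<inter> space LP \<in> sets LP"
    by (rule measurable_sets[OF LP_coord]) (use J that in auto)
   thus ?thesis by (simp only: vimage_def Int_def mem_Collect_eq conj_commute singleton_iff)
  qed
  thus ?thesis using J(1) by (rule sets.sets_Collect_finite_All)
 qed
 have "AE om in LP. \<forall>t\<in>J. Y t om = om t"
  using J(1) Y(2) by (rule AE_finite_allI)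
 hence "AE om in LP. om \<in> cylinder LP Y J \<xi> \<longleftrightarrow> om \<in> {om\<in>space LP. \<forall>t\<in>J. om t = \<xi> t}"
  by eventually_elim (auto simp: cylinder_def)
 hence "measure LP (cylinder LP Y J \<xi>) = measure LP {om\<in>space LP. \<forall>t\<in>J. om t = \<xi> t}"
  using c e by (rule Pr.P.finite_measure_eq_AE)
 also have "\<dots> = fdw x0 J \<xi>" by (rule LP_cylinder[OF J])
 finally show ?thesis .
qed

lemma Zc_AE: "t \<in> {a..b} ==> AE om in LP. Zc t om = om t"
 using coord_in_E by (rule AE_mp) (auto simp: Zc_def)

text \<open>Given the state at \<open>r\<close>, the chain is in the same state at \<open>s\<close>
  with probability at least \<open>1 - Lam * (s - r)\<close> by \<open>p_stay\<close>, whatever that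
  state is.\<close>

lemma Zc_jump:
 assumes rs: "a <= r" "r <= s" "s <= b"
 shows "measure LP {om\<in>space LP. Zc r om ~= Zc s om} <= Lam * (s - r)"
proof (cases "r = s")
 case False
 hence "r < s" using rs by simp
 have r: "r \<in> {a..b}" "s \<in> {a..b}" using rs by auto
 have m: "measure LP (cylinder LP Zc {r, s} (\<lambda>_. x)) = p a r x0 x * p r s x x" if "x \<in> E" for x
 proof -
  have "measure LP (cylinder LP Zc {r, s} (\<lambda>_. x)) = fdw x0 {s, r} (\<lambda>_. x)"
   using r that by (subst cylinder_AE_eq) (auto intro!: Zc_measurable Zc_AE simp: insert_commute)
  also have "\<dots> = fdw x0 {r} (\<lambda>_. x) * p r s x x" using \<open>r < s\<close> by (subst fdw_snoc) auto
  finally show ?thesis by (simp add: fdw_singleton)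
 qed
 have cs: "cylinder LP Zc {r, s} (\<lambda>_. x) \<in> sets LP" if "x \<in> E" for x
  by (rule cylinder_sets[where E = E]) (use r that Zc_measurable in auto)
 let ?U = "\<Union>x\<in>E. cylinder LP Zc {r, s} (\<lambda>_. x)"
 have "measure LP ?U = (\<Sum>x\<in>E. measure LP (cylinder LP Zc {r, s} (\<lambda>_. x)))"
  using fin cs by (intro Pr.P.finite_measure_finite_Union) (auto simp: disjoint_family_on_def cylinder_def)
 also have "\<dots> = (\<Sum>x\<in>E. p a r x0 x * p r s x x)" using m by (rule sum.cong[OF refl])
 also have "\<dots> \<ge> (\<Sum>x\<in>E. p a r x0 x * (1 - Lam * (s - r)))"
 proof (intro sum_mono mult_left_mono)
  fix x assume "x \<in> E"
  thus "1 - Lam * (s - r) <= p r s x x" using p_stay[OF rs] by fastforce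
  show "0 <= p a r x0 x" using rs x0 \<open>x \<in> E\<close> by (intro p_nonneg) auto
 qed
 also have "(\<Sum>x\<in>E. p a r x0 x * (1 - Lam * (s - r))) = 1 - Lam * (s - r)"
  using p_sum[of a r x0] rs x0 by (simp flip: sum_distrib_right)
 finally have U: "1 - Lam * (s - r) <= measure LP ?U" .
 have US: "?U \<in> sets LP" using fin cs by auto
 have "{om\<in>space LP. Zc r om ~= Zc s om} = space LP - ?U"
  by (auto simp: cylinder_def Zc_in_E)
 hence "measure LP {om\<in>space LP. Zc r om ~= Zc s om} = 1 - measure LP ?U"
  using Pr.P.prob_compl[OF US] by simp
 with U show ?thesis by linarith
qed simp

sublocale reg: jump_regularity LP Zc E x0 a b Lam
 by unfold_locales (use fin x0 ab Lam0 Zc_measurable Zc_jump in auto)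

lemma rcv_AE_coord:
 assumes "t \<in> {a..b}" shows "AE om in LP. reg.rcv t om = om t"
 using reg.rcv_AE[OF assms] Zc_AE[OF assms] by eventually_elim simp

lemma rcv_cylinder:
 assumes "finite J" "J \<subseteq> {a..b}" "\<And>t. t \<in> J ==> \<xi> t \<in> E"
 shows "measure LP (cylinder LP reg.rcv J \<xi>) = fdw x0 J \<xi>"
 using assms by (intro cylinder_AE_eq) (auto intro!: reg.rcv_measurable rcv_AE_coord)

lemma rcv_markov_jump_chain: "markov_jump_chain LP E q a b reg.rcv"
 unfolding markov_jump_chain_def
proof (intro conjI ballI exI[of _ p])
 show "prob_space LP" by (rule Pr.P.prob_space_axioms)
 show "reg.rcv t \<in> measurable LP (count_space E)" if "t \<in> {a..b}" for t by (rule reg.rcv_measurable[OF that])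
 show "cadlag_on a b (\<lambda>t. reg.rcv t om)" for om by (rule reg.rcv_cadlag)
 show "transition_probabilities E q a b p" by (rule tp)
 fix r s y assume r: "r \<in> {a..b}" and s: "s \<in> {r..b}" and y: "y \<in> E"
 show "AE om in LP. real_cond_exp LP (natural_filtration LP E a reg.rcv r)
       (indicator {om\<in>space LP. reg.rcv s om = y}) om = p r s (reg.rcv r om) y"
 proof (rule markov_property_from_cylinders[OF Pr.P.prob_space_axioms fin reg.rcv_measurable r s y, where h = "\<lambda>x. p r s x y"])
  fix J and \<xi> :: "real => 'e" assume J: "finite J" "J \<subseteq> {a..r}" "r \<in> J" and \<xi>: "\<And>t. t \<in> J ==> \<xi> t \<in> E"
  have Jb: "J \<subseteq> {a..b}" using J r by auto
  show "measure LP (cylinder LP reg.rcv J \<xi> \<inter> {om\<in>space LP. reg.rcv s om = y}) =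
     measure LP (cylinder LP reg.rcv J \<xi>) * p r s (\<xi> r) y"
  \<comment> \<open>\<open>fdw_snoc\<close> needs a time strictly after \<open>r\<close>; for
    \<open>r = s\<close> the transition probabilities are the identity matrix.\<close>
  proof (cases "r = s")
   case True
   have "cylinder LP reg.rcv J \<xi> \<inter> {om\<in>space LP. reg.rcv s om = y} = (if \<xi> r = y then cylinder LP reg.rcv J \<xi> else {})"
    using J(3) True unfolding cylinder_def by auto
   moreover have "p r s (\<xi> r) y = (if \<xi> r = y then 1 else 0)" using p_refl[OF r \<xi>[OF J(3)] y] True by simp
   ultimately show ?thesis by simp
  next
   case False
   hence "r < s" using s by simp
   hence sJ: "s \<notin> J" using J(2) by auto
   have "cylinder LP reg.rcv J \<xi> \<inter> {om\<in>space LP. reg.rcv s om = y} = cylinder LP reg.rcv (insert s J) (\<xi>(s := y))"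
    using sJ unfolding cylinder_def by auto
   moreover have "measure LP (cylinder LP reg.rcv (insert s J) (\<xi>(s := y))) = fdw x0 (insert s J) (\<xi>(s := y))"
    using J Jb \<xi> y s r by (intro rcv_cylinder) auto
   moreover have "fdw x0 (insert s J) (\<xi>(s := y)) = fdw x0 J (\<xi>(s := y)) * p r s (\<xi> r) y"
    using fdw_snoc[of J r s x0 "\<xi>(s := y)"] J \<open>r < s\<close> by (auto simp: subset_eq)
   moreover have "fdw x0 J (\<xi>(s := y)) = fdw x0 J \<xi>" using J(1) sJ by (intro fdw_cong) auto
   moreover have "measure LP (cylinder LP reg.rcv J \<xi>) = fdw x0 J \<xi>" using J(1) Jb \<xi> by (rule rcv_cylinder)
   ultimately show ?thesis by simp
  qed
 qed
qed

lemma rcv_start: "AE om in LP. reg.rcv a om = x0"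
proof -
 have c: "cylinder LP reg.rcv {a} (\<lambda>_. x0) \<in> sets LP"
  by (rule cylinder_sets[where E = E]) (use ab x0 reg.rcv_measurable in auto)
 have "measure LP (cylinder LP reg.rcv {a} (\<lambda>_. x0)) = 1"
  using ab x0 by (subst rcv_cylinder) (auto simp: fdw_singleton p_refl)
 hence "AE om in LP. om \<in> cylinder LP reg.rcv {a} (\<lambda>_. x0)" by (rule Pr.P.AE_prob_1)
 thus ?thesis by eventually_elim (simp add: cylinder_def)
qed

end

text \<open>The measure is built on functions of time because \<open>agent_value\<close> ranges over
  realizations on this path space.\<close>

theorem markov_jump_chain_exists:
 fixes E :: "'e::polish_space set"
 assumes "rates E q a b L" and x0: "x0 \<in> E"
 shows "\<exists>(P :: (real => 'e) measure) X. markov_jump_chain P E q a b X \<and> (AE om in P. X a om = x0)"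
proof -
 interpret rates E q a b L by fact
 obtain p where "transition_probabilities E q a b p" using transition_probabilities_exist by blast
 then interpret kolmogorov_extension E q a b L p x0 by unfold_locales (use x0 in auto)
 show ?thesis using rcv_markov_jump_chain rcv_start by blast
qed

section \<open>Expectations of functionals of a Markov chain\<close>

primrec runmax :: "(nat => real) => nat => real" where
 "runmax m 0 = 0"
| "runmax m (Suc k) = max (runmax m k) (m (Suc k))"

lemma runmax_nonneg: "0 <= runmax m k"
 by (induction k) (auto simp: le_max_iff_disj)

lemma runmax_ge: "[|m 0 = 0; k <= n|] ==> m k <= runmax m n"
 by (induction n) (auto simp: le_max_iff_disj le_Suc_eq)

text \<open>A pathwise form of Doob's inequality: if \<open>m\<close> is a martingale, the last sum has mean zero.\<close>

lemma runmax_pathwise: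
 assumes "m 0 = 0"
 shows "(runmax m n)\<^sup>2 <= 4 * (m n)\<^sup>2 - 4 * (\<Sum>k<n. runmax m k * (m (Suc k) - m k))"
proof -
 have "(\<Sum>k<n. runmax m k * (m (Suc k) - m k)) <= runmax m n * m n - (runmax m n)\<^sup>2 / 2"
 proof (induction n)
  case 0 thus ?case by simp
 next
  case (Suc n)
  let ?S = "runmax m n" and ?x = "m (Suc n)"
  \<comment> \<open>The concave function \<open>y * ?x - y^2 / 2\<close> of \<open>y\<close>
    increases up to \<open>?x\<close>, so moving \<open>?S\<close> to \<open>max ?S ?x\<close>
    cannot lower it.\<close>
  have "?S * ?x - ?S\<^sup>2 / 2 <= max ?S ?x * ?x - (max ?S ?x)\<^sup>2 / 2"
  proof (cases "?S <= ?x")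
   case True
   have "0 <= (?x - ?S)\<^sup>2" by simp
   hence "?S * ?x - ?S\<^sup>2 / 2 <= ?x * ?x - ?x\<^sup>2 / 2" by (simp add: power2_eq_square algebra_simps)
   thus ?thesis using True by (simp add: max_def)
  qed (simp add: max_def)
  moreover have "(\<Sum>k<Suc n. runmax m k * (m (Suc k) - m k)) <= (?S * m n - ?S\<^sup>2 / 2) + ?S * (?x - m n)"
   using Suc by simp
  moreover have "(?S * m n - ?S\<^sup>2 / 2) + ?S * (?x - m n) = ?S * ?x - ?S\<^sup>2 / 2" by (simp add: algebra_simps)
  ultimately show ?case unfolding runmax.simps by linarith
 qed
 moreover have "runmax m n * m n <= (runmax m n)\<^sup>2 / 4 + (m n)\<^sup>2"
  using zero_le_power2[of "runmax m n / 2 - m n"] by (simp add: power2_eq_square algebra_simps)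
 ultimately show ?thesis by argo
qed

section \<open>Laws and conditional expectations of a chain\<close>

locale chain = transition_rates E q a b L p + prob_space P
 for E :: "'e::t1_space set" and q a b L p and P :: "'w measure" +
 fixes X :: "real => 'w => 'e"
 assumes Xm: "\<And>t. t \<in> {a..b} ==> X t \<in> measurable P (count_space E)"
  and cadlag: "\<And>om. om \<in> space P ==> cadlag_on a b (\<lambda>s. X s om)"
  and markov: "\<And>r s y. [|r \<in> {a..b}; s \<in> {r..b}; y \<in> E|] ==> AE om in P.
    real_cond_exp P (natural_filtration P E a X r) (indicator {om\<in>space P. X s om = y}) om = p r s (X r om) y"

text \<open>\<open>markov_jump_chain\<close> only asserts that some transition probabilities exist;
  fixing one choice \<open>p\<close> makes conditional expectations explicit functions of the
  present state.\<close>

lemma chain_if_markov_jump_chain: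
 assumes "rates E q a b L" "markov_jump_chain P E q a b X"
 obtains p where "chain E q a b L p P X"
proof -
 obtain p where p: "transition_probabilities E q a b p" "\<forall>r\<in>{a..b}. \<forall>s\<in>{r..b}. \<forall>y\<in>E. AE om in P.
   real_cond_exp P (natural_filtration P E a X r) (indicator {om\<in>space P. X s om = y}) om = p r s (X r om) y"
  using assms(2) unfolding markov_jump_chain_def by blast
 have "chain E q a b L p P X"
  unfolding chain_def transition_rates_def transition_rates_axioms_def chain_axioms_def
  using assms p unfolding markov_jump_chain_def by blast
 thus ?thesis by (rule that)
qed

context chain begin

lemma XE: "[|t \<in> {a..b}; om \<in> space P|] ==> X t om \<in> E"
 using measurable_space[OF Xm] by simp

lemma X_sets:
 assumes t: "t \<in> {a..b}" shows "{om\<in>space P. X t om = y} \<in> sets P"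
proof -
 have "X t -` ({y} \<inter> E) \<inter> space P \<in> sets P" by (rule measurable_sets[OF Xm[OF t]]) simp
 also have "X t -` ({y} \<inter> E) \<inter> space P = {om\<in>space P. X t om = y}" using XE[OF t] by auto
 finally show ?thesis .
qed

lemma fun_X_measurable: "t \<in> {a..b} ==> (\<lambda>om. \<phi> (X t om) :: real) \<in> borel_measurable P"
 by (rule measurable_compose[OF Xm]) auto

lemma fun_X_filtration:
 assumes "u \<in> {a..r}" "r <= b" shows "(\<lambda>om. \<phi> (X u om) :: real) \<in> borel_measurable (natural_filtration P E a X r)"
 by (rule measurable_compose[OF natural_filtration_measurable[OF fin]]) (use assms XE in auto)

lemma fun_bounded: obtains B where "0 <= B" "\<forall>x\<in>E. \<bar>\<phi> x\<bar> <= (B::real)"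
proof
 show "\<forall>x\<in>E. \<bar>\<phi> x\<bar> <= (\<Sum>x\<in>E. \<bar>\<phi> x\<bar>)" using fin by (auto intro!: member_le_sum)
qed (simp add: sum_nonneg)

text \<open>Bounded measurable functions are closed under all operations used below, which settles
  every question of integrability.\<close>

definition "bdd f \<longleftrightarrow> f \<in> borel_measurable P \<and> (\<exists>B. \<forall>om\<in>space P. \<bar>f om\<bar> <= (B::real))"

lemma bdd_integrable: "bdd f ==> integrable P f"
 unfolding bdd_def by (elim conjE exE) (rule integrable_const_bound, auto intro!: AE_I2)

lemma bdd_const: "bdd (\<lambda>_. c)" unfolding bdd_def by auto

lemma bdd_add: "bdd f ==> bdd g ==> bdd (\<lambda>om. f om + g om)"
proof -
 assume "bdd f" "bdd g"
 then obtain B C where *: "\<forall>om\<in>space P. \<bar>f om\<bar> <= B" "\<forall>om\<in>space P. \<bar>g om\<bar> <= C"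
  and [measurable]: "f \<in> borel_measurable P" "g \<in> borel_measurable P" unfolding bdd_def by blast
 have "\<forall>om\<in>space P. \<bar>f om + g om\<bar> <= B + C" using * by fastforce
 thus ?thesis unfolding bdd_def by auto
qed

lemma bdd_mult: "bdd f ==> bdd g ==> bdd (\<lambda>om. f om * g om)"
proof -
 assume "bdd f" "bdd g"
 then obtain B C where *: "\<forall>om\<in>space P. \<bar>f om\<bar> <= B" "\<forall>om\<in>space P. \<bar>g om\<bar> <= C"
  and [measurable]: "f \<in> borel_measurable P" "g \<in> borel_measurable P" unfolding bdd_def by blast
 have "\<bar>f om * g om\<bar> <= \<bar>B\<bar> * \<bar>C\<bar>" if "om \<in> space P" for om
  unfolding abs_mult using bspec[OF *(1) that] bspec[OF *(2) that] by (intro mult_mono) auto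
 thus ?thesis unfolding bdd_def by auto
qed

lemma bdd_diff: "bdd f ==> bdd g ==> bdd (\<lambda>om. f om - g om)"
 using bdd_add[of f "\<lambda>om. (-1) * g om"] bdd_mult[OF bdd_const[of "-1"], of g] by simp

lemma bdd_max: "bdd f ==> bdd g ==> bdd (\<lambda>om. max (f om) (g om))"
proof -
 assume "bdd f" "bdd g"
 then obtain B C where *: "\<forall>om\<in>space P. \<bar>f om\<bar> <= B" "\<forall>om\<in>space P. \<bar>g om\<bar> <= C"
  and [measurable]: "f \<in> borel_measurable P" "g \<in> borel_measurable P" unfolding bdd_def by blast
 have "\<forall>om\<in>space P. \<bar>max (f om) (g om)\<bar> <= max B C" using * by fastforce
 thus ?thesis unfolding bdd_def by auto
qed

lemma bdd_sum: "(\<And>i. i \<in> I ==> bdd (f i)) ==> bdd (\<lambda>om. \<Sum>i\<in>I. f i om)"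
 by (induction I rule: infinite_finite_induct) (simp_all add: bdd_const bdd_add)

lemma bdd_power2: "bdd f ==> bdd (\<lambda>om. (f om)\<^sup>2)"
 unfolding power2_eq_square by (rule bdd_mult)

lemma bdd_fun_X: assumes t: "t \<in> {a..b}" shows "bdd (\<lambda>om. \<phi> (X t om))"
proof -
 obtain B where "\<forall>x\<in>E. \<bar>\<phi> x\<bar> <= B" using fun_bounded[of \<phi>] .
 hence "\<forall>om\<in>space P. \<bar>\<phi> (X t om)\<bar> <= B" using XE[OF t] by blast
 thus ?thesis unfolding bdd_def using fun_X_measurable[OF t] by blast
qed

lemma bdd_indicator: "t \<in> {a..b} ==> bdd (indicator {om\<in>space P. X t om = y})"
 unfolding bdd_def using X_sets[of t y] by (auto intro!: exI[of _ 1] simp: indicator_def)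

definition "law s y = measure P {om\<in>space P. X s om = y}"

lemma fun_X_expand:
 assumes "t \<in> {a..b}" "om \<in> space P"
 shows "\<phi> (X t om) = (\<Sum>y\<in>E. indicator {om\<in>space P. X t om = y} om * (\<phi> y :: real))"
proof -
 have "(\<Sum>y\<in>E. indicator {om\<in>space P. X t om = y} om * \<phi> y) = (\<Sum>y\<in>E. if y = X t om then \<phi> y else 0)"
  using assms(2) by (intro sum.cong refl) (auto simp: indicator_def)
 thus ?thesis using XE[OF assms] fin by simp
qed

lemma expect_law:
 assumes t: "t \<in> {a..b}"
 shows "(\<integral>om. \<phi> (X t om) \<partial>P) = (\<Sum>y\<in>E. law t y * \<phi> y)"
proof -
 have "(\<integral>om. \<phi> (X t om) \<partial>P) = (\<integral>om. (\<Sum>y\<in>E. indicator {om\<in>space P. X t om = y} om * \<phi> y) \<partial>P)"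
  using fun_X_expand[OF t] by (intro Bochner_Integration.integral_cong refl)
 also have "\<dots> = (\<Sum>y\<in>E. \<integral>om. indicator {om\<in>space P. X t om = y} om * \<phi> y \<partial>P)"
  by (intro Bochner_Integration.integral_sum bdd_integrable bdd_mult bdd_const bdd_indicator t)
 also have "\<dots> = (\<Sum>y\<in>E. law t y * \<phi> y)"
 proof (intro sum.cong refl)
  fix y
  have "{om\<in>space P. X t om = y} \<inter> space P = {om\<in>space P. X t om = y}" by blast
  thus "(\<integral>om. indicator {om\<in>space P. X t om = y} om * \<phi> y \<partial>P) = law t y * \<phi> y"
   unfolding law_def by (simp only: Bochner_Integration.integral_mult_left_zero Bochner_Integration.integral_indicator)
 qed
 finally show ?thesis .
qed

lemma subalg_filtration: "r \<in> {a..b} ==> subalgebra P (natural_filtration P E a X r)"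
 by (rule subalgebra_natural_filtration) (use Xm in auto)

text \<open>\<open>\<psi>\<close> is expanded into indicators of the states, for which the Markov
  property is given; the factor \<open>h\<close> passes through the conditional expectation because
  it is measurable for the past.\<close>

lemma markov_expect:
 assumes r: "r \<in> {a..b}" and s: "s \<in> {r..b}" and hF: "h \<in> borel_measurable (natural_filtration P E a X r)" and h: "bdd h"
 shows "(\<integral>om. h om * \<psi> (X s om) \<partial>P) = (\<integral>om. h om * (\<Sum>y\<in>E. p r s (X r om) y * \<psi> y) \<partial>P)"
proof -
 let ?F = "natural_filtration P E a X r"
 interpret F: finite_measure_subalgebra P ?F by unfold_locales (rule subalg_filtration[OF r])
 have sb: "s \<in> {a..b}" using r s by auto
 have one: "(\<integral>om. h om * indicator {om\<in>space P. X s om = y} om \<partial>P) = (\<integral>om. h om * p r s (X r om) y \<partial>P)" if y: "y \<in> E" for y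
 proof -
  have int: "integrable P (\<lambda>om. h om * indicator {om\<in>space P. X s om = y} om)"
   by (intro bdd_integrable bdd_mult h bdd_indicator sb)
  have m: "indicator {om\<in>space P. X s om = y} \<in> borel_measurable P" using X_sets[OF sb] by simp
  have "(\<integral>om. h om * indicator {om\<in>space P. X s om = y} om \<partial>P) =
    (\<integral>om. h om * real_cond_exp P ?F (indicator {om\<in>space P. X s om = y}) om \<partial>P)"
   by (rule F.real_cond_exp_intg(2)[OF int hF m, symmetric])
  also have "\<dots> = (\<integral>om. h om * p r s (X r om) y \<partial>P)"
  proof (rule integral_cong_AE)
   have hm: "h \<in> borel_measurable P" using h by (simp add: bdd_def)
   show "(\<lambda>om. h om * real_cond_exp P ?F (indicator {om\<in>space P. X s om = y}) om) \<in> borel_measurable P"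
    by (intro borel_measurable_times hm borel_measurable_cond_exp2)
   show "(\<lambda>om. h om * p r s (X r om) y) \<in> borel_measurable P"
    by (intro borel_measurable_times hm fun_X_measurable[OF r, of "\<lambda>x. p r s x y"])
   show "AE om in P. h om * real_cond_exp P ?F (indicator {om\<in>space P. X s om = y}) om = h om * p r s (X r om) y"
    using markov[OF r s y] by eventually_elim simp
  qed
  finally show ?thesis .
 qed
 have "(\<integral>om. h om * \<psi> (X s om) \<partial>P) = (\<integral>om. (\<Sum>y\<in>E. h om * indicator {om\<in>space P. X s om = y} om * \<psi> y) \<partial>P)"
 proof (intro Bochner_Integration.integral_cong refl)
  fix om assume "om \<in> space P"
  from fun_X_expand[OF sb this, of \<psi>]
  show "h om * \<psi> (X s om) = (\<Sum>y\<in>E. h om * indicator {om\<in>space P. X s om = y} om * \<psi> y)"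
   by (simp only: sum_distrib_left mult.assoc)
 qed
 also have "\<dots> = (\<Sum>y\<in>E. \<integral>om. h om * indicator {om\<in>space P. X s om = y} om * \<psi> y \<partial>P)"
  by (intro Bochner_Integration.integral_sum bdd_integrable bdd_mult bdd_const bdd_indicator sb h)
 also have "\<dots> = (\<Sum>y\<in>E. \<integral>om. h om * p r s (X r om) y * \<psi> y \<partial>P)"
  using one by (intro sum.cong refl) (simp only: Bochner_Integration.integral_mult_left_zero)
 also have "\<dots> = (\<integral>om. (\<Sum>y\<in>E. h om * p r s (X r om) y * \<psi> y) \<partial>P)"
  by (intro Bochner_Integration.integral_sum[symmetric] bdd_integrable bdd_mult bdd_const h bdd_fun_X[OF r, of "\<lambda>x. p r s x _"])
 finally show ?thesis by (simp only: sum_distrib_left mult.assoc)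
qed

lemma law_mixture:
 assumes s: "s \<in> {a..b}" and y: "y \<in> E"
 shows "law s y = (\<Sum>x\<in>E. law a x * p a s x y)"
proof -
 have a: "a \<in> {a..b}" using ab by simp
 have "law s y = (\<Sum>z\<in>E. law s z * (if z = y then 1 else 0))" using fin y by (simp add: if_distrib cong: if_cong)
 also have "\<dots> = (\<integral>om. 1 * (if X s om = y then 1 else 0) \<partial>P)"
  unfolding mult_1 by (rule expect_law[OF s, symmetric])
 also have "\<dots> = (\<integral>om. 1 * (\<Sum>z\<in>E. p a s (X a om) z * (if z = y then 1 else 0)) \<partial>P)"
  using s a by (intro markov_expect bdd_const) auto
 also have "\<dots> = (\<integral>om. p a s (X a om) y \<partial>P)" using fin y by (simp add: if_distrib cong: if_cong)
 also have "\<dots> = (\<Sum>x\<in>E. law a x * p a s x y)" by (rule expect_law[OF a])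
 finally show ?thesis .
qed

text \<open>By the Markov property at time \<open>a\<close> the law is a mixture of transition
  probabilities, each of which solves the linear equation.\<close>

lemma law_forward: "forward_sol E q a b law"
proof (rule forward_sol_cong)
 show "forward_sol E q a b (\<lambda>s y. \<Sum>x\<in>E. law a x * p a s x y)"
  using ab by (intro p_mixture_forward) auto
qed (simp add: law_mixture)

lemma law_nonneg: "0 <= law s y" by (simp add: law_def)

lemma law_sum: "s \<in> {a..b} ==> (\<Sum>y\<in>E. law s y) = 1"
 using expect_law[of s "\<lambda>_. 1"] prob_space by simp

text \<open>By right-continuity \<open>X s\<close> is the limit of \<open>X (grid_up n s)\<close>, which gives joint measurability.\<close>

definition "grid_up n s = min b (a + (real_of_int \<lfloor>(s - a) * 2 ^ n\<rfloor> + 1) / 2 ^ n)"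

lemma grid_up_in: "s \<in> {a..b} ==> grid_up n s \<in> {a..b}"
 and grid_up_gt: "s \<in> {a..<b} ==> s < grid_up n s"
 and grid_up_le: "s \<in> {a..b} ==> grid_up n s <= s + 1 / 2 ^ n"
proof -
 have *: "s < a + (real_of_int \<lfloor>(s - a) * 2 ^ n\<rfloor> + 1) / 2 ^ n" "a + (real_of_int \<lfloor>(s - a) * 2 ^ n\<rfloor> + 1) / 2 ^ n <= s + 1 / 2 ^ n"
 proof -
  have "(s - a) * 2 ^ n < real_of_int \<lfloor>(s - a) * 2 ^ n\<rfloor> + 1" by linarith
  hence "s - a < (real_of_int \<lfloor>(s - a) * 2 ^ n\<rfloor> + 1) / 2 ^ n" by (simp add: less_divide_eq)
  thus "s < a + (real_of_int \<lfloor>(s - a) * 2 ^ n\<rfloor> + 1) / 2 ^ n" by linarith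
  have "real_of_int \<lfloor>(s - a) * 2 ^ n\<rfloor> <= (s - a) * 2 ^ n" by linarith
  hence "real_of_int \<lfloor>(s - a) * 2 ^ n\<rfloor> / 2 ^ n <= s - a" by (simp add: divide_le_eq)
  thus "a + (real_of_int \<lfloor>(s - a) * 2 ^ n\<rfloor> + 1) / 2 ^ n <= s + 1 / 2 ^ n" by (simp add: add_divide_distrib)
 qed
 show "s \<in> {a..b} ==> grid_up n s \<in> {a..b}" using * ab unfolding grid_up_def by auto
 show "s \<in> {a..<b} ==> s < grid_up n s" using * unfolding grid_up_def by auto
 show "s \<in> {a..b} ==> grid_up n s <= s + 1 / 2 ^ n" using * unfolding grid_up_def by auto
qed

text \<open>\<open>E\<close> is finite in a T1 space, so the complement of
  \<open>E - {X s om}\<close> is an open neighbourhood of \<open>X s om\<close>; right-continuity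
  keeps the path in it, and inside \<open>E\<close>, just after \<open>s\<close>.\<close>

lemma right_constant:
 assumes w: "om \<in> space P" and s: "s \<in> {a..<b}"
 shows "\<exists>eps>0. \<forall>s'. s < s' \<and> s' < s + eps --> X s' om = X s om"
proof -
 let ?U = "- (E - {X s om})"
 have "((\<lambda>s. X s om) \<longlongrightarrow> X s om) (at_right s)" using cadlag[OF w] s unfolding cadlag_on_def by blast
 moreover have "open ?U" by (intro open_Compl finite_imp_closed) (use fin in auto)
 ultimately have "\<forall>\<^sub>F s' in at_right s. X s' om \<in> ?U" by (rule topological_tendstoD) simp
 then obtain c where c: "s < c" "\<And>s'. s < s' ==> s' < c ==> X s' om \<in> ?U"
  unfolding eventually_at_right_field by blast
 have "X s' om = X s om" if "s < s'" "s' < s + min (c - s) (b - s)" for s'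
 proof -
  have "X s' om \<in> E" using that s w by (intro XE) auto
  thus ?thesis using c(2)[of s'] that by auto
 qed
 thus ?thesis using c(1) s by (intro exI[of _ "min (c - s) (b - s)"]) auto
qed

lemma X_eq_iff_grid:
 assumes w: "om \<in> space P" and s: "s \<in> {a..b}"
 shows "X s om = y \<longleftrightarrow> (\<exists>m. \<forall>n\<ge>m. X (grid_up n s) om = y)"
proof -
 have "\<exists>m. \<forall>n\<ge>m. X (grid_up n s) om = X s om"
 proof (cases "s < b")
  case True
  then obtain eps where e: "0 < eps" "\<And>s'. s < s' ==> s' < s + eps ==> X s' om = X s om"
   using right_constant[OF w, of s] s by auto
  obtain m where m: "(1/2::real) ^ m < eps" using real_arch_pow_inv[OF e(1), of "1/2"] by auto
  have "X (grid_up n s) om = X s om" if "n \<ge> m" for n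
  proof (rule e(2))
   show "s < grid_up n s" using grid_up_gt True s by auto
   have "grid_up n s <= s + 1 / 2 ^ n" using grid_up_le s by auto
   moreover have "1 / 2 ^ n = (1/2::real) ^ n" by (simp add: power_one_over)
   moreover have "(1/2::real) ^ n <= (1/2) ^ m" by (rule power_decreasing[OF that]) auto
   ultimately show "grid_up n s < s + eps" using m by linarith
  qed
  thus ?thesis by blast
 next
  case False
  hence "s = b" using s by simp
  have "grid_up n b = b" for n
  proof -
   have "(b - a) * 2 ^ n < real_of_int \<lfloor>(b - a) * 2 ^ n\<rfloor> + 1" by linarith
   hence "b - a < (real_of_int \<lfloor>(b - a) * 2 ^ n\<rfloor> + 1) / 2 ^ n" by (simp add: less_divide_eq)
   thus ?thesis unfolding grid_up_def by linarith
  qed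
  thus ?thesis using \<open>s = b\<close> by simp
 qed
 then obtain m where m: "\<And>n. n \<ge> m ==> X (grid_up n s) om = X s om" by blast
 show ?thesis
 proof
  show "X s om = y ==> \<exists>m. \<forall>n\<ge>m. X (grid_up n s) om = y" using m by blast
  assume "\<exists>m. \<forall>n\<ge>m. X (grid_up n s) om = y"
  then obtain m' where "\<forall>n\<ge>m'. X (grid_up n s) om = y" by blast
  thus "X s om = y" using m[of "max m m'"] by simp
 qed
qed

definition "occ y = {(s, om). s \<in> {a..b} \<and> om \<in> space P \<and> X s om = y}"

text \<open>For fixed \<open>n\<close> time is rounded up to a grid and the set splits into
  countably many rectangles; \<open>occ y\<close> is the lower limit of these sets as
  \<open>n\<close> grows.\<close>

lemma occ_sets: "occ y \<in> sets (lborel \<Otimes>\<^sub>M P)"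
proof -
 have g: "{(s, om). s \<in> {a..b} \<and> om \<in> space P \<and> X (grid_up n s) om = y} \<in> sets (lborel \<Otimes>\<^sub>M P)" for n
 proof -
  \<comment> \<open>The integer \<open>k\<close> stands for the floor in \<open>grid_up\<close>,
    which is constant on the first factor of the rectangle \<open>B k\<close>.\<close>
  define c where "c k = min b (a + (real_of_int k + 1) / 2 ^ n)" for k :: int
  define B where "B k = (if c k \<in> {a..b} then {s\<in>{a..b}. \<lfloor>(s - a) * 2 ^ n\<rfloor> = k} \<times> {om\<in>space P. X (c k) om = y} else {})" for k
  have "B k \<in> sets (lborel \<Otimes>\<^sub>M P)" for k
  proof (cases "c k \<in> {a..b}")
   case True
   have "{s\<in>{a..b}. \<lfloor>(s - a) * 2 ^ n\<rfloor> = k} =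
     {s\<in>space borel. a <= s \<and> s <= b \<and> real_of_int k <= (s - a) * 2 ^ n \<and> (s - a) * 2 ^ n < real_of_int k + 1}"
    by (auto simp: floor_eq_iff)
   also have "\<dots> \<in> sets borel" by measurable
   finally show ?thesis unfolding B_def using True X_sets[OF True, of y] by auto
  next
   case False
   hence "B k = {}" unfolding B_def by (simp only: if_False)
   thus ?thesis by simp
  qed
  hence "(\<Union>k. B k) \<in> sets (lborel \<Otimes>\<^sub>M P)" by auto
  also have "(\<Union>k. B k) = {(s, om). s \<in> {a..b} \<and> om \<in> space P \<and> X (grid_up n s) om = y}"
  proof (intro set_eqI iffI)
   fix z assume "z \<in> (\<Union>k. B k)"
   thus "z \<in> {(s, om). s \<in> {a..b} \<and> om \<in> space P \<and> X (grid_up n s) om = y}"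
    by (auto simp: B_def c_def grid_up_def split: if_splits)
  next
   fix z assume "z \<in> {(s, om). s \<in> {a..b} \<and> om \<in> space P \<and> X (grid_up n s) om = y}"
   then obtain s om where z: "z = (s, om)" "s \<in> {a..b}" "om \<in> space P" "X (grid_up n s) om = y" by blast
   have "c \<lfloor>(s - a) * 2 ^ n\<rfloor> = grid_up n s" by (simp add: c_def grid_up_def)
   hence "z \<in> B \<lfloor>(s - a) * 2 ^ n\<rfloor>" using z grid_up_in[OF z(2), of n] unfolding B_def by simp
   thus "z \<in> (\<Union>k. B k)" by blast
  qed
  finally show ?thesis .
 qed
 have "(\<Union>m. \<Inter>n\<in>{m..}. {(s, om). s \<in> {a..b} \<and> om \<in> space P \<and> X (grid_up n s) om = y}) \<in> sets (lborel \<Otimes>\<^sub>M P)"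
  using g by (intro sets.countable_nat_UN image_subsetI sets.countable_INT') auto
 also have "(\<Union>m. \<Inter>n\<in>{m..}. {(s, om). s \<in> {a..b} \<and> om \<in> space P \<and> X (grid_up n s) om = y}) = occ y"
 proof (intro set_eqI iffI)
  fix z assume "z \<in> (\<Union>m. \<Inter>n\<in>{m..}. {(s, om). s \<in> {a..b} \<and> om \<in> space P \<and> X (grid_up n s) om = y})"
  then obtain m where m: "\<forall>n\<in>{m..}. fst z \<in> {a..b} \<and> snd z \<in> space P \<and> X (grid_up n (fst z)) (snd z) = y"
   unfolding UN_iff INT_iff mem_Collect_eq case_prod_unfold by blast
  hence "fst z \<in> {a..b}" "snd z \<in> space P" "\<exists>m. \<forall>n\<ge>m. X (grid_up n (fst z)) (snd z) = y" by blast+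
  thus "z \<in> occ y" unfolding occ_def using X_eq_iff_grid[of "snd z" "fst z" y] by (simp add: case_prod_unfold)
 next
  fix z assume "z \<in> occ y"
  hence z: "fst z \<in> {a..b}" "snd z \<in> space P" "X (fst z) (snd z) = y" unfolding occ_def by auto
  then obtain m where "\<forall>n\<ge>m. X (grid_up n (fst z)) (snd z) = y" using iffD1[OF X_eq_iff_grid[OF z(2,1)] z(3)] by blast
  thus "z \<in> (\<Union>m. \<Inter>n\<in>{m..}. {(s, om). s \<in> {a..b} \<and> om \<in> space P \<and> X (grid_up n s) om = y})"
   using z(1,2) by (auto simp: case_prod_unfold)
 qed
 finally show ?thesis .
qed

lemma occupation_fubini:
 fixes \<phi> :: "real => 'e => real"
 assumes \<phi>m: "\<And>y. y \<in> E ==> (\<lambda>s. indicator {a..b} s * \<phi> s y) \<in> borel_measurable borel"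
  and \<phi>b: "\<And>s y. [|s \<in> {a..b}; y \<in> E|] ==> \<bar>\<phi> s y\<bar> <= K"
 shows "integrable P (\<lambda>om. LINT s:{a..b}|lborel. \<phi> s (X s om))"
  and "(\<integral>om. (LINT s:{a..b}|lborel. \<phi> s (X s om)) \<partial>P) = integral {a..b} (\<lambda>s. \<Sum>y\<in>E. law s y * \<phi> s y)"
proof -
 interpret pair_sigma_finite lborel P by unfold_locales
 \<comment> \<open>Summing over the states separates the time dependence of \<open>\<phi>\<close>
   from the randomness, so joint measurability follows from that of the sets
   \<open>occ y\<close>.\<close>
 define f where "f = (\<lambda>s om. \<Sum>y\<in>E. indicator (occ y) (s, om) * (indicator {a..b} s * \<phi> s y))"
 define K' where "K' = real (card E) * \<bar>K\<bar>"
 have fm: "case_prod f \<in> borel_measurable (lborel \<Otimes>\<^sub>M P)"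
  unfolding f_def case_prod_unfold
 proof (rule borel_measurable_sum)
  fix y assume y: "y \<in> E"
  have m1: "(\<lambda>z. indicator (occ y) (fst z, snd z) :: real) \<in> borel_measurable (lborel \<Otimes>\<^sub>M P)" using occ_sets[of y] by simp
  have m2: "(\<lambda>z. indicator {a..b} (fst z) * \<phi> (fst z) y) \<in> borel_measurable (lborel \<Otimes>\<^sub>M P)"
   by (rule measurable_compose[OF measurable_fst, of "\<lambda>s. indicator {a..b} s * \<phi> s y"]) (use \<phi>m[OF y] in simp)
  show "(\<lambda>z. indicator (occ y) (fst z, snd z) * (indicator {a..b} (fst z) * \<phi> (fst z) y)) \<in> borel_measurable (lborel \<Otimes>\<^sub>M P)"
   by (rule borel_measurable_times[OF m1 m2])
 qed
 have fb: "\<bar>f s om\<bar> <= K' * indicator ({a..b} \<times> space P) (s, om)" if "om \<in> space P" for s om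
 proof (cases "s \<in> {a..b}")
  case True
  have t: "\<bar>indicator (occ y) (s, om) * (indicator {a..b} s * \<phi> s y)\<bar> <= \<bar>K\<bar>" if "y \<in> E" for y
   using order_trans[OF \<phi>b[OF True that] abs_ge_self] by (simp add: indicator_def)
  have "\<bar>f s om\<bar> <= (\<Sum>y\<in>E. \<bar>K\<bar>)"
   unfolding f_def by (rule order_trans[OF sum_abs sum_mono]) (rule t)
  thus ?thesis using True that by (simp add: K'_def)
 qed (simp add: f_def K'_def)
 have sp: "space ((lborel :: real measure) \<Otimes>\<^sub>M P) = UNIV \<times> space P" by (simp add: space_pair_measure)
 have "emeasure (lborel \<Otimes>\<^sub>M P) ({a..b} \<times> space P) = emeasure lborel {a..b} * emeasure P (space P)"
  by (rule sigma_finite_measure.emeasure_pair_measure_Times) (auto intro: prob_space_imp_sigma_finite prob_space_axioms)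
 hence "emeasure (lborel \<Otimes>\<^sub>M P) ({a..b} \<times> space P) < \<infinity>" using ab emeasure_space_1 by simp
 hence "integrable (lborel \<Otimes>\<^sub>M P) (\<lambda>z. K' * indicator ({a..b} \<times> space P) z)"
  by (intro integrable_mult_right integrable_real_indicator) auto
 hence fint: "integrable (lborel \<Otimes>\<^sub>M P) (case_prod f)"
 proof (rule Bochner_Integration.integrable_bound[OF _ fm AE_I2])
  fix z :: "real \<times> 'w" assume "z \<in> space (lborel \<Otimes>\<^sub>M P)"
  then obtain s om where z: "z = (s, om)" "om \<in> space P" unfolding sp by blast
  have "\<bar>f s om\<bar> <= \<bar>K' * indicator ({a..b} \<times> space P) (s, om)\<bar>" using fb[OF z(2), of s] by linarith
  thus "norm (case_prod f z) <= norm (K' * indicator ({a..b} \<times> space P) z)" unfolding z(1) by simp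
 qed
 have inner: "(\<integral>s. f s om \<partial>lborel) = (LINT s:{a..b}|lborel. \<phi> s (X s om))" if w: "om \<in> space P" for om
  unfolding set_lebesgue_integral_def
 proof (intro Bochner_Integration.integral_cong refl)
  fix s :: real
  show "f s om = indicator {a..b} s *\<^sub>R \<phi> s (X s om)"
  proof (cases "s \<in> {a..b}")
   case True
   have "f s om = (\<Sum>y\<in>E. if y = X s om then \<phi> s y else 0)"
    unfolding f_def using True w by (intro sum.cong refl) (auto simp: occ_def)
   thus ?thesis using True fin XE[OF True w] by simp
  qed (simp add: f_def)
 qed
 have "integrable P (\<lambda>om. \<integral>s. f s om \<partial>lborel)" by (rule integrable_snd[OF fint])
 thus "integrable P (\<lambda>om. LINT s:{a..b}|lborel. \<phi> s (X s om))"
  using inner by (simp cong: Bochner_Integration.integrable_cong)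
 have outer: "(\<integral>om. f s om \<partial>P) = indicator {a..b} s *\<^sub>R (\<Sum>y\<in>E. law s y * \<phi> s y)" for s
 proof (cases "s \<in> {a..b}")
  case True
  have "(\<integral>om. f s om \<partial>P) = (\<integral>om. \<phi> s (X s om) \<partial>P)"
  proof (intro Bochner_Integration.integral_cong refl)
   fix om assume w: "om \<in> space P"
   have "f s om = (\<Sum>y\<in>E. if y = X s om then \<phi> s y else 0)"
    unfolding f_def using True w by (intro sum.cong refl) (auto simp: occ_def)
   thus "f s om = \<phi> s (X s om)" using fin XE[OF True w] by simp
  qed
  thus ?thesis using expect_law[OF True] True by simp
 qed (simp add: f_def)
 have so: "set_integrable lborel {a..b} (\<lambda>s. \<Sum>y\<in>E. law s y * \<phi> s y)"
  unfolding set_integrable_def using integrable_fst[OF fint] unfolding outer .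
 have "(\<integral>om. (LINT s:{a..b}|lborel. \<phi> s (X s om)) \<partial>P) = (\<integral>om. (\<integral>s. f s om \<partial>lborel) \<partial>P)"
  using inner by (intro Bochner_Integration.integral_cong refl) simp
 also have "\<dots> = (\<integral>s. (\<integral>om. f s om \<partial>P) \<partial>lborel)" by (rule Fubini_integral[OF fint])
 also have "\<dots> = (LINT s:{a..b}|lborel. \<Sum>y\<in>E. law s y * \<phi> s y)" unfolding outer set_lebesgue_integral_def ..
 also have "\<dots> = integral {a..b} (\<lambda>s. \<Sum>y\<in>E. law s y * \<phi> s y)" by (rule set_borel_integral_eq_integral(2)[OF so])
 finally show "(\<integral>om. (LINT s:{a..b}|lborel. \<phi> s (X s om)) \<partial>P) = integral {a..b} (\<lambda>s. \<Sum>y\<in>E. law s y * \<phi> s y)" .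
qed

text \<open>Martingale part in the Doob decomposition of \<open>\<psi> (X (\<tau> k))\<close>: each
  summand is the new value minus its conditional mean given the previous state.\<close>

definition "mart \<psi> \<tau> k om = (\<Sum>j<k. \<psi> (X (\<tau> (Suc j)) om) - (\<Sum>y\<in>E. p (\<tau> j) (\<tau> (Suc j)) (X (\<tau> j) om) y * \<psi> y :: real))"

context
 fixes \<psi> :: "'e => real" and \<tau> :: "nat => real"
 assumes mono: "\<And>j k. j <= k ==> \<tau> j <= \<tau> k" and range: "\<And>k. \<tau> k \<in> {a..b}"
begin

lemma mart_filtration:
 assumes "\<tau> k <= r" "r <= b"
 shows "mart \<psi> \<tau> k \<in> borel_measurable (natural_filtration P E a X r)"
 unfolding mart_def
proof (rule borel_measurable_sum)
 fix j assume "j \<in> {..<k}"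
 hence "\<tau> j <= r" "\<tau> (Suc j) <= r" using mono[of j k] mono[of "Suc j" k] assms(1) by auto
 hence j: "\<tau> j \<in> {a..r}" "\<tau> (Suc j) \<in> {a..r}" using range by auto
 show "(\<lambda>om. \<psi> (X (\<tau> (Suc j)) om) - (\<Sum>y\<in>E. p (\<tau> j) (\<tau> (Suc j)) (X (\<tau> j) om) y * \<psi> y)) \<in> borel_measurable (natural_filtration P E a X r)"
  by (rule borel_measurable_diff[OF fun_X_filtration[OF j(2) assms(2)] fun_X_filtration[OF j(1) assms(2), of "\<lambda>x. \<Sum>y\<in>E. p (\<tau> j) (\<tau> (Suc j)) x y * \<psi> y"]])
qed

lemma bdd_mart: "bdd (mart \<psi> \<tau> k)"
 unfolding mart_def
 by (intro bdd_sum bdd_diff bdd_fun_X[OF range] bdd_fun_X[OF range, of "\<lambda>x. \<Sum>y\<in>E. p _ _ x y * \<psi> y"])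

lemma mart_orth:
 assumes h: "h \<in> borel_measurable (natural_filtration P E a X (\<tau> k))" "bdd h"
 shows "(\<integral>om. h om * (mart \<psi> \<tau> (Suc k) om - mart \<psi> \<tau> k om) \<partial>P) = 0"
proof -
 let ?g = "\<lambda>x. \<Sum>y\<in>E. p (\<tau> k) (\<tau> (Suc k)) x y * \<psi> y"
 have "(\<integral>om. h om * (mart \<psi> \<tau> (Suc k) om - mart \<psi> \<tau> k om) \<partial>P) = (\<integral>om. h om * \<psi> (X (\<tau> (Suc k)) om) - h om * ?g (X (\<tau> k) om) \<partial>P)"
  by (simp add: mart_def right_diff_distrib)
 also have "\<dots> = (\<integral>om. h om * \<psi> (X (\<tau> (Suc k)) om) \<partial>P) - (\<integral>om. h om * ?g (X (\<tau> k) om) \<partial>P)"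
  by (intro Bochner_Integration.integral_diff bdd_integrable bdd_mult h(2) bdd_fun_X[OF range] bdd_fun_X[OF range, of ?g])
 also have "(\<integral>om. h om * \<psi> (X (\<tau> (Suc k)) om) \<partial>P) = (\<integral>om. h om * ?g (X (\<tau> k) om) \<partial>P)"
  using range[of k] range[of "Suc k"] mono[of k "Suc k"] by (intro markov_expect h) auto
 finally show ?thesis by simp
qed

text \<open>The increments of \<open>\<psi> (X (\<tau> k))\<close> and of the martingale differ by a
  function of the present state. It is orthogonal to the martingale increment, so leaving it out can
  only lower the second moment.\<close>

lemma mart_variance:
 "(\<integral>om. (mart \<psi> \<tau> n om)\<^sup>2 \<partial>P) <= (\<Sum>k<n. \<integral>om. (\<psi> (X (\<tau> (Suc k)) om) - \<psi> (X (\<tau> k) om))\<^sup>2 \<partial>P)"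
proof (induction n)
 case 0 thus ?case by (simp add: mart_def)
next
 case (Suc n)
 let ?M = "mart \<psi> \<tau> n"
 define \<Delta> where "\<Delta> = (\<lambda>om. mart \<psi> \<tau> (Suc n) om - mart \<psi> \<tau> n om)"
 define g where "g = (\<lambda>x. (\<Sum>y\<in>E. p (\<tau> n) (\<tau> (Suc n)) x y * \<psi> y) - \<psi> x)"
 have b: "bdd ?M" "bdd \<Delta>" "bdd (\<lambda>om. g (X (\<tau> n) om))"
  unfolding \<Delta>_def by (intro bdd_diff bdd_mart bdd_fun_X[OF range])+
 have o1: "(\<integral>om. ?M om * \<Delta> om \<partial>P) = 0" unfolding \<Delta>_def
  by (rule mart_orth[OF mart_filtration bdd_mart]) (use range[of n] in auto)
 have o2: "(\<integral>om. g (X (\<tau> n) om) * \<Delta> om \<partial>P) = 0" unfolding \<Delta>_def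
  by (rule mart_orth[OF fun_X_filtration b(3)]) (use range[of n] in auto)
 have "(\<integral>om. (mart \<psi> \<tau> (Suc n) om)\<^sup>2 \<partial>P) = (\<integral>om. ((?M om)\<^sup>2 + 2 * (?M om * \<Delta> om)) + (\<Delta> om)\<^sup>2 \<partial>P)"
  by (intro Bochner_Integration.integral_cong refl) (simp add: \<Delta>_def power2_eq_square algebra_simps)
 also have "\<dots> = ((\<integral>om. (?M om)\<^sup>2 \<partial>P) + 2 * (\<integral>om. ?M om * \<Delta> om \<partial>P)) + (\<integral>om. (\<Delta> om)\<^sup>2 \<partial>P)"
 proof -
  have i: "integrable P (\<lambda>om. (?M om)\<^sup>2)" "integrable P (\<lambda>om. 2 * (?M om * \<Delta> om))" "integrable P (\<lambda>om. (\<Delta> om)\<^sup>2)"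
   by (intro bdd_integrable bdd_power2 bdd_mult bdd_const b)+
  show ?thesis using i by (simp add: Bochner_Integration.integral_add Bochner_Integration.integrable_add)
 qed
 finally have 1: "(\<integral>om. (mart \<psi> \<tau> (Suc n) om)\<^sup>2 \<partial>P) = (\<integral>om. (?M om)\<^sup>2 \<partial>P) + (\<integral>om. (\<Delta> om)\<^sup>2 \<partial>P)"
  using o1 by simp
 have D: "\<psi> (X (\<tau> (Suc n)) om) - \<psi> (X (\<tau> n) om) = \<Delta> om + g (X (\<tau> n) om)" for om
  by (simp add: \<Delta>_def g_def mart_def)
 have "(\<integral>om. (\<psi> (X (\<tau> (Suc n)) om) - \<psi> (X (\<tau> n) om))\<^sup>2 \<partial>P) = (\<integral>om. ((\<Delta> om)\<^sup>2 + 2 * (g (X (\<tau> n) om) * \<Delta> om)) + (g (X (\<tau> n) om))\<^sup>2 \<partial>P)"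
  unfolding D by (intro Bochner_Integration.integral_cong refl) (simp add: power2_eq_square algebra_simps)
 also have "\<dots> = ((\<integral>om. (\<Delta> om)\<^sup>2 \<partial>P) + 2 * (\<integral>om. g (X (\<tau> n) om) * \<Delta> om \<partial>P)) + (\<integral>om. (g (X (\<tau> n) om))\<^sup>2 \<partial>P)"
 proof -
  have i: "integrable P (\<lambda>om. (\<Delta> om)\<^sup>2)" "integrable P (\<lambda>om. 2 * (g (X (\<tau> n) om) * \<Delta> om))" "integrable P (\<lambda>om. (g (X (\<tau> n) om))\<^sup>2)"
   by (intro bdd_integrable bdd_power2 bdd_mult bdd_const b)+
  show ?thesis using i by (simp add: Bochner_Integration.integral_add Bochner_Integration.integrable_add)
 qed
 also have "\<dots> \<ge> (\<integral>om. (\<Delta> om)\<^sup>2 \<partial>P)" using o2 by simp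
 finally have 2: "(\<integral>om. (\<Delta> om)\<^sup>2 \<partial>P) <= (\<integral>om. (\<psi> (X (\<tau> (Suc n)) om) - \<psi> (X (\<tau> n) om))\<^sup>2 \<partial>P)" .
 show ?case unfolding 1 sum.lessThan_Suc using 2 Suc by linarith
qed

text \<open>Integrated form of \<open>runmax_pathwise\<close>, whose last sum has mean zero by
  \<open>mart_orth\<close>. The factor \<open>c\<close> will be \<open>1\<close> and
  \<open>-1\<close>, to bound both signs of the martingale.\<close>

lemma runmax_mart_bound:
 fixes c :: real
 defines "R \<equiv> \<lambda>k om. runmax (\<lambda>k. c * mart \<psi> \<tau> k om) k"
 shows "bdd (R n)" and "(\<integral>om. (R n om)\<^sup>2 \<partial>P) <= 4 * c\<^sup>2 * (\<integral>om. (mart \<psi> \<tau> n om)\<^sup>2 \<partial>P)"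
proof -
 have bR: "bdd (R k)" for k
  unfolding R_def by (induction k) (auto intro!: bdd_max bdd_mult bdd_const bdd_mart)
 thus "bdd (R n)" .
 have RF: "R k \<in> borel_measurable (natural_filtration P E a X r)" if "\<tau> k <= r" "r <= b" for k r
  using that unfolding R_def
 proof (induction k)
  case (Suc k)
  have "\<tau> k <= r" using Suc.prems mono[of k "Suc k"] by auto
  thus ?case unfolding runmax.simps using Suc
   by (intro borel_measurable_max borel_measurable_times borel_measurable_const mart_filtration) auto
 qed simp
 have o: "(\<integral>om. R k om * (mart \<psi> \<tau> (Suc k) om - mart \<psi> \<tau> k om) \<partial>P) = 0" for k
  by (rule mart_orth[OF RF bR]) (use range[of k] in auto)
 let ?T = "\<lambda>om. \<Sum>k<n. c * (R k om * (mart \<psi> \<tau> (Suc k) om - mart \<psi> \<tau> k om))"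
 have bT: "bdd (\<lambda>om. c * (R k om * (mart \<psi> \<tau> (Suc k) om - mart \<psi> \<tau> k om)))" for k
  by (intro bdd_mult bdd_const bR bdd_diff bdd_mart)
 have T0: "(\<integral>om. ?T om \<partial>P) = 0"
  by (subst Bochner_Integration.integral_sum[OF bdd_integrable[OF bT]]) (simp add: o)
 have "(\<integral>om. (R n om)\<^sup>2 \<partial>P) <= (\<integral>om. 4 * c\<^sup>2 * (mart \<psi> \<tau> n om)\<^sup>2 - 4 * ?T om \<partial>P)"
 proof (rule integral_mono)
  show "integrable P (\<lambda>om. (R n om)\<^sup>2)" by (intro bdd_integrable bdd_power2 bR)
  show "integrable P (\<lambda>om. 4 * c\<^sup>2 * (mart \<psi> \<tau> n om)\<^sup>2 - 4 * ?T om)"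
   by (intro bdd_integrable bdd_diff bdd_mult bdd_const bdd_power2 bdd_mart bdd_sum bT)
  fix om
  have "(R n om)\<^sup>2 <= 4 * (c * mart \<psi> \<tau> n om)\<^sup>2 - 4 * (\<Sum>k<n. R k om * (c * mart \<psi> \<tau> (Suc k) om - c * mart \<psi> \<tau> k om))"
   unfolding R_def by (rule runmax_pathwise) (simp add: mart_def)
  also have "(\<Sum>k<n. R k om * (c * mart \<psi> \<tau> (Suc k) om - c * mart \<psi> \<tau> k om)) = ?T om"
   by (intro sum.cong refl) (simp add: algebra_simps)
  finally show "(R n om)\<^sup>2 <= 4 * c\<^sup>2 * (mart \<psi> \<tau> n om)\<^sup>2 - 4 * ?T om" by (simp add: power_mult_distrib)
 qed
 also have "\<dots> = (\<integral>om. 4 * c\<^sup>2 * (mart \<psi> \<tau> n om)\<^sup>2 \<partial>P) - (\<integral>om. 4 * ?T om \<partial>P)"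
  by (intro Bochner_Integration.integral_diff bdd_integrable bdd_mult bdd_const bdd_power2 bdd_mart bdd_sum bT)
 also have "\<dots> = 4 * c\<^sup>2 * (\<integral>om. (mart \<psi> \<tau> n om)\<^sup>2 \<partial>P)"
  unfolding Bochner_Integration.integral_mult_right_zero T0 by simp
 finally show "(\<integral>om. (R n om)\<^sup>2 \<partial>P) <= 4 * c\<^sup>2 * (\<integral>om. (mart \<psi> \<tau> n om)\<^sup>2 \<partial>P)" .
qed

text \<open>\<open>16\<close>: each sign contributes 4 by Doob's inequality, and
  \<open>(x + y)^2 <= 2 * x^2 + 2 * y^2\<close> doubles their sum.\<close>

lemma mart_maximal:
 "\<exists>R. bdd R \<and> (\<forall>om. 0 <= R om) \<and> (\<forall>om. \<forall>k\<le>n. \<bar>mart \<psi> \<tau> k om\<bar> <= R om) \<and>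
   (\<integral>om. (R om)\<^sup>2 \<partial>P) <= 16 * (\<Sum>k<n. \<integral>om. (\<psi> (X (\<tau> (Suc k)) om) - \<psi> (X (\<tau> k) om))\<^sup>2 \<partial>P)"
proof -
 define R where "R c om = runmax (\<lambda>k. c * mart \<psi> \<tau> k om) n" for c om
 have b: "bdd (R c)" and e: "(\<integral>om. (R c om)\<^sup>2 \<partial>P) <= 4 * c\<^sup>2 * (\<integral>om. (mart \<psi> \<tau> n om)\<^sup>2 \<partial>P)" for c
  unfolding R_def by (rule runmax_mart_bound)+
 have n: "0 <= R c om" for c om unfolding R_def by (rule runmax_nonneg)
 have ge: "c * mart \<psi> \<tau> k om <= R c om" if "k <= n" for c k om
  unfolding R_def by (rule runmax_ge[OF _ that]) (simp add: mart_def)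
 have "\<bar>mart \<psi> \<tau> k om\<bar> <= R 1 om + R (-1) om" if "k <= n" for k om
  using ge[OF that, of 1 om] ge[OF that, of "-1" om] n[of 1 om] n[of "-1" om] by linarith
 moreover have "(\<integral>om. (R 1 om + R (-1) om)\<^sup>2 \<partial>P) <= (\<integral>om. 2 * (R 1 om)\<^sup>2 + 2 * (R (-1) om)\<^sup>2 \<partial>P)"
 proof (rule integral_mono)
  fix om
  have "0 <= (R 1 om - R (-1) om)\<^sup>2" by simp
  thus "(R 1 om + R (-1) om)\<^sup>2 <= 2 * (R 1 om)\<^sup>2 + 2 * (R (-1) om)\<^sup>2"
   by (simp add: power2_eq_square algebra_simps)
 qed (intro bdd_integrable bdd_power2 bdd_add bdd_mult bdd_const b)+
 moreover have "(\<integral>om. 2 * (R 1 om)\<^sup>2 + 2 * (R (-1) om)\<^sup>2 \<partial>P) = 2 * (\<integral>om. (R 1 om)\<^sup>2 \<partial>P) + 2 * (\<integral>om. (R (-1) om)\<^sup>2 \<partial>P)"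
 proof -
  have "integrable P (\<lambda>om. 2 * (R c om)\<^sup>2)" for c by (intro bdd_integrable bdd_power2 bdd_mult bdd_const b)
  thus ?thesis by (simp add: Bochner_Integration.integral_add)
 qed
 moreover have "bdd (\<lambda>om. R 1 om + R (-1) om)" by (intro bdd_add b)
 moreover have "0 <= R 1 om + R (-1) om" for om using n[of 1 om] n[of "-1" om] by linarith
 ultimately show ?thesis
  using e[of 1] e[of "-1"] mart_variance[of n] by (intro exI[of _ "\<lambda>om. R 1 om + R (-1) om"]) auto
qed

end

end

section \<open>The pointwise minimization\<close>

text \<open>Assumption B with its existential constants and the gradient given names; the Lipschitz
  constants are taken nonnegative so that they can be factors in monotone estimates.\<close>

locale cost_data =
 fixes T M :: real and f :: "('d::finite) running_cost" and g :: "'d terminal_cost"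
  and CF CG LD \<kappa> :: real and Df :: "'d => real => real^'d => real^'d => real^'d"
 assumes T0: "0 < T" and M0: "0 < M" and CF0: "0 <= CF" and CG0: "0 <= CG" and LD0: "0 <= LD" and \<kappa>0: "0 < \<kappa>"
  and f_irrelevant: "\<And>i t m a b. [|t \<in> {0..T}; m \<in> prob_simplex; a \<in> action_set M; b \<in> action_set M;
    \<And>j. j ~= i ==> a $ j = b $ j|] ==> f i t a m = f i t b m"
  and F_continuous: "continuous_on ({0..T} \<times> action_matrices M \<times> prob_simplex) (\<lambda>(t, a, m). total_running f t a m)"
  and F_lip: "\<And>t s a m p. [|t \<in> {0..T}; s \<in> {0..T}; a \<in> action_matrices M; m \<in> prob_simplex; p \<in> prob_simplex|]
    ==> \<bar>total_running f t a m - total_running f s a p\<bar> <= CF * (\<bar>t - s\<bar> + norm (m - p))"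
  and G_lip: "\<And>m p. [|m \<in> prob_simplex; p \<in> prob_simplex|] ==> \<bar>total_terminal g m - total_terminal g p\<bar> <= CG * norm (m - p)"
  and f_deriv: "\<And>i t m a. [|t \<in> {0..T}; m \<in> prob_simplex; a \<in> action_set M|]
    ==> ((\<lambda>b. f i t b m) has_derivative (\<lambda>h. Df i t a m \<bullet> h)) (at a within action_set M)"
  and Df_lip: "\<And>i t m p a. [|t \<in> {0..T}; m \<in> prob_simplex; p \<in> prob_simplex; a \<in> action_set M|]
    ==> norm (Df i t a m - Df i t a p) <= LD * norm (m - p)"
  and f_convex: "\<And>i t m a b. [|t \<in> {0..T}; m \<in> prob_simplex; a \<in> action_set M; b \<in> action_set M|]
    ==> f i t b m \<ge> f i t a m + Df i t a m \<bullet> (b - a) + \<kappa> * (\<Sum>j\<in>UNIV - {i}. (b $ j - a $ j)\<^sup>2)"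

lemma assumption_B_cost_data:
 fixes f :: "('d::finite) running_cost" and g :: "'d terminal_cost"
 assumes "0 < T" "0 < M" "assumption_B T M f g"
 obtains CF CG LD \<kappa> Df where "cost_data T M f g CF CG LD \<kappa> Df"
proof -
 note B = assms(3)[unfolded assumption_B_def]
 note B1 = B[THEN conjunct1] and B2 = B[THEN conjunct2, THEN conjunct1] and B3 = B[THEN conjunct2, THEN conjunct2, THEN conjunct1]
  and B4 = B[THEN conjunct2, THEN conjunct2, THEN conjunct2, THEN conjunct1]
 obtain Df where D: "(\<forall>i. \<forall>t\<in>{0..T}. \<forall>m\<in>prob_simplex.
      (\<forall>a\<in>action_set M. ((\<lambda>b. f i t b m) has_derivative (\<lambda>h. Df i t a m \<bullet> h)) (at a within action_set M)) \<and>
      continuous_on (action_set M) (\<lambda>a. Df i t a m)) \<and> (\<exists>L. \<forall>i. \<forall>t\<in>{0..T}. \<forall>a\<in>action_set M. \<forall>m\<in>prob_simplex. \<forall>p\<in>prob_simplex.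
      norm (Df i t a m - Df i t a p) <= L * norm (m - p)) \<and> (\<exists>\<kappa>>0. \<forall>i. \<forall>t\<in>{0..T}. \<forall>m\<in>prob_simplex. \<forall>a\<in>action_set M. \<forall>b\<in>action_set M.
      f i t b m \<ge> f i t a m + Df i t a m \<bullet> (b - a) + \<kappa> * (\<Sum>j\<in>UNIV - {i}. (b $ j - a $ j)\<^sup>2))"
  using B[THEN conjunct2, THEN conjunct2, THEN conjunct2, THEN conjunct2] by (rule exE)
 note B5 = D[THEN conjunct1] and B6 = D[THEN conjunct2, THEN conjunct1] and B7 = D[THEN conjunct2, THEN conjunct2]
 obtain CF where CF: "\<forall>t\<in>{0..T}. \<forall>s\<in>{0..T}. \<forall>a\<in>action_matrices M. \<forall>m\<in>prob_simplex. \<forall>p\<in>prob_simplex.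
    \<bar>total_running f t a m - total_running f s a p\<bar> <= CF * (\<bar>t - s\<bar> + norm (m - p))" using B3 ..
 obtain CG where CG: "\<forall>m\<in>prob_simplex. \<forall>p\<in>prob_simplex. \<bar>total_terminal g m - total_terminal g p\<bar> <= CG * norm (m - p)" using B4 ..
 obtain LD where LD: "\<forall>i. \<forall>t\<in>{0..T}. \<forall>a\<in>action_set M. \<forall>m\<in>prob_simplex. \<forall>p\<in>prob_simplex.
      norm (Df i t a m - Df i t a p) <= LD * norm (m - p)" using B6 ..
 obtain \<kappa> where k: "0 < \<kappa>" "\<forall>i. \<forall>t\<in>{0..T}. \<forall>m\<in>prob_simplex. \<forall>a\<in>action_set M. \<forall>b\<in>action_set M.
      f i t b m \<ge> f i t a m + Df i t a m \<bullet> (b - a) + \<kappa> * (\<Sum>j\<in>UNIV - {i}. (b $ j - a $ j)\<^sup>2)" using B7 by blast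
 have mx: "x <= c * y ==> 0 <= y ==> x <= max c 0 * y" for x c y :: real
  by (erule order_trans) (intro mult_right_mono, auto)
 have "cost_data T M f g (max CF 0) (max CG 0) (max LD 0) \<kappa> Df"
 proof unfold_locales
  fix t s and a :: "real^'d^'d" and m p :: "real^'d" assume "t \<in> {0..T}" "s \<in> {0..T}" "a \<in> action_matrices M" "m \<in> prob_simplex" "p \<in> prob_simplex"
  thus "\<bar>total_running f t a m - total_running f s a p\<bar> <= max CF 0 * (\<bar>t - s\<bar> + norm (m - p))"
   using CF by (intro mx) auto
 next
  fix m p :: "real^'d" assume "m \<in> prob_simplex" "p \<in> prob_simplex"
  thus "\<bar>total_terminal g m - total_terminal g p\<bar> <= max CG 0 * norm (m - p)" using CG by (intro mx) auto
 next
  fix i t and m p a :: "real^'d" assume "t \<in> {0..T}" "m \<in> prob_simplex" "p \<in> prob_simplex" "a \<in> action_set M"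
  thus "norm (Df i t a m - Df i t a p) <= max LD 0 * norm (m - p)" using LD by (intro mx) auto
 next
  fix i t and m a b :: "real^'d" assume "t \<in> {0..T}" "m \<in> prob_simplex" "a \<in> action_set M" "b \<in> action_set M" "\<And>j. j ~= i ==> a $ j = b $ j"
  thus "f i t a m = f i t b m" using B1 by blast
 next
  fix i t and m a :: "real^'d" assume "t \<in> {0..T}" "m \<in> prob_simplex" "a \<in> action_set M"
  thus "((\<lambda>b. f i t b m) has_derivative (\<lambda>h. Df i t a m \<bullet> h)) (at a within action_set M)" using B5 by blast
 next
  fix i t and m a b :: "real^'d" assume "t \<in> {0..T}" "m \<in> prob_simplex" "a \<in> action_set M" "b \<in> action_set M"
  thus "f i t b m \<ge> f i t a m + Df i t a m \<bullet> (b - a) + \<kappa> * (\<Sum>j\<in>UNIV - {i}. (b $ j - a $ j)\<^sup>2)" using k(2) by blast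
 qed (use assms(1,2) k(1) B2 in auto)
 thus ?thesis by (rule that)
qed

lemma action_set_cbox: "action_set M = cbox 0 (\<chi> i. M)"
 by (auto simp: action_set_def mem_box_cart)

lemma compact_action_set: "compact (action_set M)" and convex_action_set: "convex (action_set M)"
 by (simp_all add: action_set_cbox)

lemma compact_action_matrices: "compact (action_matrices M :: (real^'d::finite^'d) set)"
proof -
 have "closed (action_matrices M :: (real^'d^'d) set)"
 proof -
  have "action_matrices M = (\<Inter>i. \<Inter>j. {a :: real^'d^'d. 0 <= a $ i $ j} \<inter> {a. a $ i $ j <= M})"
   by (auto simp: action_matrices_def action_set_def)
  moreover have "closed ({a :: real^'d^'d. 0 <= a $ i $ j} \<inter> {a. a $ i $ j <= M})" for i j
   by (intro closed_Int closed_Collect_le continuous_intros)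
  ultimately show ?thesis by (simp only:) (intro closed_INT ballI)
 qed
 moreover have "bounded (action_matrices M :: (real^'d^'d) set)"
 proof (rule boundedI)
  fix a :: "real^'d^'d" assume a: "a \<in> action_matrices M"
  have "norm a <= (\<Sum>i\<in>UNIV. norm (a $ i))" by (rule norm_le_componentwise_cart[THEN order_trans, rotated]) (rule L2_set_le_sum[of UNIV "\<lambda>i. norm (a $ i)", folded norm_vec_def], auto)
  also have "\<dots> <= (\<Sum>i\<in>(UNIV::'d set). \<Sum>j\<in>(UNIV::'d set). M)"
  proof (rule sum_mono)
   fix i
   have "norm (a $ i) <= (\<Sum>j\<in>UNIV. \<bar>a $ i $ j\<bar>)" by (rule norm_le_l1_cart)
   also have "\<dots> <= (\<Sum>j\<in>(UNIV::'d set). M)" using a by (intro sum_mono) (auto simp: action_matrices_def action_set_def)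
   finally show "norm (a $ i) <= (\<Sum>j\<in>(UNIV::'d set). M)" .
  qed
  finally show "norm a <= (\<Sum>i\<in>(UNIV::'d set). \<Sum>j\<in>(UNIV::'d set). M)" .
 qed
 ultimately show ?thesis by (simp add: compact_eq_bounded_closed)
qed

lemma simplex_coord: "m \<in> prob_simplex ==> 0 <= m $ i" "m \<in> prob_simplex ==> m $ i <= 1"
proof -
 assume m: "m \<in> prob_simplex"
 thus "0 <= m $ i" by (simp add: prob_simplex_def)
 have "m $ i <= (\<Sum>i\<in>UNIV. m $ i)" using m by (intro member_le_sum) (auto simp: prob_simplex_def)
 thus "m $ i <= 1" using m by (simp add: prob_simplex_def)
qed

lemma compact_simplex: "compact (prob_simplex :: (real^'d::finite) set)"
proof -
 have "prob_simplex = (\<Inter>i. {m :: real^'d. 0 <= m $ i}) \<inter> {m. (\<Sum>i\<in>UNIV. m $ i) = 1}"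
  by (auto simp: prob_simplex_def)
 also have "closed \<dots>"
  by (intro closed_Int closed_INT ballI closed_Collect_le closed_Collect_eq continuous_intros)
 finally have "closed (prob_simplex :: (real^'d) set)" .
 moreover have "bounded (prob_simplex :: (real^'d) set)"
 proof (rule boundedI)
  fix m :: "real^'d" assume m: "m \<in> prob_simplex"
  have "norm m <= (\<Sum>i\<in>UNIV. \<bar>m $ i\<bar>)" by (rule norm_le_l1_cart)
  also have "\<dots> = 1" using m simplex_coord[OF m] by (simp add: prob_simplex_def)
  finally show "norm m <= 1" .
 qed
 ultimately show ?thesis by (simp add: compact_eq_bounded_closed)
qed

context cost_data begin

abbreviation "F \<equiv> total_running f"
abbreviation "G \<equiv> total_terminal g"

lemma F_bounded: obtains B where "0 <= B" "\<And>t a m. [|t \<in> {0..T}; a \<in> action_matrices M; m \<in> prob_simplex|] ==> \<bar>F t a m\<bar> <= B"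
proof -
 have "compact ((\<lambda>(t, a, m). F t a m) ` ({0..T} \<times> action_matrices M \<times> prob_simplex))"
  by (intro compact_continuous_image F_continuous compact_Times compact_action_matrices compact_simplex compact_Icc)
 hence "bounded ((\<lambda>(t, a, m). F t a m) ` ({0..T} \<times> action_matrices M \<times> prob_simplex))" by (rule compact_imp_bounded)
 then obtain B where B: "\<forall>x\<in>(\<lambda>(t, a, m). F t a m) ` ({0..T} \<times> action_matrices M \<times> prob_simplex). norm x <= B"
  unfolding bounded_iff by blast
 have "\<bar>F t a m\<bar> <= max B 0" if "t \<in> {0..T}" "a \<in> action_matrices M" "m \<in> prob_simplex" for t a m
 proof -
  have "F t a m \<in> (\<lambda>(t, a, m). F t a m) ` ({0..T} \<times> action_matrices M \<times> prob_simplex)"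
   using that by (intro image_eqI[of _ _ "(t, a, m)"]) auto
  hence "norm (F t a m) <= B" by (rule bspec[OF B])
  thus ?thesis by simp
 qed
 thus ?thesis using that[of "max B 0"] by simp
qed

text \<open>Minus the function maximized in \<open>opt_action\<close>, so that optimal actions are
  minimizers.\<close>

definition "hc i t m z a = f i t a m + (\<Sum>j\<in>UNIV - {i}. a $ j * z $ j)"

text \<open>The convexity inequality is applied at the midpoint \<open>c\<close>, towards both
  \<open>a\<close> and \<open>b\<close>: the gradient terms cancel, and minimality of
  \<open>a\<close> is used only against \<open>c\<close>. This avoids first order conditions at the
  boundary of the action set and gives the factor \<open>\<kappa> / 2\<close>.\<close>

lemma hc_gap:
 assumes t: "t \<in> {0..T}" and m: "m \<in> prob_simplex" and a: "a \<in> action_set M" and b: "b \<in> action_set M"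
  and min: "\<And>c. c \<in> action_set M ==> hc i t m z a <= hc i t m z c"
 shows "hc i t m z b \<ge> hc i t m z a + \<kappa> / 2 * (\<Sum>j\<in>UNIV - {i}. (b $ j - a $ j)\<^sup>2)"
proof -
 define c where "c = (1/2) *\<^sub>R a + (1/2) *\<^sub>R b"
 have c: "c \<in> action_set M" unfolding c_def by (rule convexD[OF convex_action_set a b]) auto
 have ac: "a - c = (1/2) *\<^sub>R (a - b)" and bc: "b - c = - ((1/2) *\<^sub>R (a - b))"
  unfolding c_def by (simp_all add: vec_eq_iff algebra_simps)
 have q: "(\<Sum>j\<in>UNIV - {i}. (a $ j - c $ j)\<^sup>2) = (\<Sum>j\<in>UNIV - {i}. (b $ j - a $ j)\<^sup>2) / 4"
  "(\<Sum>j\<in>UNIV - {i}. (b $ j - c $ j)\<^sup>2) = (\<Sum>j\<in>UNIV - {i}. (b $ j - a $ j)\<^sup>2) / 4"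
  unfolding sum_divide_distrib c_def by (auto intro!: sum.cong simp: power2_eq_square field_simps)
 have "f i t a m + f i t b m \<ge> 2 * f i t c m + (Df i t c m \<bullet> (a - c) + Df i t c m \<bullet> (b - c)) + \<kappa> / 2 * (\<Sum>j\<in>UNIV - {i}. (b $ j - a $ j)\<^sup>2)"
  using f_convex[OF t m c a, of i] f_convex[OF t m c b, of i] unfolding q by linarith
 moreover have "Df i t c m \<bullet> (a - c) + Df i t c m \<bullet> (b - c) = 0" unfolding ac bc by (simp add: inner_simps)
 moreover have "(\<Sum>j\<in>UNIV - {i}. a $ j * z $ j) + (\<Sum>j\<in>UNIV - {i}. b $ j * z $ j) = 2 * (\<Sum>j\<in>UNIV - {i}. c $ j * z $ j)"
  unfolding sum.distrib[symmetric] sum_distrib_left c_def by (intro sum.cong refl) (simp add: algebra_simps)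
 moreover have "fa + fb \<ge> 2 * fc + d + k ==> d = 0 ==> sa + sb = 2 * sc ==> (fa + sa) + (fb + sb) \<ge> 2 * (fc + sc) + k"
  for fa fb fc d k sa sb sc :: real by argo
 ultimately have "hc i t m z a + hc i t m z b \<ge> 2 * hc i t m z c + \<kappa> / 2 * (\<Sum>j\<in>UNIV - {i}. (b $ j - a $ j)\<^sup>2)"
  unfolding hc_def by blast
 with min[OF c] show ?thesis by linarith
qed

lemma f_continuous: "[|t \<in> {0..T}; m \<in> prob_simplex|] ==> continuous_on (action_set M) (\<lambda>a. f i t a m)"
 by (rule has_derivative_continuous_on) (rule f_deriv)

lemma zero_action: "0 \<in> action_set M" using M0 by (simp add: action_set_def)

lemma hc_minimizer:
 assumes t: "t \<in> {0..T}" and m: "m \<in> prob_simplex"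
 shows "\<exists>!a. a \<in> action_set M \<and> a $ i = 0 \<and> (\<forall>b\<in>action_set M. hc i t m z a <= hc i t m z b)"
proof -
 have "continuous_on (action_set M) (hc i t m z)"
  unfolding hc_def by (intro continuous_intros f_continuous t m)
 then obtain a where a: "a \<in> action_set M" "\<forall>b\<in>action_set M. hc i t m z a <= hc i t m z b"
  using continuous_attains_inf[OF compact_action_set, of M "hc i t m z"] zero_action by blast
 \<comment> \<open>Any minimizer may be normalized, since the \<open>i\<close>-th coordinate
   influences neither \<open>f i\<close> nor the sum.\<close>
 define a' where "a' = (\<chi> j. if j = i then 0 else a $ j)"
 have a': "a' \<in> action_set M" "a' $ i = 0" using a(1) M0 by (auto simp: a'_def action_set_def)
 have "f i t a' m = f i t a m" by (rule f_irrelevant[OF t m a'(1) a(1)]) (simp add: a'_def)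
 moreover have "(\<Sum>j\<in>UNIV - {i}. a' $ j * z $ j) = (\<Sum>j\<in>UNIV - {i}. a $ j * z $ j)" by (intro sum.cong refl) (simp add: a'_def)
 ultimately have eq: "hc i t m z a' = hc i t m z a" by (simp add: hc_def)
 show ?thesis
 proof (rule ex1I[of _ a'])
  show "a' \<in> action_set M \<and> a' $ i = 0 \<and> (\<forall>b\<in>action_set M. hc i t m z a' <= hc i t m z b)" using a' a eq by simp
  fix b assume b: "b \<in> action_set M \<and> b $ i = 0 \<and> (\<forall>c\<in>action_set M. hc i t m z b <= hc i t m z c)"
  have "hc i t m z b \<ge> hc i t m z a' + \<kappa> / 2 * (\<Sum>j\<in>UNIV - {i}. (b $ j - a' $ j)\<^sup>2)"
   using a a' b eq by (intro hc_gap t m) auto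
  moreover have "hc i t m z b <= hc i t m z a'" using b a' by blast
  ultimately have "\<kappa> / 2 * (\<Sum>j\<in>UNIV - {i}. (b $ j - a' $ j)\<^sup>2) <= 0" by linarith
  hence "(\<Sum>j\<in>UNIV - {i}. (b $ j - a' $ j)\<^sup>2) <= 0" using \<kappa>0 by (simp add: mult_le_0_iff)
  moreover have "0 <= (\<Sum>j\<in>UNIV - {i}. (b $ j - a' $ j)\<^sup>2)" by (simp add: sum_nonneg)
  ultimately have "(\<Sum>j\<in>UNIV - {i}. (b $ j - a' $ j)\<^sup>2) = 0" by linarith
  hence "\<forall>j\<in>UNIV - {i}. (b $ j - a' $ j)\<^sup>2 = 0" by (subst (asm) sum_nonneg_eq_0_iff) auto
  thus "b = a'" using b a' by (auto simp: vec_eq_iff)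
 qed
qed

abbreviation "opt \<equiv> opt_action M f"

lemma opt_props:
 assumes t: "t \<in> {0..T}" and m: "m \<in> prob_simplex"
 shows "opt t i m z \<in> action_set M" "opt t i m z $ i = 0" "\<And>b. b \<in> action_set M ==> hc i t m z (opt t i m z) <= hc i t m z b"
proof -
 have "(- (\<Sum>j\<in>UNIV - {i}. b $ j * z $ j) - f i t b m <= - (\<Sum>j\<in>UNIV - {i}. a $ j * z $ j) - f i t a m) = (hc i t m z a <= hc i t m z b)" for a b
  unfolding hc_def by linarith
 hence "opt t i m z = (THE a. a \<in> action_set M \<and> a $ i = 0 \<and> (\<forall>b\<in>action_set M. hc i t m z a <= hc i t m z b))"
  unfolding opt_action_def by simp
 hence "opt t i m z \<in> action_set M \<and> opt t i m z $ i = 0 \<and> (\<forall>b\<in>action_set M. hc i t m z (opt t i m z) <= hc i t m z b)"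
  using theI'[OF hc_minimizer[OF t m, of i z]] by simp
 thus "opt t i m z \<in> action_set M" "opt t i m z $ i = 0" "\<And>b. b \<in> action_set M ==> hc i t m z (opt t i m z) <= hc i t m z b" by auto
qed

lemma offdiag_inner: "a $ i = b $ i ==> (\<Sum>j\<in>UNIV - {i}. (a $ j - b $ j) * z $ j) = (a - b) \<bullet> (z :: real^'d)"
 unfolding inner_vec_def by (subst sum.remove[of UNIV i]) auto

lemma offdiag_norm: "a $ i = b $ i ==> (\<Sum>j\<in>UNIV - {i}. (a $ j - b $ j)\<^sup>2) = (norm (a - b :: real^'d))\<^sup>2"
 unfolding power2_norm_eq_inner using offdiag_inner[of a i b "a - b"] by (simp add: power2_eq_square)

text \<open>Adds \<open>hc_gap\<close> for both minimizers, each tested against the other. The mixed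
  difference of \<open>f\<close> is left as it stands: it is estimated through \<open>Df_lip\<close>
  when \<open>m\<close> varies and through the Lipschitz bound on \<open>F\<close> when the time
  varies.\<close>

lemma opt_compare:
 fixes i :: 'd and z y :: "real^'d"
 assumes t: "t \<in> {0..T}" and s: "s \<in> {0..T}" and m: "m \<in> prob_simplex" and p: "p \<in> prob_simplex"
 defines "a \<equiv> opt t i m z" and "b \<equiv> opt s i p y"
 shows "\<kappa> * (norm (a - b))\<^sup>2 <= norm (z - y) * norm (a - b) + ((f i t b m - f i s b p) - (f i t a m - f i s a p))"
proof -
 note A = opt_props[where i = i and z = z, OF t m, folded a_def] and B = opt_props[where i = i and z = y, OF s p, folded b_def]
 have ii: "a $ i = b $ i" "b $ i = a $ i" using A B by auto
 have 1: "hc i t m z b \<ge> hc i t m z a + \<kappa> / 2 * (norm (a - b))\<^sup>2"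
  using hc_gap[OF t m A(1) B(1) A(3)] unfolding offdiag_norm[OF ii(2)] by (simp add: norm_minus_commute)
 have 2: "hc i s p y a \<ge> hc i s p y b + \<kappa> / 2 * (norm (a - b))\<^sup>2"
  using hc_gap[OF s p B(1) A(1) B(3)] unfolding offdiag_norm[OF ii(1)] .
 have z: "(\<Sum>j\<in>UNIV - {i}. b $ j * w $ j) - (\<Sum>j\<in>UNIV - {i}. a $ j * w $ j) = (b - a) \<bullet> w" for w
  unfolding sum_subtractf[symmetric] offdiag_inner[OF ii(2), symmetric] by (intro sum.cong refl) (simp add: algebra_simps)
 have "\<kappa> * (norm (a - b))\<^sup>2 <= (b - a) \<bullet> z - (b - a) \<bullet> y + ((f i t b m - f i s b p) - (f i t a m - f i s a p))"
  using 1 2 z[of z] z[of y] unfolding hc_def by linarith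
 also have "(b - a) \<bullet> z - (b - a) \<bullet> y = (b - a) \<bullet> (z - y)" by (simp add: inner_diff_right)
 also have "(b - a) \<bullet> (z - y) <= norm (z - y) * norm (a - b)"
  using norm_cauchy_schwarz[of "b - a" "z - y"] by (simp add: mult.commute norm_minus_commute)
 finally show ?thesis by simp
qed

text \<open>In \<open>opt_compare\<close> at equal times the mixed difference is at most
  \<open>LD * norm (m - p) * norm (a - b)\<close> by the mean value inequality, and one factor
  \<open>norm (a - b)\<close> cancels.\<close>

lemma opt_lipschitz:
 assumes t: "t \<in> {0..T}" and m: "m \<in> prob_simplex" and p: "p \<in> prob_simplex"
 shows "norm (opt t i m z - opt t i p y) <= (norm (z - y) + LD * norm (m - p)) / \<kappa>"
proof -
 define a b where "a = opt t i m z" and "b = opt t i p y"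
 have ab: "a \<in> action_set M" "b \<in> action_set M" using opt_props(1)[OF t m] opt_props(1)[OF t p] by (auto simp: a_def b_def)
 have "norm ((f i t b m - f i t b p) - (f i t a m - f i t a p)) <= (LD * norm (m - p)) * norm (b - a)"
 proof (rule differentiable_bound[OF convex_action_set, of M "\<lambda>c. f i t c m - f i t c p" "\<lambda>c h. Df i t c m \<bullet> h - Df i t c p \<bullet> h"])
  fix c :: "real^'d" assume c: "c \<in> action_set M"
  show "((\<lambda>c. f i t c m - f i t c p) has_derivative (\<lambda>h. Df i t c m \<bullet> h - Df i t c p \<bullet> h)) (at c within action_set M)"
   by (intro has_derivative_diff f_deriv t m p c)
  show "onorm (\<lambda>h. Df i t c m \<bullet> h - Df i t c p \<bullet> h) <= LD * norm (m - p)"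
  proof (rule onorm_bound)
   show "0 <= LD * norm (m - p)" using LD0 by simp
   fix h
   have "norm (Df i t c m \<bullet> h - Df i t c p \<bullet> h) <= norm (Df i t c m - Df i t c p) * norm h"
    using Cauchy_Schwarz_ineq2[of "Df i t c m - Df i t c p" h] by (simp add: inner_diff_left)
   also have "\<dots> <= (LD * norm (m - p)) * norm h" by (intro mult_right_mono Df_lip t m p c) auto
   finally show "norm (Df i t c m \<bullet> h - Df i t c p \<bullet> h) <= (LD * norm (m - p)) * norm h" .
  qed
 qed (use ab in auto)
 hence "(f i t b m - f i t b p) - (f i t a m - f i t a p) <= (LD * norm (m - p)) * norm (a - b)"
  unfolding real_norm_def norm_minus_commute[of b a] by linarith
 with opt_compare[OF t t m p, of i z y, folded a_def b_def]
 have "(\<kappa> * norm (a - b)) * norm (a - b) <= (norm (z - y) + LD * norm (m - p)) * norm (a - b)"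
  by (simp add: power2_eq_square algebra_simps)
 hence "\<kappa> * norm (a - b) <= norm (z - y) + LD * norm (m - p)"
 proof (cases "norm (a - b) = 0")
  case True
  thus ?thesis using LD0 by (simp add: add_nonneg_nonneg)
 next
  case False
  hence "0 < norm (a - b)" by simp
  thus ?thesis using \<open>(\<kappa> * norm (a - b)) * norm (a - b) <= _\<close> by (rule mult_right_le_imp_le[rotated])
 qed
 thus ?thesis using \<kappa>0 unfolding a_def b_def by (simp add: pos_le_divide_eq mult.commute)
qed

definition "row_matrix i a = (\<chi> k. if k = i then a else (0 :: real^'d))"

text \<open>Only the weighted sum \<open>F\<close> is assumed Lipschitz in time, not
  \<open>f i\<close> itself. Two action matrices that differ only in row \<open>i\<close> have the
  same other summands, which cancel in the mixed difference; what remains is \<open>m $ i\<close>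
  times the wanted quantity, hence the division.\<close>

lemma f_time_difference:
 assumes t: "t \<in> {0..T}" and s: "s \<in> {0..T}" and m: "m \<in> prob_simplex" and mi: "0 < m $ i"
  and a: "a \<in> action_set M" and b: "b \<in> action_set M"
 shows "(f i t b m - f i s b m) - (f i t a m - f i s a m) <= 2 * CF * \<bar>t - s\<bar> / m $ i"
proof -
 have R: "F u (row_matrix i c) m = m $ i * f i u c m + (\<Sum>k\<in>UNIV - {i}. m $ k * f k u 0 m)" for u c
  unfolding total_running_def by (subst sum.remove[of UNIV i]) (auto simp: row_matrix_def intro!: sum.cong)
 have am: "row_matrix i c \<in> action_matrices M" if "c \<in> action_set M" for c
  using that zero_action by (auto simp: row_matrix_def action_matrices_def)
 have d: "\<bar>F t (row_matrix i c) m - F s (row_matrix i c) m\<bar> <= CF * \<bar>t - s\<bar>" if "c \<in> action_set M" for c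
  using F_lip[OF t s am[OF that] m m] by simp
 have "m $ i * ((f i t b m - f i s b m) - (f i t a m - f i s a m)) <= 2 * CF * \<bar>t - s\<bar>"
  using d[OF a] d[OF b] unfolding R right_diff_distrib by linarith
 thus ?thesis using mi by (simp add: pos_le_divide_eq mult.commute)
qed

text \<open>Serves the measurability of feedbacks in time. \<open>opt_compare\<close> bounds the
  squared distance by a quantity that vanishes as \<open>t\<close> tends to
  \<open>s\<close>.\<close>

lemma opt_continuous_in_time:
 assumes m: "m \<in> prob_simplex" and mi: "0 < m $ i" and z: "continuous_on {0..T} z"
 shows "continuous_on {0..T} (\<lambda>t. opt t i m (z t))"
proof -
 have "bounded (action_set M :: (real^'d) set)" by (rule compact_imp_bounded[OF compact_action_set])
 then obtain D where D: "\<And>a :: real^'d. a \<in> action_set M ==> norm a <= D" unfolding bounded_iff by blast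
 show ?thesis unfolding continuous_on
 proof
  fix s assume s: "s \<in> {0..T}"
  let ?e = "\<lambda>t. norm (opt t i m (z t) - opt s i m (z s))"
  have "\<forall>\<^sub>F t in at s within {0..T}. (?e t)\<^sup>2 <= (norm (z t - z s) * (2 * D) + 2 * CF * \<bar>t - s\<bar> / m $ i) / \<kappa>"
   unfolding eventually_at_filter
  proof (intro always_eventually allI impI)
   fix t assume "t ~= s" and t: "t \<in> {0..T}"
   have o: "opt t i m (z t) \<in> action_set M" "opt s i m (z s) \<in> action_set M" using opt_props(1) t s m by auto
   have "\<kappa> * (?e t)\<^sup>2 <= norm (z t - z s) * ?e t + 2 * CF * \<bar>t - s\<bar> / m $ i"
    using opt_compare[OF t s m m, of i "z t" "z s"] f_time_difference[OF t s m mi o] by linarith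
   moreover have "?e t <= 2 * D"
    using norm_triangle_ineq4[of "opt t i m (z t)" "opt s i m (z s)"] D[OF o(1)] D[OF o(2)] by linarith
   hence "norm (z t - z s) * ?e t <= norm (z t - z s) * (2 * D)" by (rule mult_left_mono) simp
   ultimately have "\<kappa> * (?e t)\<^sup>2 <= norm (z t - z s) * (2 * D) + 2 * CF * \<bar>t - s\<bar> / m $ i" by linarith
   thus "(?e t)\<^sup>2 <= (norm (z t - z s) * (2 * D) + 2 * CF * \<bar>t - s\<bar> / m $ i) / \<kappa>"
    unfolding pos_le_divide_eq[OF \<kappa>0] by (simp only: mult.commute[of _ \<kappa>])
  qed
  hence le: "\<forall>\<^sub>F t in at s within {0..T}. norm ((?e t)\<^sup>2) <= (norm (z t - z s) * (2 * D) + 2 * CF * \<bar>t - s\<bar> / m $ i) / \<kappa>"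
   unfolding real_norm_def abs_power2 .
  have zt: "(z \<longlongrightarrow> z s) (at s within {0..T})" using z s unfolding continuous_on by blast
  have "((\<lambda>t. (norm (z t - z s) * (2 * D) + 2 * CF * \<bar>t - s\<bar> / m $ i) / \<kappa>) \<longlongrightarrow> (norm (z s - z s) * (2 * D) + 2 * CF * \<bar>s - s\<bar> / m $ i) / \<kappa>) (at s within {0..T})"
   by (intro tendsto_divide tendsto_add tendsto_mult tendsto_norm tendsto_diff tendsto_const tendsto_rabs tendsto_ident_at zt)
    (use mi \<kappa>0 in auto)
  hence "((\<lambda>t. (norm (z t - z s) * (2 * D) + 2 * CF * \<bar>t - s\<bar> / m $ i) / \<kappa>) \<longlongrightarrow> 0) (at s within {0..T})" by simp
  with le have "((\<lambda>t. (?e t)\<^sup>2) \<longlongrightarrow> 0) (at s within {0..T})" by (rule Lim_null_comparison)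
  hence "((\<lambda>t. sqrt ((?e t)\<^sup>2)) \<longlongrightarrow> sqrt 0) (at s within {0..T})" by (rule tendsto_real_sqrt)
  hence "(?e \<longlongrightarrow> 0) (at s within {0..T})" unfolding real_sqrt_abs real_sqrt_zero abs_norm_cancel .
  hence "((\<lambda>t. opt t i m (z t) - opt s i m (z s)) \<longlongrightarrow> 0) (at s within {0..T})" by (rule tendsto_norm_zero_cancel)
  thus "((\<lambda>t. opt t i m (z t)) \<longlongrightarrow> opt s i m (z s)) (at s within {0..T})" by (rule LIM_zero_cancel)
 qed
qed

text \<open>Rows with \<open>m $ i = 0\<close> do not influence dynamics and cost, but there the cost need not be regular in time.\<close>

definition "opt_matrix t m z = (\<chi> i. if 0 < m $ i then opt t i m (z i) else 0)"

text \<open>Pre-Hamiltonian: running cost plus the generator of the control \<open>a\<close>, tested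
  with a separate gradient vector \<open>z i\<close> for each state \<open>i\<close>.\<close>

definition "PH t a m z = F t a m + (\<Sum>i\<in>UNIV. m $ i * (\<Sum>j\<in>UNIV - {i}. a $ i $ j * z i $ j))"

lemma PH_rows: "PH t a m z = (\<Sum>i\<in>UNIV. m $ i * hc i t m (z i) (a $ i))"
 by (simp add: PH_def total_running_def hc_def distrib_left sum.distrib)

lemma opt_matrix_in: "[|t \<in> {0..T}; m \<in> prob_simplex|] ==> opt_matrix t m z \<in> action_matrices M"
 using opt_props(1) zero_action by (auto simp: opt_matrix_def action_matrices_def)

text \<open>Sum of \<open>hc_gap\<close> over the rows with weights \<open>m $ i\<close>; the
  default row of \<open>opt_matrix\<close> is harmless because its weight is 0.\<close>

lemma PH_gap:
 assumes t: "t \<in> {0..T}" and m: "m \<in> prob_simplex" and a: "a \<in> action_matrices M"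
 shows "PH t a m z \<ge> PH t (opt_matrix t m z) m z
   + \<kappa> / 2 * (\<Sum>i\<in>UNIV. m $ i * (\<Sum>j\<in>UNIV - {i}. (a $ i $ j - opt_matrix t m z $ i $ j)\<^sup>2))"
proof -
 have "m $ i * hc i t m (z i) (a $ i) \<ge> m $ i * hc i t m (z i) (opt_matrix t m z $ i)
   + m $ i * (\<kappa> / 2 * (\<Sum>j\<in>UNIV - {i}. (a $ i $ j - opt_matrix t m z $ i $ j)\<^sup>2))" for i
 proof (cases "0 < m $ i")
  case True
  have ai: "a $ i \<in> action_set M" using a by (simp add: action_matrices_def)
  have "hc i t m (z i) (a $ i) \<ge> hc i t m (z i) (opt_matrix t m z $ i) + \<kappa> / 2 * (\<Sum>j\<in>UNIV - {i}. (a $ i $ j - opt_matrix t m z $ i $ j)\<^sup>2)"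
   using True hc_gap[OF t m opt_props(1)[OF t m] ai opt_props(3)[OF t m], of i "z i"] by (simp add: opt_matrix_def)
  thus ?thesis using True unfolding distrib_left[symmetric] by (intro mult_left_mono) auto
 next
  case False
  hence "m $ i = 0" using simplex_coord(1)[OF m, of i] by linarith
  thus ?thesis by simp
 qed
 hence "(\<Sum>i\<in>UNIV. m $ i * hc i t m (z i) (a $ i)) \<ge> (\<Sum>i\<in>UNIV. m $ i * hc i t m (z i) (opt_matrix t m z $ i)
   + m $ i * (\<kappa> / 2 * (\<Sum>j\<in>UNIV - {i}. (a $ i $ j - opt_matrix t m z $ i $ j)\<^sup>2)))" by (intro sum_mono)
 thus ?thesis unfolding PH_rows sum.distrib sum_distrib_left by (simp add: mult.left_commute)
qed

lemma PH_min:
 assumes "t \<in> {0..T}" "m \<in> prob_simplex" "a \<in> action_matrices M"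
 shows "PH t (opt_matrix t m z) m z <= PH t a m z"
proof -
 have "0 <= \<kappa> / 2 * (\<Sum>i\<in>UNIV. m $ i * (\<Sum>j\<in>UNIV - {i}. (a $ i $ j - opt_matrix t m z $ i $ j)\<^sup>2))"
  using \<kappa>0 simplex_coord(1)[OF assms(2)] by (intro mult_nonneg_nonneg sum_nonneg) auto
 with PH_gap[OF assms, of z] show ?thesis by linarith
qed

lemma PH_lip_z:
 assumes m: "m \<in> prob_simplex" and a: "a \<in> action_matrices M"
 shows "\<bar>PH t a m z - PH t a m y\<bar> <= M * (\<Sum>i\<in>UNIV. \<Sum>j\<in>UNIV - {i}. \<bar>z i $ j - y i $ j\<bar>)"
proof -
 have "PH t a m z - PH t a m y = (\<Sum>i\<in>UNIV. \<Sum>j\<in>UNIV - {i}. m $ i * a $ i $ j * (z i $ j - y i $ j))"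
  unfolding PH_def by (simp add: sum_subtractf right_diff_distrib sum_distrib_left mult.assoc)
 also have "\<bar>\<dots>\<bar> <= (\<Sum>i\<in>UNIV. \<Sum>j\<in>UNIV - {i}. M * \<bar>z i $ j - y i $ j\<bar>)"
 proof (rule order_trans[OF sum_abs sum_mono], rule order_trans[OF sum_abs sum_mono])
  fix i j
  have aij: "0 <= a $ i $ j" "a $ i $ j <= M" using a by (auto simp: action_matrices_def action_set_def)
  have "m $ i * a $ i $ j <= 1 * M" by (rule mult_mono) (use simplex_coord[OF m, of i] aij in auto)
  moreover have "0 <= m $ i * a $ i $ j" using simplex_coord[OF m, of i] aij by simp
  ultimately show "\<bar>m $ i * a $ i $ j * (z i $ j - y i $ j)\<bar> <= M * \<bar>z i $ j - y i $ j\<bar>"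
   unfolding abs_mult[of "m $ i * a $ i $ j"] by (intro mult_right_mono) auto
 qed
 finally show ?thesis by (simp add: sum_distrib_left)
qed

definition "ham t m z = PH t (opt_matrix t m z) m z"

text \<open>Each minimizer is a competitor in the other problem, so two minima differ by at most the
  uniform distance of the functions being minimized.\<close>

lemma ham_lip:
 assumes t: "t \<in> {0..T}" and s: "s \<in> {0..T}" and m: "m \<in> prob_simplex"
 shows "\<bar>ham t m z - ham s m y\<bar> <= CF * \<bar>t - s\<bar> + M * (\<Sum>i\<in>UNIV. \<Sum>j\<in>UNIV - {i}. \<bar>z i $ j - y i $ j\<bar>)"
proof -
 let ?R = "CF * \<bar>t - s\<bar> + M * (\<Sum>i\<in>UNIV. \<Sum>j\<in>UNIV - {i}. \<bar>z i $ j - y i $ j\<bar>)"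
 have d: "\<bar>PH t a m z - PH s a m y\<bar> <= ?R" if a: "a \<in> action_matrices M" for a
 proof -
  have "PH t a m z - PH s a m y = (PH t a m z - PH t a m y) + (F t a m - F s a m)" by (simp add: PH_def)
  thus ?thesis using PH_lip_z[OF m a, of t z y] F_lip[OF t s a m m] by simp
 qed
 have "ham t m z <= PH t (opt_matrix s m y) m z" unfolding ham_def by (intro PH_min opt_matrix_in t s m)
 moreover have "ham s m y <= PH s (opt_matrix t m z) m y" unfolding ham_def by (intro PH_min opt_matrix_in t s m)
 ultimately show ?thesis
  using d[OF opt_matrix_in[OF t m, of z]] d[OF opt_matrix_in[OF s m, of y]] unfolding ham_def by linarith
qed

lemma ham_continuous:
 assumes m: "m \<in> prob_simplex" and z: "\<And>i j. continuous_on {0..T} (\<lambda>t. z t i $ j)"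
 shows "continuous_on {0..T} (\<lambda>t. ham t m (z t))"
 unfolding continuous_on
proof
 fix s assume s: "s \<in> {0..T}"
 let ?b = "\<lambda>t. CF * \<bar>t - s\<bar> + M * (\<Sum>i\<in>UNIV. \<Sum>j\<in>UNIV - {i}. \<bar>z t i $ j - z s i $ j\<bar>)"
 have "((\<lambda>t. ham t m (z t) - ham s m (z s)) \<longlongrightarrow> 0) (at s within {0..T})"
 proof (rule Lim_null_comparison)
  show "\<forall>\<^sub>F t in at s within {0..T}. norm (ham t m (z t) - ham s m (z s)) <= ?b t"
   unfolding eventually_at_filter using ham_lip[OF _ s m] by (intro always_eventually) auto
  have zt: "((\<lambda>t. z t i $ j) \<longlongrightarrow> z s i $ j) (at s within {0..T})" for i j
   using z s unfolding continuous_on by blast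
  have "(?b \<longlongrightarrow> CF * \<bar>s - s\<bar> + M * (\<Sum>i\<in>UNIV. \<Sum>j\<in>UNIV - {i}. \<bar>z s i $ j - z s i $ j\<bar>)) (at s within {0..T})"
   by (intro tendsto_add tendsto_mult tendsto_const tendsto_sum tendsto_rabs tendsto_diff tendsto_ident_at zt)
  thus "(?b \<longlongrightarrow> 0) (at s within {0..T})" by simp
 qed
 thus "((\<lambda>t. ham t m (z t)) \<longlongrightarrow> ham s m (z s)) (at s within {0..T})" by (rule LIM_zero_cancel)
qed

lemma opt_matrix_continuous:
 assumes m: "m \<in> prob_simplex" and z: "\<And>i. continuous_on {0..T} (\<lambda>t. z t i)"
 shows "continuous_on {0..T} (\<lambda>t. opt_matrix t m (z t))"
proof -
 have "continuous_on {0..T} (\<lambda>t. if 0 < m $ i then opt t i m (z t i) else 0)" for i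
  using opt_continuous_in_time[OF m _ z, of i i] by (cases "0 < m $ i") auto
 thus ?thesis unfolding opt_matrix_def by (intro continuous_on_vec_lambda)
qed

end

section \<open>The mean field control problem\<close>

lemma has_integral_vec:
 fixes f :: "real => real^'d::finite"
 shows "(f has_integral I) S \<longleftrightarrow> (\<forall>k. ((\<lambda>x. f x $ k) has_integral (I $ k)) S)"
 unfolding has_integral_componentwise_iff[of f I S]
 by (auto simp: Basis_vec_def inner_axis)

lemma has_integral_modify_after:
 fixes h k :: "real => 'x::euclidean_space"
 assumes "(h has_integral I) {t..s}" "s <= t'" "\<And>u. u < t' ==> k u = h u"
 shows "(k has_integral I) {t..s}"
 by (rule has_integral_spike_finite[of "{t'}" _ _ h]) (use assms in auto)

lemma has_integral_modify_before:
 fixes h k :: "real => 'x::euclidean_space"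
 assumes "(h has_integral I) {t'..s}" "\<And>u. t' <= u ==> k u = h u"
 shows "(k has_integral I) {t'..s}"
 using assms(1) by (rule has_integral_eq[rotated]) (use assms(2) in auto)

lemma bounded_borel_integrable:
 fixes \<phi> :: "real => real"
 assumes m: "\<phi> \<in> borel_measurable (restrict_space borel {a..b})" and b: "\<And>s. s \<in> {a..b} ==> \<bar>\<phi> s\<bar> <= K"
 shows "set_integrable lborel {a..b} \<phi>" and "\<phi> integrable_on {a..b}"
  and "(LINT s:{a..b}|lborel. \<phi> s) = integral {a..b} \<phi>"
proof -
 have "(\<lambda>x. indicator {a..b} x *\<^sub>R \<phi> x) \<in> borel_measurable borel"
  using m by (subst (asm) borel_measurable_restrict_space_iff) auto
 hence m': "(\<lambda>x. indicator {a..b} x *\<^sub>R \<phi> x) \<in> borel_measurable lborel" by simp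
 have "integrable lborel (\<lambda>x. indicator {a..b} x *\<^sub>R \<bar>K\<bar>)"
  by (intro integrable_scaleR_left integrable_real_indicator) (auto simp: emeasure_lborel_Icc_eq)
 hence "integrable lborel (\<lambda>x. indicator {a..b} x *\<^sub>R \<phi> x)"
 proof (rule Bochner_Integration.integrable_bound[OF _ m' AE_I2])
  fix x show "norm (indicator {a..b} x *\<^sub>R \<phi> x) <= norm (indicator {a..b} x *\<^sub>R \<bar>K\<bar>)"
   using b[of x] by (auto simp: indicator_def)
 qed
 thus si: "set_integrable lborel {a..b} \<phi>" by (simp add: set_integrable_def)
 show "\<phi> integrable_on {a..b}" by (rule set_borel_integral_eq_integral(1)[OF si])
 show "(LINT s:{a..b}|lborel. \<phi> s) = integral {a..b} \<phi>" by (rule set_borel_integral_eq_integral(2)[OF si])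
qed

lemma action_matrices_bounds: "a \<in> action_matrices M ==> 0 <= a $ i $ j \<and> a $ i $ j <= M"
 by (auto simp: action_matrices_def action_set_def)

text \<open>The state equation is a forward Kolmogorov equation on the index type with rates
  \<open>a $ x $ y\<close>, so existence, nonnegativity and conservation of mass come from the
  locale \<open>rates\<close>.\<close>

lemma mf_drift_fwd: "mf_drift a m $ y = fwd UNIV (\<lambda>u x y. a $ x $ y) u (\<lambda>z. m $ z) y"
 unfolding mf_drift_def fwd_def
 by (simp add: sum_subtractf sum.remove[of UNIV y] sum_distrib_left)

text \<open>Mass moves along the directions \<open>shift i j\<close>; in this form the drift is
  paired with directional derivatives and compared with the jumps of the chain.\<close>

lemma mf_drift_shift: "mf_drift a m = (\<Sum>i\<in>UNIV. \<Sum>j\<in>UNIV. (m $ i * a $ i $ j) *\<^sub>R shift i j)"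
proof (rule vec_eq_iff[THEN iffD2, rule_format])
 fix k
 have "(\<Sum>i\<in>UNIV. \<Sum>j\<in>UNIV. (m $ i * a $ i $ j) *\<^sub>R shift i j) $ k
   = (\<Sum>i\<in>UNIV. \<Sum>j\<in>UNIV. m $ i * a $ i $ j * (if j = k then 1 else 0)) - (\<Sum>i\<in>UNIV. \<Sum>j\<in>UNIV. m $ i * a $ i $ j * (if i = k then 1 else 0))"
  by (simp add: shift_def axis_def sum_subtractf[symmetric] right_diff_distrib eq_commute[of k])
 also have "(\<Sum>i\<in>UNIV. \<Sum>j\<in>UNIV. m $ i * a $ i $ j * (if j = k then 1 else 0)) = (\<Sum>i\<in>UNIV. m $ i * a $ i $ k)"
  by (simp add: if_distrib cong: if_cong)
 also have "(\<Sum>i\<in>UNIV. \<Sum>j\<in>UNIV. m $ i * a $ i $ j * (if i = k then 1 else 0)) = (\<Sum>j\<in>UNIV. m $ k * a $ k $ j)"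
  by (subst sum.swap) (simp add: if_distrib cong: if_cong)
 finally show "mf_drift a m $ k = (\<Sum>i\<in>UNIV. \<Sum>j\<in>UNIV. (m $ i * a $ i $ j) *\<^sub>R shift i j) $ k"
  by (simp add: mf_drift_def sum_subtractf)
qed

lemma mf_drift_diff: "mf_drift a (p - m) = mf_drift a p - mf_drift a m"
proof (rule vec_eq_iff[THEN iffD2, rule_format])
 fix i
 show "mf_drift a (p - m) $ i = (mf_drift a p - mf_drift a m) $ i"
  unfolding mf_drift_def vec_lambda_beta vector_minus_component sum_subtractf[symmetric]
  by (intro sum.cong refl) (simp add: algebra_simps)
qed

lemma norm_mf_drift:
 fixes a :: "real^'d::finite^'d"
 assumes a: "a \<in> action_matrices M"
 shows "norm (mf_drift a v) <= (2 * (real CARD('d))\<^sup>2 * M) * norm v"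
proof -
 have "\<bar>mf_drift a v $ i\<bar> <= (\<Sum>j\<in>(UNIV::'d set). 2 * M * norm v)" for i
 proof -
  have "\<bar>v $ j * a $ j $ i - v $ i * a $ i $ j\<bar> <= 2 * M * norm v" for j
  proof -
   have "\<bar>v $ k * a $ l $ n\<bar> <= norm v * M" for k l n
    unfolding abs_mult using action_matrices_bounds[OF a, of l n] component_le_norm_cart[of v k] by (intro mult_mono) auto
   from this[of j j i] this[of i i j] show ?thesis by (simp add: algebra_simps)
  qed
  thus ?thesis unfolding mf_drift_def vec_lambda_beta by (intro order_trans[OF sum_abs] sum_mono)
 qed
 hence "(\<Sum>i\<in>UNIV. \<bar>mf_drift a v $ i\<bar>) <= (\<Sum>i\<in>(UNIV::'d set). \<Sum>j\<in>(UNIV::'d set). 2 * M * norm v)" by (intro sum_mono)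
 hence "norm (mf_drift a v) <= (\<Sum>i\<in>(UNIV::'d set). \<Sum>j\<in>(UNIV::'d set). 2 * M * norm v)"
  using norm_le_l1_cart order_trans by blast
 thus ?thesis by (simp add: power2_eq_square mult_ac)
qed

lemma simplex_norm_le_1: "m \<in> prob_simplex ==> norm (m :: real^'d::finite) <= 1"
 using norm_le_l1_cart[of m] by (simp add: prob_simplex_def)

section \<open>Trajectories, costs and dynamic programming\<close>

context cost_data begin

abbreviation "V \<equiv> mf_value T M f g"
abbreviation ctrl :: "(real => real^'d^'d) => bool" where "ctrl \<equiv> mf_control T M"
abbreviation traj :: "(real => real^'d^'d) => real => real^'d => (real => real^'d) => bool" where "traj \<equiv> mf_trajectory T"
definition "ratesof \<alpha> u x y = \<alpha> u $ x $ y" for \<alpha> :: "real => real^'d^'d"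

lemma ctrl_measurable: "ctrl \<alpha> ==> (\<lambda>u. \<alpha> u $ x $ y) \<in> borel_measurable (restrict_space borel {0..T})"
 unfolding mf_control_def
 by (intro measurable_compose[of "\<lambda>u. \<alpha> u" _ borel "\<lambda>a. a $ x $ y"] borel_measurable_continuous_onI continuous_intros) auto

lemma restrict_measurable_mono:
 "[|h \<in> borel_measurable (restrict_space borel {0..T}); 0 <= a; b <= T|] ==> h \<in> borel_measurable (restrict_space borel {a..b})"
 by (erule measurable_restrict_mono) auto

lemma ctrl_rates:
 assumes c: "ctrl \<alpha>" and t: "t \<in> {0..T}"
 shows "rates UNIV (ratesof \<alpha>) t T M"
proof
 have b: "\<alpha> u \<in> action_matrices M" if "u \<in> {t..T}" for u using c that t by (auto simp: mf_control_def)
 show "0 <= ratesof \<alpha> u x y" "ratesof \<alpha> u x y <= M" if "u \<in> {t..T}" for u x y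
  using action_matrices_bounds[OF b[OF that]] by (auto simp: ratesof_def)
 show "(\<lambda>u. ratesof \<alpha> u x y) integrable_on {t..T}" for x y
 proof (rule bounded_borel_integrable(2))
  show "(\<lambda>u. ratesof \<alpha> u x y) \<in> borel_measurable (restrict_space borel {t..T})"
   unfolding ratesof_def using t by (intro restrict_measurable_mono[OF ctrl_measurable[OF c]]) auto
  show "\<bar>ratesof \<alpha> u x y\<bar> <= M" if "u \<in> {t..T}" for u
   using action_matrices_bounds[OF b[OF that]] by (auto simp: ratesof_def)
 qed
qed (use t M0 in auto)

lemma traj_forward_iff:
 assumes "t \<in> {0..T}"
 shows "traj \<alpha> t m \<mu> \<longleftrightarrow> \<mu> t = m \<and> forward_sol UNIV (ratesof \<alpha>) t T (\<lambda>s y. \<mu> s $ y)"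
proof -
 have d: "mf_drift (\<alpha> u) (\<mu> u) $ y = fwd UNIV (ratesof \<alpha>) u (\<lambda>z. \<mu> u $ z) y" for u y
  unfolding mf_drift_fwd[where u = u] by (simp add: fwd_def ratesof_def)
 define q where "q = ratesof \<alpha>"
 define \<Psi> where "\<Psi> y u = fwd UNIV q u (\<lambda>z. \<mu> u $ z) y" for y u
 have tr: "traj \<alpha> t m \<mu> \<longleftrightarrow> (\<forall>s\<in>{t..T}. \<forall>y. (\<Psi> y has_integral (\<mu> s $ y - m $ y)) {t..s})"
  unfolding mf_trajectory_def has_integral_vec d vector_minus_component \<Psi>_def q_def ..
 have fs: "forward_sol UNIV q t T (\<lambda>s y. \<mu> s $ y) \<longleftrightarrow> (\<forall>s\<in>{t..T}. \<forall>y. (\<Psi> y has_integral (\<mu> s $ y - \<mu> t $ y)) {t..s})"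
  unfolding forward_sol_def \<Psi>_def by simp
 have "\<mu> t = m" if h: "\<forall>s\<in>{t..T}. \<forall>y. (\<Psi> y has_integral (\<mu> s $ y - m $ y)) {t..s}"
 proof (rule vec_eq_iff[THEN iffD2, rule_format])
  fix y
  have "(\<Psi> y has_integral (\<mu> t $ y - m $ y)) {t..t}"
   by (rule h[rule_format]) (use assms in simp)
  moreover have "(\<Psi> y has_integral 0) {t..t}"
   using has_integral_refl(1)[of "\<Psi> y" t] by (simp add: cbox_interval)
  ultimately have "\<mu> t $ y - m $ y = 0" by (rule has_integral_unique)
  thus "\<mu> t $ y = m $ y" by simp
 qed
 thus ?thesis unfolding tr fs[unfolded q_def] by metis
qed

lemma traj_simplex:
 assumes c: "ctrl \<alpha>" and t: "t \<in> {0..T}" and tr: "traj \<alpha> t m \<mu>" and m: "m \<in> prob_simplex" and s: "s \<in> {t..T}"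
 shows "\<mu> s \<in> prob_simplex"
proof -
 interpret rates UNIV "ratesof \<alpha>" t T M by (rule ctrl_rates[OF c t])
 have fs: "forward_sol UNIV (ratesof \<alpha>) t T (\<lambda>s y. \<mu> s $ y)" and mt: "\<mu> t = m" using tr traj_forward_iff[OF t] by auto
 have "0 <= \<mu> s $ y" for y
  by (rule forward_sol_nonneg[OF subset_refl fs]) (use m s mt in \<open>auto simp: prob_simplex_def\<close>)
 moreover have "(\<Sum>y\<in>UNIV. \<mu> s $ y) = (\<Sum>y\<in>UNIV. \<mu> t $ y)" by (rule forward_sol_mass[OF subset_refl fs s])
 ultimately show ?thesis using m mt by (simp add: prob_simplex_def)
qed

lemma traj_exists:
 assumes c: "ctrl \<alpha>" and t: "t \<in> {0..T}"
 obtains \<mu> where "traj \<alpha> t m \<mu>"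
proof -
 interpret rates UNIV "ratesof \<alpha>" t T M by (rule ctrl_rates[OF c t])
 have "t \<in> {t..T}" using t by simp
 then obtain \<pi> where \<pi>: "\<And>y. y \<in> UNIV ==> \<pi> t y = m $ y" "forward_sol UNIV (ratesof \<alpha>) t T \<pi>"
  by (rule forward_sol_exists[of t "\<lambda>y. m $ y"]) auto
 have "traj \<alpha> t m (\<lambda>s. \<chi> y. \<pi> s y)"
  unfolding traj_forward_iff[OF t]
 proof
  show "(\<chi> y. \<pi> t y) = m" using \<pi>(1) by (simp add: vec_eq_iff)
  show "forward_sol UNIV (ratesof \<alpha>) t T (\<lambda>s y. (\<chi> y. \<pi> s y) $ y)" by (rule forward_sol_cong[OF _ \<pi>(2)]) simp
 qed
 thus ?thesis by (rule that)
qed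

lemma traj_continuous:
 assumes t: "t \<in> {0..T}" and tr: "traj \<alpha> t m \<mu>"
 shows "continuous_on {t..T} \<mu>"
proof -
 have "forward_sol UNIV (ratesof \<alpha>) t T (\<lambda>s y. \<mu> s $ y)" using tr traj_forward_iff[OF t] by auto
 hence "continuous_on {t..T} (\<lambda>s. \<chi> y. \<mu> s $ y)"
  by (intro continuous_on_vec_lambda forward_sol_continuous[of UNIV _ _ _ "\<lambda>s y. \<mu> s $ y"]) auto
 thus ?thesis by simp
qed

lemma traj_sub:
 assumes t: "t \<in> {0..T}" and c: "ctrl \<alpha>" and tr: "traj \<alpha> t m \<mu>" and s: "s \<in> {t..T}"
 shows "traj \<alpha> s (\<mu> s) \<mu>"
proof -
 interpret rates UNIV "ratesof \<alpha>" t T M by (rule ctrl_rates[OF c t])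
 have "forward_sol UNIV (ratesof \<alpha>) t T (\<lambda>s y. \<mu> s $ y)" using tr traj_forward_iff[OF t] by auto
 hence "forward_sol UNIV (ratesof \<alpha>) s T (\<lambda>s y. \<mu> s $ y)"
  by (rule forward_sol_subinterval[OF subset_refl]) (use s in auto)
 thus ?thesis using s t by (subst traj_forward_iff) auto
qed

definition "Kd = 2 * (real CARD('d))\<^sup>2 * M"

lemma Kd0: "0 <= Kd" using M0 by (simp add: Kd_def)

lemma norm_drift_le: "a \<in> action_matrices M ==> norm (mf_drift a v) <= Kd * norm v" for v :: "real^'d"
 unfolding Kd_def by (rule norm_mf_drift)

lemma traj_lip:
 assumes c: "ctrl \<alpha>" and t: "t \<in> {0..T}" and tr: "traj \<alpha> t m \<mu>" and m: "m \<in> prob_simplex" and s: "s \<in> {t..T}"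
 shows "norm (\<mu> s - m) <= Kd * (s - t)"
proof -
 have i: "((\<lambda>u. mf_drift (\<alpha> u) (\<mu> u)) has_integral (\<mu> s - m)) {t..s}" using tr s by (auto simp: mf_trajectory_def)
 have "norm (mf_drift (\<alpha> u) (\<mu> u)) <= Kd" if u: "u \<in> {t..s}" for u
 proof -
  have "\<alpha> u \<in> action_matrices M" using c u s t by (auto simp: mf_control_def)
  hence "norm (mf_drift (\<alpha> u) (\<mu> u)) <= Kd * norm (\<mu> u)" by (rule norm_drift_le)
  also have "\<dots> <= Kd * 1" using traj_simplex[OF c t tr m, of u] u s Kd0 by (intro mult_left_mono simplex_norm_le_1) auto
  finally show ?thesis by simp
 qed
 hence "norm (\<mu> s - m) <= Kd * Henstock_Kurzweil_Integration.content (cbox t s)"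
  using i by (intro has_integral_bound[OF Kd0]) (auto simp: cbox_interval)
 thus ?thesis using s by simp
qed

lemma F_measurable:
 assumes ab: "0 <= a" "b <= T" and \<alpha>: "\<alpha> \<in> borel_measurable (restrict_space borel {a..b})" "\<And>s. s \<in> {a..b} ==> \<alpha> s \<in> action_matrices M"
  and \<mu>: "\<mu> \<in> borel_measurable (restrict_space borel {a..b})" "\<And>s. s \<in> {a..b} ==> \<mu> s \<in> prob_simplex"
 shows "(\<lambda>s. F s (\<alpha> s) (\<mu> s)) \<in> borel_measurable (restrict_space borel {a..b})"
proof -
 let ?K = "{0..T} \<times> action_matrices M \<times> prob_simplex"
 have i: "(\<lambda>s. s) \<in> borel_measurable (restrict_space borel {a..b})"
  by (rule measurable_restrict_space1) simp
 have "(\<lambda>s. (s, \<alpha> s, \<mu> s)) \<in> borel_measurable (restrict_space borel {a..b})"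
  by (intro borel_measurable_Pair i \<alpha>(1) \<mu>(1))
 hence 1: "(\<lambda>s. (s, \<alpha> s, \<mu> s)) \<in> measurable (restrict_space borel {a..b}) (restrict_space borel ?K)"
  by (rule measurable_restrict_space2[rotated]) (use ab \<alpha>(2) \<mu>(2) in \<open>auto simp: space_restrict_space\<close>)
 have 2: "(\<lambda>(t, a, m). F t a m) \<in> borel_measurable (restrict_space borel ?K)"
  by (rule borel_measurable_continuous_on_restrict[OF F_continuous])
 from measurable_compose[OF 1 2] show ?thesis by simp
qed

lemma traj_cost:
 assumes c: "ctrl \<alpha>" and t: "t \<in> {0..T}" and tr: "traj \<alpha> t m \<mu>" and m: "m \<in> prob_simplex"
 shows "(\<lambda>s. F s (\<alpha> s) (\<mu> s)) integrable_on {t..T}"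
  and "(LINT s:{t..T}|lborel. F s (\<alpha> s) (\<mu> s)) = integral {t..T} (\<lambda>s. F s (\<alpha> s) (\<mu> s))"
proof -
 obtain B where B: "\<And>t a m. [|t \<in> {0..T}; a \<in> action_matrices M; m \<in> prob_simplex|] ==> \<bar>F t a m\<bar> <= B" using F_bounded by metis
 have \<alpha>: "\<alpha> s \<in> action_matrices M" "\<mu> s \<in> prob_simplex" if "s \<in> {t..T}" for s
  using c that t traj_simplex[OF c t tr m that] by (auto simp: mf_control_def)
 have m: "(\<lambda>s. F s (\<alpha> s) (\<mu> s)) \<in> borel_measurable (restrict_space borel {t..T})"
 proof (rule F_measurable)
  show "\<alpha> \<in> borel_measurable (restrict_space borel {t..T})"
   using c t unfolding mf_control_def by (intro measurable_restrict_mono[of \<alpha> borel "{0..T}" borel "{t..T}"]) auto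
  show "\<mu> \<in> borel_measurable (restrict_space borel {t..T})"
   by (rule borel_measurable_continuous_on_restrict[OF traj_continuous[OF t tr]])
 qed (use t \<alpha> in auto)
 have b: "\<bar>F s (\<alpha> s) (\<mu> s)\<bar> <= B" if "s \<in> {t..T}" for s using that t \<alpha>[OF that] by (intro B) auto
 show "(\<lambda>s. F s (\<alpha> s) (\<mu> s)) integrable_on {t..T}" by (rule bounded_borel_integrable(2)[OF m b])
 show "(LINT s:{t..T}|lborel. F s (\<alpha> s) (\<mu> s)) = integral {t..T} (\<lambda>s. F s (\<alpha> s) (\<mu> s))" by (rule bounded_borel_integrable(3)[OF m b])
qed

definition "costs t m = {integral {t..T} (\<lambda>s. F s (\<alpha> s) (\<mu> s)) + G (\<mu> T) | \<alpha> \<mu>. ctrl \<alpha> \<and> traj \<alpha> t m \<mu>}"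

lemma V_costs:
 assumes t: "t \<in> {0..T}" and m: "m \<in> prob_simplex"
 shows "V t m = Inf (costs t m)"
proof -
 have "{(LINT s:{t..T}|lborel. F s (\<alpha> s) (\<mu> s)) + G (\<mu> T) | \<alpha> \<mu>. ctrl \<alpha> \<and> traj \<alpha> t m \<mu>} = costs t m"
  unfolding costs_def using traj_cost(2)[OF _ t _ m] by (intro Collect_cong ex_cong1) (metis (no_types, lifting))
 thus ?thesis unfolding mf_value_def by simp
qed

lemma const_ctrl: "a \<in> action_matrices M ==> ctrl (\<lambda>_. a)"
 by (simp add: mf_control_def)

lemma costs_nonempty: "t \<in> {0..T} ==> costs t m ~= {}"
proof -
 assume t: "t \<in> {0..T}"
 have c: "ctrl (\<lambda>_. 0)" by (rule const_ctrl) (use M0 in \<open>auto simp: action_matrices_def action_set_def\<close>)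
 obtain \<mu> where "traj (\<lambda>_. 0) t m \<mu>" by (rule traj_exists[OF c t])
 with c show ?thesis unfolding costs_def by blast
qed

lemma costs_bdd_below:
 assumes t: "t \<in> {0..T}" and m: "m \<in> prob_simplex"
 shows "bdd_below (costs t m)"
proof -
 obtain B where B: "\<And>t a m. [|t \<in> {0..T}; a \<in> action_matrices M; m \<in> prob_simplex|] ==> \<bar>F t a m\<bar> <= B" using F_bounded by metis
 have "- B * (T - t) - (\<bar>G m\<bar> + CG * 2) <= x" if x: "x \<in> costs t m" for x
 proof -
  obtain \<alpha> \<mu> where c: "ctrl \<alpha>" "traj \<alpha> t m \<mu>" and x: "x = integral {t..T} (\<lambda>s. F s (\<alpha> s) (\<mu> s)) + G (\<mu> T)"
   using x unfolding costs_def by blast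
  have S: "\<mu> s \<in> prob_simplex" if "s \<in> {t..T}" for s by (rule traj_simplex[OF c(1) t c(2) m that])
  have "\<bar>integral {t..T} (\<lambda>s. F s (\<alpha> s) (\<mu> s))\<bar> <= B * (T - t)"
   using t c S by (intro has_integral_abs_le[OF integrable_integral[OF traj_cost(1)[OF c(1) t c(2) m]]] B) (auto simp: mf_control_def)
  moreover have "\<bar>G (\<mu> T) - G m\<bar> <= CG * 2"
  proof -
   have "\<mu> T \<in> prob_simplex" using S t by auto
   hence "\<bar>G (\<mu> T) - G m\<bar> <= CG * norm (\<mu> T - m)" using m by (rule G_lip)
   also have "\<dots> <= CG * 2" using norm_triangle_ineq4[of "\<mu> T" m] simplex_norm_le_1[OF m] simplex_norm_le_1[OF \<open>\<mu> T \<in> prob_simplex\<close>] CG0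
    by (intro mult_left_mono) auto
   finally show ?thesis .
  qed
  ultimately show ?thesis unfolding x by linarith
 qed
 thus ?thesis by (rule bdd_belowI)
qed

lemma V_le:
 assumes t: "t \<in> {0..T}" and m: "m \<in> prob_simplex" and "ctrl \<alpha>" "traj \<alpha> t m \<mu>"
 shows "V t m <= integral {t..T} (\<lambda>s. F s (\<alpha> s) (\<mu> s)) + G (\<mu> T)"
 unfolding V_costs[OF t m] using assms by (intro cInf_lower costs_bdd_below) (auto simp: costs_def)

lemma V_approx:
 assumes t: "t \<in> {0..T}" and m: "m \<in> prob_simplex" and e: "0 < eps"
 obtains \<alpha> \<mu> where "ctrl \<alpha>" "traj \<alpha> t m \<mu>" "integral {t..T} (\<lambda>s. F s (\<alpha> s) (\<mu> s)) + G (\<mu> T) < V t m + eps"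
proof -
 have "Inf (costs t m) < V t m + eps" using e unfolding V_costs[OF t m] by simp
 then obtain x where "x \<in> costs t m" "x < V t m + eps" using cInf_lessD[OF costs_nonempty[OF t]] by blast
 thus ?thesis unfolding costs_def using that by blast
qed

lemma V_terminal:
 assumes m: "m \<in> prob_simplex" shows "V T m = G m"
proof -
 have T: "T \<in> {0..T}" using T0 by simp
 have "costs T m = {G m}"
 proof -
  have "x = G m" if "x \<in> costs T m" for x
   using that traj_forward_iff[OF T] unfolding costs_def by auto
  thus ?thesis using costs_nonempty[OF T, of m] by blast
 qed
 thus ?thesis using V_costs[OF T m] by simp
qed

text \<open>The tail of a nearly optimal control competes in the problem started at time
  \<open>t'\<close>.\<close>

lemma dpp_super:
 assumes t: "0 <= t" "t <= t'" "t' <= T" and m: "m \<in> prob_simplex" and e: "0 < eps"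
 obtains \<alpha> \<mu> where "ctrl \<alpha>" "traj \<alpha> t m \<mu>" "integral {t..t'} (\<lambda>s. F s (\<alpha> s) (\<mu> s)) + V t' (\<mu> t') <= V t m + eps"
proof -
 have tt: "t \<in> {0..T}" "t' \<in> {0..T}" "t' \<in> {t..T}" using t by auto
 obtain \<alpha> \<mu> where c: "ctrl \<alpha>" "traj \<alpha> t m \<mu>" and le: "integral {t..T} (\<lambda>s. F s (\<alpha> s) (\<mu> s)) + G (\<mu> T) < V t m + eps"
  by (rule V_approx[OF tt(1) m e])
 have "V t' (\<mu> t') <= integral {t'..T} (\<lambda>s. F s (\<alpha> s) (\<mu> s)) + G (\<mu> T)"
  by (rule V_le[OF tt(2) traj_simplex[OF c(1) tt(1) c(2) m tt(3)] c(1) traj_sub[OF tt(1) c tt(3)]])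
 moreover have "integral {t..t'} (\<lambda>s. F s (\<alpha> s) (\<mu> s)) + integral {t'..T} (\<lambda>s. F s (\<alpha> s) (\<mu> s)) = integral {t..T} (\<lambda>s. F s (\<alpha> s) (\<mu> s))"
  using t traj_cost(1)[OF c(1) tt(1) c(2) m] by (intro Henstock_Kurzweil_Integration.integral_combine) auto
 ultimately show ?thesis using le c by (intro that[of \<alpha> \<mu>]) auto
qed

text \<open>The given control is followed up to \<open>t'\<close> and continued by a nearly optimal
  one; the glued pair competes in the problem started at \<open>t\<close>.\<close>

lemma dpp_sub:
 assumes t: "0 <= t" "t <= t'" "t' <= T" and m: "m \<in> prob_simplex" and a: "ctrl \<alpha>" "traj \<alpha> t m \<mu>"
 shows "V t m <= integral {t..t'} (\<lambda>s. F s (\<alpha> s) (\<mu> s)) + V t' (\<mu> t')"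
proof (rule field_le_epsilon)
 fix eps :: real assume e: "0 < eps"
 have tt: "t \<in> {0..T}" "t' \<in> {0..T}" "t' \<in> {t..T}" using t by auto
 have m': "\<mu> t' \<in> prob_simplex" by (rule traj_simplex[OF a(1) tt(1) a(2) m tt(3)])
 obtain \<beta> \<nu> where b: "ctrl \<beta>" "traj \<beta> t' (\<mu> t') \<nu>" and le: "integral {t'..T} (\<lambda>s. F s (\<beta> s) (\<nu> s)) + G (\<nu> T) < V t' (\<mu> t') + eps"
  by (rule V_approx[OF tt(2) m' e])
 define \<gamma> where "\<gamma> = (\<lambda>s. if s < t' then \<alpha> s else \<beta> s)"
 define \<rho> where "\<rho> = (\<lambda>s. if s < t' then \<mu> s else \<nu> s)"
 have \<nu>t: "\<nu> t' = \<mu> t'" using b(2) traj_forward_iff[OF tt(2)] by blast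
 have c: "ctrl \<gamma>"
  unfolding mf_control_def
 proof (intro conjI ballI)
  have "(\<lambda>s. s) \<in> borel_measurable (restrict_space borel {0..T})" by (rule measurable_restrict_space1) simp
  from borel_measurable_less[OF this borel_measurable_const]
  have "{s \<in> space (restrict_space borel {0..T}). s < t'} \<in> sets (restrict_space borel {0..T})" .
  thus "\<gamma> \<in> borel_measurable (restrict_space borel {0..T})"
   unfolding \<gamma>_def using a(1) b(1) by (intro measurable_If) (auto simp: mf_control_def)
 qed (use a(1) b(1) in \<open>auto simp: mf_control_def \<gamma>_def\<close>)
 have tr: "traj \<gamma> t m \<rho>" unfolding mf_trajectory_def
 proof
  fix s assume s: "s \<in> {t..T}"
  have 1: "((\<lambda>u. mf_drift (\<gamma> u) (\<rho> u)) has_integral (\<mu> r - m)) {t..r}" if "r \<in> {t..t'}" for r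
   by (rule has_integral_modify_after[where t' = t' and h = "\<lambda>u. mf_drift (\<alpha> u) (\<mu> u)"]) (use a(2) that t in \<open>auto simp: mf_trajectory_def \<gamma>_def \<rho>_def\<close>)
  show "((\<lambda>u. mf_drift (\<gamma> u) (\<rho> u)) has_integral (\<rho> s - m)) {t..s}"
  proof (cases "s < t'")
   case True
   thus ?thesis using 1[of s] s by (simp add: \<rho>_def)
  next
   case False
   have 2: "((\<lambda>u. mf_drift (\<gamma> u) (\<rho> u)) has_integral (\<nu> s - \<mu> t')) {t'..s}"
    by (rule has_integral_modify_before[where h = "\<lambda>u. mf_drift (\<beta> u) (\<nu> u)"]) (use b(2) s False in \<open>auto simp: mf_trajectory_def \<gamma>_def \<rho>_def\<close>)
   have "((\<lambda>u. mf_drift (\<gamma> u) (\<rho> u)) has_integral ((\<mu> t' - m) + (\<nu> s - \<mu> t'))) {t..s}"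
    by (rule has_integral_combine[OF _ _ 1 2]) (use t False in auto)
   thus ?thesis using False by (simp add: \<rho>_def)
  qed
 qed
 have "((\<lambda>s. F s (\<gamma> s) (\<rho> s)) has_integral (integral {t..t'} (\<lambda>s. F s (\<alpha> s) (\<mu> s)))) {t..t'}"
 proof (rule has_integral_modify_after[where t' = t' and h = "\<lambda>s. F s (\<alpha> s) (\<mu> s)"])
  have "(\<lambda>s. F s (\<alpha> s) (\<mu> s)) integrable_on {t..t'}"
   using traj_cost(1)[OF a(1) tt(1) a(2) m] t by (auto intro: integrable_on_subinterval)
  thus "((\<lambda>s. F s (\<alpha> s) (\<mu> s)) has_integral (integral {t..t'} (\<lambda>s. F s (\<alpha> s) (\<mu> s)))) {t..t'}" by (rule integrable_integral)
 qed (auto simp: \<gamma>_def \<rho>_def)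
 moreover have "((\<lambda>s. F s (\<gamma> s) (\<rho> s)) has_integral (integral {t'..T} (\<lambda>s. F s (\<beta> s) (\<nu> s)))) {t'..T}"
  by (rule has_integral_modify_before[where h = "\<lambda>s. F s (\<beta> s) (\<nu> s)", OF integrable_integral[OF traj_cost(1)[OF b(1) tt(2) b(2) m']]]) (auto simp: \<gamma>_def \<rho>_def)
 ultimately have "((\<lambda>s. F s (\<gamma> s) (\<rho> s)) has_integral (integral {t..t'} (\<lambda>s. F s (\<alpha> s) (\<mu> s)) + integral {t'..T} (\<lambda>s. F s (\<beta> s) (\<nu> s)))) {t..T}"
  using t by (intro has_integral_combine) auto
 hence "integral {t..T} (\<lambda>s. F s (\<gamma> s) (\<rho> s)) = integral {t..t'} (\<lambda>s. F s (\<alpha> s) (\<mu> s)) + integral {t'..T} (\<lambda>s. F s (\<beta> s) (\<nu> s))"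
  by (rule integral_unique)
 moreover have "\<rho> T = \<nu> T" using t by (simp add: \<rho>_def)
 ultimately show "V t m <= integral {t..t'} (\<lambda>s. F s (\<alpha> s) (\<mu> s)) + V t' (\<mu> t') + eps"
  using V_le[OF tt(1) m c tr] le by simp
qed

text \<open>Dynamic programming over a short interval of length \<open>h\<close>, where the value
  follows its first order expansion up to \<open>O(h^2)\<close>. One inequality uses the constant
  action matrix that is optimal at \<open>(t, m)\<close>, the other an almost optimal control. The
  expansion is a hypothesis in terms of a linear map \<open>D\<close>, which keeps charts out of the
  argument; \<open>t < T\<close> leaves room for \<open>h\<close>.\<close>

lemma hjb_local:
 fixes D :: "real^'d => real"
 assumes t: "0 <= t" "t < T" and m: "m \<in> prob_simplex" and D: "linear D" and KD: "\<And>v. \<bar>D v\<bar> <= KD * norm v"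
  and \<delta>: "0 < \<delta>" and C0: "0 <= C"
  and taylor: "\<And>s p. [|s \<in> {t..T}; p \<in> prob_simplex; norm (p - m) < \<delta>|] ==>
    \<bar>V s p - V t m - vt * (s - t) - D (p - m)\<bar> <= C * ((s - t)\<^sup>2 + (norm (p - m))\<^sup>2)"
 shows "vt + ham t m (\<lambda>i. \<chi> j. D (shift i j)) = 0"
proof -
 let ?z = "\<lambda>i. \<chi> j. D (shift i j)"
 have tt: "t \<in> {0..T}" using t by auto
 have KD0: "0 <= KD" using KD[of "axis undefined 1"] abs_ge_zero[of "D (axis undefined 1)"] unfolding norm_axis_1 by linarith
 have bl: "bounded_linear D" using D by (simp add: linear_conv_bounded_linear)
 have PHD: "PH t a m ?z = F t a m + D (mf_drift a m)" for a
 proof -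
  have "D (mf_drift a m) = (\<Sum>i\<in>UNIV. \<Sum>j\<in>UNIV. m $ i * a $ i $ j * D (shift i j))"
   unfolding mf_drift_shift by (simp add: linear_sum[OF D] linear_scale[OF D])
  also have "\<dots> = (\<Sum>i\<in>UNIV. m $ i * (\<Sum>j\<in>UNIV - {i}. a $ i $ j * ?z i $ j))"
  proof (rule sum.cong[OF refl])
   fix i :: 'd
   have "(shift i i :: real^'d) = 0" by (simp add: shift_def)
   hence "D (shift i i) = 0" using linear_0[OF D] by simp
   thus "(\<Sum>j\<in>UNIV. m $ i * a $ i $ j * D (shift i j)) = m $ i * (\<Sum>j\<in>UNIV - {i}. a $ i $ j * ?z i $ j)"
    by (subst sum.remove[of UNIV i]) (auto simp: sum_distrib_left mult.assoc)
  qed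
  finally show ?thesis by (simp add: PH_def)
 qed
 define K3 where "K3 = CF * (1 + Kd) + KD * Kd * Kd"
 have K30: "0 <= K3" using CF0 Kd0 KD0 by (simp add: K3_def)
 \<comment> \<open>Below \<open>h0\<close> a trajectory neither passes the horizon nor leaves the
   ball of radius \<open>\<delta>\<close>, since its speed is at most \<open>Kd\<close>.\<close>
 define h0 where "h0 = min (T - t) (\<delta> / (Kd + 1))"
 have h0: "0 < h0" using t \<delta> Kd0 by (simp add: h0_def add_nonneg_pos)
 define C' where "C' = K3 + C * (1 + Kd\<^sup>2)"
 text \<open>Along any trajectory the running cost plus the first order change of the value is the pre-Hamiltonian at the starting point.\<close>
 have est: "\<bar>(integral {t..t + h} (\<lambda>s. F s (\<alpha> s) (\<mu> s)) + V (t + h) (\<mu> (t + h)) - V t m) - (vt * h + integral {t..t + h} (\<lambda>s. PH t (\<alpha> s) m ?z))\<bar> <= C' * h\<^sup>2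
   \<and> (\<lambda>s. PH t (\<alpha> s) m ?z) integrable_on {t..t + h}"
  if c: "ctrl \<alpha>" "traj \<alpha> t m \<mu>" and h: "0 < h" "h < h0" for \<alpha> \<mu> h
 proof -
  have th: "t + h \<in> {t..T}" "h < T - t" using h by (auto simp: h0_def)
  have S: "\<mu> s \<in> prob_simplex" "norm (\<mu> s - m) <= Kd * (s - t)" "\<alpha> s \<in> action_matrices M" "s \<in> {0..T}" if "s \<in> {t..t + h}" for s
   using that th t c traj_simplex[OF c(1) tt c(2) m, of s] traj_lip[OF c(1) tt c(2) m, of s] by (auto simp: mf_control_def)
  have Fi: "(\<lambda>s. F s (\<alpha> s) (\<mu> s)) integrable_on {t..t + h}"
   using traj_cost(1)[OF c(1) tt c(2) m] th by (auto intro: integrable_on_subinterval)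
  have "((\<lambda>u. mf_drift (\<alpha> u) (\<mu> u)) has_integral (\<mu> (t + h) - m)) {t..t + h}"
   using c(2) th by (auto simp: mf_trajectory_def)
  from has_integral_linear[OF this bl] have Di: "((\<lambda>u. D (mf_drift (\<alpha> u) (\<mu> u))) has_integral D (\<mu> (t + h) - m)) {t..t + h}"
   by (simp add: o_def)
  have PHi: "(\<lambda>s. PH t (\<alpha> s) m ?z) integrable_on {t..t + h}"
  proof -
   obtain B where B: "\<And>t a m. [|t \<in> {0..T}; a \<in> action_matrices M; m \<in> prob_simplex|] ==> \<bar>F t a m\<bar> <= B" using F_bounded by metis
   have \<alpha>m: "\<alpha> \<in> borel_measurable (restrict_space borel {t..t + h})"
    using c t th unfolding mf_control_def by (intro measurable_restrict_mono[of \<alpha> borel "{0..T}" borel "{t..t + h}"]) auto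
   have "(\<lambda>a. (t, a, m)) ` action_matrices M \<subseteq> {0..T} \<times> action_matrices M \<times> prob_simplex" using tt m by auto
   hence "continuous_on (action_matrices M) ((\<lambda>(t, a, m). F t a m) \<circ> (\<lambda>a. (t, a, m)))"
    by (intro continuous_on_compose continuous_intros continuous_on_subset[OF F_continuous])
   hence Fc: "(\<lambda>a. F t a m) \<in> borel_measurable (restrict_space borel (action_matrices M))"
    by (intro borel_measurable_continuous_on_restrict) (simp add: o_def)
   have "\<alpha> \<in> measurable (restrict_space borel {t..t + h}) (restrict_space borel (action_matrices M))"
    using \<alpha>m by (rule measurable_restrict_space2[rotated]) (use S(3) in \<open>auto simp: space_restrict_space\<close>)
   from measurable_compose[OF this Fc] have "(\<lambda>s. F t (\<alpha> s) m) \<in> borel_measurable (restrict_space borel {t..t + h})" .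
   hence 1: "(\<lambda>s. F t (\<alpha> s) m) integrable_on {t..t + h}"
    by (rule bounded_borel_integrable(2)[where K = B]) (use B tt m S(3) in auto)
   have 2: "(\<lambda>s. \<alpha> s $ i $ j) integrable_on {t..t + h}" for i j
   proof (rule bounded_borel_integrable(2)[where K = M])
    show "(\<lambda>s. \<alpha> s $ i $ j) \<in> borel_measurable (restrict_space borel {t..t + h})"
     using t th by (intro restrict_measurable_mono[OF ctrl_measurable[OF c(1)]]) auto
    show "\<bar>\<alpha> s $ i $ j\<bar> <= M" if "s \<in> {t..t + h}" for s using action_matrices_bounds[OF S(3)[OF that], of i j] by auto
   qed
   show ?thesis unfolding PH_def
    by (intro integrable_add 1 integrable_sum integrable_on_mult_right integrable_on_mult_left 2) auto
  qed
  have "\<bar>(integral {t..t + h} (\<lambda>s. F s (\<alpha> s) (\<mu> s)) + D (\<mu> (t + h) - m)) - integral {t..t + h} (\<lambda>s. PH t (\<alpha> s) m ?z)\<bar> <= (K3 * h) * (t + h - t)"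
  proof (rule has_integral_abs_le)
   show "((\<lambda>s. (F s (\<alpha> s) (\<mu> s) + D (mf_drift (\<alpha> s) (\<mu> s))) - PH t (\<alpha> s) m ?z) has_integral
     ((integral {t..t + h} (\<lambda>s. F s (\<alpha> s) (\<mu> s)) + D (\<mu> (t + h) - m)) - integral {t..t + h} (\<lambda>s. PH t (\<alpha> s) m ?z))) {t..t + h}"
    by (intro has_integral_diff has_integral_add integrable_integral Fi Di PHi)
   fix s assume s: "s \<in> {t..t + h}"
   note S = S[OF s]
   have nm: "norm (\<mu> s - m) <= Kd * h" using S(2) s Kd0 mult_left_mono[of "s - t" h Kd] by auto
   have "\<bar>F s (\<alpha> s) (\<mu> s) - F t (\<alpha> s) m\<bar> <= CF * (\<bar>s - t\<bar> + norm (\<mu> s - m))"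
    by (rule F_lip[OF S(4) tt S(3,1) m])
   also have "\<dots> <= CF * (h + Kd * h)" using nm s CF0 by (intro mult_left_mono add_mono) auto
   finally have 1: "\<bar>F s (\<alpha> s) (\<mu> s) - F t (\<alpha> s) m\<bar> <= CF * (1 + Kd) * h" by (simp add: algebra_simps)
   have "\<bar>D (mf_drift (\<alpha> s) (\<mu> s)) - D (mf_drift (\<alpha> s) m)\<bar> = \<bar>D (mf_drift (\<alpha> s) (\<mu> s - m))\<bar>"
    unfolding mf_drift_diff linear_diff[OF D] ..
   also have "\<dots> <= KD * norm (mf_drift (\<alpha> s) (\<mu> s - m))" by (rule KD)
   also have "\<dots> <= KD * (Kd * norm (\<mu> s - m))" using KD0 norm_drift_le[OF S(3)] by (intro mult_left_mono)
   also have "\<dots> <= KD * (Kd * (Kd * h))" using KD0 Kd0 nm by (intro mult_left_mono)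
   finally have 2: "\<bar>D (mf_drift (\<alpha> s) (\<mu> s)) - D (mf_drift (\<alpha> s) m)\<bar> <= KD * Kd * Kd * h" by (simp add: mult.assoc)
   show "\<bar>(F s (\<alpha> s) (\<mu> s) + D (mf_drift (\<alpha> s) (\<mu> s))) - PH t (\<alpha> s) m ?z\<bar> <= K3 * h"
    unfolding PHD K3_def distrib_right using 1 2 by linarith
  qed (use h in auto)
  hence a1: "\<bar>(integral {t..t + h} (\<lambda>s. F s (\<alpha> s) (\<mu> s)) + D (\<mu> (t + h) - m)) - integral {t..t + h} (\<lambda>s. PH t (\<alpha> s) m ?z)\<bar> <= K3 * h\<^sup>2"
   by (simp add: power2_eq_square mult.assoc)
  have e: "t + h \<in> {t..t + h}" using h by simp
  have nm: "norm (\<mu> (t + h) - m) <= Kd * h" using S(2)[OF e] by simp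
  have "Kd * h < \<delta>"
  proof -
   have "(Kd + 1) * h < \<delta>" using h Kd0 by (simp add: h0_def pos_less_divide_eq mult.commute)
   thus ?thesis using h by (simp add: distrib_right)
  qed
  hence "\<bar>V (t + h) (\<mu> (t + h)) - V t m - vt * (t + h - t) - D (\<mu> (t + h) - m)\<bar> <= C * ((t + h - t)\<^sup>2 + (norm (\<mu> (t + h) - m))\<^sup>2)"
   using nm by (intro taylor th S(1)[OF e]) auto
  also have "\<dots> <= C * (h\<^sup>2 + (Kd * h)\<^sup>2)" using nm C0 h by (intro mult_left_mono add_mono power_mono) auto
  also have "\<dots> = C * (1 + Kd\<^sup>2) * h\<^sup>2" by (simp add: power_mult_distrib algebra_simps)
  finally have a2: "\<bar>V (t + h) (\<mu> (t + h)) - V t m - vt * h - D (\<mu> (t + h) - m)\<bar> <= C * (1 + Kd\<^sup>2) * h\<^sup>2" by simp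
  show ?thesis using a1 a2 PHi unfolding C'_def distrib_right by linarith
 qed
 have lower: "0 <= vt + ham t m ?z"
 proof (rule field_le_epsilon)
  fix eps :: real assume e: "0 < eps"
  have C'0: "0 <= C'" using K30 C0 by (simp add: C'_def)
  define h where "h = min (h0 / 2) (eps / (C' + 1))"
  have h: "0 < h" "h < h0" using h0 e C'0 by (auto simp: h_def add_nonneg_pos)
  have Ch: "C' * h <= eps"
  proof -
   have "(C' + 1) * h <= eps"
  proof -
   have "h <= eps / (C' + 1)" by (simp add: h_def)
   hence "(C' + 1) * h <= (C' + 1) * (eps / (C' + 1))" using C'0 by (intro mult_left_mono) auto
   also have "\<dots> = eps" using C'0 by simp
   finally show ?thesis .
  qed
   thus ?thesis using h by (simp add: distrib_right)
  qed
  define a where "a = opt_matrix t m ?z"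
  have ca: "ctrl (\<lambda>_. a)" unfolding a_def by (intro const_ctrl opt_matrix_in tt m)
  obtain \<mu> where tr: "traj (\<lambda>_. a) t m \<mu>" by (rule traj_exists[OF ca tt])
  have "V t m <= integral {t..t + h} (\<lambda>s. F s a (\<mu> s)) + V (t + h) (\<mu> (t + h))"
   by (rule dpp_sub[OF t(1) _ _ m ca tr]) (use h h0_def in auto)
  moreover have "integral {t..t + h} (\<lambda>s. PH t a m ?z) = h * ham t m ?z" using h by (simp add: ham_def a_def)
  ultimately have "0 <= vt * h + h * ham t m ?z + C' * h\<^sup>2" using est[OF ca tr h] by linarith
  hence "0 <= h * (vt + ham t m ?z + C' * h)" by (simp add: algebra_simps power2_eq_square)
  hence "0 <= vt + ham t m ?z + C' * h" using h by (simp add: zero_le_mult_iff)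
  thus "0 <= vt + ham t m ?z + eps" using Ch by linarith
 qed
 have upper: "vt + ham t m ?z <= 0"
 proof (rule field_le_epsilon)
  fix eps :: real assume e: "0 < eps"
  have C'0: "0 <= C'" using K30 C0 by (simp add: C'_def)
  define h where "h = min (h0 / 2) (eps / (C' + 1))"
  have h: "0 < h" "h < h0" using h0 e C'0 by (auto simp: h_def add_nonneg_pos)
  have Ch: "(C' + 1) * h <= eps"
  proof -
   have "h <= eps / (C' + 1)" by (simp add: h_def)
   hence "(C' + 1) * h <= (C' + 1) * (eps / (C' + 1))" using C'0 by (intro mult_left_mono) auto
   also have "\<dots> = eps" using C'0 by simp
   finally show ?thesis .
  qed
  have "0 < h\<^sup>2" using h by simp
  \<comment> \<open>The tolerance \<open>h^2\<close> has the order of the other errors and still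
    vanishes after division by \<open>h\<close>.\<close>
  obtain \<alpha> \<mu> where c: "ctrl \<alpha>" "traj \<alpha> t m \<mu>" and le: "integral {t..t + h} (\<lambda>s. F s (\<alpha> s) (\<mu> s)) + V (t + h) (\<mu> (t + h)) <= V t m + h\<^sup>2"
   by (rule dpp_super[of t "t + h" m "h\<^sup>2"]) (use t h h0_def m in auto)
  have "((\<lambda>s. ham t m ?z) has_integral (h * ham t m ?z)) {t..t + h}"
   using has_integral_const_real[of "ham t m ?z" t "t + h"] h by simp
  moreover have "((\<lambda>s. PH t (\<alpha> s) m ?z) has_integral integral {t..t + h} (\<lambda>s. PH t (\<alpha> s) m ?z)) {t..t + h}"
   using est[OF c h] by (intro integrable_integral) auto
  ultimately have "h * ham t m ?z <= integral {t..t + h} (\<lambda>s. PH t (\<alpha> s) m ?z)"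
  proof (rule has_integral_le)
   fix s assume "s \<in> {t..t + h}"
   hence "\<alpha> s \<in> action_matrices M" using c(1) t h by (auto simp: mf_control_def h0_def)
   thus "ham t m ?z <= PH t (\<alpha> s) m ?z" unfolding ham_def by (rule PH_min[OF tt m])
  qed
  hence "vt * h + h * ham t m ?z <= C' * h\<^sup>2 + h\<^sup>2" using est[OF c h] le by linarith
  hence "h * (vt + ham t m ?z) <= h * ((C' + 1) * h)" by (simp add: algebra_simps power2_eq_square)
  hence "vt + ham t m ?z <= (C' + 1) * h" using h by simp
  thus "vt + ham t m ?z <= 0 + eps" using Ch by linarith
 qed
 show ?thesis using lower upper by linarith
qed

end

text \<open>What the rest of the proof takes from the regularity hypothesis, free of charts.
  \<open>U\<close> is the extension of the value to the closed simplex, \<open>ut\<close> its time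
  derivative and \<open>z i\<close> its gradient along the directions \<open>shift i j\<close>.
  \<open>z_grad\<close> ties \<open>z\<close> to \<open>mf_value\<close>, through which the mean
  field feedback is defined.\<close>

locale regular_value = cost_data T M f g CF CG LD \<kappa> Df
 for T M and f :: "('d::finite) running_cost" and g CF CG LD \<kappa> Df +
 fixes U :: "real => real^'d => real" and ut :: "real => real^'d => real" and z :: "'d => real => real^'d => real^'d" and LU :: real
 assumes LU0: "0 <= LU"
  and U_time: "\<And>t s m. [|t \<in> {0..T}; s \<in> {0..T}; m \<in> prob_simplex|] ==> \<bar>U s m - U t m - ut t m * (s - t)\<bar> <= LU * (s - t)\<^sup>2"
  and U_space: "\<And>t m h i j. [|t \<in> {0..T}; m \<in> prob_simplex; m + h *\<^sub>R shift i j \<in> prob_simplex|]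
    ==> \<bar>U t (m + h *\<^sub>R shift i j) - U t m - h * z i t m $ j\<bar> <= LU * h\<^sup>2"
  and U_terminal: "\<And>m. m \<in> prob_simplex ==> U T m = total_terminal g m"
  and z_grad: "\<And>i t m. [|t \<in> {0..T}; m \<in> prob_simplex|] ==> simplex_grad i (mf_value T M f g t) m = z i t m"
  and z_lip: "\<And>i t s m p. [|t \<in> {0..T}; s \<in> {0..T}; m \<in> prob_simplex; p \<in> prob_simplex|]
    ==> norm (z i t m - z i s p) <= LU * (\<bar>t - s\<bar> + norm (m - p))"
  and z_bound: "\<And>i t m. [|t \<in> {0..T}; m \<in> prob_simplex|] ==> norm (z i t m) <= LU"
  and ut_lip: "\<And>t s m. [|t \<in> {0..T}; s \<in> {0..T}; m \<in> prob_simplex|] ==> \<bar>ut t m - ut s m\<bar> <= LU * \<bar>t - s\<bar>"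
  and ut_bound: "\<And>t m. [|t \<in> {0..T}; m \<in> prob_simplex|] ==> \<bar>ut t m\<bar> <= LU"
  and hjb: "\<And>t m. [|t \<in> {0..T}; m \<in> prob_simplex|] ==> ut t m + ham t m (\<lambda>i. z i t m) = 0"

subsection \<open>The chart of the simplex\<close>

definition prj :: "real^('n::finite option) => real^'n" where "prj m = (\<chi> j. m $ Some j)"

text \<open>Strict inequalities in place of \<open>interior hat_simplex\<close>: the set is open,
  convex and dense in \<open>hat_simplex\<close>, and its inclusion in the interior makes the
  derivatives available on it.\<close>

definition inner_hat :: "(real^'n::finite) set" where "inner_hat = {x. (\<forall>j. 0 < x $ j) \<and> (\<Sum>j\<in>UNIV. x $ j) < 1}"

lemma sum_option: "(\<Sum>k\<in>(UNIV :: 'n::finite option set). h k) = h None + (\<Sum>j\<in>UNIV. h (Some j))"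
 unfolding UNIV_option_conv by (subst sum.insert) (auto simp: sum.reindex)

lemma linear_prj: "linear prj"
 by (rule linearI) (simp_all add: prj_def vec_eq_iff)

lemma prj_chart [simp]: "prj (chart x) = x"
 by (simp add: prj_def chart_def vec_eq_iff)

lemma chart_prj: assumes "m \<in> prob_simplex" shows "chart (prj m) = m"
proof (rule vec_eq_iff[THEN iffD2, rule_format])
 fix k show "chart (prj m) $ k = m $ k"
  using assms by (cases k) (auto simp: chart_def prj_def prob_simplex_def sum_option)
qed

lemma chart_simplex: "x \<in> hat_simplex ==> chart x \<in> prob_simplex"
 by (auto simp: prob_simplex_def hat_simplex_def chart_def sum_option split: option.splits)

lemma prj_hat: assumes "m \<in> prob_simplex" shows "prj m \<in> hat_simplex"
proof -
 have "0 <= m $ None" "m $ None + (\<Sum>j\<in>UNIV. m $ Some j) = 1"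
  using simplex_coord(1)[OF assms] assms by (auto simp: prob_simplex_def sum_option)
 hence "(\<Sum>j\<in>UNIV. m $ Some j) <= 1" by linarith
 thus ?thesis using simplex_coord(1)[OF assms] by (simp add: hat_simplex_def prj_def)
qed

lemma chart_interior: "x \<in> inner_hat ==> chart x \<in> simplex_interior"
 unfolding simplex_interior_def using chart_simplex[of x]
 by (auto simp: inner_hat_def hat_simplex_def chart_def less_imp_le split: option.splits)

lemma prj_interior: "m \<in> simplex_interior ==> prj m \<in> inner_hat"
proof -
 assume m: "m \<in> simplex_interior"
 hence "0 < m $ None" "m $ None + (\<Sum>j\<in>UNIV. m $ Some j) = 1" by (auto simp: simplex_interior_def prob_simplex_def sum_option)
 hence "(\<Sum>j\<in>UNIV. m $ Some j) < 1" by linarith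
 thus ?thesis using m by (simp add: inner_hat_def prj_def simplex_interior_def)
qed

lemma norm_prj_le: "norm (prj v) <= norm (v :: real^('n::finite option))"
proof -
 have "(norm (prj v))\<^sup>2 <= (norm v)\<^sup>2"
  unfolding power2_norm_eq_inner inner_vec_def by (simp add: sum_option prj_def)
 thus ?thesis by (rule power2_le_imp_le) simp
qed

lemma open_inner_hat: "open (inner_hat :: (real^'n::finite) set)"
proof -
 have "inner_hat = (\<Inter>j. {x :: real^'n. 0 < x $ j}) \<inter> {x. (\<Sum>j\<in>UNIV. x $ j) < 1}" by (auto simp: inner_hat_def)
 also have "open \<dots>" by (intro open_Int open_INT ballI open_Collect_less continuous_intros) auto
 finally show ?thesis .
qed

lemma inner_hat_sub: "inner_hat \<subseteq> hat_simplex"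
 by (auto simp: inner_hat_def hat_simplex_def less_imp_le)

lemma inner_hat_interior: "inner_hat \<subseteq> interior hat_simplex"
 by (rule interior_maximal[OF inner_hat_sub open_inner_hat])

lemma convex_inner_hat: "convex (inner_hat :: (real^'n::finite) set)"
proof (rule convexI)
 fix x y :: "real^'n" and u v :: real assume h: "x \<in> inner_hat" "y \<in> inner_hat" "0 <= u" "0 <= v" "u + v = 1"
 have pos: "0 < u * a + v * b" if "0 < a" "0 < b" for a b
  using that h(3-5) by (cases "u = 0") (auto intro: add_pos_nonneg)
 have "(\<Sum>j\<in>UNIV. (u *\<^sub>R x + v *\<^sub>R y) $ j) = u * (\<Sum>j\<in>UNIV. x $ j) + v * (\<Sum>j\<in>UNIV. y $ j)"
  by (simp add: sum.distrib sum_distrib_left)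
 also have "\<dots> < 1"
  using pos[of "1 - (\<Sum>j\<in>UNIV. x $ j)" "1 - (\<Sum>j\<in>UNIV. y $ j)"] h by (simp add: inner_hat_def algebra_simps)
 finally show "u *\<^sub>R x + v *\<^sub>R y \<in> inner_hat" using h pos by (auto simp: inner_hat_def)
qed

lemma closed_hat_simplex: "closed (hat_simplex :: (real^'n::finite) set)"
proof -
 have "hat_simplex = (\<Inter>j. {x :: real^'n. 0 <= x $ j}) \<inter> {x. (\<Sum>j\<in>UNIV. x $ j) <= 1}" by (auto simp: hat_simplex_def)
 also have "closed \<dots>" by (intro closed_Int closed_INT ballI closed_Collect_le continuous_intros)
 finally show ?thesis .
qed

definition centre :: "real^'n::finite" where "centre = (\<chi> j. 1 / (real CARD('n) + 1))"

lemma centre_inner: "centre \<in> inner_hat"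
proof -
 have "(\<Sum>j\<in>(UNIV::'n set). 1 / (real CARD('n) + 1)) < 1" by (simp add: divide_less_eq add_nonneg_pos)
 thus ?thesis by (simp add: inner_hat_def centre_def add_nonneg_pos)
qed

lemma towards_centre:
 fixes x :: "real^'n::finite"
 assumes x: "x \<in> hat_simplex" and e: "0 < eps" "eps <= 1"
 shows "x + eps *\<^sub>R (centre - x) \<in> inner_hat"
proof -
 have c: "0 < (centre :: real^'n) $ j" "(\<Sum>j\<in>UNIV. (centre :: real^'n) $ j) < 1" for j using centre_inner by (auto simp: inner_hat_def)
 have "0 < (x + eps *\<^sub>R (centre - x)) $ j" for j
 proof -
  have "(x + eps *\<^sub>R (centre - x)) $ j = (1 - eps) * x $ j + eps * centre $ j" by (simp add: algebra_simps)
  thus ?thesis using x e c(1)[of j] by (simp add: hat_simplex_def add_nonneg_pos)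
 qed
 moreover have "(\<Sum>j\<in>UNIV. (x + eps *\<^sub>R (centre - x)) $ j) < 1"
 proof -
  have "(\<Sum>j\<in>UNIV. (x + eps *\<^sub>R (centre - x)) $ j) = (1 - eps) * (\<Sum>j\<in>UNIV. x $ j) + eps * (\<Sum>j\<in>UNIV. (centre :: real^'n) $ j)"
   by (simp add: sum.distrib sum_subtractf sum_distrib_left[symmetric] algebra_simps)
  also have "\<dots> < (1 - eps) * 1 + eps * 1"
   using x e c(2) by (intro add_le_less_mono mult_left_mono mult_strict_left_mono) (auto simp: hat_simplex_def)
  finally show ?thesis by simp
 qed
 ultimately show ?thesis by (simp add: inner_hat_def)
qed

lemma closure_inner_hat: "closure inner_hat = (hat_simplex :: (real^'n::finite) set)"
proof
 show "closure inner_hat \<subseteq> (hat_simplex :: (real^'n) set)" by (rule closure_minimal[OF inner_hat_sub closed_hat_simplex])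
 show "hat_simplex \<subseteq> closure (inner_hat :: (real^'n) set)"
 proof
  fix x :: "real^'n" assume x: "x \<in> hat_simplex"
  have "(\<lambda>n. x + (1 / real (Suc n)) *\<^sub>R (centre - x)) \<longlonglongrightarrow> x + 0 *\<^sub>R (centre - x)"
   by (intro tendsto_intros LIMSEQ_inverse_real_of_nat[unfolded inverse_eq_divide])
  hence "(\<lambda>n. x + (1 / real (Suc n)) *\<^sub>R (centre - x)) \<longlonglongrightarrow> x" by simp
  moreover have "x + (1 / real (Suc n)) *\<^sub>R (centre - x) \<in> inner_hat" for n by (rule towards_centre[OF x]) auto
  ultimately show "x \<in> closure inner_hat" unfolding closure_sequential
   by (intro exI[of _ "\<lambda>n. x + (1 / real (Suc n)) *\<^sub>R (centre - x)"]) simp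
 qed
qed

lemma compact_hat_simplex: "compact (hat_simplex :: (real^'n::finite) set)"
proof -
 have "hat_simplex = prj ` (prob_simplex :: (real^('n option)) set)"
  using prj_hat chart_simplex prj_chart by (metis (no_types, lifting) image_eqI image_subset_iff subsetI subset_antisym)
 moreover have "compact (prj ` (prob_simplex :: (real^('n option)) set))"
  by (intro compact_continuous_image compact_simplex linear_continuous_on) (simp add: linear_conv_bounded_linear[symmetric] linear_prj)
 ultimately show ?thesis by simp
qed

context cost_data begin

text \<open>As \<open>ham_lip\<close>, but with the point of the simplex varying too; the last term
  accounts for the changed weights in front of \<open>y i\<close>. It carries the
  Hamilton-Jacobi-Bellman equation to the faces by continuity.\<close>

lemma ham_lip_joint:
 assumes t: "t \<in> {0..T}" and s: "s \<in> {0..T}" and m: "m \<in> prob_simplex" and p: "p \<in> prob_simplex"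
 shows "\<bar>ham t m z - ham s p y\<bar> <= CF * (\<bar>t - s\<bar> + norm (m - p)) + M * (\<Sum>i\<in>UNIV. \<Sum>j\<in>UNIV - {i}. \<bar>z i $ j - y i $ j\<bar>)
   + norm (m - p) * (M * (\<Sum>i\<in>UNIV. \<Sum>j\<in>UNIV - {i}. \<bar>y i $ j\<bar>))"
proof -
 let ?R = "CF * (\<bar>t - s\<bar> + norm (m - p)) + M * (\<Sum>i\<in>UNIV. \<Sum>j\<in>UNIV - {i}. \<bar>z i $ j - y i $ j\<bar>)
   + norm (m - p) * (M * (\<Sum>i\<in>UNIV. \<Sum>j\<in>UNIV - {i}. \<bar>y i $ j\<bar>))"
 have d: "\<bar>PH t a m z - PH s a p y\<bar> <= ?R" if a: "a \<in> action_matrices M" for a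
 proof -
  define Q where "Q = (\<Sum>i\<in>UNIV. (m - p) $ i * (\<Sum>j\<in>UNIV - {i}. a $ i $ j * y i $ j))"
  have "PH t a m z - PH s a p y = (PH t a m z - PH t a m y) + (F t a m - F s a p) + Q"
   by (simp add: PH_def Q_def left_diff_distrib sum_subtractf)
  moreover have "\<bar>Q\<bar> <= (\<Sum>i\<in>UNIV. norm (m - p) * (M * (\<Sum>j\<in>UNIV - {i}. \<bar>y i $ j\<bar>)))"
   unfolding Q_def
  proof (rule order_trans[OF sum_abs sum_mono])
   fix i
   have "\<bar>\<Sum>j\<in>UNIV - {i}. a $ i $ j * y i $ j\<bar> <= (\<Sum>j\<in>UNIV - {i}. M * \<bar>y i $ j\<bar>)"
   proof (rule order_trans[OF sum_abs sum_mono])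
    fix j show "\<bar>a $ i $ j * y i $ j\<bar> <= M * \<bar>y i $ j\<bar>"
     unfolding abs_mult using action_matrices_bounds[OF a, of i j] by (intro mult_right_mono) auto
   qed
   thus "\<bar>(m - p) $ i * (\<Sum>j\<in>UNIV - {i}. a $ i $ j * y i $ j)\<bar> <= norm (m - p) * (M * (\<Sum>j\<in>UNIV - {i}. \<bar>y i $ j\<bar>))"
    unfolding abs_mult sum_distrib_left[symmetric] by (intro mult_mono component_le_norm_cart) auto
  qed
  ultimately show ?thesis using PH_lip_z[OF m a, of t z y] F_lip[OF t s a m p] by (simp add: sum_distrib_left)
 qed
 have "ham t m z <= PH t (opt_matrix s p y) m z" unfolding ham_def by (intro PH_min opt_matrix_in t s m p)
 moreover have "ham s p y <= PH s (opt_matrix t m z) p y" unfolding ham_def by (intro PH_min opt_matrix_in t s m p)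
 ultimately show ?thesis
  using d[OF opt_matrix_in[OF t m, of z]] d[OF opt_matrix_in[OF s p, of y]] unfolding ham_def by linarith
qed

end

subsection \<open>Extension of the value function to the closed simplex\<close>

locale smooth_value = cost_data T M f g CF CG LD \<kappa> Df
 for T M and f :: "('n::finite option) running_cost" and g CF CG LD \<kappa> Df +
 fixes vt :: "real \<times> (real^'n) => real" and vx :: "real \<times> (real^'n) => real^'n" and L :: real
 assumes V_deriv: "\<forall>t\<in>{0..T}. \<forall>x\<in>interior hat_simplex.
      ((\<lambda>(s, y). mf_value T M f g s (chart y)) has_derivative (\<lambda>(h, k). vt (t, x) * h + vx (t, x) \<bullet> k))
       (at (t, x) within {0..T} \<times> interior hat_simplex)"
  and vt_lip: "L-lipschitz_on ({0..T} \<times> hat_simplex) vt"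
  and vx_lip: "L-lipschitz_on ({0..T} \<times> hat_simplex) vx"
begin

definition "W = (\<lambda>(s, y). V s (chart y :: real^'n option))"
definition "OP = {0..T} \<times> (inner_hat :: (real^'n) set)"
definition "CL = {0..T} \<times> (hat_simplex :: (real^'n) set)"

lemma closure_OP: "closure OP = CL" by (simp add: OP_def CL_def closure_Times closure_inner_hat)
lemma OP_CL: "OP \<subseteq> CL" using closure_subset[of OP] closure_OP by simp
lemma convex_OP: "convex OP" unfolding OP_def by (intro convex_Times convex_inner_hat) simp
lemma L0: "0 <= L" using vt_lip by (rule lipschitz_on_nonneg)

lemma W_deriv:
 assumes "a \<in> OP" "S \<subseteq> OP"
 shows "(W has_derivative (\<lambda>w. vt a * fst w + vx a \<bullet> snd w)) (at a within S)"
proof -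
 have a: "fst a \<in> {0..T}" "snd a \<in> interior hat_simplex" using assms(1) inner_hat_interior by (auto simp: OP_def)
 have "((\<lambda>(s, y). V s (chart y)) has_derivative (\<lambda>(h, k). vt (fst a, snd a) * h + vx (fst a, snd a) \<bullet> k))
       (at (fst a, snd a) within {0..T} \<times> interior hat_simplex)" using V_deriv a by blast
 hence "(W has_derivative (\<lambda>w. vt a * fst w + vx a \<bullet> snd w)) (at a within {0..T} \<times> interior hat_simplex)"
  by (simp add: W_def case_prod_unfold)
 thus ?thesis by (rule has_derivative_subset) (use assms(2) inner_hat_interior in \<open>auto simp: OP_def\<close>)
qed

lemma lin_onorm: "onorm (\<lambda>w :: real \<times> (real^'n). c * fst w + e \<bullet> snd w) <= \<bar>c\<bar> + norm e" for c :: real and e :: "real^'n"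
proof (rule onorm_bound)
 fix w :: "real \<times> (real^'n)"
 have "norm (c * fst w + e \<bullet> snd w) <= \<bar>c\<bar> * norm (fst w) + norm e * norm (snd w)"
  using abs_triangle_ineq[of "c * fst w" "e \<bullet> snd w"] Cauchy_Schwarz_ineq2[of e "snd w"] by (simp add: abs_mult)
 also have "\<dots> <= \<bar>c\<bar> * norm w + norm e * norm w"
  using norm_fst_le[of "fst w" "snd w"] norm_snd_le[of "snd w" "fst w"] by (intro add_mono mult_left_mono) auto
 finally show "norm (c * fst w + e \<bullet> snd w) <= (\<bar>c\<bar> + norm e) * norm w" by (simp add: distrib_right)
qed simp

text \<open>Mean value inequality for \<open>W\<close> minus its linear part at \<open>a\<close>, on
  the segment from \<open>a\<close> to \<open>b\<close>, where both derivatives change by at most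
  \<open>L * norm (b - a)\<close>; the factor 2 counts the time part and the space part.\<close>

lemma W_taylor:
 assumes a: "a \<in> OP" and b: "b \<in> OP"
 shows "\<bar>W b - W a - vt a * (fst b - fst a) - vx a \<bullet> (snd b - snd a)\<bar> <= 2 * L * (norm (b - a))\<^sup>2"
proof -
 let ?S = "closed_segment a b"
 have S: "?S \<subseteq> OP" using a b convex_OP by (rule closed_segment_subset)
 define \<Phi> where "\<Phi> w = W w - (vt a * fst w + vx a \<bullet> snd w)" for w
 have "norm (\<Phi> b - \<Phi> a) <= (2 * L * norm (b - a)) * norm (b - a)"
 proof (rule differentiable_bound[where S = ?S and f' = "\<lambda>c w. (vt c - vt a) * fst w + (vx c - vx a) \<bullet> snd w"])
  fix c assume c: "c \<in> ?S"
  have "(\<Phi> has_derivative (\<lambda>w. (vt c * fst w + vx c \<bullet> snd w) - (vt a * fst w + vx a \<bullet> snd w))) (at c within ?S)"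
   unfolding \<Phi>_def using c S
   by (intro has_derivative_diff W_deriv has_derivative_add has_derivative_mult_right has_derivative_inner_right has_derivative_fst has_derivative_snd has_derivative_ident) auto
  thus "(\<Phi> has_derivative (\<lambda>w. (vt c - vt a) * fst w + (vx c - vx a) \<bullet> snd w)) (at c within ?S)"
   by (simp add: algebra_simps inner_diff_left)
  have cl: "c \<in> CL" "a \<in> CL" using c S a OP_CL by auto
  have "\<bar>vt c - vt a\<bar> <= L * norm (c - a)" using lipschitz_onD[OF vt_lip, of c a] cl by (simp add: CL_def dist_norm)
  moreover have "norm (vx c - vx a) <= L * norm (c - a)" using lipschitz_onD[OF vx_lip, of c a] cl by (simp add: CL_def dist_norm)
  moreover have "L * norm (c - a) <= L * norm (b - a)" using segment_bound(1)[OF c] L0 by (intro mult_left_mono) auto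
  ultimately show "onorm (\<lambda>w. (vt c - vt a) * fst w + (vx c - vx a) \<bullet> snd w) <= 2 * L * norm (b - a)"
   using lin_onorm[of "vt c - vt a" "vx c - vx a"] by linarith
 qed auto
 moreover have "\<Phi> b - \<Phi> a = W b - W a - vt a * (fst b - fst a) - vx a \<bullet> (snd b - snd a)"
  by (simp add: \<Phi>_def algebra_simps inner_diff_right)
 ultimately show ?thesis by (simp add: power2_eq_square)
qed

lemma compact_CL: "compact CL" unfolding CL_def by (intro compact_Times compact_Icc compact_hat_simplex)

lemma v_bounds: obtains B where "0 <= B" "\<forall>a\<in>CL. \<bar>vt a\<bar> <= B" "\<forall>a\<in>CL. norm (vx a) <= B"
proof -
 have "bounded (vt ` CL)" "bounded (vx ` CL)"
  using lipschitz_on_continuous_on[OF vt_lip] lipschitz_on_continuous_on[OF vx_lip]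
  by (auto intro!: compact_imp_bounded compact_continuous_image compact_CL simp: CL_def[symmetric])
 then obtain B1 B2 where "\<And>a. a \<in> CL ==> norm (vt a) <= B1" "\<And>a. a \<in> CL ==> norm (vx a) <= B2"
  unfolding bounded_iff by (metis image_eqI)
 thus ?thesis by (intro that[of "max 0 (max B1 B2)"]) (auto simp: le_max_iff_disj)
qed

lemma W_uniformly_continuous: "uniformly_continuous_on OP W"
proof -
 obtain B where B0: "0 <= B" "\<forall>a\<in>CL. \<bar>vt a\<bar> <= B" "\<forall>a\<in>CL. norm (vx a) <= B" by (rule v_bounds)
 note B = B0(1) B0(2)[rule_format] B0(3)[rule_format]
 have "(2 * B)-lipschitz_on OP W"
 proof (rule lipschitz_onI)
  fix a b assume ab: "a \<in> OP" "b \<in> OP"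
  have "norm (W a - W b) <= (2 * B) * norm (a - b)"
  proof (rule differentiable_bound[OF convex_OP _ _ ab])
   fix c assume c: "c \<in> OP"
   show "(W has_derivative (\<lambda>w. vt c * fst w + vx c \<bullet> snd w)) (at c within OP)" by (rule W_deriv[OF c]) simp
   show "onorm (\<lambda>w. vt c * fst w + vx c \<bullet> snd w) <= 2 * B"
    using lin_onorm[of "vt c" "vx c"] B(2,3)[of c] c OP_CL by auto
  qed
  thus "dist (W a) (W b) <= 2 * B * dist a b" by (simp add: dist_norm)
 qed (use B in simp)
 thus ?thesis by (rule lipschitz_on_uniformly_continuous)
qed

text \<open>Smoothness of \<open>V\<close> is known only inside, so a continuous extension
  \<open>We\<close> takes its place on the faces. The Taylor bound is a closed condition on pairs of
  points and survives passage to the closure.\<close>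

lemma W_extension:
 obtains We where "continuous_on CL We" "\<forall>a\<in>OP. We a = W a"
  "\<forall>a\<in>CL. \<forall>b\<in>CL. \<bar>We b - We a - vt a * (fst b - fst a) - vx a \<bullet> (snd b - snd a)\<bar> <= 2 * L * (norm (b - a))\<^sup>2"
proof -
 have "\<exists>We. uniformly_continuous_on (closure OP) We \<and> (\<forall>a\<in>OP. W a = We a)"
 proof (rule uniformly_continuous_on_extension_on_closure[OF W_uniformly_continuous])
  fix g assume "uniformly_continuous_on (closure OP) g" and "\<And>x. x \<in> OP ==> W x = g x"
  thus ?thesis by (intro exI[of _ g]) simp
 qed
 then obtain We where We0: "uniformly_continuous_on (closure OP) We" "\<forall>a\<in>OP. W a = We a" by (elim exE conjE)
 note We = We0(1) We0(2)[rule_format]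
 have cW: "continuous_on CL We" using uniformly_continuous_imp_continuous[OF We(1)] unfolding closure_OP .
 have cvt: "continuous_on CL vt" and cvx: "continuous_on CL vx"
  using lipschitz_on_continuous_on[OF vt_lip] lipschitz_on_continuous_on[OF vx_lip] by (auto simp: CL_def)
 define h where "h w = \<bar>We (snd w) - We (fst w) - vt (fst w) * (fst (snd w) - fst (fst w)) - vx (fst w) \<bullet> (snd (snd w) - snd (fst w))\<bar>
   - 2 * L * (norm (snd w - fst w))\<^sup>2" for w
 have cl: "closure (OP \<times> OP) = CL \<times> CL" by (simp add: closure_Times closure_OP)
 have pr: "continuous_on (CL \<times> CL) fst" "continuous_on (CL \<times> CL) snd" by (intro continuous_intros)+
 have c: "continuous_on (CL \<times> CL) (\<lambda>x. We (fst x))" "continuous_on (CL \<times> CL) (\<lambda>x. We (snd x))"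
   "continuous_on (CL \<times> CL) (\<lambda>x. vt (fst x))" "continuous_on (CL \<times> CL) (\<lambda>x. vx (fst x))"
  using pr by (auto intro: continuous_on_compose2[OF cW] continuous_on_compose2[OF cvt] continuous_on_compose2[OF cvx])
 have ch: "continuous_on (closure (OP \<times> OP)) h"
  unfolding cl h_def
  by (intro continuous_intros c)
 have "h w <= 0" if "w \<in> CL \<times> CL" for w
 proof (rule continuous_le_on_closure[OF ch])
  show "w \<in> closure (OP \<times> OP)" using that cl by simp
  fix v assume "v \<in> OP \<times> OP"
  hence v: "fst v \<in> OP" "snd v \<in> OP" by auto
  show "h v <= 0" using W_taylor[OF v] unfolding h_def We(2)[OF v(1), symmetric] We(2)[OF v(2), symmetric] by linarith
 qed
 hence h: "h (a, b) <= 0" if "a \<in> CL" "b \<in> CL" for a b using that by (simp add: mem_Times_iff)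
 have "\<bar>We b - We a - vt a * (fst b - fst a) - vx a \<bullet> (snd b - snd a)\<bar> <= 2 * L * (norm (b - a))\<^sup>2" if "a \<in> CL" "b \<in> CL" for a b
  using h[OF that] unfolding h_def fst_conv snd_conv by linarith
 thus ?thesis by (intro that[of We] cW ballI We(2)[symmetric])
qed

text \<open>Derivatives along \<open>shift i j\<close> read off from the gradient in the chart:
  \<open>prj\<close> maps a tangent vector of the simplex to its first coordinates.\<close>

definition "zg a i = (\<chi> j. vx a \<bullet> prj (shift i j))"

lemma hjb_inner:
 assumes a: "t \<in> {0..<T}" "x \<in> inner_hat"
 shows "vt (t, x) + ham t (chart x) (zg (t, x)) = 0"
proof -
 have x: "chart x \<in> prob_simplex" using a inner_hat_sub chart_simplex by blast
 obtain \<delta> where \<delta>: "0 < \<delta>" "ball x \<delta> \<subseteq> inner_hat" using open_inner_hat a(2) openE by blast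
 have ax: "(t, x) \<in> OP" using a by (auto simp: OP_def)
 have "vt (t, x) + ham t (chart x) (\<lambda>i. \<chi> j. vx (t, x) \<bullet> prj (shift i j)) = 0"
 proof (rule hjb_local[where D = "\<lambda>v. vx (t, x) \<bullet> prj v" and KD = "norm (vx (t, x))" and \<delta> = \<delta> and C = "2 * L"])
  show "linear (\<lambda>v. vx (t, x) \<bullet> prj v)"
   using linear_compose[OF linear_prj, of "\<lambda>y. vx (t, x) \<bullet> y"] by (simp add: o_def linear_iff inner_add_right)
  show "\<bar>vx (t, x) \<bullet> prj v\<bar> <= norm (vx (t, x)) * norm v" for v
   using Cauchy_Schwarz_ineq2[of "vx (t, x)" "prj v"] mult_left_mono[OF norm_prj_le[of v] norm_ge_zero[of "vx (t, x)"]] by linarith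
  fix s p assume s: "s \<in> {t..T}" and p: "p \<in> prob_simplex" and d: "norm (p - chart x) < \<delta>"
  have pd: "prj (p - chart x) = prj p - x" using linear_diff[OF linear_prj, of p "chart x"] by simp
  have np: "norm (prj p - x) <= norm (p - chart x)" using norm_prj_le[of "p - chart x"] pd by simp
  hence "prj p \<in> ball x \<delta>" using d by (simp add: dist_norm norm_minus_commute)
  hence b: "(s, prj p) \<in> OP" using s a \<delta>(2) by (auto simp: OP_def)
  have "(norm ((s, prj p) - (t, x)))\<^sup>2 = (s - t)\<^sup>2 + (norm (prj p - x))\<^sup>2" by (simp add: norm_prod_def)
  also have "\<dots> <= (s - t)\<^sup>2 + (norm (p - chart x))\<^sup>2" using np by (intro add_left_mono power_mono) auto
  finally have "2 * L * (norm ((s, prj p) - (t, x)))\<^sup>2 <= 2 * L * ((s - t)\<^sup>2 + (norm (p - chart x))\<^sup>2)"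
   using L0 by (intro mult_left_mono) auto
  thus "\<bar>V s p - V t (chart x) - vt (t, x) * (s - t) - vx (t, x) \<bullet> prj (p - chart x)\<bar> <= 2 * L * ((s - t)\<^sup>2 + (norm (p - chart x))\<^sup>2)"
   using W_taylor[OF ax b] chart_prj[OF p] unfolding pd by (simp add: W_def)
 qed (use a x \<delta> L0 in auto)
 thus ?thesis by (simp add: zg_def[abs_def])
qed

lemma zg_diff: "zg a i $ j - zg b i $ j = (vx a - vx b) \<bullet> prj (shift i j)"
 by (simp add: zg_def inner_diff_left)

lemma norm_shift: "norm (shift i j :: real^'n option) <= 2"
 unfolding shift_def using norm_triangle_ineq4[of "axis j 1 :: real^'n option" "axis i 1"] by (simp add: norm_axis_1)

lemma norm_zg:
 "norm (\<chi> j. e \<bullet> prj (shift i j)) <= 2 * real CARD('n option) * norm e" for e :: "real^'n"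
proof -
 have "norm (\<chi> j. e \<bullet> prj (shift i j)) <= (\<Sum>j\<in>UNIV. \<bar>(\<chi> j. e \<bullet> prj (shift i j)) $ j\<bar>)" by (rule norm_le_l1_cart)
 also have "\<dots> <= (\<Sum>j\<in>(UNIV::'n option set). norm e * 2)"
 proof (rule sum_mono)
  fix j :: "'n option"
  have "\<bar>e \<bullet> prj (shift i j)\<bar> <= norm e * norm (prj (shift i j))" by (rule Cauchy_Schwarz_ineq2)
  also have "\<dots> <= norm e * 2" using norm_prj_le[of "shift i j"] norm_shift[of i j] by (intro mult_left_mono) auto
  finally show "\<bar>(\<chi> j. e \<bullet> prj (shift i j)) $ j\<bar> <= norm e * 2" by simp
 qed
 finally show ?thesis by (simp add: algebra_simps del: card_option)
qed

text \<open>\<open>hjb_local\<close> looks ahead in time, so \<open>hjb_inner\<close> excludes the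
  final time as well as the faces. Both are recovered by density, since the Hamiltonian is
  continuous on \<open>CL\<close>.\<close>

lemma hjb_closed:
 assumes a: "a \<in> CL"
 shows "vt a + ham (fst a) (chart (snd a)) (zg a) = 0"
proof -
 let ?O = "{0..<T} \<times> (inner_hat :: (real^'n) set)"
 have cl: "closure ?O = CL" using T0 by (simp add: closure_Times CL_def closure_inner_hat)
 have cvt: "continuous_on CL vt" and cvx: "continuous_on CL vx"
  using lipschitz_on_continuous_on[OF vt_lip] lipschitz_on_continuous_on[OF vx_lip] by (auto simp: CL_def)
 have cchart: "continuous_on UNIV (chart :: real^'n => _)"
 proof -
  have "continuous_on UNIV (\<lambda>x :: real^'n. case k of None => 1 - (\<Sum>j\<in>UNIV. x $ j) | Some j => x $ j)" for k
   by (cases k) (auto intro!: continuous_intros)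
  thus ?thesis unfolding chart_def by (intro continuous_on_vec_lambda)
 qed
 have ch: "continuous_on CL (\<lambda>a. ham (fst a) (chart (snd a)) (zg a))"
  unfolding continuous_on
 proof
  fix b assume b: "b \<in> CL"
  let ?m = "\<lambda>a. chart (snd a) :: real^'n option"
  let ?R = "\<lambda>a. CF * (\<bar>fst a - fst b\<bar> + norm (?m a - ?m b)) + M * (\<Sum>i\<in>UNIV. \<Sum>j\<in>UNIV - {i}. \<bar>zg a i $ j - zg b i $ j\<bar>)
    + norm (?m a - ?m b) * (M * (\<Sum>i\<in>UNIV. \<Sum>j\<in>UNIV - {i}. \<bar>zg b i $ j\<bar>))"
  have "((\<lambda>a. ham (fst a) (?m a) (zg a) - ham (fst b) (?m b) (zg b)) \<longlongrightarrow> 0) (at b within CL)"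
  proof (rule Lim_null_comparison)
   have "norm (ham (fst a) (?m a) (zg a) - ham (fst b) (?m b) (zg b)) <= ?R a" if "a \<in> CL" for a
    unfolding real_norm_def using that b by (intro ham_lip_joint chart_simplex) (auto simp: CL_def)
   thus "\<forall>\<^sub>F a in at b within CL. norm (ham (fst a) (?m a) (zg a) - ham (fst b) (?m b) (zg b)) <= ?R a"
    unfolding eventually_at_filter by (intro always_eventually) blast
   have vb: "(vx \<longlongrightarrow> vx b) (at b within CL)" using cvx b by (auto simp: continuous_on)
   have zb: "((\<lambda>a. zg a i $ j) \<longlongrightarrow> zg b i $ j) (at b within CL)" for i j
    unfolding zg_def vec_lambda_beta by (intro tendsto_inner vb tendsto_const)
   have "continuous_on UNIV ?m" by (rule continuous_on_compose2[OF cchart]) (auto intro: continuous_intros)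
   hence mb: "(?m \<longlongrightarrow> ?m b) (at b within CL)"
    using continuous_on_subset[of UNIV ?m CL] b by (auto simp: continuous_on)
   have fb: "(fst \<longlongrightarrow> fst b) (at b within CL)" by (intro tendsto_fst tendsto_ident_at)
   have "(?R \<longlongrightarrow> CF * (\<bar>fst b - fst b\<bar> + norm (?m b - ?m b)) + M * (\<Sum>i\<in>UNIV. \<Sum>j\<in>UNIV - {i}. \<bar>zg b i $ j - zg b i $ j\<bar>)
    + norm (?m b - ?m b) * (M * (\<Sum>i\<in>UNIV. \<Sum>j\<in>UNIV - {i}. \<bar>zg b i $ j\<bar>))) (at b within CL)"
    by (intro tendsto_add tendsto_mult tendsto_const tendsto_rabs tendsto_norm tendsto_diff tendsto_sum zb mb fb)
   thus "(?R \<longlongrightarrow> 0) (at b within CL)" by simp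
  qed
  thus "((\<lambda>a. ham (fst a) (?m a) (zg a)) \<longlongrightarrow> ham (fst b) (?m b) (zg b)) (at b within CL)" by (rule LIM_zero_cancel)
 qed
 have cont: "continuous_on (closure ?O) (\<lambda>a. vt a + ham (fst a) (chart (snd a)) (zg a))"
  unfolding cl by (intro continuous_on_add cvt ch)
 show ?thesis
  by (rule continuous_constant_on_closure[OF cont]) (use hjb_inner a cl in auto)
qed

lemma dir_deriv_inner:
 assumes t: "t \<in> {0..T}" and m: "m \<in> simplex_interior"
 shows "dir_deriv i j (V t) m = zg (t, prj m) i $ j"
proof -
 let ?x = "prj m" and ?e = "prj (shift i j) :: real^'n"
 have ms: "m \<in> prob_simplex" using m by (simp add: simplex_interior_def)
 have x: "?x \<in> inner_hat" by (rule prj_interior[OF m])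
 obtain \<delta> where \<delta>: "0 < \<delta>" "ball ?x \<delta> \<subseteq> inner_hat" using open_inner_hat x openE by blast
 have a: "(t, ?x) \<in> OP" using t x by (simp add: OP_def)
 have ss: "(\<Sum>k\<in>UNIV. (shift i j :: real^'n option) $ k) = 0" by (simp add: shift_def sum_subtractf axis_def)
 have est: "\<bar>V t (m + h *\<^sub>R shift i j) - V t m - h * (vx (t, ?x) \<bullet> ?e)\<bar> <= 2 * L * (norm (h *\<^sub>R ?e))\<^sup>2" if h: "norm (h *\<^sub>R ?e) < \<delta>" for h
 proof -
  have pp: "prj (m + h *\<^sub>R shift i j) = ?x + h *\<^sub>R ?e" using linear_add[OF linear_prj, of m "h *\<^sub>R shift i j"] linear_scale[OF linear_prj, of h "shift i j"] by simp
  have y: "?x + h *\<^sub>R ?e \<in> inner_hat" using h \<delta>(2) by (auto simp: dist_norm subset_eq)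
  have mm: "chart (?x + h *\<^sub>R ?e) = m + h *\<^sub>R shift i j"
  proof (rule vec_eq_iff[THEN iffD2, rule_format])
   fix k :: "'n option"
   have "(\<Sum>k\<in>UNIV. m $ k) = 1" using ms by (simp add: prob_simplex_def)
   thus "chart (?x + h *\<^sub>R ?e) $ k = (m + h *\<^sub>R shift i j) $ k"
    using ss by (cases k) (auto simp: chart_def prj_def sum_option sum.distrib sum_distrib_left[symmetric] algebra_simps add_eq_0_iff)
  qed
  have b: "(t, ?x + h *\<^sub>R ?e) \<in> OP" using t y by (simp add: OP_def)
  show ?thesis using W_taylor[OF a b] chart_prj[OF ms] mm by (simp add: W_def norm_prod_def)
 qed
 have "((\<lambda>h. V t (m + h *\<^sub>R shift i j)) has_field_derivative (vx (t, ?x) \<bullet> ?e)) (at 0)"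
  unfolding has_field_derivative_iff
 proof (rule LIM_zero_cancel, rule Lim_null_comparison)
  have "((\<lambda>h. norm (h *\<^sub>R ?e)) \<longlongrightarrow> norm (0 *\<^sub>R ?e)) (at (0::real))" by (intro tendsto_intros)
  hence "\<forall>\<^sub>F h in at (0::real). norm (h *\<^sub>R ?e) < \<delta>" using \<delta>(1) by (intro order_tendstoD(2)) auto
  moreover have "\<forall>\<^sub>F h in at (0::real). h ~= 0" by (simp add: eventually_at_filter)
  ultimately show "\<forall>\<^sub>F h in at (0::real). norm ((V t (m + h *\<^sub>R shift i j) - V t (m + 0 *\<^sub>R shift i j)) / (h - 0) - vx (t, ?x) \<bullet> ?e) <= 2 * L * (norm ?e)\<^sup>2 * \<bar>h\<bar>"
  proof eventually_elim
   fix h :: real assume h: "norm (h *\<^sub>R ?e) < \<delta>" "h ~= 0"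
   have "\<bar>V t (m + h *\<^sub>R shift i j) - V t m - h * (vx (t, ?x) \<bullet> ?e)\<bar> <= 2 * L * (norm ?e)\<^sup>2 * \<bar>h\<bar> * \<bar>h\<bar>"
    using est[OF h(1)] by (simp add: power_mult_distrib power2_eq_square mult_ac)
   moreover have "(V t (m + h *\<^sub>R shift i j) - V t (m + 0 *\<^sub>R shift i j)) / (h - 0) - vx (t, ?x) \<bullet> ?e = (V t (m + h *\<^sub>R shift i j) - V t m - h * (vx (t, ?x) \<bullet> ?e)) / h"
    using h(2) by (simp add: field_simps)
   ultimately show "norm ((V t (m + h *\<^sub>R shift i j) - V t (m + 0 *\<^sub>R shift i j)) / (h - 0) - vx (t, ?x) \<bullet> ?e) <= 2 * L * (norm ?e)\<^sup>2 * \<bar>h\<bar>"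
    using h(2) by (simp add: divide_le_eq)
  qed
  have "((\<lambda>h. 2 * L * (norm ?e)\<^sup>2 * \<bar>h\<bar>) \<longlongrightarrow> 2 * L * (norm ?e)\<^sup>2 * \<bar>0\<bar>) (at (0::real))" by (intro tendsto_intros)
  thus "((\<lambda>h. 2 * L * (norm ?e)\<^sup>2 * \<bar>h\<bar>) \<longlongrightarrow> 0) (at (0::real))" by simp
 qed
 thus ?thesis unfolding dir_deriv_def zg_def vec_lambda_beta by (rule DERIV_imp_deriv)
qed

text \<open>On a face \<open>simplex_grad\<close> is a limit over interior points. It is the value
  of the continuous function \<open>zg\<close> provided the limit is unique; this holds because the
  segment from \<open>m\<close> to the centre runs through the interior and makes \<open>m\<close> a
  limit point.\<close>

lemma simplex_grad_zg:
 assumes t: "t \<in> {0..T}" and m: "m \<in> prob_simplex"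
 shows "simplex_grad i (V t) m = zg (t, prj m) i"
proof (rule vec_eq_iff[THEN iffD2, rule_format])
 fix j
 show "simplex_grad i (V t) m $ j = zg (t, prj m) i $ j"
 proof (cases "m \<in> simplex_interior")
  case True
  thus ?thesis using dir_deriv_inner[OF t True] by (simp add: simplex_grad_def)
 next
  case False
  have pos: "0 < c $ k" if "c \<in> simplex_interior" for c :: "real^'n option" and k using that by (simp add: simplex_interior_def)
  define c where "c = (chart centre :: real^'n option)"
  have c: "c \<in> simplex_interior" unfolding c_def by (rule chart_interior[OF centre_inner])
  define w where "w n = m + (1 / real (Suc n)) *\<^sub>R (c - m)" for n
  have wi: "w n \<in> simplex_interior" for n
  proof -
   obtain u where u: "0 < u" "u <= 1" "w n = m + u *\<^sub>R (c - m)" using w_def[of n] that[of "1 / real (Suc n)"] by auto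
   have wk: "w n $ k = (1 - u) * m $ k + u * c $ k" for k unfolding u(3) by (simp add: algebra_simps)
   have "0 < w n $ k" for k
    unfolding wk using u simplex_coord(1)[OF m, of k] pos[OF c, of k] by (intro add_nonneg_pos) auto
   moreover have "(\<Sum>k\<in>UNIV. w n $ k) = (1 - u) * (\<Sum>k\<in>UNIV. m $ k) + u * (\<Sum>k\<in>UNIV. c $ k)"
    unfolding wk sum.distrib sum_distrib_left ..
   moreover have "(\<Sum>k\<in>UNIV. m $ k) = 1" "(\<Sum>k\<in>UNIV. c $ k) = 1" using m c by (auto simp: prob_simplex_def simplex_interior_def)
   ultimately show ?thesis by (auto simp: simplex_interior_def prob_simplex_def less_imp_le)
  qed
  have "w \<longlonglongrightarrow> m + 0 *\<^sub>R (c - m)"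
   unfolding w_def by (intro tendsto_intros LIMSEQ_inverse_real_of_nat[unfolded inverse_eq_divide])
  hence "w \<longlonglongrightarrow> m" by simp
  moreover have "w n \<in> simplex_interior - {m}" for n using wi[of n] False by auto
  ultimately have "m islimpt simplex_interior" unfolding islimpt_sequential by blast
  hence nt: "\<not> trivial_limit (at m within simplex_interior)" by (simp add: trivial_limit_within)
  have cvx: "continuous_on CL vx" using lipschitz_on_continuous_on[OF vx_lip] by (auto simp: CL_def)
  have "continuous_on prob_simplex (\<lambda>p. vx (t, prj p))"
  proof (rule continuous_on_compose2[OF cvx])
   show "continuous_on prob_simplex (\<lambda>p. (t, prj p :: real^'n))"
    using linear_prj by (intro continuous_on_Pair continuous_on_const linear_continuous_on) (simp add: linear_conv_bounded_linear)
  qed (use t prj_hat in \<open>auto simp: CL_def\<close>)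
  hence "((\<lambda>p. vx (t, prj p)) \<longlongrightarrow> vx (t, prj m)) (at m within prob_simplex)" using m by (auto simp: continuous_on)
  hence "((\<lambda>p. vx (t, prj p)) \<longlongrightarrow> vx (t, prj m)) (at m within simplex_interior)"
   by (rule tendsto_within_subset) (auto simp: simplex_interior_def)
  hence "((\<lambda>p. zg (t, prj p) i $ j) \<longlongrightarrow> zg (t, prj m) i $ j) (at m within simplex_interior)"
   unfolding zg_def vec_lambda_beta by (intro tendsto_inner tendsto_const)
  moreover have "\<forall>\<^sub>F p in at m within simplex_interior. zg (t, prj p) i $ j = dir_deriv i j (V t) p"
   unfolding eventually_at_filter using dir_deriv_inner[OF t] by (intro always_eventually) simp
  ultimately have "(dir_deriv i j (V t) \<longlongrightarrow> zg (t, prj m) i $ j) (at m within simplex_interior)"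
   by (rule Lim_transform_eventually)
  hence "Lim (at m within simplex_interior) (dir_deriv i j (V t)) = zg (t, prj m) i $ j" by (rule tendsto_Lim[OF nt])
  thus ?thesis using False by (simp add: simplex_grad_def)
 qed
qed

lemma regular_value_exists: "\<exists>U ut z LU. regular_value T M f g CF CG LD \<kappa> Df U ut z LU"
proof -
 obtain We where We0: "continuous_on CL We" "\<forall>a\<in>OP. We a = W a"
  "\<forall>a\<in>CL. \<forall>b\<in>CL. \<bar>We b - We a - vt a * (fst b - fst a) - vx a \<bullet> (snd b - snd a)\<bar> <= 2 * L * (norm (b - a))\<^sup>2"
  by (rule W_extension)
 note We = We0(1) We0(2)[rule_format] We0(3)[rule_format]
 obtain B where B0: "0 <= B" "\<forall>a\<in>CL. \<bar>vt a\<bar> <= B" "\<forall>a\<in>CL. norm (vx a) <= B" by (rule v_bounds)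
 note B = B0(1) B0(2)[rule_format] B0(3)[rule_format]
 define d where "d = real CARD('n option)"
 have d0: "0 <= d" by (simp add: d_def)
 \<comment> \<open>One constant for all assumptions of the locale: \<open>8 * L\<close> is
   \<open>2 * L\<close> times the square of the bound 2 on \<open>norm (shift i j)\<close>, and
   \<open>2 * d\<close> is the loss from \<open>vx\<close> to the vectors \<open>zg\<close>.\<close>
 define LU where "LU = 8 * L + B + 2 * d * L + 2 * d * B"
 have nn: "0 <= d * L" "0 <= d * B" using d0 L0 B(1) by auto
 have LUge: "0 <= LU" "2 * L <= LU" "8 * L <= LU" "L <= LU" "B <= LU" "2 * d * L <= LU" "2 * d * B <= LU"
  using nn L0 B(1) unfolding LU_def by linarith+
 have cl: "(t, prj m) \<in> CL" if "t \<in> {0..T}" "m \<in> prob_simplex" for t m using that prj_hat by (auto simp: CL_def)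
 have "regular_value T M f g CF CG LD \<kappa> Df (\<lambda>t m. We (t, prj m)) (\<lambda>t m. vt (t, prj m)) (\<lambda>i t m. zg (t, prj m) i) LU"
 proof
  show "0 <= LU" by (rule LUge)
  fix t s and m p :: "real^'n option" assume t: "t \<in> {0..T}" and s: "s \<in> {0..T}" and m: "m \<in> prob_simplex"
  have "\<bar>We (s, prj m) - We (t, prj m) - vt (t, prj m) * (s - t)\<bar> <= 2 * L * (s - t)\<^sup>2"
   using We(3)[OF cl[OF t m] cl[OF s m]] by (simp add: norm_prod_def)
  also have "\<dots> <= LU * (s - t)\<^sup>2" using LUge by (intro mult_right_mono) auto
  finally show "\<bar>We (s, prj m) - We (t, prj m) - vt (t, prj m) * (s - t)\<bar> <= LU * (s - t)\<^sup>2" .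
  have "\<bar>vt (t, prj m) - vt (s, prj m)\<bar> <= L * \<bar>t - s\<bar>"
   using lipschitz_onD[OF vt_lip, of "(t, prj m)" "(s, prj m)"] cl[OF t m] cl[OF s m] by (simp add: CL_def dist_Pair_Pair dist_real_def)
  also have "\<dots> <= LU * \<bar>t - s\<bar>" using LUge by (intro mult_right_mono) auto
  finally show "\<bar>vt (t, prj m) - vt (s, prj m)\<bar> <= LU * \<bar>t - s\<bar>" .
  show "\<bar>vt (t, prj m)\<bar> <= LU" using B(2)[OF cl[OF t m]] LUge by linarith
  show "simplex_grad i (V t) m = zg (t, prj m) i" for i by (rule simplex_grad_zg[OF t m])
  show "norm (zg (t, prj m) i) <= LU" for i
  proof -
   have "norm (zg (t, prj m) i) <= 2 * d * norm (vx (t, prj m))" unfolding zg_def d_def by (rule norm_zg)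
   also have "\<dots> <= 2 * d * B" using B(3)[OF cl[OF t m]] d0 by (intro mult_left_mono) auto
   finally show ?thesis using LUge by linarith
  qed
  show "vt (t, prj m) + ham t m (\<lambda>i. zg (t, prj m) i) = 0"
   using hjb_closed[OF cl[OF t m]] chart_prj[OF m] by simp
 next
  fix i t s and m p :: "real^'n option" assume t: "t \<in> {0..T}" and s: "s \<in> {0..T}" and m: "m \<in> prob_simplex" and p: "p \<in> prob_simplex"
  have "zg (t, prj m) i - zg (s, prj p) i = (\<chi> j. (vx (t, prj m) - vx (s, prj p)) \<bullet> prj (shift i j))"
   unfolding vec_eq_iff vector_minus_component zg_diff by simp
  hence "norm (zg (t, prj m) i - zg (s, prj p) i) <= 2 * d * norm (vx (t, prj m) - vx (s, prj p))"
   using norm_zg[of "vx (t, prj m) - vx (s, prj p)" i] by (simp add: d_def)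
  also have "\<dots> <= 2 * d * (L * (\<bar>t - s\<bar> + norm (m - p)))"
  proof (intro mult_left_mono)
   have "norm (vx (t, prj m) - vx (s, prj p)) <= L * dist (t, prj m) (s, prj p)"
    using lipschitz_onD[OF vx_lip, of "(t, prj m)" "(s, prj p)"] cl[OF t m] cl[OF s p] by (simp add: CL_def dist_norm)
   also have "dist (t, prj m) (s, prj p) <= \<bar>t - s\<bar> + norm (prj (m - p))"
    unfolding dist_Pair_Pair dist_norm linear_diff[OF linear_prj] using sqrt_sum_squares_le_sum[of "\<bar>t - s\<bar>" "norm (prj m - prj p)"] by (simp add: norm_prod_def)
   also have "\<dots> <= \<bar>t - s\<bar> + norm (m - p)" using norm_prj_le[of "m - p"] by simp
   finally show "norm (vx (t, prj m) - vx (s, prj p)) <= L * (\<bar>t - s\<bar> + norm (m - p))" using L0 by (simp add: mult_left_mono)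
  qed (use d0 in auto)
  also have "\<dots> = (2 * d * L) * (\<bar>t - s\<bar> + norm (m - p))" by simp
  also have "\<dots> <= LU * (\<bar>t - s\<bar> + norm (m - p))" using LUge by (intro mult_right_mono) auto
  finally show "norm (zg (t, prj m) i - zg (s, prj p) i) <= LU * (\<bar>t - s\<bar> + norm (m - p))" .
 next
  fix t h i j and m :: "real^'n option" assume t: "t \<in> {0..T}" and m: "m \<in> prob_simplex" and m': "m + h *\<^sub>R shift i j \<in> prob_simplex"
  let ?e = "prj (shift i j) :: real^'n"
  have pp: "prj (m + h *\<^sub>R shift i j) = prj m + h *\<^sub>R ?e" using linear_add[OF linear_prj, of m "h *\<^sub>R shift i j"] linear_scale[OF linear_prj, of h "shift i j"] by simp
  have "\<bar>We (t, prj (m + h *\<^sub>R shift i j)) - We (t, prj m) - h * (vx (t, prj m) \<bullet> ?e)\<bar> <= 2 * L * (norm (h *\<^sub>R ?e))\<^sup>2"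
   using We(3)[OF cl[OF t m] cl[OF t m']] unfolding pp by (simp add: norm_prod_def)
  also have "\<dots> <= 2 * L * (\<bar>h\<bar> * 2)\<^sup>2"
   using norm_prj_le[of "shift i j"] norm_shift[of i j] L0 by (intro mult_left_mono power_mono) (auto intro!: mult_left_mono)
  also have "\<dots> = 8 * L * h\<^sup>2" by (simp add: power_mult_distrib)
  also have "\<dots> <= LU * h\<^sup>2" using LUge by (intro mult_right_mono) auto
  finally show "\<bar>We (t, prj (m + h *\<^sub>R shift i j)) - We (t, prj m) - h * zg (t, prj m) i $ j\<bar> <= LU * h\<^sup>2" by (simp add: zg_def)
 next
  fix m :: "real^'n option" assume m: "m \<in> prob_simplex"
  have TT: "T \<in> {0..T}" using T0 by simp
  \<comment> \<open>At the final time both functions are continuous, and they agree inside, where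
    \<open>We\<close> is \<open>V\<close> and \<open>V T\<close> is \<open>G\<close>.\<close>
  have G: "\<bar>We (T, x) - G (chart x)\<bar> <= 0" if "x \<in> hat_simplex" for x
  proof -
   have c1: "continuous_on hat_simplex (\<lambda>x. We (T, x))"
    by (rule continuous_on_compose2[OF We(1)]) (use TT in \<open>auto simp: CL_def intro!: continuous_intros\<close>)
   have c2: "continuous_on prob_simplex G"
   proof -
    have "CG-lipschitz_on prob_simplex G" using G_lip CG0 by (intro lipschitz_onI) (auto simp: dist_norm)
    thus ?thesis by (rule lipschitz_on_continuous_on)
   qed
   have "continuous_on UNIV (\<lambda>x :: real^'n. case k of None => 1 - (\<Sum>j\<in>UNIV. x $ j) | Some j => x $ j)" for k
    by (cases k) (auto intro!: continuous_intros)
   hence c3: "continuous_on UNIV (chart :: real^'n => _)" unfolding chart_def by (intro continuous_on_vec_lambda)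
   have "continuous_on hat_simplex (\<lambda>x. G (chart x))"
    by (rule continuous_on_compose2[OF c2 continuous_on_subset[OF c3]]) (use chart_simplex in auto)
   hence c4: "continuous_on (closure inner_hat) (\<lambda>x. \<bar>We (T, x) - G (chart x)\<bar>)"
    unfolding closure_inner_hat by (intro continuous_intros c1)
   have xc: "x \<in> closure inner_hat" unfolding closure_inner_hat by (rule that)
   have "\<bar>We (T, y) - G (chart y)\<bar> <= 0" if y: "y \<in> inner_hat" for y
   proof -
    have "We (T, y) = V T (chart y)" using We(2)[of "(T, y)"] TT y by (simp add: OP_def W_def)
    thus ?thesis using V_terminal[OF chart_simplex, of y] y inner_hat_sub by auto
   qed
   thus ?thesis using continuous_le_on_closure[OF c4 xc] by blast
  qed
  show "We (T, prj m) = G m" using G[OF prj_hat[OF m]] chart_prj[OF m] by simp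
 qed
 thus ?thesis by blast
qed

end

section \<open>The \<open>N\<close>-agent problem\<close>

subsection \<open>Jumps on the grid\<close>

lemma sum_shift: "(\<Sum>k\<in>UNIV. shift i j $ k) = (0::real)" for i :: "'d::finite"
 by (simp add: shift_def axis_def sum_subtractf)

lemma simplex_grid_simplex: "m \<in> simplex_grid N ==> m \<in> prob_simplex"
 by (simp add: simplex_grid_def)

lemma finite_simplex_grid:
 assumes N: "0 < N" shows "finite (simplex_grid N :: (real^'d::finite) set)"
proof (rule finite_subset)
 show "finite ((\<lambda>k. \<chi> i. real (k i) / real N) ` (PiE (UNIV :: 'd set) (\<lambda>_. {..N})))"
  by (intro finite_imageI finite_PiE) auto
 show "simplex_grid N \<subseteq> (\<lambda>k. \<chi> i. real (k i) / real N) ` (PiE (UNIV :: 'd set) (\<lambda>_. {..N}))"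
 proof
  fix m :: "real^'d" assume m: "m \<in> simplex_grid N"
  hence "\<forall>i. \<exists>k::nat. m $ i = real k / real N" by (simp add: simplex_grid_def)
  then obtain k where k: "\<forall>i. m $ i = real (k i :: nat) / real N" by (rule choice[THEN exE])
  have "k i <= N" for i using simplex_coord(2)[OF simplex_grid_simplex[OF m], of i] k N by (simp add: divide_le_eq)
  moreover have "m = (\<chi> i. real (k i) / real N)" using k by (simp add: vec_eq_iff)
  ultimately show "m \<in> (\<lambda>k. \<chi> i. real (k i) / real N) ` (PiE (UNIV :: 'd set) (\<lambda>_. {..N}))" by auto
 qed
qed

text \<open>A positive coordinate on the grid is at least \<open>1 / real N\<close>, so one unit can
  be removed from it.\<close>

lemma grid_step:
 fixes x :: "real^'d::finite"
 assumes N: "0 < N" and x: "x \<in> simplex_grid N" and xi: "0 < x $ i"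
 shows "x + (1 / real N) *\<^sub>R shift i j \<in> simplex_grid N"
proof (cases "i = j")
 case True thus ?thesis using x by (simp add: shift_def)
next
 case ij: False
 let ?y = "x + (1 / real N) *\<^sub>R shift i j"
 have "\<exists>n::nat. ?y $ k = real n / real N" for k
 proof -
  obtain n :: nat where n: "x $ k = real n / real N" using x by (auto simp: simplex_grid_def)
  consider "k = i" | "k = j" | "k ~= i" "k ~= j" by blast
  thus ?thesis
  proof cases
   case 1
   hence "0 < n" using n xi N by (simp add: zero_less_divide_iff)
   hence "?y $ k = real (n - 1) / real N" using 1 ij n by (simp add: shift_def axis_def of_nat_diff diff_divide_distrib)
   thus ?thesis by blast
  next
   case 2
   hence "?y $ k = real (n + 1) / real N" using ij n by (simp add: shift_def axis_def add_divide_distrib)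
   thus ?thesis by blast
  next
   case 3
   hence "?y $ k = real n / real N" using n by (simp add: shift_def axis_def)
   thus ?thesis by blast
  qed
 qed
 note k = this
 have "0 <= ?y $ k" for k using k[of k] by (metis divide_nonneg_nonneg of_nat_0_le_iff)
 moreover have "(\<Sum>k\<in>UNIV. ?y $ k) = 1"
  using x by (simp add: sum.distrib sum_distrib_left[symmetric] sum_divide_distrib[symmetric] sum_shift simplex_grid_def prob_simplex_def)
 ultimately show ?thesis using k by (simp add: simplex_grid_def prob_simplex_def del: vector_add_component)
qed

lemma shift_nonzero: "i ~= j ==> shift i j ~= 0"
 by (simp add: shift_def vec_eq_iff axis_def) (metis zero_neq_one)

lemma jump_rate_sum:
 fixes x :: "real^'d::finite"
 assumes N: "0 < N" and x: "x \<in> simplex_grid N"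
 shows "(\<Sum>y\<in>simplex_grid N - {x}. jump_rate N \<alpha> u x y * h y)
  = (\<Sum>i\<in>UNIV. \<Sum>j\<in>UNIV - {i}. real N * x $ i * \<alpha> u x $ i $ j * h (x + (1 / real N) *\<^sub>R shift i j))"
proof -
 let ?E = "simplex_grid N - {x}" and ?y = "\<lambda>i j. x + (1 / real N) *\<^sub>R shift i j"
 let ?c = "\<lambda>i j. real N * x $ i * \<alpha> u x $ i $ j * h (?y i j)"
 have "(\<Sum>y\<in>?E. jump_rate N \<alpha> u x y * h y) = (\<Sum>y\<in>?E. \<Sum>i\<in>UNIV. \<Sum>j\<in>UNIV - {i}. if y = ?y i j then ?c i j else 0)"
  unfolding jump_rate_def sum_distrib_right by (intro sum.cong refl) auto
 also have "\<dots> = (\<Sum>i\<in>UNIV. \<Sum>y\<in>?E. \<Sum>j\<in>UNIV - {i}. if y = ?y i j then ?c i j else 0)" by (rule sum.swap)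
 also have "\<dots> = (\<Sum>i\<in>UNIV. \<Sum>j\<in>UNIV - {i}. \<Sum>y\<in>?E. if y = ?y i j then ?c i j else 0)" by (intro sum.cong refl sum.swap)
 also have "\<dots> = (\<Sum>i\<in>UNIV. \<Sum>j\<in>UNIV - {i}. ?c i j)"
 proof (intro sum.cong refl)
  fix i j :: 'd assume "j \<in> UNIV - {i}" hence ij: "i ~= j" by auto
  show "(\<Sum>y\<in>?E. if y = ?y i j then ?c i j else 0) = ?c i j"
  proof (cases "0 < x $ i")
   case True
   have "?y i j \<in> ?E" using grid_step[OF N x True, of j] shift_nonzero[OF ij] N by simp
   thus ?thesis using finite_simplex_grid[OF N, where 'd = 'd] by simp
  next
   \<comment> \<open>From an empty state the target may lie off the grid, but then the rate is
     0.\<close>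
   case False
   hence "x $ i = 0" using simplex_coord(1)[OF simplex_grid_simplex[OF x], of i] by simp
   hence c0: "?c i j = 0" by simp
   show ?thesis by (simp only: c0 if_cancel sum.neutral_const)
  qed
 qed
 finally show ?thesis .
qed

text \<open>Discrete gradient masked in empty states, so that values of \<open>v\<close> outside the
  grid never enter; wherever it is used, such a state has weight 0.\<close>

definition dz :: "nat => (real^'d::finite => real) => real^'d => 'd => real^'d" where
 "dz N v x i = (if 0 < x $ i then discrete_grad N i v x else 0)"

lemma jump_rate_generator:
 fixes x :: "real^'d::finite"
 assumes N: "0 < N" and x: "x \<in> simplex_grid N"
 shows "(\<Sum>y\<in>simplex_grid N - {x}. jump_rate N \<alpha> u x y * (v y - v x))
  = (\<Sum>i\<in>UNIV. x $ i * (\<Sum>j\<in>UNIV - {i}. \<alpha> u x $ i $ j * dz N v x i $ j))"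
 unfolding jump_rate_sum[OF N x] sum_distrib_left
proof (intro sum.cong refl)
 fix i j :: 'd
 have "\<not> 0 < x $ i ==> x $ i = 0" using simplex_coord(1)[OF simplex_grid_simplex[OF x], of i] by simp
 thus "real N * x $ i * \<alpha> u x $ i $ j * (v (x + (1 / real N) *\<^sub>R shift i j) - v x) = x $ i * (\<alpha> u x $ i $ j * dz N v x i $ j)"
  by (cases "0 < x $ i") (auto simp: dz_def discrete_grad_def)
qed

lemma sum_offdiag_le: "(\<Sum>i\<in>UNIV. \<Sum>j\<in>UNIV - {i}. h i j) <= (real CARD('d))\<^sup>2 * c"
 if "\<And>i j :: 'd. j ~= i ==> h i j <= c" "0 <= c" for h :: "'d::finite => 'd => real"
proof -
 have "(\<Sum>j\<in>UNIV - {i}. h i j) <= real CARD('d) * c" for i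
 proof -
  have "(\<Sum>j\<in>UNIV - {i}. h i j) <= (\<Sum>j\<in>UNIV - {i}. c)" using that by (intro sum_mono) auto
  also have "\<dots> <= (\<Sum>j\<in>(UNIV::'d set). c)" using that by (intro sum_mono2) auto
  finally show ?thesis by simp
 qed
 hence "(\<Sum>i\<in>UNIV. \<Sum>j\<in>UNIV - {i}. h i j) <= (\<Sum>i\<in>(UNIV::'d set). real CARD('d) * c)" by (intro sum_mono)
 thus ?thesis by (simp add: power2_eq_square)
qed

lemma jump_rate_bounds:
 fixes x :: "real^'d::finite"
 assumes a: "\<alpha> u x \<in> action_matrices M" and x: "x \<in> prob_simplex"
 shows "0 <= jump_rate N \<alpha> u x y" "jump_rate N \<alpha> u x y <= (real CARD('d))\<^sup>2 * (real N * M)"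
proof -
 note b = action_matrices_bounds[OF a] and c = simplex_coord[OF x]
 have M: "0 <= M" using b order_trans by blast
 show "0 <= jump_rate N \<alpha> u x y" unfolding jump_rate_def using b c by (intro sum_nonneg) auto
 have "real N * x $ i * \<alpha> u x $ i $ j <= real N * M" for i j
 proof -
  have "x $ i * \<alpha> u x $ i $ j <= 1 * M" using b c M by (intro mult_mono) auto
  thus ?thesis by (simp add: mult.assoc mult_left_mono)
 qed
 thus "jump_rate N \<alpha> u x y <= (real CARD('d))\<^sup>2 * (real N * M)"
  unfolding jump_rate_def using M by (intro sum_offdiag_le) auto
qed

text \<open>The feedback in \<open>agent_opt_process\<close> and the one built from the solution
  \<open>w\<close> may differ in rows of empty states; only their jump rates agree, on the grid and
  for times in \<open>{0..T}\<close>.\<close>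

lemma markov_jump_chain_cong:
 assumes eq: "\<And>u x y. [|u \<in> {t0..T}; x \<in> E; y \<in> E|] ==> q u x y = q' u x y" and mc: "markov_jump_chain P E q t0 T X"
 shows "markov_jump_chain P E q' t0 T X"
proof -
 have "transition_probabilities E q' t0 T p" if "transition_probabilities E q t0 T p" for p
  unfolding transition_probabilities_def
 proof (intro ballI)
  fix r s x y assume r: "r \<in> {t0..T}" "s \<in> {r..T}" "x \<in> E" "y \<in> E"
  show "((\<lambda>u. (\<Sum>z\<in>E - {y}. p r u x z * q' u z y) - p r u x y * (\<Sum>z\<in>E - {y}. q' u y z))
      has_integral (p r s x y - (if x = y then 1 else 0))) {r..s}"
  proof (rule has_integral_eq)
   show "((\<lambda>u. (\<Sum>z\<in>E - {y}. p r u x z * q u z y) - p r u x y * (\<Sum>z\<in>E - {y}. q u y z))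
      has_integral (p r s x y - (if x = y then 1 else 0))) {r..s}"
    using that[unfolded transition_probabilities_def, rule_format, OF r] .
   fix u assume u: "u \<in> {r..s}"
   have "(\<Sum>z\<in>E - {y}. p r u x z * q u z y) = (\<Sum>z\<in>E - {y}. p r u x z * q' u z y)" "(\<Sum>z\<in>E - {y}. q u y z) = (\<Sum>z\<in>E - {y}. q' u y z)"
    using eq[of u] u r by (auto intro!: sum.cong)
   thus "(\<Sum>z\<in>E - {y}. p r u x z * q u z y) - p r u x y * (\<Sum>z\<in>E - {y}. q u y z)
    = (\<Sum>z\<in>E - {y}. p r u x z * q' u z y) - p r u x y * (\<Sum>z\<in>E - {y}. q' u y z)" by simp
  qed
 qed
 thus ?thesis using mc unfolding markov_jump_chain_def by (elim conjE exE) (intro conjI exI, assumption+)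
qed

context cost_data begin

lemma agent_rates:
 fixes \<alpha> :: "real => real^'d => real^'d^'d"
 assumes N: "0 < N" and t: "t \<in> {0..T}" and fc: "feedback_control T M N \<alpha>"
 shows "rates (simplex_grid N) (jump_rate N \<alpha>) t T ((real CARD('d))\<^sup>2 * (real N * M))"
proof
 show "finite (simplex_grid N :: (real^'d) set)" by (rule finite_simplex_grid[OF N])
 show "t <= T" using t by simp
 show "0 <= (real CARD('d))\<^sup>2 * (real N * M)" using M0 by simp
 have a: "\<alpha> u x \<in> action_matrices M" if "u \<in> {t..T}" "x \<in> simplex_grid N" for u x
  using fc t that by (auto simp: feedback_control_def)
 show b: "0 <= jump_rate N \<alpha> u x y" "jump_rate N \<alpha> u x y <= (real CARD('d))\<^sup>2 * (real N * M)"
  if "u \<in> {t..T}" "x \<in> simplex_grid N" for u x y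
  using jump_rate_bounds[of \<alpha> u x M N y, OF a[OF that] simplex_grid_simplex[OF that(2)]] .
 fix x y :: "real^'d" assume x: "x \<in> simplex_grid N"
 have "(\<lambda>u. \<alpha> u x) \<in> borel_measurable (restrict_space borel {0..T})" using fc x by (simp add: feedback_control_def)
 hence c: "(\<lambda>u. \<alpha> u x $ i $ j) \<in> borel_measurable (restrict_space borel {0..T})" for i j
  by (rule measurable_compose) (intro borel_measurable_continuous_onI continuous_intros)
 have "(\<lambda>u. if y = x + (1 / real N) *\<^sub>R shift i j then real N * x $ i * \<alpha> u x $ i $ j else 0) \<in> borel_measurable (restrict_space borel {0..T})" for i j
  using c[of i j] by (cases "y = x + (1 / real N) *\<^sub>R shift i j") auto
 hence "(\<lambda>u. jump_rate N \<alpha> u x y) \<in> borel_measurable (restrict_space borel {0..T})"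
  unfolding jump_rate_def by (intro borel_measurable_sum)
 hence "(\<lambda>u. jump_rate N \<alpha> u x y) \<in> borel_measurable (restrict_space borel {t..T})"
  by (rule restrict_measurable_mono) (use t in auto)
 thus "(\<lambda>u. jump_rate N \<alpha> u x y) integrable_on {t..T}"
  by (rule bounded_borel_integrable(2)[where K = "(real CARD('d))\<^sup>2 * (real N * M)"]) (use b[OF _ x] in auto)
qed

lemma feedback_control_opt:
 fixes z :: "real => real^'d => 'd => real^'d"
 assumes z: "\<And>x i. x \<in> simplex_grid N ==> continuous_on {0..T} (\<lambda>t. z t x i)"
 shows "feedback_control T M N (\<lambda>t x. opt_matrix t x (z t x))"
 unfolding feedback_control_def
proof (intro ballI conjI)
 fix x :: "real^'d" assume x: "x \<in> simplex_grid N"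
 note xs = simplex_grid_simplex[OF x]
 show "(\<lambda>t. opt_matrix t x (z t x)) \<in> borel_measurable (restrict_space borel {0..T})"
  by (intro borel_measurable_continuous_on_restrict opt_matrix_continuous xs z[OF x])
 show "opt_matrix t x (z t x) \<in> action_matrices M" if "t \<in> {0..T}" for t by (rule opt_matrix_in[OF that xs])
qed

lemma PH_cong:
 assumes m: "m \<in> prob_simplex" and z: "\<And>i. 0 < m $ i ==> z i = y i"
 shows "PH t a m z = PH t a m y"
proof -
 have eq: "m $ i * (\<Sum>j\<in>UNIV - {i}. a $ i $ j * z i $ j) = m $ i * (\<Sum>j\<in>UNIV - {i}. a $ i $ j * y i $ j)" for i
  using simplex_coord(1)[OF m, of i] z[of i] by (cases "0 < m $ i") auto
 show ?thesis unfolding PH_def eq ..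
qed

lemma jump_rate_PH:
 fixes x :: "real^'d"
 assumes N: "0 < N" and x: "x \<in> simplex_grid N"
 shows "(\<Sum>y\<in>simplex_grid N - {x}. jump_rate N \<alpha> u x y * (v y - v x)) = PH u (\<alpha> u x) x (dz N v x) - F u (\<alpha> u x) x"
 unfolding jump_rate_generator[OF N x] PH_def by simp

lemma dz_lip:
 fixes x :: "real^'d"
 assumes N: "0 < N" and x: "x \<in> simplex_grid N"
 shows "\<bar>dz N u x i $ j - dz N v x i $ j\<bar> <= 2 * real N * (\<Sum>y\<in>simplex_grid N. \<bar>u y - v y\<bar>)"
proof (cases "0 < x $ i")
 case True
 let ?S = "\<Sum>y\<in>simplex_grid N. \<bar>u y - v y\<bar>" and ?y = "x + (1 / real N) *\<^sub>R shift i j"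
 have m: "\<bar>u y - v y\<bar> <= ?S" if "y \<in> simplex_grid N" for y
  using that by (intro member_le_sum[where f = "\<lambda>y. \<bar>u y - v y\<bar>"] finite_simplex_grid N) auto
 have "dz N u x i $ j - dz N v x i $ j = real N * ((u ?y - v ?y) - (u x - v x))"
  using True by (simp add: dz_def discrete_grad_def algebra_simps)
 also have "\<bar>\<dots>\<bar> <= real N * (2 * ?S)"
  unfolding abs_mult using m[OF x] m[OF grid_step[OF N x True, of j]] by (intro mult_mono) auto
 finally show ?thesis by simp
next
 case False
 thus ?thesis by (simp add: dz_def sum_nonneg)
qed

text \<open>The Hamilton-Jacobi-Bellman system on the finite grid runs backward from
  \<open>T\<close>; under the reversal \<open>s = T - t\<close> it is an initial value problem for
  \<open>picard_finite\<close>. The Hamiltonian is Lipschitz in the gradient, with a constant that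
  may depend on \<open>N\<close>.\<close>

lemma agent_hjb_exists:
 assumes N: "0 < N"
 shows "\<exists>w. \<forall>x\<in>simplex_grid N. w T x = G x \<and>
   (\<forall>t\<in>{0..T}. ((\<lambda>t. w t x) has_vector_derivative - ham t x (dz N (w t) x)) (at t within {0..T}))"
proof -
 let ?E = "simplex_grid N :: (real^'d) set"
 define \<Phi> where "\<Phi> s u x = ham (T - s) x (dz N u x)" for s and u :: "real^'d => real" and x
 have fE: "finite ?E" by (rule finite_simplex_grid[OF N])
 let ?K = "M * ((real CARD('d))\<^sup>2 * (2 * real N))"
 have cont: "continuous_on {0..T} (\<lambda>s. \<Phi> s (u s) x)" if u: "\<And>y. y \<in> ?E ==> continuous_on {0..T} (\<lambda>s. u s y)" and x: "x \<in> ?E" for u x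
 proof -
  have im: "(\<lambda>s. T - s) ` {0..T} \<subseteq> {0..T}" by auto
  have u': "continuous_on {0..T} (\<lambda>t. u (T - t) y)" if "y \<in> ?E" for y
   by (rule continuous_on_compose2[OF u[OF that] _ im]) (intro continuous_intros)
  have "continuous_on {0..T} (\<lambda>t. dz N (u (T - t)) x i $ j)" for i j
   using u'[OF x] u'[OF grid_step[OF N x, of i j]]
   by (cases "0 < x $ i") (auto simp: dz_def discrete_grad_def intro!: continuous_intros)
  hence "continuous_on {0..T} (\<lambda>t. ham t x (dz N (u (T - t)) x))"
   by (intro ham_continuous simplex_grid_simplex[OF x])
  moreover have "continuous_on {0..T} (\<lambda>s. T - s)" by (intro continuous_intros)
  ultimately have "continuous_on {0..T} (\<lambda>s. ham (T - s) x (dz N (u (T - (T - s))) x))"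
   using im by (rule continuous_on_compose2)
  thus ?thesis by (simp add: \<Phi>_def)
 qed
 have "\<exists>W. \<forall>x\<in>?E. continuous_on {0..T} (\<lambda>s. W s x) \<and> (\<forall>s\<in>{0..T}. ((\<lambda>r. \<Phi> r (W r) x) has_integral (W s x - G x)) {0..s})"
 \<comment> \<open>\<open>?K\<close> combines the rate bound \<open>M\<close>, at most
   \<open>CARD('d)^2\<close> pairs of states, and differences that are
   \<open>2 * real N\<close>-Lipschitz in the values. \<open>B\<close> takes the Hamiltonian at time
   0 and moves it to other times at cost \<open>CF * T\<close>.\<close>
 proof (rule picard_finite[OF fE, where K = ?K and B = "(\<Sum>x\<in>?E. \<bar>ham 0 x (dz N G x)\<bar>) + CF * T"])
  show "0 <= T" "0 <= ?K" using T0 M0 by auto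
  fix s :: real and x assume s: "s \<in> {0..T}" and x: "x \<in> ?E"
  have xs: "x \<in> prob_simplex" by (rule simplex_grid_simplex[OF x])
  have ts: "T - s \<in> {0..T}" "0 \<in> {0..T}" using s T0 by auto
  show "\<bar>\<Phi> s u x - \<Phi> s v x\<bar> <= ?K * (\<Sum>y\<in>?E. \<bar>u y - v y\<bar>)" for u v
  proof -
   let ?S = "\<Sum>y\<in>?E. \<bar>u y - v y\<bar>"
   have "\<bar>\<Phi> s u x - \<Phi> s v x\<bar> <= CF * \<bar>(T - s) - (T - s)\<bar> + M * (\<Sum>i\<in>UNIV. \<Sum>j\<in>UNIV - {i}. \<bar>dz N u x i $ j - dz N v x i $ j\<bar>)"
    unfolding \<Phi>_def by (rule ham_lip[OF ts(1) ts(1) xs])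
   also have "\<dots> = M * (\<Sum>i\<in>UNIV. \<Sum>j\<in>UNIV - {i}. \<bar>dz N u x i $ j - dz N v x i $ j\<bar>)" by simp
   also have "\<dots> <= M * ((real CARD('d))\<^sup>2 * (2 * real N * ?S))"
    using M0 by (intro mult_left_mono sum_offdiag_le dz_lip[OF N x] mult_nonneg_nonneg sum_nonneg) auto
   finally show ?thesis by (simp add: mult.assoc)
  qed
  have "\<bar>ham (T - s) x (dz N G x) - ham 0 x (dz N G x)\<bar> <= CF * \<bar>(T - s) - 0\<bar> + M * (\<Sum>i\<in>UNIV. \<Sum>j\<in>UNIV - {i}. \<bar>dz N G x i $ j - dz N G x i $ j\<bar>)"
   by (rule ham_lip[OF ts xs])
  moreover have "CF * \<bar>(T - s) - 0\<bar> <= CF * T" using CF0 s by (intro mult_left_mono) auto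
  moreover have "\<bar>ham 0 x (dz N G x)\<bar> <= (\<Sum>x\<in>?E. \<bar>ham 0 x (dz N G x)\<bar>)"
   using x fE by (intro member_le_sum[where f = "\<lambda>x. \<bar>ham 0 x (dz N G x)\<bar>"]) auto
  ultimately show "\<bar>\<Phi> s G x\<bar> <= (\<Sum>x\<in>?E. \<bar>ham 0 x (dz N G x)\<bar>) + CF * T" unfolding \<Phi>_def by simp
 next
  fix u :: "real => real^'d => real" and x assume "\<And>y. y \<in> ?E ==> continuous_on {0..T} (\<lambda>s. u s y)" "x \<in> ?E"
  thus "(\<lambda>s. \<Phi> s (u s) x) integrable_on {0..T}" by (intro integrable_continuous_real cont)
 qed
 then obtain W where W: "\<forall>x\<in>?E. continuous_on {0..T} (\<lambda>s. W s x) \<and> (\<forall>s\<in>{0..T}. ((\<lambda>r. \<Phi> r (W r) x) has_integral (W s x - G x)) {0..s})" by (rule exE)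
 have "W (T - T) x = G x \<and> (\<forall>t\<in>{0..T}. ((\<lambda>t. W (T - t) x) has_vector_derivative - ham t x (dz N (W (T - t)) x)) (at t within {0..T}))"
  if x: "x \<in> ?E" for x
 proof (intro conjI ballI)
  have Wx: "((\<lambda>r. \<Phi> r (W r) x) has_integral (W s x - G x)) {0..s}" if "s \<in> {0..T}" for s using W x that by blast
  have "((\<lambda>r. \<Phi> r (W r) x) has_integral (W 0 x - G x)) {0}" using Wx[of 0] T0 by simp
  thus "W (T - T) x = G x" using has_integral_unique[OF _ has_integral_refl(2)] by fastforce
  fix t assume t: "t \<in> {0..T}"
  have c: "continuous_on {0..T} (\<lambda>r. \<Phi> r (W r) x)" using W x by (intro cont) auto
  have im: "(\<lambda>s. T - s) ` {0..T} = {0..T}"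
  proof (intro set_eqI iffI)
   fix y assume "y \<in> {0..T}" thus "y \<in> (\<lambda>s. T - s) ` {0..T}" by (intro image_eqI[of _ _ "T - y"]) auto
  qed auto
  have "((\<lambda>s. G x + integral {0..s} (\<lambda>r. \<Phi> r (W r) x)) has_vector_derivative 0 + \<Phi> (T - t) (W (T - t)) x) (at (T - t) within {0..T})"
   using t by (intro has_vector_derivative_add has_vector_derivative_const integral_has_vector_derivative[OF c]) auto
  hence "((\<lambda>s. W s x) has_vector_derivative 0 + \<Phi> (T - t) (W (T - t)) x) (at (T - t) within {0..T})"
  proof (rule has_vector_derivative_transform[rotated 2])
   show "W s x = G x + integral {0..s} (\<lambda>r. \<Phi> r (W r) x)" if "s \<in> {0..T}" for s using integral_unique[OF Wx[OF that]] by simp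
  qed (use t in auto)
  hence 1: "((\<lambda>s. W s x) has_vector_derivative \<Phi> (T - t) (W (T - t)) x) (at (T - t) within (\<lambda>s. T - s) ` {0..T})" unfolding im by simp
  have 2: "((\<lambda>s. T - s) has_vector_derivative -1) (at t within {0..T})" by (auto intro!: derivative_eq_intros simp: has_real_derivative_iff_has_vector_derivative[symmetric])
  show "((\<lambda>t. W (T - t) x) has_vector_derivative - ham t x (dz N (W (T - t)) x)) (at t within {0..T})"
   using vector_diff_chain_within[OF 2 1] by (simp add: o_def \<Phi>_def)
 qed
 thus ?thesis by (intro exI[of _ "\<lambda>t x. W (T - t) x"] ballI)
qed

end

subsection \<open>The value function of the \<open>N\<close>-agent problem\<close>

text \<open>\<open>w\<close> is kept apart from \<open>agent_value\<close> until the verification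
  argument identifies the two.\<close>

locale agent_hjb = cost_data T M f g CF CG LD \<kappa> Df
 for T M and f :: "('d::finite) running_cost" and g CF CG LD \<kappa> Df +
 fixes N :: nat and w :: "real => real^'d => real"
 assumes N0: "0 < N" and w_T: "\<And>x. x \<in> simplex_grid N ==> w T x = total_terminal g x"
  and w_deriv: "\<And>x t. [|x \<in> simplex_grid N; t \<in> {0..T}|]
    ==> ((\<lambda>t. w t x) has_vector_derivative - ham t x (dz N (w t) x)) (at t within {0..T})"
begin

abbreviation "E \<equiv> (simplex_grid N :: (real^'d) set)"
abbreviation "zw t x \<equiv> dz N (w t) x"
abbreviation "hw t x \<equiv> ham t x (zw t x)"
definition "\<alpha>w t x = opt_matrix t x (zw t x)"

lemma fin_E: "finite E" by (rule finite_simplex_grid[OF N0])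
lemma E_simplex: "x \<in> E ==> x \<in> prob_simplex" by (rule simplex_grid_simplex)

lemma w_continuous: "x \<in> E ==> continuous_on {0..T} (\<lambda>t. w t x)"
 by (rule continuous_on_vector_derivative) (rule w_deriv)

lemma zw_continuous: assumes x: "x \<in> E" shows "continuous_on {0..T} (\<lambda>t. zw t x i)"
proof (cases "0 < x $ i")
 case True
 have "continuous_on {0..T} (\<lambda>t. real N * (w t (x + (1 / real N) *\<^sub>R shift i j) - w t x))" for j
  by (intro continuous_intros w_continuous x grid_step N0 True)
 thus ?thesis using True unfolding dz_def discrete_grad_def by (simp add: continuous_on_vec_lambda)
next
 case False
 thus ?thesis by (simp add: dz_def)
qed

lemma hw_continuous: assumes x: "x \<in> E" shows "continuous_on {0..T} (\<lambda>t. hw t x)"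
 by (intro ham_continuous E_simplex[OF x] continuous_on_component zw_continuous[OF x])

lemma hw_bounded: "\<exists>K. \<forall>u\<in>{0..T}. \<forall>x\<in>E. \<bar>hw u x\<bar> <= K"
proof -
 have "bounded (\<Union>x\<in>E. (\<lambda>u. hw u x) ` {0..T})"
  by (intro bounded_UN ballI compact_imp_bounded compact_continuous_image hw_continuous compact_Icc fin_E)
 then obtain K where "\<forall>y\<in>(\<Union>x\<in>E. (\<lambda>u. hw u x) ` {0..T}). norm y <= K" unfolding bounded_iff by blast
 thus ?thesis by (intro exI[of _ K]) auto
qed

lemma w_integral:
 assumes "0 <= c" "c <= s" "s <= T" and x: "x \<in> E"
 shows "((\<lambda>u. - hw u x) has_integral (w s x - w c x)) {c..s}"
proof (rule fundamental_theorem_of_calculus[OF assms(2)])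
 fix u assume "u \<in> {c..s}"
 thus "((\<lambda>t. w t x) has_vector_derivative - hw u x) (at u within {c..s})"
  using assms by (intro has_vector_derivative_within_subset[OF w_deriv[OF x]]) auto
qed

lemma feedback_\<alpha>w: "feedback_control T M N \<alpha>w"
 using feedback_control_opt[of N zw] zw_continuous by (simp add: \<alpha>w_def[abs_def])

lemma \<alpha>w_PH: "PH t (\<alpha>w t x) x (zw t x) = hw t x" by (simp add: \<alpha>w_def ham_def)

lemma dynkin_w:
 assumes r: "rates E (jump_rate N \<alpha>) t T L" and t: "0 <= t" and fs: "forward_sol E (jump_rate N \<alpha>) t T \<pi>"
 shows "((\<lambda>u. \<Sum>y\<in>E. \<pi> u y * (PH u (\<alpha> u y) y (zw u y) - hw u y - F u (\<alpha> u y) y)) has_integral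
   ((\<Sum>y\<in>E. \<pi> T y * G y) - (\<Sum>y\<in>E. \<pi> t y * w t y))) {t..T}"
proof -
 interpret rates E "jump_rate N \<alpha>" t T L by (rule r)
 obtain K where K: "\<forall>u\<in>{0..T}. \<forall>x\<in>E. \<bar>hw u x\<bar> <= K" using hw_bounded by (rule exE)
 have "((\<lambda>u. \<Sum>y\<in>E. \<pi> u y * (- hw u y + (\<Sum>x\<in>E - {y}. jump_rate N \<alpha> u y x * (w u x - w u y)))) has_integral
   ((\<Sum>y\<in>E. \<pi> T y * w T y) - (\<Sum>y\<in>E. \<pi> t y * w t y))) {t..T}"
 proof (rule dynkin[OF _ fs])
  show "((\<lambda>u. - hw u y) has_integral (w s y - w t y)) {t..s}" if "y \<in> E" "s \<in> {t..T}" for y s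
   using that t by (intro w_integral) auto
  show "\<bar>- hw u y\<bar> <= K" if "u \<in> {t..T}" "y \<in> E" for u y using K that t by auto
 qed (use ab in auto)
 moreover have "(\<Sum>y\<in>E. \<pi> T y * w T y) = (\<Sum>y\<in>E. \<pi> T y * G y)" by (simp add: w_T)
 moreover have "(\<Sum>y\<in>E. \<pi> u y * (- hw u y + (\<Sum>x\<in>E - {y}. jump_rate N \<alpha> u y x * (w u x - w u y))))
   = (\<Sum>y\<in>E. \<pi> u y * (PH u (\<alpha> u y) y (zw u y) - hw u y - F u (\<alpha> u y) y))" for u
 proof (rule sum.cong[OF refl])
  fix y assume "y \<in> E"
  thus "\<pi> u y * (- hw u y + (\<Sum>x\<in>E - {y}. jump_rate N \<alpha> u y x * (w u x - w u y)))
   = \<pi> u y * (PH u (\<alpha> u y) y (zw u y) - hw u y - F u (\<alpha> u y) y)" by (simp add: jump_rate_PH[OF N0])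
 qed
 ultimately show ?thesis by simp
qed

text \<open>Verification argument: by Dynkin's formula \<open>J - w t m\<close> is the expected time
  integral of \<open>PH - ham\<close>, which is nonnegative and vanishes when the feedback attains
  the minimum.\<close>

lemma expected_cost:
 fixes P :: "'w measure" and \<alpha> :: "real => real^'d => real^'d^'d"
 assumes t: "t \<in> {0..T}" and fc: "feedback_control T M N \<alpha>" and ch: "agent_chain T N \<alpha> t P X"
  and init: "AE om in P. X t om = m" and m: "m \<in> E"
 defines "J \<equiv> (LINT om|P. (LINT s:{t..T}|lborel. F s (\<alpha> s (X s om)) (X s om)) + G (X T om))"
 shows "w t m <= J" and "(\<And>u y. [|u \<in> {t..T}; y \<in> E|] ==> PH u (\<alpha> u y) y (zw u y) = hw u y) ==> J = w t m"
proof -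
 note r = agent_rates[OF N0 t fc]
 obtain p where "chain E (jump_rate N \<alpha>) t T ((real CARD('d))\<^sup>2 * (real N * M)) p P X"
  by (rule chain_if_markov_jump_chain[OF r ch[unfolded agent_chain_def]])
 then interpret C: chain E "jump_rate N \<alpha>" t T "(real CARD('d))\<^sup>2 * (real N * M)" p P X .
 obtain B where B: "\<And>t a m. [|t \<in> {0..T}; a \<in> action_matrices M; m \<in> prob_simplex|] ==> \<bar>F t a m\<bar> <= B" using F_bounded by metis
 have a: "\<alpha> s y \<in> action_matrices M" if "s \<in> {t..T}" "y \<in> E" for s y using fc that t by (auto simp: feedback_control_def)
 have Fb: "\<bar>F s (\<alpha> s y) y\<bar> <= B" if "s \<in> {t..T}" "y \<in> E" for s y using that t a by (intro B E_simplex) auto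
 have Fm: "(\<lambda>s. F s (\<alpha> s y) y) \<in> borel_measurable (restrict_space borel {t..T})" if y: "y \<in> E" for y
 proof (rule F_measurable)
  show "(\<lambda>s. \<alpha> s y) \<in> borel_measurable (restrict_space borel {t..T})"
  proof (rule measurable_restrict_mono)
   show "(\<lambda>s. \<alpha> s y) \<in> borel_measurable (restrict_space borel {0..T})" using fc y by (simp add: feedback_control_def)
  qed (use t in auto)
 qed (use t a y E_simplex in auto)
 have Fm': "(\<lambda>s. indicator {t..T} s * F s (\<alpha> s y) y) \<in> borel_measurable borel" if y: "y \<in> E" for y
  using Fm[OF y] unfolding borel_measurable_restrict_space_iff[of "{t..T}" borel "\<lambda>s. F s (\<alpha> s y) y", simplified] by simp
 let ?S = "\<lambda>u. \<Sum>y\<in>E. C.law u y * F u (\<alpha> u y) y"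
 have occ: "integrable P (\<lambda>om. LINT s:{t..T}|lborel. F s (\<alpha> s (X s om)) (X s om))"
  "(\<integral>om. (LINT s:{t..T}|lborel. F s (\<alpha> s (X s om)) (X s om)) \<partial>P) = integral {t..T} ?S"
  by (rule C.occupation_fubini[where \<phi> = "\<lambda>s y. F s (\<alpha> s y) y" and K = B]; (rule Fm' | rule Fb); assumption)+
 have TT: "T \<in> {t..T}" using t by simp
 have J: "J = integral {t..T} ?S + (\<Sum>y\<in>E. C.law T y * G y)"
  unfolding J_def Bochner_Integration.integral_add[OF occ(1) C.bdd_integrable[OF C.bdd_fun_X[OF TT, of G]]] occ(2) C.expect_law[OF TT, of G] ..
 have lc: "continuous_on {t..T} (\<lambda>u. C.law u y)" if "y \<in> E" for y by (rule forward_sol_continuous[OF C.law_forward that])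
 have Si: "?S integrable_on {t..T}"
 proof (intro integrable_sum fin_E)
  fix y assume y: "y \<in> E"
  have "(\<lambda>u. F u (\<alpha> u y) y) integrable_on {t..T}" by (rule bounded_borel_integrable(2)[OF Fm[OF y] Fb[OF _ y]])
  hence "(\<lambda>u. F u (\<alpha> u y) y * C.law u y) integrable_on {t..T}"
   by (rule integrable_on_mult_continuous[where K = B]) (use lc[OF y] Fb[OF _ y] in auto)
  thus "(\<lambda>u. C.law u y * F u (\<alpha> u y) y) integrable_on {t..T}" by (simp add: mult.commute)
 qed
 have tt: "t \<in> {t..T}" using t by simp
 have "(\<Sum>y\<in>E. C.law t y * w t y) = (\<integral>om. w t (X t om) \<partial>P)" by (rule C.expect_law[OF tt, symmetric])
 also have "\<dots> = (\<integral>om. w t m \<partial>P)"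
 proof (rule integral_cong_AE)
  show "AE om in P. w t (X t om) = w t m" using init by eventually_elim simp
 qed (use C.fun_X_measurable[OF tt, of "w t"] in simp_all)
 finally have l0: "(\<Sum>y\<in>E. C.law t y * w t y) = w t m" by (simp add: C.prob_space)
 have t0: "0 <= t" using t by simp
 have hi0: "((\<lambda>u. (\<Sum>y\<in>E. C.law u y * (PH u (\<alpha> u y) y (zw u y) - hw u y - F u (\<alpha> u y) y)) + ?S u) has_integral
   (((\<Sum>y\<in>E. C.law T y * G y) - w t m) + integral {t..T} ?S)) {t..T}"
  using has_integral_add[OF dynkin_w[OF r t0 C.law_forward] integrable_integral[OF Si]] unfolding l0 .
 have hi: "((\<lambda>u. \<Sum>y\<in>E. C.law u y * (PH u (\<alpha> u y) y (zw u y) - hw u y)) has_integral (J - w t m)) {t..T}"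
 proof -
  have "(\<Sum>y\<in>E. C.law u y * (PH u (\<alpha> u y) y (zw u y) - hw u y - F u (\<alpha> u y) y)) + ?S u
    = (\<Sum>y\<in>E. C.law u y * (PH u (\<alpha> u y) y (zw u y) - hw u y))" for u
   unfolding sum.distrib[symmetric] by (intro sum.cong refl) (simp only: right_diff_distrib diff_add_cancel)
  moreover have "((\<Sum>y\<in>E. C.law T y * G y) - w t m) + integral {t..T} ?S = J - w t m" unfolding J by simp
  ultimately show ?thesis using hi0 by (simp only:)
 qed
 have "0 <= J - w t m"
 proof (rule has_integral_nonneg[OF hi])
  fix u assume u: "u \<in> {t..T}"
  hence "u \<in> {0..T}" using t by auto
  thus "0 <= (\<Sum>y\<in>E. C.law u y * (PH u (\<alpha> u y) y (zw u y) - hw u y))"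
   using PH_min a[OF u] E_simplex by (intro sum_nonneg mult_nonneg_nonneg C.law_nonneg) (auto simp: ham_def)
 qed
 thus "w t m <= J" by simp
 assume eq: "\<And>u y. [|u \<in> {t..T}; y \<in> E|] ==> PH u (\<alpha> u y) y (zw u y) = hw u y"
 have "(\<Sum>y\<in>E. C.law u y * (PH u (\<alpha> u y) y (zw u y) - hw u y)) = 0" if "u \<in> {t..T}" for u
  by (intro sum.neutral ballI) (simp only: eq[OF that] diff_self mult_zero_right)
 hence "((\<lambda>u. 0) has_integral (J - w t m)) {t..T}" by (rule has_integral_eq[OF _ hi])
 from has_integral_unique[OF this has_integral_0] show "J = w t m" by simp
qed

lemma agent_value_eq:
 assumes t: "t \<in> {0..T}" and m: "m \<in> E"
 shows "agent_value T M f g N t m = w t m"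
 unfolding agent_value_def
proof (rule cInf_eq_minimum)
 obtain P :: "(real => real^'d) measure" and X where PX: "markov_jump_chain P E (jump_rate N \<alpha>w) t T X" "AE om in P. X t om = m"
  using markov_jump_chain_exists[OF agent_rates[OF N0 t feedback_\<alpha>w] m] by (elim exE conjE)
 have ac: "agent_chain T N \<alpha>w t P X" using PX(1) by (simp add: agent_chain_def)
 have J: "(LINT om|P. (LINT s:{t..T}|lborel. F s (\<alpha>w s (X s om)) (X s om)) + G (X T om)) = w t m"
  by (rule expected_cost(2)[OF t feedback_\<alpha>w ac PX(2) m]) (rule \<alpha>w_PH)
 show "w t m \<in> {(LINT om|P. (LINT s:{t..T}|lborel. F s (\<alpha> s (X s om)) (X s om)) + G (X T om)) |
      \<alpha> (P :: (real => real^'d) measure) X.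
      feedback_control T M N \<alpha> \<and> agent_chain T N \<alpha> t P X \<and> (AE om in P. X t om = m)}"
  by (rule CollectI, rule exI[of _ \<alpha>w], rule exI[of _ P], rule exI[of _ X]) (intro conjI J[symmetric] feedback_\<alpha>w ac PX(2))
next
 fix y assume "y \<in> {(LINT om|P. (LINT s:{t..T}|lborel. F s (\<alpha> s (X s om)) (X s om)) + G (X T om)) |
      \<alpha> (P :: (real => real^'d) measure) X.
      feedback_control T M N \<alpha> \<and> agent_chain T N \<alpha> t P X \<and> (AE om in P. X t om = m)}"
 then obtain \<alpha> and P :: "(real => real^'d) measure" and X where
  y: "y = (LINT om|P. (LINT s:{t..T}|lborel. F s (\<alpha> s (X s om)) (X s om)) + G (X T om))"
   "feedback_control T M N \<alpha>" "agent_chain T N \<alpha> t P X" "AE om in P. X t om = m"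
  unfolding mem_Collect_eq by (elim exE conjE)
 show "w t m <= y" unfolding y(1) by (rule expected_cost(1)[OF t y(2-4) m])
qed

text \<open>In an occupied state both feedbacks use the same discrete gradient, all of whose
  arguments lie on the grid; in an empty state the factor \<open>x $ i\<close> removes the
  difference.\<close>

lemma agent_opt_rate:
 assumes t: "t \<in> {0..T}" and x: "x \<in> E"
 shows "jump_rate N (agent_opt_feedback T M f g N) t x y = jump_rate N \<alpha>w t x y"
 unfolding jump_rate_def
proof (intro sum.cong refl if_cong)
 fix i j
 have "real N * x $ i * agent_opt_feedback T M f g N t x $ i $ j = real N * x $ i * \<alpha>w t x $ i $ j"
 proof (cases "0 < x $ i")
  case True
  have "discrete_grad N i (agent_value T M f g N t) x = discrete_grad N i (w t) x"
   by (simp add: discrete_grad_def vec_eq_iff agent_value_eq[OF t] grid_step[OF N0 x True] x)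
  thus ?thesis using True by (simp add: agent_opt_feedback_def \<alpha>w_def opt_matrix_def dz_def)
 next
  case False
  hence "x $ i = 0" using simplex_coord(1)[OF E_simplex[OF x], of i] by simp
  thus ?thesis by simp
 qed
 thus "real N * x $ i * agent_opt_feedback T M f g N t x $ i $ j = real N * x $ i * \<alpha>w t x $ i $ j" .
qed

end

subsection \<open>Comparison with the mean field control problem\<close>

locale agent_regular = regular_value T M f g CF CG LD \<kappa> Df U ut z LU + agent_hjb T M f g CF CG LD \<kappa> Df N w
 for T M and f :: "('d::finite) running_cost" and g CF CG LD \<kappa> Df U ut z LU N w

context regular_value begin

lemma U_deriv:
 assumes t: "t \<in> {0..T}" and m: "m \<in> prob_simplex"
 shows "((\<lambda>t. U t m) has_vector_derivative ut t m) (at t within {0..T})"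
 unfolding has_real_derivative_iff_has_vector_derivative[symmetric] has_field_derivative_iff
proof (rule LIM_zero_cancel, rule Lim_null_comparison)
 have "norm ((U s m - U t m) / (s - t) - ut t m) <= LU * \<bar>s - t\<bar>" if s: "s \<in> {0..T}" "s ~= t" for s
 proof -
  have "(U s m - U t m) / (s - t) - ut t m = (U s m - U t m - ut t m * (s - t)) / (s - t)" using s by (simp add: field_simps)
  thus ?thesis using U_time[OF t s(1) m] s by (simp add: divide_le_eq power2_eq_square abs_mult[symmetric] mult.assoc)
 qed
 thus "\<forall>\<^sub>F s in at t within {0..T}. norm ((U s m - U t m) / (s - t) - ut t m) <= LU * \<bar>s - t\<bar>"
  unfolding eventually_at_filter by (intro always_eventually) blast
 have "((\<lambda>s. LU * \<bar>s - t\<bar>) \<longlongrightarrow> LU * \<bar>t - t\<bar>) (at t within {0..T})" by (intro tendsto_intros)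
 thus "((\<lambda>s. LU * \<bar>s - t\<bar>) \<longlongrightarrow> 0) (at t within {0..T})" by simp
qed

lemma z_continuous: assumes m: "m \<in> prob_simplex" shows "continuous_on {0..T} (\<lambda>t. z i t m)"
proof -
 have "LU-lipschitz_on {0..T} (\<lambda>t. z i t m)"
  using z_lip[OF _ _ m m, of _ _ i] LU0 by (intro lipschitz_onI) (auto simp: dist_norm)
 thus ?thesis by (rule lipschitz_on_continuous_on)
qed

definition "\<alpha>s t x = opt_matrix t x (\<lambda>i. z i t x)"

text \<open>Consistency error of the mean field value on the grid, up to the factor
  \<open>1 / real N\<close>; see \<open>dz_U_close\<close>.\<close>

definition "c1 = M * ((real CARD('d))\<^sup>2 * LU)"

lemma c1_nonneg: "0 <= c1" using M0 LU0 by (simp add: c1_def)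

end

context agent_regular begin

text \<open>The Taylor error of one jump is at most \<open>LU / N^2\<close>; the difference quotient
  multiplies it by \<open>N\<close>, and the pairing with the rates by \<open>M\<close> for each
  pair of states.\<close>

lemma dz_U_close:
 assumes t: "t \<in> {0..T}" and y: "y \<in> E" and a: "a \<in> action_matrices M"
 shows "\<bar>PH t a y (dz N (U t) y) - PH t a y (\<lambda>i. z i t y)\<bar> <= c1 / real N"
proof -
 have ys: "y \<in> prob_simplex" by (rule E_simplex[OF y])
 let ?z = "\<lambda>i. if 0 < y $ i then z i t y else 0"
 have b: "\<bar>dz N (U t) y i $ j - ?z i $ j\<bar> <= LU / real N" for i j
 proof (cases "0 < y $ i")
  case True
  let ?h = "1 / real N"
  have "\<bar>U t (y + ?h *\<^sub>R shift i j) - U t y - ?h * z i t y $ j\<bar> <= LU * ?h\<^sup>2"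
   by (rule U_space[OF t ys E_simplex[OF grid_step[OF N0 y True]]])
  hence "real N * \<bar>U t (y + ?h *\<^sub>R shift i j) - U t y - ?h * z i t y $ j\<bar> <= real N * (LU * ?h\<^sup>2)" by (intro mult_left_mono) auto
  moreover have "real N * (LU * ?h\<^sup>2) = LU / real N" using N0 by (simp add: power2_eq_square)
  moreover have "dz N (U t) y i $ j - ?z i $ j = real N * (U t (y + ?h *\<^sub>R shift i j) - U t y - ?h * z i t y $ j)"
   using True N0 by (simp add: dz_def discrete_grad_def right_diff_distrib)
  ultimately show ?thesis by (simp add: abs_mult)
 next
  case False
  thus ?thesis using LU0 by (simp add: dz_def)
 qed
 have "PH t a y (\<lambda>i. z i t y) = PH t a y ?z" by (rule PH_cong[OF ys]) simp
 hence "\<bar>PH t a y (dz N (U t) y) - PH t a y (\<lambda>i. z i t y)\<bar> <= M * (\<Sum>i\<in>UNIV. \<Sum>j\<in>UNIV - {i}. \<bar>dz N (U t) y i $ j - ?z i $ j\<bar>)"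
  using PH_lip_z[OF ys a, of t "dz N (U t) y" ?z] by simp
 also have "\<dots> <= M * ((real CARD('d))\<^sup>2 * (LU / real N))"
  using b M0 LU0 by (intro mult_left_mono sum_offdiag_le) auto
 finally show ?thesis by (simp add: c1_def)
qed

text \<open>Dynkin's formula for \<open>U - w\<close>, whose terminal values cancel. The integrand
  is arranged as the residual of \<open>U\<close> under the control \<open>\<alpha>\<close> plus a
  bracket that is minus the suboptimality of \<open>\<alpha>\<close> for \<open>w\<close>; their
  signs are used separately.\<close>

lemma dynkin_difference:
 assumes r: "rates E (jump_rate N \<alpha>) 0 T L" and fs: "forward_sol E (jump_rate N \<alpha>) 0 T \<pi>"
 shows "((\<lambda>u. \<Sum>y\<in>E. \<pi> u y * (ut u y + PH u (\<alpha> u y) y (dz N (U u) y) + (hw u y - PH u (\<alpha> u y) y (zw u y)))) has_integral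
   (\<Sum>y\<in>E. \<pi> 0 y * (w 0 y - U 0 y))) {0..T}"
proof -
 interpret rates E "jump_rate N \<alpha>" 0 T L by (rule r)
 obtain K where K: "\<forall>u\<in>{0..T}. \<forall>x\<in>E. \<bar>hw u x\<bar> <= K" using hw_bounded by (rule exE)
 have "((\<lambda>u. \<Sum>y\<in>E. \<pi> u y * ((ut u y - - hw u y) + (\<Sum>x\<in>E - {y}. jump_rate N \<alpha> u y x * ((U u x - w u x) - (U u y - w u y))))) has_integral
   ((\<Sum>y\<in>E. \<pi> T y * (U T y - w T y)) - (\<Sum>y\<in>E. \<pi> 0 y * (U 0 y - w 0 y)))) {0..T}"
 proof (rule dynkin[OF _ fs])
  show "((\<lambda>u. ut u y - - hw u y) has_integral ((U s y - w s y) - (U 0 y - w 0 y))) {0..s}" if "y \<in> E" "s \<in> {0..T}" for y s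
  proof -
   have "((\<lambda>u. ut u y) has_integral (U s y - U 0 y)) {0..s}"
   proof (rule fundamental_theorem_of_calculus)
    fix u assume "u \<in> {0..s}"
    thus "((\<lambda>u. U u y) has_vector_derivative ut u y) (at u within {0..s})"
     using that by (intro has_vector_derivative_within_subset[OF U_deriv[OF _ E_simplex]]) auto
   qed (use that in auto)
   from has_integral_diff[OF this w_integral[of 0 s y]] that show ?thesis by (simp add: algebra_simps)
  qed
  show "\<bar>ut u y - - hw u y\<bar> <= LU + K" if "u \<in> {0..T}" "y \<in> E" for u y
   using K that ut_bound[OF that(1) E_simplex[OF that(2)]] abs_triangle_ineq[of "ut u y" "hw u y"] by fastforce
 qed (use T0 in auto)
 moreover have "(\<Sum>y\<in>E. \<pi> T y * (U T y - w T y)) = 0" by (intro sum.neutral ballI) (simp add: w_T U_terminal E_simplex)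
 moreover have "- (\<Sum>y\<in>E. \<pi> 0 y * (U 0 y - w 0 y)) = (\<Sum>y\<in>E. \<pi> 0 y * (w 0 y - U 0 y))"
  by (simp add: sum_negf[symmetric] algebra_simps)
 moreover have "(\<Sum>y\<in>E. \<pi> u y * ((ut u y - - hw u y) + (\<Sum>x\<in>E - {y}. jump_rate N \<alpha> u y x * ((U u x - w u x) - (U u y - w u y)))))
   = (\<Sum>y\<in>E. \<pi> u y * (ut u y + PH u (\<alpha> u y) y (dz N (U u) y) + (hw u y - PH u (\<alpha> u y) y (zw u y))))" for u
 proof (intro sum.cong refl arg_cong[where f = "\<lambda>h. \<pi> u _ * h"])
  fix y assume y: "y \<in> E"
  have "(\<Sum>x\<in>E - {y}. jump_rate N \<alpha> u y x * ((U u x - w u x) - (U u y - w u y)))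
    = (\<Sum>x\<in>E - {y}. jump_rate N \<alpha> u y x * (U u x - U u y)) - (\<Sum>x\<in>E - {y}. jump_rate N \<alpha> u y x * (w u x - w u y))"
   by (simp add: sum_subtractf[symmetric] algebra_simps)
  thus "(ut u y - - hw u y) + (\<Sum>x\<in>E - {y}. jump_rate N \<alpha> u y x * ((U u x - w u x) - (U u y - w u y)))
   = ut u y + PH u (\<alpha> u y) y (dz N (U u) y) + (hw u y - PH u (\<alpha> u y) y (zw u y))" unfolding jump_rate_PH[OF N0 y] by simp
 qed
 ultimately show ?thesis by simp
qed

text \<open>Under the mean field feedback the residual of \<open>U\<close> is at most
  \<open>c1 / N\<close> by the Hamilton-Jacobi-Bellman equation, and the other bracket is at most 0.
  Both are averaged over the solution \<open>\<pi>\<close> of the forward equation started at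
  \<open>x\<close>.\<close>

lemma w_le_U:
 assumes x: "x \<in> E" shows "w 0 x - U 0 x <= c1 / real N * T"
proof -
 have T: "(0::real) \<in> {0..T}" using T0 by simp
 have fc: "feedback_control T M N \<alpha>s"
  using feedback_control_opt[of N "\<lambda>t x i. z i t x"] z_continuous E_simplex by (simp add: \<alpha>s_def[abs_def])
 note r = agent_rates[OF N0 T fc]
 interpret rates E "jump_rate N \<alpha>s" 0 T "(real CARD('d))\<^sup>2 * (real N * M)" by (rule r)
 obtain \<pi> where \<pi>0: "\<And>y. y \<in> E ==> \<pi> 0 y = (if y = x then 1 else 0)" and fs: "forward_sol E (jump_rate N \<alpha>s) 0 T \<pi>"
  using forward_sol_exists[OF T, of "\<lambda>y. if y = x then 1 else 0"] by metis
 have nn: "0 <= \<pi> u y" if "u \<in> {0..T}" "y \<in> E" for u y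
  by (rule forward_sol_nonneg[OF _ fs _ that]) (auto simp: \<pi>0)
 have mass: "(\<Sum>y\<in>E. \<pi> u y) = 1" if "u \<in> {0..T}" for u
  using forward_sol_mass[OF _ fs that] \<pi>0 fin_E x by simp
 have "(\<Sum>y\<in>E. \<pi> 0 y * (w 0 y - U 0 y)) <= c1 / real N * T"
 proof (rule has_integral_le[OF dynkin_difference[OF r fs]])
  show "((\<lambda>u. c1 / real N) has_integral (c1 / real N * T)) {0..T}" using has_integral_const_real[of "c1 / real N" 0 T] T0 by (simp add: mult.commute)
  fix u assume u: "u \<in> {0..T}"
  have "ut u y + PH u (\<alpha>s u y) y (dz N (U u) y) + (hw u y - PH u (\<alpha>s u y) y (zw u y)) <= c1 / real N" if y: "y \<in> E" for y
  proof -
   have ys: "y \<in> prob_simplex" by (rule E_simplex[OF y])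
   have a: "\<alpha>s u y \<in> action_matrices M" unfolding \<alpha>s_def by (rule opt_matrix_in[OF u ys])
   have "PH u (\<alpha>s u y) y (\<lambda>i. z i u y) = ham u y (\<lambda>i. z i u y)" by (simp add: \<alpha>s_def ham_def)
   thus ?thesis using dz_U_close[OF u y a] hjb[OF u ys] PH_min[OF u ys a, of "zw u y"] unfolding ham_def by linarith
  qed
  hence "(\<Sum>y\<in>E. \<pi> u y * (ut u y + PH u (\<alpha>s u y) y (dz N (U u) y) + (hw u y - PH u (\<alpha>s u y) y (zw u y)))) <= (\<Sum>y\<in>E. \<pi> u y * (c1 / real N))"
   using nn[OF u] by (intro sum_mono mult_left_mono) auto
  also have "\<dots> = c1 / real N" unfolding sum_distrib_right[symmetric] mass[OF u] by simp
  finally show "(\<Sum>y\<in>E. \<pi> u y * (ut u y + PH u (\<alpha>s u y) y (dz N (U u) y) + (hw u y - PH u (\<alpha>s u y) y (zw u y)))) <= c1 / real N" .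
 qed
 moreover have "(\<Sum>y\<in>E. \<pi> 0 y * (w 0 y - U 0 y)) = w 0 x - U 0 x"
 proof -
  have "(\<Sum>y\<in>E. \<pi> 0 y * (w 0 y - U 0 y)) = (\<Sum>y\<in>E. if y = x then w 0 y - U 0 y else 0)" by (intro sum.cong refl) (simp add: \<pi>0)
  thus ?thesis using fin_E x by simp
 qed
 ultimately show ?thesis by simp
qed

definition "Dgap u y = (\<Sum>i\<in>UNIV. y $ i * (\<Sum>j\<in>UNIV - {i}. (\<alpha>w u y $ i $ j - \<alpha>s u y $ i $ j)\<^sup>2))"

lemma \<alpha>w_continuous: "y \<in> E ==> continuous_on {0..T} (\<lambda>u. \<alpha>w u y)"
 unfolding \<alpha>w_def by (intro opt_matrix_continuous E_simplex zw_continuous)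

lemma \<alpha>s_continuous: "y \<in> E ==> continuous_on {0..T} (\<lambda>u. \<alpha>s u y)"
 unfolding \<alpha>s_def by (intro opt_matrix_continuous E_simplex z_continuous)

lemma Dgap_continuous: "y \<in> E ==> continuous_on {0..T} (\<lambda>u. Dgap u y)"
 unfolding Dgap_def by (intro continuous_intros continuous_on_component \<alpha>w_continuous \<alpha>s_continuous)

text \<open>Under the optimal feedback \<open>\<alpha>w\<close> the second bracket of
  \<open>dynkin_difference\<close> vanishes, and the residual of \<open>U\<close> is at least
  \<open>\<kappa> / 2 * Dgap - c1 / N\<close> by \<open>PH_gap\<close>. With \<open>w_le_U\<close>
  two errors \<open>c1 * T / N\<close> remain, and division by \<open>\<kappa> / 2\<close> gives the
  factor 4.\<close>

lemma energy:
 assumes fs: "forward_sol E (jump_rate N \<alpha>w) 0 T \<pi>" and nn: "\<And>u y. [|u \<in> {0..T}; y \<in> E|] ==> 0 <= \<pi> u y"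
  and mass: "\<And>u. u \<in> {0..T} ==> (\<Sum>y\<in>E. \<pi> u y) = 1"
 shows "(\<lambda>u. \<Sum>y\<in>E. \<pi> u y * Dgap u y) integrable_on {0..T}"
  "integral {0..T} (\<lambda>u. \<Sum>y\<in>E. \<pi> u y * Dgap u y) <= 4 * c1 * T / (\<kappa> * real N)"
proof -
 have T: "(0::real) \<in> {0..T}" using T0 by simp
 note r = agent_rates[OF N0 T feedback_\<alpha>w]
 have "continuous_on {0..T} (\<lambda>u. \<Sum>y\<in>E. \<pi> u y * Dgap u y)"
  by (intro continuous_intros Dgap_continuous forward_sol_continuous[OF fs])
 thus int: "(\<lambda>u. \<Sum>y\<in>E. \<pi> u y * Dgap u y) integrable_on {0..T}" by (rule integrable_continuous_real)
 let ?I = "integral {0..T} (\<lambda>u. \<Sum>y\<in>E. \<pi> u y * Dgap u y)"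
 have "((\<lambda>u. \<kappa> / 2 * (\<Sum>y\<in>E. \<pi> u y * Dgap u y) - c1 / real N) has_integral (\<kappa> / 2 * ?I - c1 / real N * T)) {0..T}"
  using has_integral_diff[OF has_integral_mult_right[OF integrable_integral[OF int], of "\<kappa> / 2"] has_integral_const_real[of "c1 / real N" 0 T]] T0
  by (simp add: mult.commute)
 hence "\<kappa> / 2 * ?I - c1 / real N * T <= (\<Sum>y\<in>E. \<pi> 0 y * (w 0 y - U 0 y))"
 proof (rule has_integral_le[OF _ dynkin_difference[OF r fs]])
  fix u assume u: "u \<in> {0..T}"
  have "\<kappa> / 2 * Dgap u y - c1 / real N <= ut u y + PH u (\<alpha>w u y) y (dz N (U u) y) + (hw u y - PH u (\<alpha>w u y) y (zw u y))" if y: "y \<in> E" for y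
  proof -
   have ys: "y \<in> prob_simplex" by (rule E_simplex[OF y])
   have a: "\<alpha>w u y \<in> action_matrices M" unfolding \<alpha>w_def by (rule opt_matrix_in[OF u ys])
   have "PH u (\<alpha>w u y) y (\<lambda>i. z i u y) \<ge> ham u y (\<lambda>i. z i u y) + \<kappa> / 2 * Dgap u y"
    unfolding ham_def Dgap_def \<alpha>s_def by (rule PH_gap[OF u ys a])
   thus ?thesis using dz_U_close[OF u y a] hjb[OF u ys] \<alpha>w_PH[of u y] by linarith
  qed
  hence "(\<Sum>y\<in>E. \<pi> u y * (\<kappa> / 2 * Dgap u y - c1 / real N))
   <= (\<Sum>y\<in>E. \<pi> u y * (ut u y + PH u (\<alpha>w u y) y (dz N (U u) y) + (hw u y - PH u (\<alpha>w u y) y (zw u y))))"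
   using nn[OF u] by (intro sum_mono mult_left_mono) auto
  moreover have "(\<Sum>y\<in>E. \<pi> u y * (\<kappa> / 2 * Dgap u y - c1 / real N)) = \<kappa> / 2 * (\<Sum>y\<in>E. \<pi> u y * Dgap u y) - (\<Sum>y\<in>E. \<pi> u y) * (c1 / real N)"
   unfolding right_diff_distrib sum_subtractf sum_distrib_right[symmetric] by (simp add: sum_distrib_left mult.left_commute)
  ultimately show "\<kappa> / 2 * (\<Sum>y\<in>E. \<pi> u y * Dgap u y) - c1 / real N
   <= (\<Sum>y\<in>E. \<pi> u y * (ut u y + PH u (\<alpha>w u y) y (dz N (U u) y) + (hw u y - PH u (\<alpha>w u y) y (zw u y))))"
   using mass[OF u] by simp
 qed
 also have "\<dots> <= (\<Sum>y\<in>E. \<pi> 0 y * (c1 / real N * T))" using nn[OF T] w_le_U by (intro sum_mono mult_left_mono) auto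
 also have "\<dots> = c1 / real N * T" unfolding sum_distrib_right[symmetric] mass[OF T] by simp
 finally have "\<kappa> / 2 * ?I <= c1 / real N * T + c1 / real N * T" unfolding diff_le_eq .
 thus "?I <= 4 * c1 * T / (\<kappa> * real N)" using \<kappa>0 N0 by (simp add: field_simps)
qed

end

section \<open>Convergence of the optimal processes\<close>

subsection \<open>Short-time estimates for a chain\<close>

lemma discrete_gronwall:
 fixes e h :: "nat => real"
 assumes L: "0 <= L" and A: "0 <= A" and h: "\<And>j. 0 <= h j"
  and e: "\<And>k. k <= n ==> e k <= A + L * (\<Sum>j<k. h j * e j)" and k: "k <= n"
 shows "e k <= A * exp (L * (\<Sum>j<k. h j))"
proof -
 have "A + L * (\<Sum>j<k. h j * e j) <= A * exp (L * (\<Sum>j<k. h j))" if "k <= n" for k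
  using that
 proof (induction k)
  case 0 thus ?case by simp
 next
  case (Suc k)
  let ?B = "A + L * (\<Sum>j<k. h j * e j)" and ?S = "\<Sum>j<k. h j"
  have B: "?B <= A * exp (L * ?S)" using Suc by simp
  have ek: "e k <= ?B" using e[of k] Suc by simp
  have Lh: "0 <= L * h k" using L h by simp
  have "A + L * (\<Sum>j<Suc k. h j * e j) = ?B + L * h k * e k" by (simp add: algebra_simps)
  also have "\<dots> <= ?B + L * h k * ?B" by (intro add_left_mono mult_left_mono ek Lh)
  also have "\<dots> = ?B * (1 + L * h k)" by (simp add: algebra_simps)
  also have "\<dots> <= (A * exp (L * ?S)) * exp (L * h k)"
   using A Lh by (intro mult_mono B exp_ge_add_one_self) auto
  also have "\<dots> = A * exp (L * (\<Sum>j<Suc k. h j))" by (simp add: exp_add distrib_left)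
  finally show ?case .
 qed
 thus ?thesis using e[OF k] k by (meson order_trans)
qed

context transition_rates begin

definition gen :: "real => ('e => real) => 'e => real" where
 "gen u \<psi> y = (\<Sum>z\<in>E - {y}. q u y z * (\<psi> z - \<psi> y))"

lemma p_dynkin:
 assumes r: "a <= r" "r <= s" "s <= b" and x: "x \<in> E"
 shows "((\<lambda>u. \<Sum>y\<in>E. p r u x y * gen u \<psi> y) has_integral ((\<Sum>y\<in>E. p r s x y * \<psi> y) - \<psi> x)) {r..s}"
proof -
 have "((\<lambda>u. \<Sum>y\<in>E. p r u x y * (0 + (\<Sum>z\<in>E - {y}. q u y z * (\<psi> z - \<psi> y)))) has_integral
   ((\<Sum>y\<in>E. p r s x y * \<psi> y) - (\<Sum>y\<in>E. p r r x y * \<psi> y))) {r..s}"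
  by (rule dynkin[where c = r and d = b and K' = 0 and v = "\<lambda>_. \<psi>", OF _ p_forward]) (use assms in auto)
 moreover have "(\<Sum>y\<in>E. p r r x y * \<psi> y) = \<psi> x"
 proof -
  have "(\<Sum>y\<in>E. p r r x y * \<psi> y) = (\<Sum>y\<in>E. if x = y then \<psi> y else 0)" by (intro sum.cong refl) (use p_refl r x in auto)
  thus ?thesis using fin x by simp
 qed
 ultimately show ?thesis by (simp add: gen_def)
qed

text \<open>The generator is frozen at the starting state. This is wrong only where the chain has
  left \<open>x\<close>, which has probability at most \<open>Lam * (s - r)\<close>, and then by at
  most \<open>2 * B\<close>.\<close>

lemma p_drift:
 assumes r: "a <= r" "r <= s" "s <= b" and x: "x \<in> E" and B: "\<And>u y. [|u \<in> {r..s}; y \<in> E|] ==> \<bar>gen u \<psi> y\<bar> <= B"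
 shows "\<bar>(\<Sum>y\<in>E. p r s x y * \<psi> y) - \<psi> x - integral {r..s} (\<lambda>u. gen u \<psi> x)\<bar> <= 2 * B * Lam * (s - r)\<^sup>2"
proof -
 have gi: "(\<lambda>u. gen u \<psi> x) integrable_on {r..s}"
  unfolding gen_def
 proof (intro integrable_sum integrable_on_mult_left)
  fix z assume "z \<in> E - {x}"
  hence "(\<lambda>u. q u x z) integrable_on {a..b}" using x by (intro qint) auto
  thus "(\<lambda>u. q u x z) integrable_on {r..s}" by (rule integrable_on_subinterval) (use r in auto)
 qed (use fin in auto)
 have B0: "0 <= B" using B[of r x] r x abs_ge_zero[of "gen r \<psi> x"] by (meson atLeastAtMost_iff order_refl order_trans)
 have b: "\<bar>(\<Sum>y\<in>E. p r u x y * gen u \<psi> y) - gen u \<psi> x\<bar> <= 2 * B * Lam * (s - r)" if u: "u \<in> {r..s}" for u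
 proof -
  have u': "a <= r" "r <= u" "u <= b" using u r by auto
  have "(\<Sum>y\<in>E. p r u x y * gen u \<psi> y) - gen u \<psi> x = (\<Sum>y\<in>E. p r u x y * (gen u \<psi> y - gen u \<psi> x))"
   unfolding right_diff_distrib sum_subtractf sum_distrib_right[symmetric] p_sum[OF u' x] by simp
  also have "\<dots> = (\<Sum>y\<in>E - {x}. p r u x y * (gen u \<psi> y - gen u \<psi> x))"
   using fin x by (simp add: sum.remove)
  also have "\<bar>\<dots>\<bar> <= (\<Sum>y\<in>E - {x}. p r u x y * (2 * B))"
  proof (rule order_trans[OF sum_abs sum_mono])
   fix y assume y: "y \<in> E - {x}"
   hence "\<bar>gen u \<psi> y - gen u \<psi> x\<bar> <= 2 * B" using B[OF u, of y] B[OF u x] abs_triangle_ineq4[of "gen u \<psi> y" "gen u \<psi> x"] by force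
   thus "\<bar>p r u x y * (gen u \<psi> y - gen u \<psi> x)\<bar> <= p r u x y * (2 * B)"
    unfolding abs_mult using p_nonneg[OF u' x, of y] y by (simp add: mult_left_mono)
  qed
  also have "\<dots> <= (Lam * (u - r)) * (2 * B)" unfolding sum_distrib_right[symmetric] using p_leave[OF u' x] B0 by (intro mult_right_mono) auto
  also have "\<dots> <= (Lam * (s - r)) * (2 * B)" using u Lam0 B0 by (intro mult_right_mono mult_left_mono) auto
  finally show ?thesis by (simp add: mult_ac)
 qed
 have "\<bar>((\<Sum>y\<in>E. p r s x y * \<psi> y) - \<psi> x) - integral {r..s} (\<lambda>u. gen u \<psi> x)\<bar> <= (2 * B * Lam * (s - r)) * (s - r)"
  by (rule has_integral_abs_le[OF has_integral_diff[OF p_dynkin[OF r x] integrable_integral[OF gi]] r(2) b])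
 thus ?thesis by (simp add: power2_eq_square mult.assoc)
qed

text \<open>While the chain sits at \<open>x\<close> the square grows at rate at most
  \<open>Bq\<close>; elsewhere the crude rate \<open>Lam\<close> is used, but this has probability
  at most \<open>Lam * (s - r)\<close>. The crude term is quadratic in the step and disappears under
  refinement.\<close>

lemma p_square:
 assumes r: "a <= r" "r <= s" "s <= b" and x: "x \<in> E" and Bq0: "0 <= Bq"
  and Bq: "\<And>u. u \<in> {r..s} ==> (\<Sum>z\<in>E - {x}. q u x z * (\<psi> z - \<psi> x)\<^sup>2) <= Bq"
  and one: "\<And>y. y \<in> E ==> \<bar>\<psi> y - \<psi> x\<bar> <= 1"
 shows "(\<Sum>y\<in>E. p r s x y * (\<psi> y - \<psi> x)\<^sup>2) <= Bq * (s - r) + Lam\<^sup>2 * (s - r)\<^sup>2"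
proof -
 let ?\<phi> = "\<lambda>y. (\<psi> y - \<psi> x)\<^sup>2"
 have \<phi>1: "?\<phi> y <= 1" if "y \<in> E" for y using one[OF that] by (simp add: abs_square_le_1)
 have "(\<Sum>y\<in>E. p r s x y * ?\<phi> y) - ?\<phi> x <= (Bq + Lam\<^sup>2 * (s - r)) * (s - r)"
 proof (rule has_integral_le[OF p_dynkin[OF r x]])
  show "((\<lambda>u. Bq + Lam\<^sup>2 * (s - r)) has_integral (Bq + Lam\<^sup>2 * (s - r)) * (s - r)) {r..s}"
   using has_integral_const_real[of "Bq + Lam\<^sup>2 * (s - r)" r s] r by (simp add: mult.commute)
  fix u assume u: "u \<in> {r..s}"
  have u': "a <= r" "r <= u" "u <= b" "u \<in> {a..b}" using u r by auto
  have gx: "gen u ?\<phi> x <= Bq" using Bq[OF u] by (simp add: gen_def)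
  have gy: "gen u ?\<phi> y <= Lam" if y: "y \<in> E" for y
  proof -
   have "gen u ?\<phi> y <= (\<Sum>z\<in>E - {y}. q u y z * 1)"
    unfolding gen_def
   proof (intro sum_mono mult_left_mono)
    fix z assume z: "z \<in> E - {y}"
    hence "?\<phi> z <= 1" using \<phi>1 by blast
    thus "?\<phi> z - ?\<phi> y <= 1" using zero_le_power2[of "\<psi> y - \<psi> x"] by linarith
    show "0 <= q u y z" using q0 u' y z by blast
   qed
   thus ?thesis using exit_rate(2)[OF u'(4) y] by simp
  qed
  have "(\<Sum>y\<in>E. p r u x y * gen u ?\<phi> y) = p r u x x * gen u ?\<phi> x + (\<Sum>y\<in>E - {x}. p r u x y * gen u ?\<phi> y)"
   using fin x by (simp add: sum.remove)
  also have "\<dots> <= 1 * Bq + (\<Sum>y\<in>E - {x}. p r u x y * Lam)"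
  proof (intro add_mono sum_mono mult_left_mono)
   have "p r u x x * gen u ?\<phi> x <= p r u x x * Bq" using p_nonneg[OF u'(1-3) x x] gx by (rule mult_left_mono[rotated])
   also have "\<dots> <= 1 * Bq" using p_le_1[OF u'(1-3) x x] Bq0 by (rule mult_right_mono)
   finally show "p r u x x * gen u ?\<phi> x <= 1 * Bq" .
  qed (use gy p_nonneg[OF u'(1-3) x] in auto)
  also have "\<dots> <= Bq + (Lam * (u - r)) * Lam"
   unfolding sum_distrib_right[symmetric] using mult_right_mono[OF p_leave[OF u'(1-3) x] Lam0] by simp
  also have "\<dots> <= Bq + (Lam * (s - r)) * Lam" using u Lam0 by (intro add_left_mono mult_right_mono mult_left_mono) auto
  finally show "(\<Sum>y\<in>E. p r u x y * gen u ?\<phi> y) <= Bq + Lam\<^sup>2 * (s - r)" by (simp add: power2_eq_square mult_ac)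
 qed
 thus ?thesis by (simp add: power2_eq_square algebra_simps)
qed

end

context chain begin

text \<open>The square is expanded; in the mixed term the past factor \<open>\<psi> (X r om)\<close>
  plays the part of \<open>h\<close> in \<open>markov_expect\<close>.\<close>

lemma markov_square:
 assumes r: "r \<in> {a..b}" and s: "s \<in> {r..b}"
 shows "(\<integral>om. (\<psi> (X s om) - \<psi> (X r om))\<^sup>2 \<partial>P) = (\<integral>om. (\<Sum>y\<in>E. p r s (X r om) y * (\<psi> y - \<psi> (X r om))\<^sup>2) \<partial>P)"
proof -
 have sb: "s \<in> {a..b}" and rr: "r \<in> {a..r}" "r <= b" using r s by auto
 let ?A = "\<lambda>x. \<Sum>y\<in>E. p r s x y * (\<psi> y)\<^sup>2" and ?B = "\<lambda>x. \<Sum>y\<in>E. p r s x y * \<psi> y"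
 have 1: "(\<integral>om. 1 * (\<psi> (X s om))\<^sup>2 \<partial>P) = (\<integral>om. 1 * ?A (X r om) \<partial>P)"
  by (rule markov_expect[OF r s, where h = "\<lambda>_. 1" and \<psi> = "\<lambda>x. (\<psi> x)\<^sup>2"]) (auto intro: bdd_const)
 have 2: "(\<integral>om. (- 2 * \<psi> (X r om)) * \<psi> (X s om) \<partial>P) = (\<integral>om. (- 2 * \<psi> (X r om)) * ?B (X r om) \<partial>P)"
  by (rule markov_expect[OF r s fun_X_filtration[OF rr, of "\<lambda>x. - 2 * \<psi> x"] bdd_fun_X[OF r, of "\<lambda>x. - 2 * \<psi> x"]])
 have i: "integrable P (\<lambda>om. (\<psi> (X s om))\<^sup>2)" "integrable P (\<lambda>om. (\<psi> (X r om))\<^sup>2)" "integrable P (\<lambda>om. ?A (X r om))"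
  by (rule bdd_integrable[OF bdd_fun_X[OF sb, of "\<lambda>x. (\<psi> x)\<^sup>2"]], rule bdd_integrable[OF bdd_fun_X[OF r, of "\<lambda>x. (\<psi> x)\<^sup>2"]],
    rule bdd_integrable[OF bdd_fun_X[OF r, of ?A]])
 have j: "integrable P (\<lambda>om. (- 2 * \<psi> (X r om)) * \<psi> (X s om))" "integrable P (\<lambda>om. (- 2 * \<psi> (X r om)) * ?B (X r om))"
  by (rule bdd_integrable[OF bdd_mult[OF bdd_fun_X[OF r, of "\<lambda>x. - 2 * \<psi> x"] bdd_fun_X[OF sb, of \<psi>]]],
    rule bdd_integrable[OF bdd_fun_X[OF r, of "\<lambda>x. (- 2 * \<psi> x) * ?B x"]])
 have "(\<integral>om. (\<psi> (X s om) - \<psi> (X r om))\<^sup>2 \<partial>P) = (\<integral>om. ((\<psi> (X s om))\<^sup>2 + (- 2 * \<psi> (X r om)) * \<psi> (X s om)) + (\<psi> (X r om))\<^sup>2 \<partial>P)"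
  by (intro Bochner_Integration.integral_cong refl) (simp add: power2_diff)
 also have "\<dots> = ((\<integral>om. (\<psi> (X s om))\<^sup>2 \<partial>P) + (\<integral>om. (- 2 * \<psi> (X r om)) * \<psi> (X s om) \<partial>P)) + (\<integral>om. (\<psi> (X r om))\<^sup>2 \<partial>P)"
  by (simp only: Bochner_Integration.integral_add[OF Bochner_Integration.integrable_add[OF i(1) j(1)] i(2)] Bochner_Integration.integral_add[OF i(1) j(1)])
 also have "\<dots> = ((\<integral>om. ?A (X r om) \<partial>P) + (\<integral>om. (- 2 * \<psi> (X r om)) * ?B (X r om) \<partial>P)) + (\<integral>om. (\<psi> (X r om))\<^sup>2 \<partial>P)"
  using 1 2 by simp
 also have "\<dots> = (\<integral>om. (?A (X r om) + (- 2 * \<psi> (X r om)) * ?B (X r om)) + (\<psi> (X r om))\<^sup>2 \<partial>P)"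
  by (simp only: Bochner_Integration.integral_add[OF Bochner_Integration.integrable_add[OF i(3) j(2)] i(2)] Bochner_Integration.integral_add[OF i(3) j(2)])
 also have "\<dots> = (\<integral>om. (\<Sum>y\<in>E. p r s (X r om) y * (\<psi> y - \<psi> (X r om))\<^sup>2) \<partial>P)"
 proof (intro Bochner_Integration.integral_cong refl)
  fix om assume w: "om \<in> space P"
  let ?x = "X r om"
  have ps: "(\<Sum>y\<in>E. p r s ?x y) = 1" using r s by (intro p_sum XE[OF r w]) auto
  have "(\<Sum>y\<in>E. p r s ?x y * (\<psi> y - \<psi> ?x)\<^sup>2) = (\<Sum>y\<in>E. p r s ?x y * (\<psi> y)\<^sup>2 + (- 2 * \<psi> ?x) * (p r s ?x y * \<psi> y) + p r s ?x y * (\<psi> ?x)\<^sup>2)"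
   by (intro sum.cong refl) (simp add: power2_diff algebra_simps)
  also have "\<dots> = (?A ?x + (- 2 * \<psi> ?x) * ?B ?x) + (\<psi> ?x)\<^sup>2"
   unfolding sum.distrib sum_distrib_left[symmetric] sum_distrib_right[symmetric] ps by simp
  finally show "(?A ?x + (- 2 * \<psi> ?x) * ?B ?x) + (\<psi> ?x)\<^sup>2 = (\<Sum>y\<in>E. p r s ?x y * (\<psi> y - \<psi> ?x)\<^sup>2)" by simp
 qed
 finally show ?thesis .
qed

lemma law_lipschitz: "\<exists>K\<ge>0. \<forall>r s. \<forall>y\<in>E. a <= r --> r <= s --> s <= b --> \<bar>law s y - law r y\<bar> <= K * (s - r)"
proof -
 obtain K where K: "0 <= K" "\<forall>u\<in>{a..b}. \<forall>y\<in>E. \<bar>fwd E q u (law u) y\<bar> <= K" "\<forall>u\<in>{a..b}. \<forall>y\<in>E. \<bar>law u y\<bar> <= K"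
  by (rule forward_sol_derivative_bounded[OF order_refl law_forward])
 have "\<bar>law s y - law r y\<bar> <= K * (s - r)" if "a <= r" "r <= s" "s <= b" "y \<in> E" for r s y
 proof (rule has_integral_abs_le)
  have "forward_sol E q r b law" by (rule forward_sol_subinterval[OF order_refl law_forward]) (use that in auto)
  thus "((\<lambda>u. fwd E q u (law u) y) has_integral (law s y - law r y)) {r..s}" using that by (auto simp: forward_sol_def)
  show "\<bar>fwd E q u (law u) y\<bar> <= K" if "u \<in> {r..s}" for u using K(2) that \<open>a <= r\<close> \<open>s <= b\<close> \<open>y \<in> E\<close> by auto
 qed (use that in auto)
 thus ?thesis using K(1) by blast
qed

lemma mart_telescope:
 "\<psi> (X (\<tau> k) om) = \<psi> (X (\<tau> 0) om) + mart \<psi> \<tau> k om + (\<Sum>j<k. (\<Sum>y\<in>E. p (\<tau> j) (\<tau> (Suc j)) (X (\<tau> j) om) y * \<psi> y) - \<psi> (X (\<tau> j) om))"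
 by (induction k) (simp_all add: mart_def)

text \<open>\<open>p_square\<close>, summed over the steps, bounds the second moments in
  \<open>mart_maximal\<close> through the rates; the part with \<open>H\<close> vanishes for fine
  grids.\<close>

lemma mart_maximal_rates:
 assumes mono: "\<And>j k. j <= k ==> \<tau> j <= \<tau> k" and range: "\<And>k. \<tau> k \<in> {a..b}"
  and step: "\<And>k. \<tau> (Suc k) - \<tau> k <= H" and Bq0: "0 <= Bq"
  and Bq: "\<And>u x. [|u \<in> {a..b}; x \<in> E|] ==> (\<Sum>z\<in>E - {x}. q u x z * (\<psi> z - \<psi> x)\<^sup>2) <= Bq"
  and one: "\<And>x y. [|x \<in> E; y \<in> E|] ==> \<bar>\<psi> y - \<psi> x\<bar> <= 1"
 shows "\<exists>R. bdd R \<and> (\<forall>om. 0 <= R om) \<and> (\<forall>om. \<forall>k\<le>n. \<bar>mart \<psi> \<tau> k om\<bar> <= R om) \<and>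
   (\<integral>om. (R om)\<^sup>2 \<partial>P) <= 16 * ((Bq + Lam\<^sup>2 * H) * (b - a))"
proof -
 have sq: "(\<integral>om. (\<psi> (X (\<tau> (Suc k)) om) - \<psi> (X (\<tau> k) om))\<^sup>2 \<partial>P) <= (Bq + Lam\<^sup>2 * H) * (\<tau> (Suc k) - \<tau> k)" for k
 proof -
  let ?r = "\<tau> k" and ?s = "\<tau> (Suc k)"
  have rs: "a <= ?r" "?r <= ?s" "?s <= b" "?r \<in> {a..b}" "?s \<in> {?r..b}" using range[of k] range[of "Suc k"] mono[of k "Suc k"] by auto
  have b: "(\<Sum>y\<in>E. p ?r ?s x y * (\<psi> y - \<psi> x)\<^sup>2) <= (Bq + Lam\<^sup>2 * H) * (?s - ?r)" if x: "x \<in> E" for x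
  proof -
   have "(\<Sum>y\<in>E. p ?r ?s x y * (\<psi> y - \<psi> x)\<^sup>2) <= Bq * (?s - ?r) + Lam\<^sup>2 * (?s - ?r)\<^sup>2"
    by (rule p_square[OF rs(1-3) x Bq0]) (use Bq x one rs in auto)
   also have "\<dots> = Bq * (?s - ?r) + Lam\<^sup>2 * (?s - ?r) * (?s - ?r)" by (simp add: power2_eq_square)
   also have "\<dots> <= Bq * (?s - ?r) + Lam\<^sup>2 * H * (?s - ?r)" using step[of k] rs by (intro add_left_mono mult_right_mono mult_left_mono) auto
   finally show ?thesis by (simp add: algebra_simps)
  qed
  have "(\<integral>om. (\<psi> (X ?s om) - \<psi> (X ?r om))\<^sup>2 \<partial>P) = (\<Sum>x\<in>E. law ?r x * (\<Sum>y\<in>E. p ?r ?s x y * (\<psi> y - \<psi> x)\<^sup>2))"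
   unfolding markov_square[OF rs(4,5)] by (rule expect_law[OF rs(4), where \<phi> = "\<lambda>x. \<Sum>y\<in>E. p ?r ?s x y * (\<psi> y - \<psi> x)\<^sup>2"])
  also have "\<dots> <= (\<Sum>x\<in>E. law ?r x * ((Bq + Lam\<^sup>2 * H) * (?s - ?r)))" by (intro sum_mono mult_left_mono b law_nonneg)
  also have "\<dots> = (Bq + Lam\<^sup>2 * H) * (?s - ?r)" unfolding sum_distrib_right[symmetric] law_sum[OF rs(4)] by simp
  finally show ?thesis .
 qed
 have H0: "0 <= H" using step[of 0] mono[of 0 "Suc 0"] by simp
 have "(\<Sum>k<n. \<integral>om. (\<psi> (X (\<tau> (Suc k)) om) - \<psi> (X (\<tau> k) om))\<^sup>2 \<partial>P) <= (\<Sum>k<n. (Bq + Lam\<^sup>2 * H) * (\<tau> (Suc k) - \<tau> k))"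
  by (intro sum_mono sq)
 also have "\<dots> = (Bq + Lam\<^sup>2 * H) * (\<tau> n - \<tau> 0)" unfolding sum_distrib_left[symmetric] sum_lessThan_telescope ..
 also have "\<dots> <= (Bq + Lam\<^sup>2 * H) * (b - a)" using range[of n] range[of 0] Bq0 H0 by (intro mult_left_mono) auto
 finally have fin: "16 * (\<Sum>k<n. \<integral>om. (\<psi> (X (\<tau> (Suc k)) om) - \<psi> (X (\<tau> k) om))\<^sup>2 \<partial>P) <= 16 * ((Bq + Lam\<^sup>2 * H) * (b - a))" by simp
 have "\<exists>R. bdd R \<and> (\<forall>om. 0 <= R om) \<and> (\<forall>om. \<forall>k\<le>n. \<bar>mart \<psi> \<tau> k om\<bar> <= R om) \<and>
   (\<integral>om. (R om)\<^sup>2 \<partial>P) <= 16 * (\<Sum>k<n. \<integral>om. (\<psi> (X (\<tau> (Suc k)) om) - \<psi> (X (\<tau> k) om))\<^sup>2 \<partial>P)"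
  by (rule mart_maximal) (rule mono, assumption, rule range)
 then obtain R where "bdd R" "\<forall>om. 0 <= R om" "\<forall>om. \<forall>k\<le>n. \<bar>mart \<psi> \<tau> k om\<bar> <= R om"
   "(\<integral>om. (R om)\<^sup>2 \<partial>P) <= 16 * (\<Sum>k<n. \<integral>om. (\<psi> (X (\<tau> (Suc k)) om) - \<psi> (X (\<tau> k) om))\<^sup>2 \<partial>P)"
  by (elim exE conjE)
 thus ?thesis using order_trans[OF _ fin] by (intro exI[of _ R] conjI) auto
qed

end

subsection \<open>The drifts of the two optimal dynamics\<close>

lemma mf_drift_row_cong:
 assumes y: "y \<in> prob_simplex" and rows: "\<And>i. 0 < y $ i ==> a $ i = a' $ i"
 shows "mf_drift a y = mf_drift a' (y :: real^'d::finite)"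
proof -
 have eq: "y $ i * a $ i $ j = y $ i * a' $ i $ j" for i j
  using rows[of i] simplex_coord(1)[OF y, of i] by (cases "0 < y $ i") auto
 show ?thesis unfolding mf_drift_def eq ..
qed

lemma norm_shift_le: "norm (shift i j :: real^'d::finite) <= 2"
 unfolding shift_def using norm_triangle_ineq4[of "axis j 1 :: real^'d" "axis i 1"] by (simp add: norm_axis_1)

lemma norm_mf_drift_matrix_diff:
 fixes y :: "real^'d::finite"
 assumes y: "y \<in> prob_simplex"
 shows "norm (mf_drift a y - mf_drift a' y) <= 2 * (\<Sum>i\<in>UNIV. y $ i * (\<Sum>j\<in>UNIV - {i}. \<bar>a $ i $ j - a' $ i $ j\<bar>))"
proof -
 have z: "(\<Sum>j\<in>UNIV. c j *\<^sub>R shift i j) = (\<Sum>j\<in>UNIV - {i}. c j *\<^sub>R shift i j)" for c and i :: 'd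
  by (subst sum.remove[of UNIV i]) (auto simp: shift_def)
 have "mf_drift a y - mf_drift a' y = (\<Sum>i\<in>UNIV. \<Sum>j\<in>UNIV - {i}. (y $ i * (a $ i $ j - a' $ i $ j)) *\<^sub>R shift i j)"
  unfolding mf_drift_shift z sum_subtractf[symmetric] by (intro sum.cong refl) (simp add: algebra_simps)
 also have "norm \<dots> <= (\<Sum>i\<in>UNIV. \<Sum>j\<in>UNIV - {i}. y $ i * \<bar>a $ i $ j - a' $ i $ j\<bar> * 2)"
 proof (intro order_trans[OF norm_sum] sum_mono)
  fix i j
  show "norm ((y $ i * (a $ i $ j - a' $ i $ j)) *\<^sub>R shift i j) <= y $ i * \<bar>a $ i $ j - a' $ i $ j\<bar> * 2"
   unfolding norm_scaleR abs_mult using simplex_coord(1)[OF y, of i] norm_shift_le[of i j] by (intro mult_mono) auto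
 qed
 finally show ?thesis by (simp add: sum_distrib_left mult_ac)
qed

context regular_value begin

definition "drift t y = mf_drift (\<alpha>s t y) y"
text \<open>Lipschitz constant of the optimal mean field drift in the state: \<open>Kd\<close> comes
  from the explicit dependence on the measure, the rest from the feedback through
  \<open>opt_lipschitz\<close>.\<close>

definition "Lb = Kd + 2 * (real CARD('d) * ((LU + LD) / \<kappa>))"

lemma Lb0: "0 <= Lb" unfolding Lb_def using Kd0 LU0 LD0 \<kappa>0 by (intro add_nonneg_nonneg mult_nonneg_nonneg divide_nonneg_pos) auto

lemma sum_offdiag_const:
 assumes y: "y \<in> prob_simplex" and c: "0 <= c" and h: "\<And>i j. h i j <= c"
 shows "(\<Sum>i\<in>UNIV. (y :: real^'d) $ i * (\<Sum>j\<in>UNIV - {i}. h i j)) <= real CARD('d) * c"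
proof -
 have "(\<Sum>j\<in>UNIV - {i}. h i j) <= real CARD('d) * c" for i
 proof -
  have "(\<Sum>j\<in>UNIV - {i}. h i j) <= (\<Sum>j\<in>UNIV - {i}. c)" using h by (intro sum_mono)
  also have "\<dots> <= (\<Sum>j\<in>(UNIV :: 'd set). c)" using c by (intro sum_mono2) auto
  finally show ?thesis by simp
 qed
 hence "(\<Sum>i\<in>UNIV. y $ i * (\<Sum>j\<in>UNIV - {i}. h i j)) <= (\<Sum>i\<in>UNIV. y $ i * (real CARD('d) * c))"
  using simplex_coord(1)[OF y] by (intro sum_mono mult_left_mono)
 also have "\<dots> = real CARD('d) * c" unfolding sum_distrib_right[symmetric] using y by (simp add: prob_simplex_def)
 finally show ?thesis .
qed

lemma drift_lip:
 assumes t: "t \<in> {0..T}" and x: "x \<in> prob_simplex" and y: "y \<in> prob_simplex"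
 shows "norm (drift t x - drift t y) <= Lb * norm (x - y)"
proof -
 \<comment> \<open>\<open>\<alpha>s\<close> may jump to 0 where a coordinate vanishes; the unmasked
   \<open>ao\<close> gives the same drift and is Lipschitz in the state.\<close>
 define ao where "ao x = (\<chi> i. opt t i x (z i t x))" for x
 have ao: "ao x \<in> action_matrices M" if "x \<in> prob_simplex" for x
  using opt_props(1)[OF t that] by (simp add: ao_def action_matrices_def)
 have d: "drift t x = mf_drift (ao x) x" if "x \<in> prob_simplex" for x
  unfolding drift_def by (rule mf_drift_row_cong[OF that]) (simp add: \<alpha>s_def opt_matrix_def ao_def)
 let ?c = "(LU + LD) / \<kappa> * norm (x - y)"
 have c0: "0 <= ?c" using LU0 LD0 \<kappa>0 by simp
 have ac: "\<bar>ao x $ i $ j - ao y $ i $ j\<bar> <= ?c" for i j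
 proof -
  have "\<bar>ao x $ i $ j - ao y $ i $ j\<bar> <= norm (opt t i x (z i t x) - opt t i y (z i t y))"
   using component_le_norm_cart[of "opt t i x (z i t x) - opt t i y (z i t y)" j] by (simp add: ao_def)
  also have "\<dots> <= (norm (z i t x - z i t y) + LD * norm (x - y)) / \<kappa>" by (rule opt_lipschitz[OF t x y])
  also have "\<dots> <= (LU * norm (x - y) + LD * norm (x - y)) / \<kappa>"
   using z_lip[OF t t x y, of i] \<kappa>0 by (intro divide_right_mono add_right_mono) auto
  finally show ?thesis by (simp add: algebra_simps add_divide_distrib)
 qed
 have "drift t x - drift t y = mf_drift (ao x) (x - y) + (mf_drift (ao x) y - mf_drift (ao y) y)"
  unfolding d[OF x] d[OF y] mf_drift_diff by simp
 also have "norm \<dots> <= Kd * norm (x - y) + 2 * (real CARD('d) * ?c)"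
 proof (rule norm_triangle_le, rule add_mono)
  show "norm (mf_drift (ao x) (x - y)) <= Kd * norm (x - y)" by (rule norm_drift_le[OF ao[OF x]])
  have "norm (mf_drift (ao x) y - mf_drift (ao y) y) <= 2 * (\<Sum>i\<in>UNIV. y $ i * (\<Sum>j\<in>UNIV - {i}. \<bar>ao x $ i $ j - ao y $ i $ j\<bar>))"
   by (rule norm_mf_drift_matrix_diff[OF y])
  also have "\<dots> <= 2 * (real CARD('d) * ?c)" by (intro mult_left_mono sum_offdiag_const y c0 ac) simp
  finally show "norm (mf_drift (ao x) y - mf_drift (ao y) y) <= 2 * (real CARD('d) * ?c)" .
 qed
 finally show ?thesis by (simp add: Lb_def algebra_simps)
qed

lemma norm_mf_drift_simplex:
 assumes a: "a \<in> action_matrices M" and y: "y \<in> prob_simplex" shows "norm (mf_drift a (y :: real^'d)) <= Kd"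
 using norm_drift_le[OF a, of y] mult_left_mono[OF simplex_norm_le_1[OF y] Kd0] by simp

definition "opt_traj \<mu> \<longleftrightarrow> (\<forall>t\<in>{0..T}. \<mu> t \<in> prob_simplex) \<and>
  (\<forall>r s. 0 <= r --> r <= s --> s <= T --> ((\<lambda>u. drift u (\<mu> u)) has_integral (\<mu> s - \<mu> r)) {r..s})"

lemma opt_traj_if_mf_opt_trajectory:
 assumes "mf_opt_trajectory T M f g m0 \<mu>" shows "opt_traj \<mu>"
 unfolding opt_traj_def
proof (intro conjI ballI allI impI)
 note A = assms[unfolded mf_opt_trajectory_def, THEN conjunct2, rule_format]
 show "\<mu> t \<in> prob_simplex" if "t \<in> {0..T}" for t using A[OF that] by blast
 fix r s :: real assume rs: "0 <= r" "r <= s" "s <= T"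
 show "((\<lambda>u. drift u (\<mu> u)) has_integral (\<mu> s - \<mu> r)) {r..s}"
 proof (rule fundamental_theorem_of_calculus[OF rs(2)])
  fix u assume "u \<in> {r..s}"
  hence u: "u \<in> {0..T}" and sub: "{r..s} \<subseteq> {0..T}" using rs by auto
  have m: "\<mu> u \<in> prob_simplex" using A[OF u] by blast
  have "mf_drift (mf_opt_feedback T M f g u (\<mu> u)) (\<mu> u) = drift u (\<mu> u)"
   unfolding drift_def by (rule mf_drift_row_cong[OF m]) (simp add: mf_opt_feedback_def \<alpha>s_def opt_matrix_def z_grad[OF u m] vec_eq_iff)
  thus "(\<mu> has_vector_derivative drift u (\<mu> u)) (at u within {r..s})"
   using A[OF u] has_vector_derivative_within_subset[OF _ sub] by fastforce
 qed
qed

lemma opt_traj_lip: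
 assumes \<mu>: "opt_traj \<mu>" and rs: "0 <= r" "r <= s" "s <= T"
 shows "norm (\<mu> s - \<mu> r) <= Kd * (s - r)"
proof -
 have i: "((\<lambda>u. drift u (\<mu> u)) has_integral (\<mu> s - \<mu> r)) {r..s}" using \<mu> rs by (simp add: opt_traj_def)
 have "norm (drift u (\<mu> u)) <= Kd" if "u \<in> {r..s}" for u
 proof -
  have u: "u \<in> {0..T}" using that rs by auto
  hence m: "\<mu> u \<in> prob_simplex" using \<mu> by (simp add: opt_traj_def)
  show ?thesis unfolding drift_def \<alpha>s_def by (rule norm_mf_drift_simplex[OF opt_matrix_in[OF u m] m])
 qed
 hence "norm (\<mu> s - \<mu> r) <= Kd * Henstock_Kurzweil_Integration.content (cbox r s)"
  using i by (intro has_integral_bound[OF Kd0]) (auto simp: cbox_interval)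
 thus ?thesis using rs by simp
qed

end

context agent_regular begin

lemma \<alpha>w_in: "[|u \<in> {0..T}; y \<in> E|] ==> \<alpha>w u y \<in> action_matrices M"
 unfolding \<alpha>w_def by (intro opt_matrix_in E_simplex)
lemma \<alpha>s_in: "[|u \<in> {0..T}; y \<in> E|] ==> \<alpha>s u y \<in> action_matrices M"
 unfolding \<alpha>s_def by (intro opt_matrix_in E_simplex)

lemma Dgap_bounds:
 assumes u: "u \<in> {0..T}" and y: "y \<in> E"
 shows "0 <= Dgap u y" "Dgap u y <= real CARD('d) * M\<^sup>2"
proof -
 show "0 <= Dgap u y" unfolding Dgap_def using simplex_coord(1)[OF E_simplex[OF y]] by (intro sum_nonneg mult_nonneg_nonneg) auto
 have "(\<alpha>w u y $ i $ j - \<alpha>s u y $ i $ j)\<^sup>2 <= M\<^sup>2" for i j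
 proof -
  have "\<bar>\<alpha>w u y $ i $ j - \<alpha>s u y $ i $ j\<bar> <= \<bar>M\<bar>"
   using action_matrices_bounds[OF \<alpha>w_in[OF u y], of i j] action_matrices_bounds[OF \<alpha>s_in[OF u y], of i j] by linarith
  thus ?thesis by (rule abs_le_square_iff[THEN iffD1])
 qed
 thus "Dgap u y <= real CARD('d) * M\<^sup>2" unfolding Dgap_def by (intro sum_offdiag_const E_simplex[OF y]) auto
qed

text \<open>Young's inequality for each entry trades absolute differences of the feedbacks for
  \<open>Dgap\<close>, whose mean is bounded by \<open>energy\<close>; \<open>eps\<close> stays free
  until expectations are taken.\<close>

lemma drift_gap:
 assumes u: "u \<in> {0..T}" and y: "y \<in> E" and e: "0 < eps"
 shows "norm (mf_drift (\<alpha>w u y) y - drift u y) <= real CARD('d) * eps + Dgap u y / eps"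
proof -
 have ys: "y \<in> prob_simplex" by (rule E_simplex[OF y])
 have am: "2 * \<bar>v\<bar> <= eps + v\<^sup>2 / eps" for v :: real
 proof -
  have "0 <= (\<bar>v\<bar> - eps)\<^sup>2" by simp
  hence "2 * \<bar>v\<bar> * eps <= eps\<^sup>2 + v\<^sup>2" by (simp add: power2_diff)
  thus ?thesis using e by (simp add: field_simps power2_eq_square)
 qed
 let ?v = "\<lambda>i j. \<alpha>w u y $ i $ j - \<alpha>s u y $ i $ j"
 have "norm (mf_drift (\<alpha>w u y) y - drift u y) <= 2 * (\<Sum>i\<in>UNIV. y $ i * (\<Sum>j\<in>UNIV - {i}. \<bar>?v i j\<bar>))"
  unfolding drift_def by (rule norm_mf_drift_matrix_diff[OF ys])
 also have "\<dots> = (\<Sum>i\<in>UNIV. y $ i * (\<Sum>j\<in>UNIV - {i}. 2 * \<bar>?v i j\<bar>))" by (simp add: sum_distrib_left mult_ac)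
 also have "\<dots> <= (\<Sum>i\<in>UNIV. y $ i * (\<Sum>j\<in>UNIV - {i}. eps + (?v i j)\<^sup>2 / eps))"
  using simplex_coord(1)[OF ys] am by (intro sum_mono mult_left_mono)
 also have "\<dots> = (\<Sum>i\<in>UNIV. y $ i * (\<Sum>j\<in>UNIV - {i}. eps)) + Dgap u y / eps"
  unfolding Dgap_def sum.distrib distrib_left by (simp add: sum_divide_distrib[symmetric])
 also have "\<dots> <= real CARD('d) * eps + Dgap u y / eps" using e by (intro add_right_mono sum_offdiag_const ys) auto
 finally show ?thesis .
qed

lemma generator_coordinate:
 assumes y: "y \<in> E"
 shows "(\<Sum>z\<in>E - {y}. jump_rate N \<alpha>w u y z * (z $ c - y $ c)) = mf_drift (\<alpha>w u y) y $ c"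
proof -
 have "(\<Sum>z\<in>E - {y}. jump_rate N \<alpha>w u y z * (z $ c - y $ c)) = (\<Sum>i\<in>UNIV. \<Sum>j\<in>UNIV - {i}. y $ i * \<alpha>w u y $ i $ j * shift i j $ c)"
  unfolding jump_rate_sum[OF N0 y] using N0 by (intro sum.cong refl) simp
 also have "\<dots> = (\<Sum>i\<in>UNIV. \<Sum>j\<in>UNIV. y $ i * \<alpha>w u y $ i $ j * shift i j $ c)"
  by (intro sum.cong refl sum.mono_neutral_left) (auto simp: shift_def)
 also have "\<dots> = mf_drift (\<alpha>w u y) y $ c" unfolding mf_drift_shift by simp
 finally show ?thesis .
qed

text \<open>Jump rates are of order \<open>N\<close> and squared jumps of order
  \<open>1 / N^2\<close>; this makes the martingale part small.\<close>

lemma generator_square: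
 assumes u: "u \<in> {0..T}" and y: "y \<in> E"
 shows "(\<Sum>z\<in>E - {y}. jump_rate N \<alpha>w u y z * (z $ c - y $ c)\<^sup>2) <= (real CARD('d))\<^sup>2 * (M / real N)"
proof -
 note a = action_matrices_bounds[OF \<alpha>w_in[OF u y]] and ys = simplex_coord[OF E_simplex[OF y]]
 have "(\<Sum>z\<in>E - {y}. jump_rate N \<alpha>w u y z * (z $ c - y $ c)\<^sup>2)
   = (\<Sum>i\<in>UNIV. \<Sum>j\<in>UNIV - {i}. (y $ i * \<alpha>w u y $ i $ j * (shift i j $ c)\<^sup>2) / real N)"
  unfolding jump_rate_sum[OF N0 y] using N0 by (intro sum.cong refl) (simp add: power2_eq_square)
 also have "\<dots> <= (real CARD('d))\<^sup>2 * (M / real N)"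
 proof (rule sum_offdiag_le)
  fix i j :: 'd
  have "(shift i j $ c)\<^sup>2 <= (1::real)" by (simp add: shift_def axis_def)
  moreover have "y $ i * \<alpha>w u y $ i $ j <= 1 * M" using a[of i j] ys(1)[of i] ys(2)[of i] M0 by (intro mult_mono) auto
  ultimately have "y $ i * \<alpha>w u y $ i $ j * (shift i j $ c)\<^sup>2 <= (1 * M) * 1" using M0 by (intro mult_mono[of "y $ i * \<alpha>w u y $ i $ j"]) auto
  thus "(y $ i * \<alpha>w u y $ i $ j * (shift i j $ c)\<^sup>2) / real N <= M / real N" by (simp add: divide_right_mono)
 qed (use M0 in auto)
 finally show ?thesis .
qed

lemma step_bound:
 assumes tr: "transition_rates E (jump_rate N \<alpha>w) 0 T L p" and \<mu>: "opt_traj \<mu>" and rs: "0 <= r" "r <= s" "s <= T"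
  and x: "x \<in> E" and e: "0 < eps"
 shows "norm ((\<chi> c. (\<Sum>y\<in>E. p r s x y * y $ c) - x $ c) - (\<mu> s - \<mu> r))
  <= (s - r) * (real CARD('d) * eps + Lb * norm (x - \<mu> r) + Lb * Kd * (s - r)) + (1 / eps) * integral {r..s} (\<lambda>u. Dgap u x)
    + real CARD('d) * (2 * Kd * rates.Lam E L * (s - r)\<^sup>2)"
proof -
 interpret transition_rates E "jump_rate N \<alpha>w" 0 T L p by (rule tr)
 have sub: "{r..s} \<subseteq> {0..T}" using rs by auto
 let ?A = "\<chi> c. (\<Sum>y\<in>E. p r s x y * y $ c) - x $ c"
 have gen: "gen u (\<lambda>y. y $ c) y = mf_drift (\<alpha>w u y) y $ c" if "y \<in> E" for u c y
  unfolding gen_def by (rule generator_coordinate[OF that])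
 have cm: "continuous_on {r..s} (\<lambda>u. mf_drift (\<alpha>w u x) x)"
  unfolding mf_drift_def
  by (intro continuous_on_vec_lambda continuous_intros continuous_on_component continuous_on_subset[OF \<alpha>w_continuous[OF x] sub])
 define D where "D = integral {r..s} (\<lambda>u. mf_drift (\<alpha>w u x) x)"
 have Di: "((\<lambda>u. mf_drift (\<alpha>w u x) x) has_integral D) {r..s}"
  unfolding D_def by (intro integrable_integral integrable_continuous_real cm)
 have Dc: "integral {r..s} (\<lambda>u. mf_drift (\<alpha>w u x) x $ c) = D $ c" for c
  using Di[unfolded has_integral_vec] by (intro integral_unique) blast
 have "norm (?A - D) <= (\<Sum>c\<in>UNIV. \<bar>(?A - D) $ c\<bar>)" by (rule norm_le_l1_cart)
 also have "\<dots> <= (\<Sum>c\<in>(UNIV::'d set). 2 * Kd * Lam * (s - r)\<^sup>2)"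
 proof (rule sum_mono)
  fix c :: 'd
  have "\<bar>(\<Sum>y\<in>E. p r s x y * y $ c) - x $ c - integral {r..s} (\<lambda>u. gen u (\<lambda>y. y $ c) x)\<bar> <= 2 * Kd * Lam * (s - r)\<^sup>2"
  proof (rule p_drift[OF rs x])
   fix u and y :: "real^'d" assume u: "u \<in> {r..s}" and y: "y \<in> E"
   hence "norm (mf_drift (\<alpha>w u y) y) <= Kd" using sub by (intro norm_mf_drift_simplex \<alpha>w_in E_simplex) auto
   thus "\<bar>gen u (\<lambda>y. y $ c) y\<bar> <= Kd" unfolding gen[OF y] using component_le_norm_cart[of "mf_drift (\<alpha>w u y) y" c] by linarith
  qed
  thus "\<bar>(?A - D) $ c\<bar> <= 2 * Kd * Lam * (s - r)\<^sup>2" by (simp add: gen[OF x] Dc)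
 qed
 finally have 1: "norm (?A - D) <= real CARD('d) * (2 * Kd * Lam * (s - r)\<^sup>2)" by simp
 let ?k = "real CARD('d) * eps + Lb * norm (x - \<mu> r) + Lb * Kd * (s - r)"
 have dint: "((\<lambda>u. mf_drift (\<alpha>w u x) x - drift u (\<mu> u)) has_integral (D - (\<mu> s - \<mu> r))) {r..s}"
  using Di \<mu> rs by (intro has_integral_diff) (auto simp: opt_traj_def)
 have gD: "(\<lambda>u. Dgap u x) integrable_on {r..s}"
  by (intro integrable_continuous_real continuous_on_subset[OF Dgap_continuous[OF x] sub])
 have gint: "((\<lambda>u. ?k + (1 / eps) * Dgap u x) has_integral ((s - r) * ?k + (1 / eps) * integral {r..s} (\<lambda>u. Dgap u x))) {r..s}"
  using has_integral_add[OF has_integral_const_real[of ?k r s] has_integral_mult_right[OF integrable_integral[OF gD], of "1 / eps"]] rs by simp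
 have "norm (integral {r..s} (\<lambda>u. mf_drift (\<alpha>w u x) x - drift u (\<mu> u))) <= integral {r..s} (\<lambda>u. ?k + (1 / eps) * Dgap u x)"
 proof (rule Henstock_Kurzweil_Integration.integral_norm_bound_integral)
  fix u assume u: "u \<in> {r..s}"
  have uT: "u \<in> {0..T}" using u sub by blast
  have m: "\<mu> u \<in> prob_simplex" using \<mu> uT by (simp add: opt_traj_def)
  have "norm (x - \<mu> u) <= norm (x - \<mu> r) + norm (\<mu> u - \<mu> r)"
   using norm_triangle_ineq4[of "x - \<mu> r" "\<mu> u - \<mu> r"] by simp
  also have "norm (\<mu> u - \<mu> r) <= Kd * (s - r)"
   using opt_traj_lip[OF \<mu>, of r u] u rs mult_left_mono[of "u - r" "s - r" Kd] Kd0 by force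
  finally have "Lb * norm (x - \<mu> u) <= Lb * (norm (x - \<mu> r) + Kd * (s - r))" using Lb0 by (intro mult_left_mono) auto
  moreover have "norm (mf_drift (\<alpha>w u x) x - drift u (\<mu> u)) <= norm (mf_drift (\<alpha>w u x) x - drift u x) + norm (drift u x - drift u (\<mu> u))"
   using norm_triangle_ineq[of "mf_drift (\<alpha>w u x) x - drift u x" "drift u x - drift u (\<mu> u)"] by simp
  moreover note drift_gap[OF uT x e] drift_lip[OF uT E_simplex[OF x] m]
  ultimately show "norm (mf_drift (\<alpha>w u x) x - drift u (\<mu> u)) <= ?k + (1 / eps) * Dgap u x" by (simp add: algebra_simps)
 qed (use dint gint in blast)+
 hence 2: "norm (D - (\<mu> s - \<mu> r)) <= (s - r) * ?k + (1 / eps) * integral {r..s} (\<lambda>u. Dgap u x)"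
  unfolding integral_unique[OF dint] integral_unique[OF gint] .
 have eq: "?A - (\<mu> s - \<mu> r) = (?A - D) + (D - (\<mu> s - \<mu> r))" by simp
 show ?thesis unfolding eq using norm_triangle_ineq[of "?A - D" "D - (\<mu> s - \<mu> r)"] 1 2 by linarith
qed

end

subsection \<open>Dyadic times\<close>

text \<open>Capped at \<open>b\<close>, so every index is meaningful and the sequence is constant
  from \<open>dyad_count\<close> on at the latest.\<close>

definition dyad :: "real => real => nat => nat => real" where
 "dyad a b n k = min b (a + real k / 2 ^ n)"

definition dyad_count :: "real => real => nat => nat" where
 "dyad_count a b n = nat \<lceil>b - a\<rceil> * 2 ^ n"

lemma dyad_in: "a <= b ==> dyad a b n k \<in> {a..b}"
 by (simp add: dyad_def)

lemma dyad_0: "a <= b ==> dyad a b n 0 = a"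
 by (simp add: dyad_def)

lemma dyad_mono: "j <= k ==> dyad a b n j <= dyad a b n k"
 unfolding dyad_def by (intro min.mono order_refl add_left_mono divide_right_mono) auto

lemma dyad_step: "dyad a b n (Suc k) - dyad a b n k <= 1 / 2 ^ n"
proof -
 have "a + real (Suc k) / 2 ^ n = (a + real k / 2 ^ n) + 1 / 2 ^ n" by (simp add: add_divide_distrib)
 moreover have mn: "min b (x + c) - min b x <= c" if "0 <= c" for x c :: real using that by (simp add: min_def)
 ultimately show ?thesis unfolding dyad_def using mn[of "1 / 2 ^ n" "a + real k / 2 ^ n"] by (simp only:) simp
qed

lemma dyad_end:
 assumes "dyad_count a b n <= k" shows "dyad a b n k = b"
proof -
 have "(b - a) * 2 ^ n <= real (nat \<lceil>b - a\<rceil>) * 2 ^ n" by (intro mult_right_mono real_nat_ceiling_ge) simp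
 also have "\<dots> = real (dyad_count a b n)" by (simp add: dyad_count_def)
 also have "\<dots> <= real k" using assms by simp
 finally have "b <= a + real k / 2 ^ n" by (simp add: field_simps)
 thus ?thesis by (simp add: dyad_def)
qed

lemma dyad_nested: "dyad a b n k = dyad a b (Suc n) (2 * k)"
 by (simp add: dyad_def)

lemma integral_partition:
 fixes f :: "real => real"
 assumes mono: "\<And>j k. j <= k ==> \<tau> j <= \<tau> k" and f: "\<And>k. f integrable_on {\<tau> 0..\<tau> k}"
 shows "(\<Sum>j<K. integral {\<tau> j..\<tau> (Suc j)} f) = integral {\<tau> 0..\<tau> K} f"
proof (induction K)
 case (Suc K)
 have "integral {\<tau> 0..\<tau> K} f + integral {\<tau> K..\<tau> (Suc K)} f = integral {\<tau> 0..\<tau> (Suc K)} f"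
  by (rule Henstock_Kurzweil_Integration.integral_combine) (auto intro: mono f)
 thus ?case using Suc by simp
qed simp

context chain begin

lemma grid_up_dyad: "s \<in> {a..b} ==> grid_up n s = dyad a b n (nat (\<lfloor>(s - a) * 2 ^ n\<rfloor> + 1))"
 by (simp add: grid_up_def dyad_def)

text \<open>The grids are nested, so a bound at a finer level \<open>m\<close> also holds at level
  \<open>n\<close>; letting \<open>m\<close> tend to infinity removes the error
  \<open>CN * (1/2)^m\<close>, however large \<open>CN\<close> is. Every time before
  \<open>b\<close> is approached from the right by grid times at which the path already has the
  value \<open>X t\<close>, and \<open>\<phi>\<close> is continuous in time.\<close>

lemma sup_expectation:
 fixes \<phi> :: "real => 'e => real"
 assumes \<phi>c: "\<And>y. y \<in> E ==> continuous_on {a..b} (\<lambda>s. \<phi> s y)" and \<phi>0: "\<And>s y. 0 <= \<phi> s y"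
  and A: "\<And>n. \<exists>A. integrable P A \<and> (\<forall>om\<in>space P. \<forall>k. \<phi> (dyad a b n k) (X (dyad a b n k) om) <= A om) \<and> (\<integral>om. A om \<partial>P) <= c + CN * (1 / 2) ^ n"
 shows "(\<integral>\<^sup>+om. (SUP t\<in>{a..b}. ennreal (\<phi> t (X t om))) \<partial>P) <= ennreal c"
proof -
 define S where "S n om = (SUP k. ennreal (\<phi> (dyad a b n k) (X (dyad a b n k) om)))" for n om
 have Sm: "S n \<in> borel_measurable P" for n
  unfolding S_def by (intro borel_measurable_SUP measurable_compose[OF fun_X_measurable[OF dyad_in[OF ab]] measurable_ennreal]) simp
 have inc: "incseq S"
 proof (intro incseq_SucI le_funI)
  fix n om show "S n om <= S (Suc n) om"
   unfolding S_def
  proof (rule SUP_least)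
   fix k show "ennreal (\<phi> (dyad a b n k) (X (dyad a b n k) om)) <= (SUP k. ennreal (\<phi> (dyad a b (Suc n) k) (X (dyad a b (Suc n) k) om)))"
    unfolding dyad_nested[of a b n k] by (rule SUP_upper) simp
  qed
 qed
 have le: "(\<integral>\<^sup>+om. S n om \<partial>P) <= ennreal (c + CN * (1 / 2) ^ n)" for n
 proof -
  obtain A where A': "integrable P A" "\<forall>om\<in>space P. \<forall>k. \<phi> (dyad a b n k) (X (dyad a b n k) om) <= A om" "(\<integral>om. A om \<partial>P) <= c + CN * (1 / 2) ^ n"
   using A[of n] by (elim exE conjE)
  have "(\<integral>\<^sup>+om. S n om \<partial>P) <= (\<integral>\<^sup>+om. ennreal (A om) \<partial>P)"
  proof (rule nn_integral_mono)
   fix om assume "om \<in> space P"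
   thus "S n om <= ennreal (A om)" unfolding S_def using A'(2) by (intro SUP_least ennreal_leI) auto
  qed
  also have "\<dots> = ennreal (\<integral>om. A om \<partial>P)"
  proof (rule nn_integral_eq_integral[OF A'(1)], rule AE_I2)
   fix om assume "om \<in> space P"
   hence "\<phi> (dyad a b n 0) (X (dyad a b n 0) om) <= A om" using A'(2) by blast
   thus "0 <= A om" using \<phi>0 order_trans by blast
  qed
  also have "\<dots> <= ennreal (c + CN * (1 / 2) ^ n)" by (rule ennreal_leI[OF A'(3)])
  finally show ?thesis .
 qed
 have lim: "(\<lambda>m. ennreal (c + CN * (1 / 2) ^ m)) \<longlonglongrightarrow> ennreal (c + CN * 0)"
  by (intro tendsto_ennrealI tendsto_intros LIMSEQ_power_zero) simp
 have lec: "(\<integral>\<^sup>+om. S n om \<partial>P) <= ennreal c" for n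
 proof -
  have "(\<integral>\<^sup>+om. S n om \<partial>P) <= ennreal (c + CN * (1 / 2) ^ m)" if "n <= m" for m
   using order_trans[OF nn_integral_mono le[of m]] incseqD[OF inc that] by (simp add: le_fun_def)
  hence "(\<integral>\<^sup>+om. S n om \<partial>P) <= ennreal (c + CN * 0)" by (intro LIMSEQ_le_const[OF lim]) blast
  thus ?thesis by simp
 qed
 have pw: "(SUP t\<in>{a..b}. ennreal (\<phi> t (X t om))) <= (SUP n. S n om)" if w: "om \<in> space P" for om
 proof (rule SUP_least)
  fix t assume t: "t \<in> {a..b}"
  have up: "ennreal (\<phi> (dyad a b n k) (X (dyad a b n k) om)) <= (SUP n. S n om)" for n k
  proof -
   have "ennreal (\<phi> (dyad a b n k) (X (dyad a b n k) om)) <= S n om" unfolding S_def by (rule SUP_upper) simp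
   also have "\<dots> <= (SUP n. S n om)" by (rule SUP_upper) simp
   finally show ?thesis .
  qed
  show "ennreal (\<phi> t (X t om)) <= (SUP n. S n om)"
  proof (cases "t = b")
   case True
   thus ?thesis using up[of 0 "dyad_count a b 0"] dyad_end[OF order_refl, of a b 0] by simp
  next
   case False
   hence tb: "t \<in> {a..<b}" using t by auto
   obtain eps where e: "0 < eps" "\<forall>s'. t < s' \<and> s' < t + eps --> X s' om = X t om"
    using right_constant[OF w tb] by (elim exE conjE)
   have z: "(\<lambda>n. t + (1 / 2 :: real) ^ n) \<longlonglongrightarrow> t + 0" by (intro tendsto_intros LIMSEQ_power_zero) simp
   have gl: "t < grid_up n t" "grid_up n t <= t + (1 / 2) ^ n" "grid_up n t \<in> {a..b}" for n
    using grid_up_gt[OF tb, of n] grid_up_le[OF t, of n] grid_up_in[OF t, of n] by (auto simp: power_one_over)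
   have gt: "(\<lambda>n. grid_up n t) \<longlonglongrightarrow> t"
   proof (rule tendsto_sandwich[where f = "\<lambda>_. t" and h = "\<lambda>n. t + (1 / 2) ^ n"])
    show "\<forall>\<^sub>F n in sequentially. t <= grid_up n t" using gl(1) by (intro always_eventually allI less_imp_le)
    show "\<forall>\<^sub>F n in sequentially. grid_up n t <= t + (1 / 2) ^ n" using gl(2) by (intro always_eventually allI)
   qed (use z in auto)
   have c: "((\<lambda>s. \<phi> s (X t om)) \<longlongrightarrow> \<phi> t (X t om)) (at t within {a..b})"
    using \<phi>c[OF XE[OF t w]] t unfolding continuous_on by blast
   have "filterlim (\<lambda>n. grid_up n t) (at t within {a..b}) sequentially"
    unfolding filterlim_at using gt gl by (auto intro!: always_eventually simp: less_imp_neq[symmetric])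
   hence lim: "(\<lambda>n. ennreal (\<phi> (grid_up n t) (X t om))) \<longlonglongrightarrow> ennreal (\<phi> t (X t om))"
    by (intro tendsto_ennrealI filterlim_compose[OF c])
   have ev: "\<forall>\<^sub>F n in sequentially. ennreal (\<phi> (grid_up n t) (X t om)) <= (SUP n. S n om)"
   proof -
    have "\<forall>\<^sub>F n in sequentially. grid_up n t < t + eps" using order_tendstoD(2)[OF gt, of "t + eps"] e(1) by simp
    thus ?thesis
    proof eventually_elim
     fix n assume "grid_up n t < t + eps"
     hence "X (grid_up n t) om = X t om" using e(2) gl(1)[of n] by blast
     thus "ennreal (\<phi> (grid_up n t) (X t om)) <= (SUP n. S n om)"
      using up[of n "nat (\<lfloor>(t - a) * 2 ^ n\<rfloor> + 1)"] unfolding grid_up_dyad[OF t, symmetric] by simp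
    qed
   qed
   show ?thesis by (rule tendsto_upperbound[OF lim ev]) simp
  qed
 qed
 have "(\<integral>\<^sup>+om. (SUP t\<in>{a..b}. ennreal (\<phi> t (X t om))) \<partial>P) <= (\<integral>\<^sup>+om. (SUP n. S n om) \<partial>P)" by (rule nn_integral_mono) (rule pw)
 also have "\<dots> = (SUP n. \<integral>\<^sup>+om. S n om \<partial>P)" by (rule nn_integral_monotone_convergence_SUP[OF inc Sm])
 also have "\<dots> <= ennreal c" by (rule SUP_least) (rule lec)
 finally show ?thesis .
qed

end

subsection \<open>The distance between the optimal trajectories\<close>

context regular_value begin

text \<open>Coefficient of \<open>1 / sqrt N\<close> in \<open>path_expectation\<close>: the
  martingales of the coordinates, the term \<open>eps\<close> of Young's inequality over the
  horizon, and the bound of \<open>energy\<close> divided by \<open>eps\<close>.\<close>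

definition "C0 = real CARD('d) * (1 / 2 + 8 * ((real CARD('d))\<^sup>2 * M) * T) + T * real CARD('d) + 4 * c1 * T / \<kappa>"

lemma C0_nonneg: "0 <= C0"
 unfolding C0_def using T0 M0 c1_nonneg \<kappa>0 by (intro add_nonneg_nonneg mult_nonneg_nonneg divide_nonneg_pos) auto

end

context agent_regular begin

lemma path_bound:
 fixes R :: "'d => 'w => real"
 assumes ch: "chain E (jump_rate N \<alpha>w) 0 T L p P X" and \<mu>: "opt_traj \<mu>" and om: "om \<in> space P" and e: "0 < eps"
  and R: "\<And>c k. k <= dyad_count 0 T n ==> \<bar>chain.mart E p X (\<lambda>x. x $ c) (dyad 0 T n) k om\<bar> <= R c om"
 defines "\<tau> \<equiv> dyad 0 T n" and "h \<equiv> 1 / 2 ^ n" and "K \<equiv> dyad_count 0 T n"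
 shows "norm (X (\<tau> k) om - \<mu> (\<tau> k)) <= exp (Lb * T) * (norm (X 0 om - \<mu> 0) + (\<Sum>c\<in>UNIV. R c om)
   + T * (real CARD('d) * eps + Lb * Kd * h + 2 * real CARD('d) * Kd * rates.Lam E L * h)
   + (1 / eps) * (\<Sum>j<K. integral {\<tau> j..\<tau> (Suc j)} (\<lambda>u. Dgap u (X (\<tau> j) om))))"
proof -
 interpret C: chain E "jump_rate N \<alpha>w" 0 T L p P X by (rule ch)
 have tr: "transition_rates E (jump_rate N \<alpha>w) 0 T L p" by (rule C.transition_rates_axioms)
 have T: "0 <= T" using T0 by simp
 have \<tau>0: "\<tau> 0 = 0" using dyad_0[OF T] by (simp add: \<tau>_def)
 have \<tau>in: "\<tau> j \<in> {0..T}" for j unfolding \<tau>_def by (rule dyad_in[OF T])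
 have \<tau>m: "\<tau> j <= \<tau> (Suc j)" for j unfolding \<tau>_def by (rule dyad_mono) simp
 have \<tau>h: "\<tau> (Suc j) - \<tau> j <= h" for j unfolding \<tau>_def h_def by (rule dyad_step)
 have XE: "X (\<tau> j) om \<in> E" for j by (rule C.XE[OF \<tau>in om])
 let ?e = "\<lambda>k. norm (X (\<tau> k) om - \<mu> (\<tau> k))" and ?h = "\<lambda>j. \<tau> (Suc j) - \<tau> j"
 let ?I = "\<lambda>j. integral {\<tau> j..\<tau> (Suc j)} (\<lambda>u. Dgap u (X (\<tau> j) om))"
 let ?k1 = "real CARD('d) * eps + Lb * Kd * h + 2 * real CARD('d) * Kd * rates.Lam E L * h"
 let ?A = "norm (X 0 om - \<mu> 0) + (\<Sum>c\<in>UNIV. R c om) + T * ?k1 + (1 / eps) * (\<Sum>j<K. ?I j)"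
 define sv where "sv j = (\<chi> c. (\<Sum>y\<in>E. p (\<tau> j) (\<tau> (Suc j)) (X (\<tau> j) om) y * y $ c) - X (\<tau> j) om $ c)" for j
 define mv where "mv k = (\<chi> c. C.mart (\<lambda>x. x $ c) \<tau> k om)" for k
 have h0: "0 <= h" by (simp add: h_def)
 have k0: "0 <= ?k1" using e Lb0 Kd0 C.Lam0 h0 by (intro add_nonneg_nonneg mult_nonneg_nonneg) auto
 have I0: "0 <= ?I j" for j
 proof (rule Henstock_Kurzweil_Integration.integral_nonneg)
  have sub: "{\<tau> j..\<tau> (Suc j)} \<subseteq> {0..T}" using \<tau>in[of j] \<tau>in[of "Suc j"] by auto
  thus "(\<lambda>u. Dgap u (X (\<tau> j) om)) integrable_on {\<tau> j..\<tau> (Suc j)}"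
   by (intro integrable_continuous_real continuous_on_subset[OF Dgap_continuous[OF XE]])
  show "0 <= Dgap u (X (\<tau> j) om)" if "u \<in> {\<tau> j..\<tau> (Suc j)}" for u using that sub by (intro Dgap_bounds XE) auto
 qed
 have R0: "0 <= R c om" for c using R[of 0 c] abs_ge_zero order_trans by blast
 have A0: "0 <= ?A" using T k0 e I0 R0 Lb0 Kd0 C.Lam0 h0 by (intro add_nonneg_nonneg mult_nonneg_nonneg sum_nonneg) auto
 have st: "norm (sv j - (\<mu> (\<tau> (Suc j)) - \<mu> (\<tau> j))) <= ?h j * ?k1 + Lb * (?h j * ?e j) + (1 / eps) * ?I j" for j
 proof -
  have "norm (sv j - (\<mu> (\<tau> (Suc j)) - \<mu> (\<tau> j))) <= ?h j * (real CARD('d) * eps + Lb * ?e j + Lb * Kd * ?h j) + (1 / eps) * ?I j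
    + real CARD('d) * (2 * Kd * C.Lam * (?h j)\<^sup>2)"
   unfolding sv_def by (rule step_bound[OF tr \<mu> _ \<tau>m _ XE e]) (use \<tau>in[of j] \<tau>in[of "Suc j"] in auto)
  also have "\<dots> = ?h j * (real CARD('d) * eps) + Lb * (?h j * ?e j) + Lb * Kd * (?h j * ?h j) + (1 / eps) * ?I j + 2 * real CARD('d) * Kd * C.Lam * (?h j * ?h j)"
   by (simp add: algebra_simps power2_eq_square)
  also have "\<dots> <= ?h j * (real CARD('d) * eps) + Lb * (?h j * ?e j) + Lb * Kd * (?h j * h) + (1 / eps) * ?I j + 2 * real CARD('d) * Kd * C.Lam * (?h j * h)"
   using \<tau>h[of j] \<tau>m[of j] Lb0 Kd0 C.Lam0 by (intro add_mono order_refl mult_left_mono) auto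
  finally show ?thesis by (simp add: algebra_simps)
 qed
 have rec: "?e k <= ?A + Lb * (\<Sum>j<k. ?h j * ?e j)" if k: "k <= K" for k
 proof -
  have dmu: "(\<Sum>j<k. \<mu> (\<tau> (Suc j)) - \<mu> (\<tau> j)) = \<mu> (\<tau> k) - \<mu> 0" using sum_lessThan_telescope[of "\<lambda>j. \<mu> (\<tau> j)" k] \<tau>0 by simp
  have Xk: "X (\<tau> k) om = X 0 om + mv k + (\<Sum>j<k. sv j)"
   unfolding vec_eq_iff using C.mart_telescope[where \<psi> = "\<lambda>x. x $ _" and \<tau> = \<tau> and k = k and om = om] by (simp add: mv_def sv_def \<tau>0)
  have ss: "(\<Sum>j<k. sv j - (\<mu> (\<tau> (Suc j)) - \<mu> (\<tau> j))) = (\<Sum>j<k. sv j) - (\<mu> (\<tau> k) - \<mu> 0)"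
   unfolding dmu[symmetric] by (rule sum_subtractf)
  have "X (\<tau> k) om - \<mu> (\<tau> k) = (X 0 om - \<mu> 0) + mv k + (\<Sum>j<k. sv j - (\<mu> (\<tau> (Suc j)) - \<mu> (\<tau> j)))"
   unfolding ss Xk by simp
  hence "?e k <= norm (X 0 om - \<mu> 0) + norm (mv k) + norm (\<Sum>j<k. sv j - (\<mu> (\<tau> (Suc j)) - \<mu> (\<tau> j)))"
   by (simp add: norm_triangle_le norm_triangle_ineq add_right_mono)
  also have "norm (mv k) <= (\<Sum>c\<in>UNIV. R c om)"
  proof -
   have "norm (mv k) <= (\<Sum>c\<in>UNIV. \<bar>mv k $ c\<bar>)" by (rule norm_le_l1_cart)
   also have "\<dots> <= (\<Sum>c\<in>UNIV. R c om)" using R k by (intro sum_mono) (auto simp: mv_def \<tau>_def K_def)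
   finally show ?thesis .
  qed
  also have "norm (\<Sum>j<k. sv j - (\<mu> (\<tau> (Suc j)) - \<mu> (\<tau> j))) <= (\<Sum>j<k. ?h j * ?k1 + Lb * (?h j * ?e j) + (1 / eps) * ?I j)"
   by (rule order_trans[OF norm_sum sum_mono]) (rule st)
  also have "\<dots> = (\<Sum>j<k. ?h j) * ?k1 + Lb * (\<Sum>j<k. ?h j * ?e j) + (1 / eps) * (\<Sum>j<k. ?I j)"
   unfolding sum.distrib sum_distrib_left sum_distrib_right ..
  also have "(\<Sum>j<k. ?h j) * ?k1 <= T * ?k1"
   unfolding sum_lessThan_telescope \<tau>0 using \<tau>in[of k] by (intro mult_right_mono k0) simp
  also have "(1 / eps) * (\<Sum>j<k. ?I j) <= (1 / eps) * (\<Sum>j<K. ?I j)" using k e I0 by (intro mult_left_mono sum_mono2) auto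
  finally show ?thesis by simp
 qed
 have gr: "?e k <= exp (Lb * T) * ?A" if k: "k <= K" for k
 proof -
  have "?e k <= ?A * exp (Lb * (\<Sum>j<k. ?h j))"
   by (rule discrete_gronwall[OF Lb0 A0 _ rec k]) (use \<tau>m in auto)
  also have "\<dots> <= ?A * exp (Lb * T)"
   unfolding sum_lessThan_telescope \<tau>0 using \<tau>in[of k] A0 Lb0 by (intro mult_left_mono) (auto intro: mult_left_mono)
  finally show ?thesis by (simp only: mult.commute)
 qed
 show ?thesis
 proof (cases "k <= K")
  case True thus ?thesis by (rule gr)
 next
  case False
  hence "\<tau> k = \<tau> K" using dyad_end[of 0 T n k] dyad_end[of 0 T n K] by (simp add: \<tau>_def K_def)
  thus ?thesis using gr[OF order_refl] by simp
 qed
qed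

text \<open>The second moment from \<open>mart_maximal_rates\<close> becomes a first moment by
  \<open>x <= 1 / (2 * s) + s / 2 * x^2\<close>; the choice \<open>s = sqrt N\<close> balances a
  second moment of order \<open>1 / N\<close>.\<close>

lemma mart_expectation:
 assumes ch: "chain E (jump_rate N \<alpha>w) 0 T L p P X"
 shows "\<exists>R. chain.bdd P R \<and> (\<forall>om. \<forall>k\<le>K. \<bar>chain.mart E p X (\<lambda>x. x $ c) (dyad 0 T n) k om\<bar> <= R om) \<and>
  (\<integral>om. R om \<partial>P) <= (1 / 2 + 8 * ((real CARD('d))\<^sup>2 * M) * T) / sqrt (real N) + 8 * (rates.Lam E L)\<^sup>2 * T * sqrt (real N) * (1 / 2) ^ n"
proof -
 interpret C: chain E "jump_rate N \<alpha>w" 0 T L p P X by (rule ch)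
 have T: "0 <= T" using T0 by simp
 define s where "s = sqrt (real N)"
 have s: "0 < s" "s * s = real N" using N0 by (auto simp: s_def)
 let ?Bq = "(real CARD('d))\<^sup>2 * (M / real N)"
 have "\<exists>R. C.bdd R \<and> (\<forall>om. 0 <= R om) \<and> (\<forall>om. \<forall>k\<le>K. \<bar>C.mart (\<lambda>x. x $ c) (dyad 0 T n) k om\<bar> <= R om) \<and>
   (\<integral>om. (R om)\<^sup>2 \<partial>P) <= 16 * ((?Bq + C.Lam\<^sup>2 * (1 / 2 ^ n)) * (T - 0))"
 proof (rule C.mart_maximal_rates)
  show "dyad 0 T n j <= dyad 0 T n k" if "j <= k" for j k by (rule dyad_mono[OF that])
  show "dyad 0 T n k \<in> {0..T}" for k by (rule dyad_in[OF T])
  show "dyad 0 T n (Suc k) - dyad 0 T n k <= 1 / 2 ^ n" for k by (rule dyad_step)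
  show "0 <= ?Bq" using M0 by simp
  show "(\<Sum>z\<in>E - {x}. jump_rate N \<alpha>w u x z * (z $ c - x $ c)\<^sup>2) <= ?Bq" if "u \<in> {0..T}" "x \<in> E" for u x
   by (rule generator_square[OF that])
  show "\<bar>y $ c - x $ c\<bar> <= 1" if "x \<in> E" "y \<in> E" for x y
   using simplex_coord[OF E_simplex[OF that(1)], of c] simplex_coord[OF E_simplex[OF that(2)], of c] by linarith
 qed
 then obtain R where R: "C.bdd R" "\<forall>om. 0 <= R om" "\<forall>om. \<forall>k\<le>K. \<bar>C.mart (\<lambda>x. x $ c) (dyad 0 T n) k om\<bar> <= R om"
   "(\<integral>om. (R om)\<^sup>2 \<partial>P) <= 16 * ((?Bq + C.Lam\<^sup>2 * (1 / 2 ^ n)) * (T - 0))" by (elim exE conjE)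
 have am: "x <= 1 / (2 * s) + s / 2 * x\<^sup>2" for x :: real
 proof -
  have "0 <= (s * x - 1)\<^sup>2" by simp
  hence "2 * (s * x) <= s * s * x\<^sup>2 + 1" by (simp add: power2_eq_square algebra_simps)
  thus ?thesis using s(1) by (simp add: field_simps)
 qed
 have i: "integrable P (\<lambda>om. (R om)\<^sup>2)" by (rule C.bdd_integrable[OF C.bdd_power2[OF R(1)]])
 have "(\<integral>om. R om \<partial>P) <= (\<integral>om. 1 / (2 * s) + s / 2 * (R om)\<^sup>2 \<partial>P)"
  by (intro integral_mono C.bdd_integrable[OF R(1)] Bochner_Integration.integrable_add integrable_mult_right i am) simp
 also have "\<dots> = 1 / (2 * s) + s / 2 * (\<integral>om. (R om)\<^sup>2 \<partial>P)" using i by (simp add: C.prob_space)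
 also have "\<dots> <= 1 / (2 * s) + s / 2 * (16 * ((?Bq + C.Lam\<^sup>2 * (1 / 2 ^ n)) * (T - 0)))"
  using s R(4) by (intro add_left_mono mult_left_mono) auto
 also have "\<dots> = (1 / 2 + 8 * ((real CARD('d))\<^sup>2 * M) * T) / s + 8 * C.Lam\<^sup>2 * T * s * (1 / 2) ^ n"
  unfolding s(2)[symmetric] using s(1) by (simp add: field_simps power_one_over)
 finally show ?thesis using R(1,3) unfolding s_def by blast
qed

text \<open>In each step the state is frozen at the left end, while \<open>energy\<close> uses the
  law at the current time. The law is Lipschitz in time, so the difference is of the order of the
  step; \<open>C1\<close> may depend on \<open>N\<close>.\<close>

lemma occupation_partition:
 assumes ch: "chain E (jump_rate N \<alpha>w) 0 T L p P X"
 shows "\<exists>C1\<ge>0. \<forall>n. (\<Sum>j<dyad_count 0 T n. \<integral>om. integral {dyad 0 T n j..dyad 0 T n (Suc j)} (\<lambda>u. Dgap u (X (dyad 0 T n j) om)) \<partial>P)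
  <= 4 * c1 * T / (\<kappa> * real N) + C1 * (1 / 2) ^ n"
proof -
 interpret C: chain E "jump_rate N \<alpha>w" 0 T L p P X by (rule ch)
 have T: "0 <= T" using T0 by simp
 obtain KL where KL: "0 <= KL" "\<forall>r s. \<forall>y\<in>E. 0 <= r --> r <= s --> s <= T --> \<bar>C.law s y - C.law r y\<bar> <= KL * (s - r)"
  using C.law_lipschitz by (elim exE conjE)
 let ?B = "real CARD('d) * M\<^sup>2" and ?f = "\<lambda>u. \<Sum>y\<in>E. C.law u y * Dgap u y"
 define C1 where "C1 = real (card E) * (KL * ?B) * T"
 have lc: "continuous_on {0..T} (\<lambda>u. C.law u y)" if "y \<in> E" for y by (rule forward_sol_continuous[OF C.law_forward that])
 have fc: "continuous_on {0..T} ?f" by (intro continuous_intros lc Dgap_continuous)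
 have en: "integral {0..T} ?f <= 4 * c1 * T / (\<kappa> * real N)"
  by (rule energy(2)[OF C.law_forward C.law_nonneg C.law_sum])
 have "(\<Sum>j<dyad_count 0 T n. \<integral>om. integral {dyad 0 T n j..dyad 0 T n (Suc j)} (\<lambda>u. Dgap u (X (dyad 0 T n j) om)) \<partial>P)
  <= 4 * c1 * T / (\<kappa> * real N) + C1 * (1 / 2) ^ n" for n
 proof -
  define \<tau> where "\<tau> = dyad 0 T n"
  define h :: real where "h = (1 / 2) ^ n"
  let ?K = "dyad_count 0 T n"
  have \<tau>in: "\<tau> j \<in> {0..T}" for j unfolding \<tau>_def by (rule dyad_in[OF T])
  have \<tau>m: "\<tau> j <= \<tau> (Suc j)" for j unfolding \<tau>_def by (rule dyad_mono) simp
  have \<tau>h: "\<tau> (Suc j) - \<tau> j <= h" for j using dyad_step[of 0 T n j] by (simp add: \<tau>_def h_def power_one_over)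
  have \<tau>0: "\<tau> 0 = 0" "\<tau> ?K = T" using dyad_0[OF T] dyad_end[OF order_refl] by (simp_all add: \<tau>_def)
  have sub: "{\<tau> i..\<tau> j} \<subseteq> {0..T}" for i j using \<tau>in[of i] \<tau>in[of j] by auto
  let ?J = "\<lambda>j. {\<tau> j..\<tau> (Suc j)}"
  have one: "(\<integral>om. integral (?J j) (\<lambda>u. Dgap u (X (\<tau> j) om)) \<partial>P) <= integral (?J j) ?f + real (card E) * (KL * ?B) * h * (\<tau> (Suc j) - \<tau> j)" for j
  proof -
   have Di: "(\<lambda>u. Dgap u y) integrable_on ?J j" if "y \<in> E" for y
    by (intro integrable_continuous_real continuous_on_subset[OF Dgap_continuous[OF that] sub])
   have li: "(\<lambda>u. C.law u y * Dgap u y) integrable_on ?J j" if "y \<in> E" for y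
    by (intro integrable_continuous_real continuous_on_subset[OF _ sub] continuous_on_mult lc Dgap_continuous that)
   have trm: "C.law (\<tau> j) y * integral (?J j) (\<lambda>u. Dgap u y) <= integral (?J j) (\<lambda>u. C.law u y * Dgap u y) + (KL * ?B) * h * (\<tau> (Suc j) - \<tau> j)" if y: "y \<in> E" for y
   proof -
    have "((\<lambda>u. C.law (\<tau> j) y * Dgap u y) has_integral (C.law (\<tau> j) y * integral (?J j) (\<lambda>u. Dgap u y))) (?J j)"
     by (intro has_integral_mult_right integrable_integral Di y)
    moreover have "((\<lambda>u. C.law u y * Dgap u y + (KL * ?B) * h) has_integral (integral (?J j) (\<lambda>u. C.law u y * Dgap u y) + (KL * ?B) * h * (\<tau> (Suc j) - \<tau> j))) (?J j)"
     using has_integral_add[OF integrable_integral[OF li[OF y]] has_integral_const_real[of "(KL * ?B) * h" "\<tau> j" "\<tau> (Suc j)"]] \<tau>m[of j] by (simp add: mult.commute)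
    ultimately show ?thesis
    proof (rule has_integral_le)
     fix u assume u: "u \<in> ?J j"
     have uT: "u \<in> {0..T}" using u sub by blast
     have "\<bar>C.law u y - C.law (\<tau> j) y\<bar> <= KL * (u - \<tau> j)" using KL(2) y \<tau>in[of j] u uT by auto
     also have "\<dots> <= KL * h" using u \<tau>h[of j] KL(1) by (intro mult_left_mono) auto
     finally have "C.law (\<tau> j) y <= C.law u y + KL * h" by linarith
     hence "C.law (\<tau> j) y * Dgap u y <= (C.law u y + KL * h) * Dgap u y" using Dgap_bounds(1)[OF uT y] by (rule mult_right_mono)
     also have "\<dots> = C.law u y * Dgap u y + KL * h * Dgap u y" by (rule distrib_right)
     also have "\<dots> <= C.law u y * Dgap u y + KL * h * ?B"
      using Dgap_bounds(2)[OF uT y] KL(1) by (intro add_left_mono mult_left_mono) (auto simp: h_def)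
     finally show "C.law (\<tau> j) y * Dgap u y <= C.law u y * Dgap u y + (KL * ?B) * h" by (simp only: mult_ac)
    qed
   qed
   have "(\<integral>om. integral (?J j) (\<lambda>u. Dgap u (X (\<tau> j) om)) \<partial>P) = (\<Sum>y\<in>E. C.law (\<tau> j) y * integral (?J j) (\<lambda>u. Dgap u y))"
    by (rule C.expect_law[OF \<tau>in, where \<phi> = "\<lambda>y. integral (?J j) (\<lambda>u. Dgap u y)"])
   also have "\<dots> <= (\<Sum>y\<in>E. integral (?J j) (\<lambda>u. C.law u y * Dgap u y) + (KL * ?B) * h * (\<tau> (Suc j) - \<tau> j))" by (intro sum_mono trm)
   also have "\<dots> = integral (?J j) ?f + real (card E) * ((KL * ?B) * h * (\<tau> (Suc j) - \<tau> j))"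
    unfolding sum.distrib by (simp add: Henstock_Kurzweil_Integration.integral_sum[OF fin_E li])
   finally show ?thesis by (simp only: mult.assoc)
  qed
  have "(\<Sum>j<?K. \<integral>om. integral (?J j) (\<lambda>u. Dgap u (X (\<tau> j) om)) \<partial>P) <= (\<Sum>j<?K. integral (?J j) ?f + real (card E) * (KL * ?B) * h * (\<tau> (Suc j) - \<tau> j))"
   by (intro sum_mono one)
  also have "\<dots> = (\<Sum>j<?K. integral (?J j) ?f) + real (card E) * (KL * ?B) * h * (\<tau> ?K - \<tau> 0)"
   unfolding sum.distrib sum_distrib_left[symmetric] sum_lessThan_telescope ..
  also have "(\<Sum>j<?K. integral (?J j) ?f) = integral {\<tau> 0..\<tau> ?K} ?f"
  proof (rule integral_partition)
   show "\<tau> j <= \<tau> k" if "j <= k" for j k unfolding \<tau>_def by (rule dyad_mono[OF that])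
   show "?f integrable_on {\<tau> 0..\<tau> k}" for k by (intro integrable_continuous_real continuous_on_subset[OF fc sub])
  qed
  also have "integral {\<tau> 0..\<tau> ?K} ?f <= 4 * c1 * T / (\<kappa> * real N)" unfolding \<tau>0 by (rule en)
  finally show ?thesis by (simp add: C1_def h_def[symmetric] \<tau>0 \<tau>_def[symmetric] mult_ac)
 qed
 moreover have "0 <= C1" unfolding C1_def using KL(1) T by (intro mult_nonneg_nonneg) auto
 ultimately show ?thesis by blast
qed

text \<open>Expectation of \<open>path_bound\<close> with \<open>eps = 1 / sqrt N\<close>, for which
  \<open>eps\<close> and the energy bound divided by \<open>eps\<close> have the same order. All
  discretization errors are collected in \<open>CN\<close>, which does not depend on the level
  \<open>n\<close>.\<close>

lemma path_expectation:
 assumes ch: "chain E (jump_rate N \<alpha>w) 0 T L p P X" and \<mu>: "opt_traj \<mu>" and I0: "(\<integral>om. norm (X 0 om - \<mu> 0) \<partial>P) <= I0"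
 shows "\<exists>CN. \<forall>n. \<exists>A. integrable P A \<and> (\<forall>om\<in>space P. \<forall>k. norm (X (dyad 0 T n k) om - \<mu> (dyad 0 T n k)) <= A om) \<and>
   (\<integral>om. A om \<partial>P) <= exp (Lb * T) * (I0 + C0 / sqrt (real N)) + CN * (1 / 2) ^ n"
proof -
 interpret C: chain E "jump_rate N \<alpha>w" 0 T L p P X by (rule ch)
 have T: "0 <= T" "0 \<in> {0..T}" using T0 by auto
 define s where "s = sqrt (real N)"
 have s: "0 < s" "real N = s * s" using N0 by (auto simp: s_def)
 let ?d = "real CARD('d)"
 obtain C1 where C1: "0 <= C1" "\<forall>n. (\<Sum>j<dyad_count 0 T n. \<integral>om. integral {dyad 0 T n j..dyad 0 T n (Suc j)} (\<lambda>u. Dgap u (X (dyad 0 T n j) om)) \<partial>P)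
  <= 4 * c1 * T / (\<kappa> * real N) + C1 * (1 / 2) ^ n" using occupation_partition[OF ch] by (elim exE conjE)
 define CN where "CN = exp (Lb * T) * (?d * (8 * C.Lam\<^sup>2 * T * s) + T * (Lb * Kd + 2 * ?d * Kd * C.Lam) + s * C1)"
 have "\<exists>A. integrable P A \<and> (\<forall>om\<in>space P. \<forall>k. norm (X (dyad 0 T n k) om - \<mu> (dyad 0 T n k)) <= A om) \<and>
   (\<integral>om. A om \<partial>P) <= exp (Lb * T) * (I0 + C0 / sqrt (real N)) + CN * (1 / 2) ^ n" for n
 proof -
  define h :: real where "h = (1 / 2) ^ n"
  let ?K = "dyad_count 0 T n" and ?\<tau> = "dyad 0 T n"
  let ?r = "(1 / 2 + 8 * (?d\<^sup>2 * M) * T) / s + 8 * C.Lam\<^sup>2 * T * s * h"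
  have "\<forall>c. \<exists>R. C.bdd R \<and> (\<forall>om. \<forall>k\<le>?K. \<bar>C.mart (\<lambda>x. x $ c) ?\<tau> k om\<bar> <= R om) \<and> (\<integral>om. R om \<partial>P) <= ?r"
   unfolding s_def h_def by (intro allI mart_expectation[OF ch])
  then obtain R where R: "\<forall>c. C.bdd (R c) \<and> (\<forall>om. \<forall>k\<le>?K. \<bar>C.mart (\<lambda>x. x $ c) ?\<tau> k om\<bar> <= R c om) \<and> (\<integral>om. R c om \<partial>P) <= ?r"
   by (rule choice[THEN exE])
  have R1: "C.bdd (R c)" and R2: "k <= ?K ==> \<bar>C.mart (\<lambda>x. x $ c) ?\<tau> k om\<bar> <= R c om" and R3: "(\<integral>om. R c om \<partial>P) <= ?r" for c k om
   using R by blast+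
  define k1 where "k1 = ?d * (1 / s) + Lb * Kd * (1 / 2 ^ n) + 2 * ?d * Kd * C.Lam * (1 / 2 ^ n)"
  let ?f1 = "\<lambda>om. norm (X 0 om - \<mu> 0)" and ?f2 = "\<lambda>om. \<Sum>c\<in>UNIV. R c om"
   and ?f4 = "\<lambda>om. \<Sum>j<?K. integral {?\<tau> j..?\<tau> (Suc j)} (\<lambda>u. Dgap u (X (?\<tau> j) om))"
  \<comment> \<open>The factor \<open>1 / (1 / s)\<close> keeps the shape of
    \<open>path_bound\<close> with \<open>eps = 1 / s\<close>.\<close>
  define A where "A om = exp (Lb * T) * (?f1 om + ?f2 om + T * k1 + (1 / (1 / s)) * ?f4 om)" for om
  have i1: "integrable P ?f1" by (rule C.bdd_integrable[OF C.bdd_fun_X[OF T(2), of "\<lambda>x. norm (x - \<mu> 0)"]])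
  have i2: "integrable P ?f2" by (intro Bochner_Integration.integrable_sum C.bdd_integrable R1)
  have i4': "integrable P (\<lambda>om. integral {?\<tau> j..?\<tau> (Suc j)} (\<lambda>u. Dgap u (X (?\<tau> j) om)))" for j
   by (rule C.bdd_integrable[OF C.bdd_fun_X[OF dyad_in[OF T(1)], of "\<lambda>x. integral {?\<tau> j..?\<tau> (Suc j)} (\<lambda>u. Dgap u x)"]])
  have i4: "integrable P ?f4" by (intro Bochner_Integration.integrable_sum i4')
  have Ai: "integrable P A" unfolding A_def
   by (intro integrable_mult_right Bochner_Integration.integrable_add i1 i2 i4) simp
  have "(\<integral>om. A om \<partial>P) = exp (Lb * T) * ((\<integral>om. ?f1 om \<partial>P) + (\<integral>om. ?f2 om \<partial>P) + T * k1 + (1 / (1 / s)) * (\<integral>om. ?f4 om \<partial>P))"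
   unfolding A_def using i1 i2 i4 by (simp add: C.prob_space C.integrable_const)
  also have "\<dots> <= exp (Lb * T) * (I0 + ?d * ?r + T * k1 + s * (4 * c1 * T / (\<kappa> * real N) + C1 * h))"
  proof (rule mult_left_mono, (rule add_mono)+)
   show "(\<integral>om. ?f1 om \<partial>P) <= I0" by (rule I0)
   have "(\<integral>om. ?f2 om \<partial>P) = (\<Sum>c\<in>UNIV. \<integral>om. R c om \<partial>P)" by (intro Bochner_Integration.integral_sum C.bdd_integrable R1)
   also have "\<dots> <= (\<Sum>c\<in>(UNIV::'d set). ?r)" by (intro sum_mono R3)
   finally show "(\<integral>om. ?f2 om \<partial>P) <= ?d * ?r" by simp
   have "(\<integral>om. ?f4 om \<partial>P) = (\<Sum>j<?K. \<integral>om. integral {?\<tau> j..?\<tau> (Suc j)} (\<lambda>u. Dgap u (X (?\<tau> j) om)) \<partial>P)" by (intro Bochner_Integration.integral_sum i4')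
   also have "\<dots> <= 4 * c1 * T / (\<kappa> * real N) + C1 * h" using C1(2) unfolding h_def by blast
   finally show "1 / (1 / s) * (\<integral>om. ?f4 om \<partial>P) <= s * (4 * c1 * T / (\<kappa> * real N) + C1 * h)" using s by (simp add: mult_left_mono)
  qed simp_all
  also have "\<dots> = exp (Lb * T) * (I0 + C0 / s) + CN * h"
  proof -
   have sN: "s * (4 * c1 * T / (\<kappa> * real N)) = (4 * c1 * T / \<kappa>) / s" using s \<kappa>0 by (simp add: field_simps)
   have k1: "k1 = ?d / s + (Lb * Kd + 2 * ?d * Kd * C.Lam) * h" by (simp add: k1_def h_def power_one_over algebra_simps)
   have C0s: "C0 / s = ?d * ((1 / 2 + 8 * (?d\<^sup>2 * M) * T) / s) + T * (?d / s) + (4 * c1 * T / \<kappa>) / s"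
    unfolding C0_def using s(1) \<kappa>0 by (simp add: field_simps)
   show ?thesis unfolding k1 distrib_left[of s] sN C0s CN_def by (simp add: algebra_simps)
  qed
  finally have "(\<integral>om. A om \<partial>P) <= exp (Lb * T) * (I0 + C0 / sqrt (real N)) + CN * (1 / 2) ^ n" by (simp only: s_def h_def)
  moreover have "norm (X (?\<tau> k) om - \<mu> (?\<tau> k)) <= A om" if "om \<in> space P" for om k
   unfolding A_def k1_def by (rule path_bound[where R = R and eps = "1 / s", OF ch \<mu> that]) (use s R2 in auto)
  ultimately show ?thesis using Ai by blast
 qed
 thus ?thesis by blast
qed

lemma mean_sup_distance:
 assumes ch: "chain E (jump_rate N \<alpha>w) 0 T L p P X" and \<mu>: "opt_traj \<mu>" and I0: "(\<integral>om. norm (X 0 om - \<mu> 0) \<partial>P) <= I0"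
 shows "(\<integral>\<^sup>+om. (SUP t\<in>{0..T}. ennreal (norm (X t om - \<mu> t))) \<partial>P) <= ennreal (exp (Lb * T) * (I0 + C0 / sqrt (real N)))"
proof -
 interpret C: chain E "jump_rate N \<alpha>w" 0 T L p P X by (rule ch)
 obtain CN where CN: "\<forall>n. \<exists>A. integrable P A \<and> (\<forall>om\<in>space P. \<forall>k. norm (X (dyad 0 T n k) om - \<mu> (dyad 0 T n k)) <= A om) \<and>
   (\<integral>om. A om \<partial>P) <= exp (Lb * T) * (I0 + C0 / sqrt (real N)) + CN * (1 / 2) ^ n" using path_expectation[OF ch \<mu> I0] by (rule exE)
 have "Kd-lipschitz_on {0..T} \<mu>"
 proof (rule lipschitz_onI[OF _ Kd0])
  fix r s assume "r \<in> {0..T}" "s \<in> {0..T}"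
  thus "dist (\<mu> r) (\<mu> s) <= Kd * dist r s"
   using opt_traj_lip[OF \<mu>, of r s] opt_traj_lip[OF \<mu>, of s r] by (cases "r <= s") (auto simp: dist_norm norm_minus_commute)
 qed
 hence c: "continuous_on {0..T} \<mu>" by (rule lipschitz_on_continuous_on)
 show ?thesis
 proof (rule C.sup_expectation[where \<phi> = "\<lambda>t x. norm (x - \<mu> t)"])
  show "continuous_on {0..T} (\<lambda>t. norm (y - \<mu> t))" for y by (intro continuous_intros c)
  show "\<exists>A. integrable P A \<and> (\<forall>om\<in>space P. \<forall>k. norm (X (dyad 0 T n k) om - \<mu> (dyad 0 T n k)) <= A om) \<and>
   (\<integral>om. A om \<partial>P) <= exp (Lb * T) * (I0 + C0 / sqrt (real N)) + CN * (1 / 2) ^ n" for n using CN by blast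
 qed simp
qed

end

subsection \<open>The initial condition and the rate of convergence\<close>

text \<open>Each coordinate is an average of \<open>N\<close> independent centred variables bounded
  by 1, so the second moment of their sum is at most \<open>N\<close>; Young's inequality turns this
  into a first moment of order \<open>1 / sqrt N\<close>.\<close>

lemma empirical_measure_distance:
 fixes m0 :: "real^'d::finite"
 assumes P: "prob_space P" and Y: "iid_with_law P N m0 Y" and N: "0 < N" and m0: "m0 \<in> prob_simplex"
 shows "(\<lambda>om. norm (empirical_measure N (\<lambda>k. Y k om) - m0)) \<in> borel_measurable P"
  and "(\<integral>om. norm (empirical_measure N (\<lambda>k. Y k om) - m0) \<partial>P) <= real CARD('d) / sqrt (real N)"
proof -
 interpret prob_space P by (rule P)
 have ind: "indep_vars (\<lambda>_. count_space UNIV) Y {..<N}" and law: "\<And>k i. k < N ==> measure P {om\<in>space P. Y k om = i} = m0 $ i"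
  using Y by (auto simp: iid_with_law_def)
 have Ym: "Y k \<in> measurable P (count_space UNIV)" if "k < N" for k using ind that by (auto simp: indep_vars_def)
 define \<xi> where "\<xi> c k om = (if Y k om = c then 1 else 0) - m0 $ c" for c k om
 have \<xi>m: "\<xi> c k \<in> borel_measurable P" if "k < N" for c k
  unfolding \<xi>_def by (rule measurable_compose[OF Ym[OF that]]) simp
 have \<xi>b: "\<bar>\<xi> c k om\<bar> <= 1" for c k om using simplex_coord[OF m0, of c] by (auto simp: \<xi>_def)
 have \<xi>i: "integrable P (\<xi> c k)" if "k < N" for c k
  by (rule integrable_const_bound[where B = 1]) (use \<xi>b \<xi>m[OF that] in auto)
 have \<xi>E: "(\<integral>om. \<xi> c k om \<partial>P) = 0" if k: "k < N" for c k
 proof -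
  have S: "{om\<in>space P. Y k om = c} \<in> sets P"
  proof -
   have "Y k -` {c} \<inter> space P \<in> sets P" by (rule measurable_sets[OF Ym[OF k]]) simp
   also have "Y k -` {c} \<inter> space P = {om\<in>space P. Y k om = c}" by auto
   finally show ?thesis .
  qed
  have "(\<integral>om. \<xi> c k om \<partial>P) = (\<integral>om. indicator {om\<in>space P. Y k om = c} om - m0 $ c \<partial>P)"
   by (intro Bochner_Integration.integral_cong refl) (simp add: \<xi>_def indicator_def)
  also have "\<dots> = (\<integral>om. indicator {om\<in>space P. Y k om = c} om \<partial>P) - (\<integral>om. m0 $ c \<partial>P)"
   using S by (intro Bochner_Integration.integral_diff) (auto intro!: integrable_const_bound[where B = 1])
  also have "\<dots> = 0" using S law[OF k, of c] by (simp add: prob_space)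
  finally show ?thesis .
 qed
 have cross: "(\<integral>om. \<xi> c k om * \<xi> c l om \<partial>P) = 0" if kl: "k < N" "l < N" "k ~= l" for c k l
 proof -
  have "indep_vars (\<lambda>_. borel) (\<lambda>k om. \<xi> c k om) {..<N}"
   unfolding \<xi>_def by (rule indep_vars_compose2[OF ind, where Y = "\<lambda>k y. (if y = c then 1 else 0) - m0 $ c"]) simp
  hence "indep_vars (\<lambda>_. borel) (\<xi> c) {k, l}" by (rule indep_vars_subset) (use kl in auto)
  from indep_vars_lebesgue_integral[OF _ this] have "(\<integral>om. (\<Prod>i\<in>{k, l}. \<xi> c i om) \<partial>P) = (\<Prod>i\<in>{k, l}. \<integral>om. \<xi> c i om \<partial>P)"
   using \<xi>i kl by auto
  thus ?thesis using kl \<xi>E by simp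
 qed
 have prod_i: "integrable P (\<lambda>om. \<xi> c k om * \<xi> c l om)" if "k < N" "l < N" for c k l
 proof (rule integrable_const_bound[where B = 1])
  have "\<bar>\<xi> c k om\<bar> * \<bar>\<xi> c l om\<bar> <= 1 * 1" for om by (intro mult_mono \<xi>b) auto
  thus "AE om in P. norm (\<xi> c k om * \<xi> c l om) <= 1" by (intro AE_I2) (simp add: abs_mult)
 qed (use \<xi>m that in measurable)
 define S where "S c om = (\<Sum>k<N. \<xi> c k om)" for c om
 have S2: "(S c om)\<^sup>2 = (\<Sum>k<N. \<Sum>l<N. \<xi> c k om * \<xi> c l om)" for c om
  unfolding S_def power2_eq_square sum_product ..
 have S2i: "integrable P (\<lambda>om. (S c om)\<^sup>2)" for c
  unfolding S2 by (intro Bochner_Integration.integrable_sum prod_i) auto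
 have Si: "integrable P (S c)" for c unfolding S_def by (intro Bochner_Integration.integrable_sum \<xi>i) auto
 have var: "(\<integral>om. (S c om)\<^sup>2 \<partial>P) <= real N" for c
 proof -
  have "(\<integral>om. (S c om)\<^sup>2 \<partial>P) = (\<Sum>k<N. \<integral>om. (\<Sum>l<N. \<xi> c k om * \<xi> c l om) \<partial>P)"
   unfolding S2 by (intro Bochner_Integration.integral_sum Bochner_Integration.integrable_sum prod_i) auto
  also have "\<dots> = (\<Sum>k<N. \<Sum>l<N. \<integral>om. \<xi> c k om * \<xi> c l om \<partial>P)"
   by (intro sum.cong refl Bochner_Integration.integral_sum prod_i) auto
  also have "\<dots> = (\<Sum>k<N. \<Sum>l<N. if l = k then \<integral>om. \<xi> c k om * \<xi> c k om \<partial>P else 0)"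
   by (intro sum.cong refl) (auto simp: cross)
  also have "\<dots> = (\<Sum>k<N. \<integral>om. \<xi> c k om * \<xi> c k om \<partial>P)" by simp
  also have "\<dots> <= (\<Sum>k<N. 1)"
  proof (rule sum_mono)
   fix k assume "k \<in> {..<N}"
   hence k: "k < N" by simp
   have "\<xi> c k om * \<xi> c k om <= 1" for om using abs_square_le_1[of "\<xi> c k om"] \<xi>b by (simp add: power2_eq_square)
   hence "(\<integral>om. \<xi> c k om * \<xi> c k om \<partial>P) <= (\<integral>om. 1 \<partial>P)" by (intro integral_mono prod_i k) auto
   thus "(\<integral>om. \<xi> c k om * \<xi> c k om \<partial>P) <= 1" by (simp add: prob_space)
  qed
  finally show ?thesis by simp
 qed
 define s where "s = sqrt (real N)"
 have s: "0 < s" "real N = s * s" using N by (auto simp: s_def)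
 have emp: "(empirical_measure N (\<lambda>k. Y k om) - m0) $ c = S c om / real N" for c om
 proof -
  have "(empirical_measure N (\<lambda>k. Y k om)) $ c = (\<Sum>k<N. if Y k om = c then 1 else 0) / real N"
   by (simp add: empirical_measure_def axis_def eq_commute)
  moreover have "S c om = (\<Sum>k<N. if Y k om = c then 1 else 0) - real N * m0 $ c" by (simp add: S_def \<xi>_def sum_subtractf)
  ultimately show ?thesis using N by (simp add: diff_divide_distrib)
 qed
 have am: "\<bar>v\<bar> / real N <= 1 / (2 * s) + v\<^sup>2 / (2 * s * real N)" for v
 proof -
  have "0 <= (\<bar>v\<bar> - s)\<^sup>2" by simp
  hence "2 * \<bar>v\<bar> * s <= s\<^sup>2 + v\<^sup>2" by (simp add: power2_diff)
  thus ?thesis unfolding s(2) using s(1) by (simp add: field_simps power2_eq_square)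
 qed
 have nrm: "norm (empirical_measure N (\<lambda>k. Y k om) - m0) = sqrt (\<Sum>c\<in>UNIV. (S c om / real N)\<^sup>2)" for om
  unfolding norm_vec_def L2_set_def emp by (simp add: power_divide)
 have Sm: "S c \<in> borel_measurable P" for c by (rule borel_measurable_integrable[OF Si])
 show m: "(\<lambda>om. norm (empirical_measure N (\<lambda>k. Y k om) - m0)) \<in> borel_measurable P"
  unfolding nrm using Sm by measurable
 let ?D = "\<lambda>om. \<Sum>c\<in>(UNIV::'d set). 1 / (2 * s) + (S c om)\<^sup>2 / (2 * s * real N)"
 have Di: "integrable P ?D" by (intro Bochner_Integration.integrable_sum Bochner_Integration.integrable_add integrable_const integrable_divide S2i)
 have le: "norm (empirical_measure N (\<lambda>k. Y k om) - m0) <= ?D om" for om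
 proof -
  have "norm (empirical_measure N (\<lambda>k. Y k om) - m0) <= (\<Sum>c\<in>UNIV. \<bar>(empirical_measure N (\<lambda>k. Y k om) - m0) $ c\<bar>)" by (rule norm_le_l1_cart)
  also have "\<dots> = (\<Sum>c\<in>UNIV. \<bar>S c om\<bar> / real N)" unfolding emp by simp
  also have "\<dots> <= ?D om" by (intro sum_mono am)
  finally show ?thesis .
 qed
 have "(\<integral>om. norm (empirical_measure N (\<lambda>k. Y k om) - m0) \<partial>P) <= (\<integral>om. ?D om \<partial>P)"
 proof (rule integral_mono[OF _ Di le])
  show "integrable P (\<lambda>om. norm (empirical_measure N (\<lambda>k. Y k om) - m0))"
   by (rule Bochner_Integration.integrable_bound[OF Di m]) (use le in \<open>auto intro!: AE_I2 intro: order_trans[OF _ abs_ge_self]\<close>)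
 qed
 also have "\<dots> = (\<Sum>c\<in>(UNIV::'d set). \<integral>om. 1 / (2 * s) + (S c om)\<^sup>2 / (2 * s * real N) \<partial>P)"
  by (intro Bochner_Integration.integral_sum Bochner_Integration.integrable_add integrable_const integrable_divide S2i)
 also have "\<dots> <= (\<Sum>c\<in>(UNIV::'d set). 1 / s)"
 proof (rule sum_mono)
  fix c :: 'd
  have "(\<integral>om. 1 / (2 * s) + (S c om)\<^sup>2 / (2 * s * real N) \<partial>P) = (\<integral>om. 1 / (2 * s) \<partial>P) + (\<integral>om. (S c om)\<^sup>2 / (2 * s * real N) \<partial>P)"
   by (intro Bochner_Integration.integral_add integrable_const integrable_divide S2i)
  also have "\<dots> = 1 / (2 * s) + (\<integral>om. (S c om)\<^sup>2 \<partial>P) / (2 * s * real N)" by (simp add: prob_space)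
  also have "\<dots> <= 1 / (2 * s) + real N / (2 * s * real N)" using s(1) N var[of c] by (intro add_left_mono divide_right_mono) auto
  also have "\<dots> = 1 / s" using s(1) N by (simp add: field_simps)
  finally show "(\<integral>om. 1 / (2 * s) + (S c om)\<^sup>2 / (2 * s * real N) \<partial>P) <= 1 / s" .
 qed
 finally show "(\<integral>om. norm (empirical_measure N (\<lambda>k. Y k om) - m0) \<partial>P) <= real CARD('d) / sqrt (real N)" by (simp add: s_def)
qed

lemma (in regular_value) mean_sup_distance_bound:
 fixes P :: "'w measure" and m0 :: "real^'d"
 assumes N: "0 < N" and op: "agent_opt_process T M f g m0 N P X" and m0: "m0 \<in> prob_simplex"
  and mo: "mf_opt_trajectory T M f g m0 \<mu>"
 shows "(\<integral>\<^sup>+om. (SUP t\<in>{0..T}. ennreal (norm (X t om - \<mu> t))) \<partial>P)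
  <= ennreal (exp (Lb * T) * (real CARD('d) + C0) / real N powr (1 / 9))"
proof -
 obtain w where w: "\<forall>x\<in>simplex_grid N. w T x = G x \<and>
   (\<forall>t\<in>{0..T}. ((\<lambda>t. w t x) has_vector_derivative - ham t x (dz N (w t) x)) (at t within {0..T}))"
  using agent_hjb_exists[OF N] by (rule exE)
 interpret agent_regular T M f g CF CG LD \<kappa> Df U ut z LU N w
  by unfold_locales (use N w in auto)
 have T: "(0::real) \<in> {0..T}" using T0 by simp
 have mc: "markov_jump_chain P E (jump_rate N \<alpha>w) 0 T X"
 proof (rule markov_jump_chain_cong)
  show "markov_jump_chain P E (jump_rate N (agent_opt_feedback T M f g N)) 0 T X"
   using op by (simp add: agent_opt_process_def agent_chain_def)
 qed (rule agent_opt_rate)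
 obtain p where "chain E (jump_rate N \<alpha>w) 0 T ((real CARD('d))\<^sup>2 * (real N * M)) p P X"
  by (rule chain_if_markov_jump_chain[OF agent_rates[OF N0 T feedback_\<alpha>w] mc])
 note ch = this
 interpret C: chain E "jump_rate N \<alpha>w" 0 T "(real CARD('d))\<^sup>2 * (real N * M)" p P X by (rule ch)
 obtain Y where Y: "iid_with_law P N m0 Y" "AE om in P. X 0 om = empirical_measure N (\<lambda>k. Y k om)"
  using op unfolding agent_opt_process_def by (elim exE conjE)
 note emp = empirical_measure_distance[OF C.prob_space_axioms Y(1) N m0]
 have \<mu>0: "\<mu> 0 = m0" using mo by (simp add: mf_opt_trajectory_def)
 have "(\<integral>om. norm (X 0 om - \<mu> 0) \<partial>P) = (\<integral>om. norm (empirical_measure N (\<lambda>k. Y k om) - m0) \<partial>P)"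
 proof (rule integral_cong_AE)
  show "AE om in P. norm (X 0 om - \<mu> 0) = norm (empirical_measure N (\<lambda>k. Y k om) - m0)"
   using Y(2) by eventually_elim (simp add: \<mu>0)
  show "(\<lambda>om. norm (X 0 om - \<mu> 0)) \<in> borel_measurable P" by (rule C.fun_X_measurable[OF T, of "\<lambda>x. norm (x - \<mu> 0)"])
 qed (rule emp(1))
 hence I0: "(\<integral>om. norm (X 0 om - \<mu> 0) \<partial>P) <= real CARD('d) / sqrt (real N)" using emp(2) by simp
 have "(\<integral>\<^sup>+om. (SUP t\<in>{0..T}. ennreal (norm (X t om - \<mu> t))) \<partial>P) <= ennreal (exp (Lb * T) * (real CARD('d) / sqrt (real N) + C0 / sqrt (real N)))"
  by (rule mean_sup_distance[OF ch opt_traj_if_mf_opt_trajectory[OF mo] I0])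
 also have "\<dots> <= ennreal (exp (Lb * T) * (real CARD('d) + C0) / real N powr (1 / 9))"
 proof (rule ennreal_leI)
  \<comment> \<open>As \<open>N\<close> is at least 1, the power increases with its exponent, so the
    rate \<open>1 / sqrt N\<close> may be weakened to the stated one.\<close>
  have "real N powr (1 / 9) <= real N powr (1 / 2)" using N by (intro powr_mono) auto
  also have "\<dots> = sqrt (real N)" by (simp add: powr_half_sqrt)
  finally have le: "real N powr (1 / 9) <= sqrt (real N)" .
  have "exp (Lb * T) * (real CARD('d) / sqrt (real N) + C0 / sqrt (real N)) = exp (Lb * T) * (real CARD('d) + C0) / sqrt (real N)"
   by (simp add: add_divide_distrib distrib_left)
  also have "\<dots> <= exp (Lb * T) * (real CARD('d) + C0) / real N powr (1 / 9)"
   using le N C0_nonneg by (intro divide_left_mono mult_nonneg_nonneg mult_pos_pos) auto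
  finally show "exp (Lb * T) * (real CARD('d) / sqrt (real N) + C0 / sqrt (real N)) <= exp (Lb * T) * (real CARD('d) + C0) / real N powr (1 / 9)" .
 qed
 finally show ?thesis .
qed

theorem theorem13:
  fixes T M :: real
    and f :: "('n::finite option) running_cost"
    and g :: "('n option) terminal_cost"
    and m0 :: "real^('n option)"
    and \<mu> :: "real \<Rightarrow> real^('n option)"
  assumes "T > 0" and "M > 0"
    and "assumption_B T M f g"
    and "C11_simplex T (mf_value T M f g)"
    and "m0 \<in> prob_simplex"
    and "mf_opt_trajectory T M f g m0 \<mu>"
  shows "\<exists>C::real. \<forall>N\<ge>1. \<forall>(P :: 'w measure) \<mu>N.
    agent_opt_process T M f g m0 N P \<mu>N \<longrightarrow>
      (\<integral>\<^sup>+\<omega>. (SUP t\<in>{0..T}. ennreal (norm (\<mu>N t \<omega> - \<mu> t))) \<partial>P)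
        \<le> ennreal (C / real N powr (1 / 9))"
proof -
 obtain CF CG LD \<kappa> Df where cd: "cost_data T M f g CF CG LD \<kappa> Df"
  by (rule assumption_B_cost_data[OF assms(1-3)])
 obtain vt :: "real \<times> (real^'n) => real" and vx :: "real \<times> (real^'n) => real^'n" and L where
  "\<forall>t\<in>{0..T}. \<forall>x\<in>interior hat_simplex.
      ((\<lambda>(s, y). mf_value T M f g s (chart y)) has_derivative (\<lambda>(h, k). vt (t, x) * h + vx (t, x) \<bullet> k))
       (at (t, x) within {0..T} \<times> interior hat_simplex)"
  "L-lipschitz_on ({0..T} \<times> hat_simplex) vt" "L-lipschitz_on ({0..T} \<times> hat_simplex) vx"
  using assms(4) unfolding C11_simplex_def by (elim exE conjE)
 hence "smooth_value T M f g CF CG LD \<kappa> Df vt vx L"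
  by (intro smooth_value.intro cd smooth_value_axioms.intro)
 then obtain U ut z LU where "regular_value T M f g CF CG LD \<kappa> Df U ut z LU"
  using smooth_value.regular_value_exists by blast
 then interpret regular_value T M f g CF CG LD \<kappa> Df U ut z LU .
 show ?thesis
 \<comment> \<open>The constant is fixed before \<open>N\<close> is introduced: \<open>Lb\<close>
   and \<open>C0\<close> belong to \<open>regular_value\<close>, in which the number of agents does
   not occur.\<close>
 proof (intro exI[of _ "exp (Lb * T) * (real CARD('n option) + C0)"] allI impI)
  fix N :: nat and P :: "'w measure" and \<mu>N
  assume "1 <= N" and op: "agent_opt_process T M f g m0 N P \<mu>N"
  hence "0 < N" by simp
  thus "(\<integral>\<^sup>+om. (SUP t\<in>{0..T}. ennreal (norm (\<mu>N t om - \<mu> t))) \<partial>P)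
   <= ennreal (exp (Lb * T) * (real CARD('n option) + C0) / real N powr (1 / 9))"
   by (rule mean_sup_distance_bound[OF _ op assms(5,6)])
 qed
qed

end
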